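(* Let $\mathcal F$ be a saturated fusion system on a finite $p$-group $S$. Then the collapse map $q\colon A^{\mathrm{char}}(\mathcal F)_{(p)}\to A(\mathcal F)_{(p)}$, which quotients out the right $S$-action, is an isomorphism of rings, and it sends the basis element $\beta_{\Delta(P,\mathrm{id})}$ of $A^{\mathrm{char}}(\mathcal F)_{(p)}$ to the basis element $\beta_P$ of $A(\mathcal F)_{(p)}$ (for every $P\le S$).
   Context: Here $p$ is a prime and $p$-groups are finite. A fusion system $\mathcal F$ on a $p$-group $S$ is a category whose objects are the subgroups of $S$, whose morphism sets $\mathcal F(P,Q)=\mathrm{Hom}_{\mathcal F}(P,Q)$ consist of injective group homomorphisms $P\to Q$ (composed as homomorphisms) and contain all homomorphisms $P\to Q$ induced by conjugation by elements of $S$, and such that for each $\varphi\in\mathcal F(P,Q)$ the isomorphism $\varphi\colon P\to\varphi P$ and its inverse are morphisms of $\mathcal F$. Write $\mathrm{Aut}_{\mathcal F}(P)=\mathcal F(P,P)$. Subgroups $P,Q$ are $\mathcal F$-conjugate ($P\sim_{\mathcal F}Q$) if they are isomorphic in $\mathcal F$; $[P]_{\mathcal F}$ is the set of $\mathcal F$-conjugates of $P$. $P$ is fully $\mathcal F$-normalized (resp. fully $\mathcal F$-centralized) if $|N_SP|\ge|N_SQ|$ (resp. $|C_SP|\ge|C_SQ|$) for all $Q\in[P]_{\mathcal F}$. $\mathcal F$ is saturated if for all $P\le S$: (1) if $P$ is fully $\mathcal F$-normalized, then $P$ is fully $\mathcal F$-centralized and $\mathrm{Aut}_S(P)$ is a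 Sylow $p$-subgroup of $\mathrm{Aut}_{\mathcal F}(P)$; (2) every $\varphi\in\mathcal F(P,S)$ with $\varphi(P)$ fully $\mathcal F$-centralized extends to a morphism in $\mathcal F(N_\varphi,S)$, where $N_\varphi=\{x\in N_S(P)\mid \exists y\in S:\varphi\circ c_x=c_y\circ\varphi\}$. Burnside rings: $A(S)$ is the Burnside ring of $S$, $\Phi_Q(X)=|X^Q|$ the fixed point homomorphisms, and $(p)$ denotes tensoring with $\mathbb Z_{(p)}$. $X\in A(S)_{(p)}$ is $\mathcal F$-stable if for all $P\le S$, $\varphi\in\mathcal F(P,S)$ its restrictions to $A(P)_{(p)}$ along $\varphi$ and along the inclusion agree; equivalently $\Phi_P(X)=\Phi_Q(X)$ whenever $P\sim_{\mathcal F}Q$. $A(\mathcal F)_{(p)}\subseteq A(S)_{(p)}$ is the subring of $\mathcal F$-stable elements. For $P\le S$, $\beta_P\in A(\mathcal F)_{(p)}$ is the (existing, unique) element with $\Phi_Q(\beta_P)=\frac1{|[Q]_{\mathcal F}|}\sum_{Q'\in[Q]_{\mathcal F}}\Phi_{Q'}([S/P])$ for all $Q\le S$; the distinct $\beta_P$ form a $\mathbb Z_{(p)}$-basis of $A(\mathcal F)_{(p)}$, indexed by $\mathcal F$-conjugacy classes. Bisets: for finite groups $G,H$, a $(G,H)$-biset is a finite set with commuting right $G$-action and left $H$-action, regarded as a left $(H\times G)$-set via $(h,g).x=hxg^{-1}$. $A(G,H)$ is the Grothendieck group of isomorphism classes of $(G,H)$-bisets; additively $A(G,H)\cong A(H\times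 G)$. Composition $\circ\colon A(H,K)\times A(G,H)\to A(G,K)$ is induced by $Y\circ X=Y\times_HX$. For $U\le G$, $\varphi\colon U\to H$, put $\Delta(U,\varphi)=\{(\varphi(u),u)\mid u\in U\}$ and $[U,\varphi]_G^H=[(H\times G)/\Delta(U,\varphi)]$. $X\in A(S,S)_{(p)}$ is $\mathcal F$-generated if it is a $\mathbb Z_{(p)}$-linear combination of elements $[P,\varphi]_S^S$ with $P\le S$, $\varphi\in\mathcal F(P,S)$. It is $\mathcal F$-stable if $X\circ[P,\varphi]_P^S=X\circ[P,\mathrm{id}]_P^S$ and $[\varphi P,\varphi^{-1}]_S^P\circ X=[P,\mathrm{id}]_S^P\circ X$ for all $P\le S$, $\varphi\in\mathcal F(P,S)$. $A^{\mathrm{char}}(\mathcal F)_{(p)}$ is the subring (with multiplication $\circ$) of $A(S,S)_{(p)}$ of all elements that are both $\mathcal F$-generated and $\mathcal F$-stable; its multiplicative identity is the characteristic idempotent $\omega_{\mathcal F}$, the unique idempotent of $A(S,S)_{(p)}$ that is $\mathcal F$-generated, $\mathcal F$-stable, and has $\varepsilon(\omega_{\mathcal F})$ invertible in $\mathbb Z_{(p)}$, where $\varepsilon$ is the linear extension of $X\mapsto |X|/|S|$ on left-free bisets. $\beta_{\Delta(P,\mathrm{id})}:=\omega_{\mathcal F}\circ[P,\mathrm{id}]_S^S\circ\omega_{\mathcal F}$. Equivalently, it is the element of $A(S,S)_{(p)}\cong A(S\times S)_{(p)}$ whose number of $D$-fixed points, for $D\le S\times S$, is the average over the $(\mathcal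 F\times\mathcal F)$-conjugates $D'$ of $D$ of the number of $D'$-fixed points of $(S\times S)/\Delta(P,\mathrm{id})$; here $\mathcal F\times\mathcal F$ is the product fusion system on $S\times S$, whose morphisms are restrictions of products $\varphi_2\times\varphi_1$ of morphisms of $\mathcal F$. These elements, indexed by $\mathcal F$-conjugacy classes of $P\le S$, form a $\mathbb Z_{(p)}$-basis of $A^{\mathrm{char}}(\mathcal F)_{(p)}$. The collapse map $q\colon A(S,S)_{(p)}\to A(S)_{(p)}$ is the $\mathbb Z_{(p)}$-linear map sending an $(S,S)$-biset $X$ to the left $S$-set $X/S$ (quotient by the right $S$-action); it maps $A^{\mathrm{char}}(\mathcal F)_{(p)}$ into $A(\mathcal F)_{(p)}$. *)

theory Defs
  imports Complex_Main "HOL-Computational_Algebra.Primes" "HOL-Library.Poly_Mapping"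
    "HOL-Algebra.Group_Action" "HOL-Algebra.Left_Coset" "HOL-Algebra.QuotRing"
begin

section \<open>Fusion systems\<close>

definition conj_map :: "('a, 'm) monoid_scheme \<Rightarrow> 'a \<Rightarrow> 'a set \<Rightarrow> 'a \<Rightarrow> 'a" where
  "conj_map S x P = (\<lambda>u\<in>P. x \<otimes>\<^bsub>S\<^esub> u \<otimes>\<^bsub>S\<^esub> inv\<^bsub>S\<^esub> x)"

definition inverse_map :: "'a set \<Rightarrow> ('a \<Rightarrow> 'b) \<Rightarrow> 'b \<Rightarrow> 'a" where
  "inverse_map P \<phi> = restrict (inv_into P \<phi>) (\<phi> ` P)"

text \<open>The set of morphisms from \<open>P\<close> to \<open>Q\<close> is \<open>F P Q\<close>. A morphism is an extensional function on
  its domain, so that equality of morphisms is equality in HOL. Only the values of \<open>F\<close> at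
  subgroups of \<open>S\<close> matter.\<close>

type_synonym 'a hom_sets = "'a set \<Rightarrow> 'a set \<Rightarrow> ('a \<Rightarrow> 'a) set"

locale fusion_system = group S for S :: "('a, 'm) monoid_scheme" (structure) +
  fixes p :: nat and F :: "'a hom_sets"
  assumes prime_p: "prime p"
    and finite_S: "finite (carrier S)"
    and p_group: "\<exists>n. order S = p ^ n"
    and morphism: "\<lbrakk>subgroup P S; subgroup Q S; \<phi> \<in> F P Q\<rbrakk>
        \<Longrightarrow> \<phi> \<in> mon (S\<lparr>carrier := P\<rparr>) (S\<lparr>carrier := Q\<rparr>) \<inter> extensional P"
    and compose_closed: "\<lbrakk>subgroup P S; subgroup Q S; subgroup R S; \<phi> \<in> F P Q; \<psi> \<in> F Q R\<rbrakk>
        \<Longrightarrow> compose P \<psi> \<phi> \<in> F P R"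
    and conj_closed: "\<lbrakk>subgroup P S; subgroup Q S; x \<in> carrier S; conj_map S x P ` P \<subseteq> Q\<rbrakk>
        \<Longrightarrow> conj_map S x P \<in> F P Q"
    and onto_image: "\<lbrakk>subgroup P S; subgroup Q S; \<phi> \<in> F P Q\<rbrakk> \<Longrightarrow> \<phi> \<in> F P (\<phi> ` P)"
    and inverse_closed: "\<lbrakk>subgroup P S; subgroup Q S; \<phi> \<in> F P Q\<rbrakk>
        \<Longrightarrow> inverse_map P \<phi> \<in> F (\<phi> ` P) P"

definition fusion_conj :: "'a hom_sets \<Rightarrow> 'a set \<Rightarrow> 'a set \<Rightarrow> bool" where
  "fusion_conj F P Q \<longleftrightarrow> (\<exists>\<phi>\<in>F P Q. \<exists>\<psi>\<in>F Q P.
     compose P \<psi> \<phi> = (\<lambda>x\<in>P. x) \<and> compose Q \<phi> \<psi> = (\<lambda>x\<in>Q. x))"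

definition fusion_class :: "('a, 'm) monoid_scheme \<Rightarrow> 'a hom_sets \<Rightarrow> 'a set \<Rightarrow> 'a set set" where
  "fusion_class S F P = {Q. subgroup Q S \<and> fusion_conj F P Q}"

definition centralizer :: "('a, 'm) monoid_scheme \<Rightarrow> 'a set \<Rightarrow> 'a set" where
  "centralizer S P = {x \<in> carrier S. \<forall>u\<in>P. x \<otimes>\<^bsub>S\<^esub> u = u \<otimes>\<^bsub>S\<^esub> x}"

definition fully_normalized :: "('a, 'm) monoid_scheme \<Rightarrow> 'a hom_sets \<Rightarrow> 'a set \<Rightarrow> bool" where
  "fully_normalized S F P \<longleftrightarrow>
     (\<forall>Q\<in>fusion_class S F P. card (normalizer S Q) \<le> card (normalizer S P))"

definition fully_centralized :: "('a, 'm) monoid_scheme \<Rightarrow> 'a hom_sets \<Rightarrow> 'a set \<Rightarrow> bool" where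
  "fully_centralized S F P \<longleftrightarrow>
     (\<forall>Q\<in>fusion_class S F P. card (centralizer S Q) \<le> card (centralizer S P))"

definition aut_fusion :: "'a hom_sets \<Rightarrow> 'a set \<Rightarrow> ('a \<Rightarrow> 'a) monoid" where
  "aut_fusion F P = \<lparr>carrier = F P P, mult = compose P, one = (\<lambda>x\<in>P. x)\<rparr>"

definition aut_conj :: "('a, 'm) monoid_scheme \<Rightarrow> 'a set \<Rightarrow> ('a \<Rightarrow> 'a) set" where
  "aut_conj S P = (\<lambda>x. conj_map S x P) ` normalizer S P"

definition sylow_subgroup :: "nat \<Rightarrow> 'a set \<Rightarrow> ('a, 'm) monoid_scheme \<Rightarrow> bool" where
  "sylow_subgroup p H G \<longleftrightarrow> subgroup H G \<and> card H = p ^ multiplicity p (order G)"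

definition extension_domain ::
  "('a, 'm) monoid_scheme \<Rightarrow> 'a set \<Rightarrow> ('a \<Rightarrow> 'a) \<Rightarrow> 'a set" where
  "extension_domain S P \<phi> = {x \<in> normalizer S P. \<exists>y\<in>carrier S. \<forall>u\<in>P.
     \<phi> (x \<otimes>\<^bsub>S\<^esub> u \<otimes>\<^bsub>S\<^esub> inv\<^bsub>S\<^esub> x) = y \<otimes>\<^bsub>S\<^esub> \<phi> u \<otimes>\<^bsub>S\<^esub> inv\<^bsub>S\<^esub> y}"

locale saturated_fusion_system = fusion_system S p F
  for S :: "('a, 'm) monoid_scheme" (structure) and p F +
  assumes sylow_axiom: "\<lbrakk>subgroup P S; fully_normalized S F P\<rbrakk>
        \<Longrightarrow> fully_centralized S F P \<and> sylow_subgroup p (aut_conj S P) (aut_fusion F P)"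
    and extension_axiom:
      "\<lbrakk>subgroup P S; \<phi> \<in> F P (carrier S); fully_centralized S F (\<phi> ` P)\<rbrakk>
        \<Longrightarrow> \<exists>\<psi>\<in>F (extension_domain S P \<phi>) (carrier S). restrict \<psi> P = \<phi>"


section \<open>Finite sets with a group action\<close>

type_synonym ('g, 'x) gset = "'x set \<times> ('g \<Rightarrow> 'x \<Rightarrow> 'x)"

definition finite_gset :: "('g, 'm) monoid_scheme \<Rightarrow> ('g, 'x) gset \<Rightarrow> bool" where
  "finite_gset G X \<longleftrightarrow> finite (fst X) \<and> group_action G (fst X) (snd X)"

definition gset_iso :: "('g, 'm) monoid_scheme \<Rightarrow> ('g, 'x) gset \<Rightarrow> ('g, 'y) gset \<Rightarrow> bool" where
  "gset_iso G X Y \<longleftrightarrow> (\<exists>f. bij_betw f (fst X) (fst Y) \<and>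
     (\<forall>g\<in>carrier G. \<forall>x\<in>fst X. f (snd X g x) = snd Y g (f x)))"

definition gset_sum :: "('g, 'x) gset \<Rightarrow> ('g, 'y) gset \<Rightarrow> ('g, 'x + 'y) gset" where
  "gset_sum X Y = (fst X <+> fst Y, \<lambda>g. \<lambda>z\<in>fst X <+> fst Y. map_sum (snd X g) (snd Y g) z)"

definition gset_prod :: "('g, 'x) gset \<Rightarrow> ('g, 'y) gset \<Rightarrow> ('g, 'x \<times> 'y) gset" where
  "gset_prod X Y = (fst X \<times> fst Y, \<lambda>g. \<lambda>z\<in>fst X \<times> fst Y. map_prod (snd X g) (snd Y g) z)"

definition coset_gset :: "('g, 'm) monoid_scheme \<Rightarrow> 'g set \<Rightarrow> ('g, 'g set) gset" where
  "coset_gset G K = (lcosets\<^bsub>G\<^esub> K, \<lambda>g. \<lambda>C\<in>lcosets\<^bsub>G\<^esub> K. g <#\<^bsub>G\<^esub> C)"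

definition gset_restrict :: "('h \<Rightarrow> 'g) \<Rightarrow> ('g, 'x) gset \<Rightarrow> ('h, 'x) gset" where
  "gset_restrict \<phi> X = (fst X, \<lambda>h. snd X (\<phi> h))"

definition fixed_points :: "'g set \<Rightarrow> ('g, 'x) gset \<Rightarrow> 'x set" where
  "fixed_points Q X = {x \<in> fst X. \<forall>g\<in>Q. snd X g x = x}"

text \<open>A \<open>(G, H)\<close>-biset (right \<open>G\<close>-action, left \<open>H\<close>-action) is a \<open>H \<times>\<times> G\<close>-set with
  \<open>(h, g) . x = h x g\<^sup>-\<^sup>1\<close>. So on \<open>Y \<times> X\<close> the \<open>H\<close>-action whose orbits form \<open>Y \<times>\<^sub>H X\<close>,
  \<open>h . (y, x) = (y h\<^sup>-\<^sup>1, h x)\<close>, uses \<open>(1, h)\<close> on \<open>Y\<close> and \<open>(h, 1)\<close> on \<open>X\<close>.\<close>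

definition biset_comp ::
  "('g, 'm) monoid_scheme \<Rightarrow> ('h, 'n) monoid_scheme \<Rightarrow> ('k, 'o) monoid_scheme \<Rightarrow>
   ('k \<times> 'h, 'y) gset \<Rightarrow> ('h \<times> 'g, 'x) gset \<Rightarrow> ('k \<times> 'g, ('y \<times> 'x) set) gset" where
  "biset_comp G H K Y X =
     (let E = orbits H (fst Y \<times> fst X)
                (\<lambda>h. map_prod (snd Y (\<one>\<^bsub>K\<^esub>, h)) (snd X (h, \<one>\<^bsub>G\<^esub>)))
      in (E, \<lambda>(k, g). \<lambda>c\<in>E. map_prod (snd Y (k, \<one>\<^bsub>H\<^esub>)) (snd X (\<one>\<^bsub>H\<^esub>, g)) ` c))"

definition biset_collapse ::
  "('g, 'm) monoid_scheme \<Rightarrow> ('h, 'n) monoid_scheme \<Rightarrow> ('h \<times> 'g, 'x) gset \<Rightarrow> ('h, 'x set) gset" where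
  "biset_collapse G H X =
     (let E = orbits G (fst X) (\<lambda>g. snd X (\<one>\<^bsub>H\<^esub>, g))
      in (E, \<lambda>h. \<lambda>c\<in>E. snd X (h, \<one>\<^bsub>G\<^esub>) ` c))"


section \<open>Burnside modules localized at a prime\<close>

text \<open>Isomorphism classes are represented inside the universe \<open>nat\<close>, which contains a copy of every
  finite \<open>G\<close>-set; the class of a finite \<open>G\<close>-set over any type is defined.\<close>

type_synonym 'g iso_type = "('g, nat) gset set"

definition iso_class :: "('g, 'm) monoid_scheme \<Rightarrow> ('g, 'x) gset \<Rightarrow> 'g iso_type" where
  "iso_class G X = {Y. finite_gset G Y \<and> gset_iso G X Y}"

definition iso_classes :: "('g, 'm) monoid_scheme \<Rightarrow> 'g iso_type set" where
  "iso_classes G = iso_class G ` {X :: ('g, nat) gset. finite_gset G X}"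

definition representative :: "'g iso_type \<Rightarrow> ('g, nat) gset" where
  "representative C = (SOME X. X \<in> C)"

definition localized_int :: "nat \<Rightarrow> rat set" where
  "localized_int p = {of_int a / of_int b | a b. \<not> int p dvd b}"

text \<open>\<open>A(G)\<^sub>(\<^sub>p\<^sub>)\<close> is the free module over the localization of the integers at \<open>p\<close> on the isomorphism
  classes of finite \<open>G\<close>-sets, modulo the submodule spanned by \<open>[X \<squnion> Y] - [X] - [Y]\<close>.\<close>

definition formal_sums :: "nat \<Rightarrow> ('g, 'm) monoid_scheme \<Rightarrow> ('g iso_type \<Rightarrow>\<^sub>0 rat) set" where
  "formal_sums p G = {a. Poly_Mapping.keys a \<subseteq> iso_classes G \<and>
     (\<forall>C. Poly_Mapping.lookup a C \<in> localized_int p)}"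

inductive_set burnside_rels :: "nat \<Rightarrow> ('g, 'm) monoid_scheme \<Rightarrow> ('g iso_type \<Rightarrow>\<^sub>0 rat) set"
  for p :: nat and G :: "('g, 'm) monoid_scheme" where
  zero: "0 \<in> burnside_rels p G"
| step: "\<lbrakk>r \<in> burnside_rels p G; c \<in> localized_int p;
     finite_gset G (X :: ('g, nat) gset); finite_gset G (Y :: ('g, nat) gset)\<rbrakk>
   \<Longrightarrow> r + (Poly_Mapping.single (iso_class G (gset_sum X Y)) c
            - Poly_Mapping.single (iso_class G X) c - Poly_Mapping.single (iso_class G Y) c)
       \<in> burnside_rels p G"

definition burnside_eq ::
  "nat \<Rightarrow> ('g, 'm) monoid_scheme \<Rightarrow> (('g iso_type \<Rightarrow>\<^sub>0 rat) \<times> ('g iso_type \<Rightarrow>\<^sub>0 rat)) set" where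
  "burnside_eq p G =
     {(a, b). a \<in> formal_sums p G \<and> b \<in> formal_sums p G \<and> b - a \<in> burnside_rels p G}"

type_synonym 'g burnside = "('g iso_type \<Rightarrow>\<^sub>0 rat) set"

definition burnside :: "nat \<Rightarrow> ('g, 'm) monoid_scheme \<Rightarrow> 'g burnside set" where
  "burnside p G = formal_sums p G // burnside_eq p G"

definition burnside_class :: "nat \<Rightarrow> ('g, 'm) monoid_scheme \<Rightarrow> ('g, 'x) gset \<Rightarrow> 'g burnside" where
  "burnside_class p G X = burnside_eq p G `` {Poly_Mapping.single (iso_class G X) 1}"

definition burnside_zero :: "nat \<Rightarrow> ('g, 'm) monoid_scheme \<Rightarrow> 'g burnside" where
  "burnside_zero p G = burnside_eq p G `` {0}"

definition burnside_add ::
  "nat \<Rightarrow> ('g, 'm) monoid_scheme \<Rightarrow> 'g burnside \<Rightarrow> 'g burnside \<Rightarrow> 'g burnside" where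
  "burnside_add p G a b = (\<Union>x\<in>a. \<Union>y\<in>b. burnside_eq p G `` {x + y})"

definition linear_ext :: "('c \<Rightarrow> 'd) \<Rightarrow> ('c \<Rightarrow>\<^sub>0 rat) \<Rightarrow> ('d \<Rightarrow>\<^sub>0 rat)" where
  "linear_ext f x = (\<Sum>C\<in>Poly_Mapping.keys x. Poly_Mapping.single (f C) (Poly_Mapping.lookup x C))"

definition bilinear_ext :: "('c \<Rightarrow> 'd \<Rightarrow> 'e) \<Rightarrow> ('c \<Rightarrow>\<^sub>0 rat) \<Rightarrow> ('d \<Rightarrow>\<^sub>0 rat) \<Rightarrow> ('e \<Rightarrow>\<^sub>0 rat)" where
  "bilinear_ext f x y = (\<Sum>C\<in>Poly_Mapping.keys x. \<Sum>D\<in>Poly_Mapping.keys y.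
     Poly_Mapping.single (f C D) (Poly_Mapping.lookup x C * Poly_Mapping.lookup y D))"

text \<open>The value at \<open>a\<close> of the linear extension of a numerical isomorphism invariant of finite
  \<open>G\<close>-sets that is additive on disjoint unions.\<close>

definition rat_ext :: "(('g, nat) gset \<Rightarrow> rat) \<Rightarrow> 'g burnside \<Rightarrow> rat" where
  "rat_ext f a = the_elem ((\<lambda>x. \<Sum>C\<in>Poly_Mapping.keys x.
     Poly_Mapping.lookup x C * f (representative C)) ` a)"

definition burnside_mult ::
  "nat \<Rightarrow> ('g, 'm) monoid_scheme \<Rightarrow> 'g burnside \<Rightarrow> 'g burnside \<Rightarrow> 'g burnside" where
  "burnside_mult p G a b = (\<Union>x\<in>a. \<Union>y\<in>b. burnside_eq p G ``
     {bilinear_ext (\<lambda>C D. iso_class G (gset_prod (representative C) (representative D))) x y})"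

text \<open>Restriction \<open>A(G)\<^sub>(\<^sub>p\<^sub>) \<rightarrow> A(H)\<^sub>(\<^sub>p\<^sub>)\<close> along \<open>\<phi> : H \<rightarrow> G\<close>.\<close>

definition burnside_restrict ::
  "nat \<Rightarrow> ('h, 'm) monoid_scheme \<Rightarrow> ('h \<Rightarrow> 'g) \<Rightarrow> 'g burnside \<Rightarrow> 'h burnside" where
  "burnside_restrict p H \<phi> a = (\<Union>x\<in>a. burnside_eq p H ``
     {linear_ext (\<lambda>C. iso_class H (gset_restrict \<phi> (representative C))) x})"

definition mark :: "'g set \<Rightarrow> 'g burnside \<Rightarrow> rat" where
  "mark Q a = rat_ext (\<lambda>X. of_nat (card (fixed_points Q X))) a"

abbreviation bisets :: "nat \<Rightarrow> ('g, 'm) monoid_scheme \<Rightarrow> ('h, 'n) monoid_scheme \<Rightarrow>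
    ('h \<times> 'g) burnside set" where
  "bisets p G H \<equiv> burnside p (H \<times>\<times> G)"

definition burnside_comp ::
  "nat \<Rightarrow> ('g, 'm) monoid_scheme \<Rightarrow> ('h, 'n) monoid_scheme \<Rightarrow> ('k, 'o) monoid_scheme \<Rightarrow>
   ('k \<times> 'h) burnside \<Rightarrow> ('h \<times> 'g) burnside \<Rightarrow> ('k \<times> 'g) burnside" where
  "burnside_comp p G H K b a = (\<Union>y\<in>b. \<Union>x\<in>a. burnside_eq p (K \<times>\<times> G) ``
     {bilinear_ext (\<lambda>C D. iso_class (K \<times>\<times> G)
        (biset_comp G H K (representative C) (representative D))) y x})"

definition twisted_diagonal :: "'g set \<Rightarrow> ('g \<Rightarrow> 'h) \<Rightarrow> ('h \<times> 'g) set" where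
  "twisted_diagonal U \<phi> = (\<lambda>u. (\<phi> u, u)) ` U"

definition transitive_biset ::
  "('g, 'm) monoid_scheme \<Rightarrow> ('h, 'n) monoid_scheme \<Rightarrow> 'g set \<Rightarrow> ('g \<Rightarrow> 'h) \<Rightarrow>
   ('h \<times> 'g, ('h \<times> 'g) set) gset" where
  "transitive_biset G H U \<phi> = coset_gset (H \<times>\<times> G) (twisted_diagonal U \<phi>)"

abbreviation basic_biset ::
  "nat \<Rightarrow> ('g, 'm) monoid_scheme \<Rightarrow> ('h, 'n) monoid_scheme \<Rightarrow> 'g set \<Rightarrow> ('g \<Rightarrow> 'h) \<Rightarrow>
   ('h \<times> 'g) burnside" where
  "basic_biset p G H U \<phi> \<equiv> burnside_class p (H \<times>\<times> G) (transitive_biset G H U \<phi>)"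

definition collapse ::
  "nat \<Rightarrow> ('g, 'm) monoid_scheme \<Rightarrow> ('g \<times> 'g) burnside \<Rightarrow> 'g burnside" where
  "collapse p S a = (\<Union>x\<in>a. burnside_eq p S ``
     {linear_ext (\<lambda>C. iso_class S (biset_collapse S S (representative C))) x})"


section \<open>The Burnside ring of a fusion system\<close>

definition fusion_stable ::
  "nat \<Rightarrow> ('a, 'm) monoid_scheme \<Rightarrow> 'a hom_sets \<Rightarrow> 'a burnside \<Rightarrow> bool" where
  "fusion_stable p S F a \<longleftrightarrow> (\<forall>P \<phi>. subgroup P S \<and> \<phi> \<in> F P (carrier S) \<longrightarrow>
     burnside_restrict p (S\<lparr>carrier := P\<rparr>) \<phi> a = burnside_restrict p (S\<lparr>carrier := P\<rparr>) id a)"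

definition fusion_burnside_ring ::
  "nat \<Rightarrow> ('a, 'm) monoid_scheme \<Rightarrow> 'a hom_sets \<Rightarrow> 'a burnside ring" where
  "fusion_burnside_ring p S F =
     \<lparr>carrier = {a \<in> burnside p S. fusion_stable p S F a},
      mult = burnside_mult p S,
      one = burnside_class p S (coset_gset S (carrier S)),
      zero = burnside_zero p S,
      add = burnside_add p S\<rparr>"

definition beta ::
  "nat \<Rightarrow> ('a, 'm) monoid_scheme \<Rightarrow> 'a hom_sets \<Rightarrow> 'a set \<Rightarrow> 'a burnside" where
  "beta p S F P = (THE b. b \<in> carrier (fusion_burnside_ring p S F) \<and>
     (\<forall>Q. subgroup Q S \<longrightarrow> mark Q b =
        (\<Sum>Q'\<in>fusion_class S F Q. mark Q' (burnside_class p S (coset_gset S P)))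
          / of_nat (card (fusion_class S F Q))))"


section \<open>The ring of characteristic elements\<close>

text \<open>For a finite group the index set of the sum below is finite, since morphisms are
  extensional.\<close>

definition biset_generated ::
  "nat \<Rightarrow> ('a, 'm) monoid_scheme \<Rightarrow> 'a hom_sets \<Rightarrow> ('a \<times> 'a) burnside \<Rightarrow> bool" where
  "biset_generated p S F X \<longleftrightarrow> (\<exists>c :: 'a set \<Rightarrow> ('a \<Rightarrow> 'a) \<Rightarrow> rat.
     (\<forall>P \<phi>. c P \<phi> \<in> localized_int p) \<and>
     X = burnside_eq p (S \<times>\<times> S) ``
       {\<Sum>(P, \<phi>)\<in>{(P, \<phi>). subgroup P S \<and> \<phi> \<in> F P (carrier S)}.
          Poly_Mapping.single (iso_class (S \<times>\<times> S) (transitive_biset S S P \<phi>)) (c P \<phi>)})"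

definition biset_stable ::
  "nat \<Rightarrow> ('a, 'm) monoid_scheme \<Rightarrow> 'a hom_sets \<Rightarrow> ('a \<times> 'a) burnside \<Rightarrow> bool" where
  "biset_stable p S F X \<longleftrightarrow> (\<forall>P \<phi>. subgroup P S \<and> \<phi> \<in> F P (carrier S) \<longrightarrow>
     (let T = S\<lparr>carrier := P\<rparr> in
       burnside_comp p T S S X (basic_biset p T S P \<phi>)
         = burnside_comp p T S S X (basic_biset p T S P id) \<and>
       burnside_comp p S S T (basic_biset p S T (\<phi> ` P) (inverse_map P \<phi>)) X
         = burnside_comp p S S T (basic_biset p S T P id) X))"

text \<open>On left-free bisets, hence on generated elements, this is the linear extension of
  \<open>|X| / |S|\<close>; the same formula is used on all of \<open>A(S, S)\<^sub>(\<^sub>p\<^sub>)\<close>, with values in \<open>rat\<close>.\<close>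

definition augmentation :: "('a, 'm) monoid_scheme \<Rightarrow> ('a \<times> 'a) burnside \<Rightarrow> rat" where
  "augmentation S a = rat_ext (\<lambda>X. of_nat (card (fst X)) / of_nat (order S)) a"

definition char_idempotent ::
  "nat \<Rightarrow> ('a, 'm) monoid_scheme \<Rightarrow> 'a hom_sets \<Rightarrow> ('a \<times> 'a) burnside" where
  "char_idempotent p S F = (THE w. w \<in> bisets p S S \<and> burnside_comp p S S S w w = w \<and>
     biset_generated p S F w \<and> biset_stable p S F w \<and>
     (\<exists>u\<in>localized_int p. augmentation S w \<in> localized_int p \<and> augmentation S w * u = 1))"

definition char_ring ::
  "nat \<Rightarrow> ('a, 'm) monoid_scheme \<Rightarrow> 'a hom_sets \<Rightarrow> ('a \<times> 'a) burnside ring" where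
  "char_ring p S F =
     \<lparr>carrier = {X \<in> bisets p S S. biset_generated p S F X \<and> biset_stable p S F X},
      mult = burnside_comp p S S S,
      one = char_idempotent p S F,
      zero = burnside_zero p (S \<times>\<times> S),
      add = burnside_add p (S \<times>\<times> S)\<rparr>"

definition beta_diagonal ::
  "nat \<Rightarrow> ('a, 'm) monoid_scheme \<Rightarrow> 'a hom_sets \<Rightarrow> 'a set \<Rightarrow> ('a \<times> 'a) burnside" where
  "beta_diagonal p S F P = burnside_comp p S S S
     (burnside_comp p S S S (char_idempotent p S F) (basic_biset p S S P id))
     (char_idempotent p S F)"

end

theory Submission
  imports Defs
begin

text \<open>The proof describes an element of \<open>A(G)\<^sub>(\<^sub>p\<^sub>)\<close> by its \<^emph>\<open>ghost\<close>, the function that counts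
  points by their exact stabilizers. Ghosts separate elements (\<open>ghost_inject\<close>), and the functions
  that occur are those that are constant on conjugacy classes, vanish off the subgroups and
  satisfy \<open>|D| \<tau>(D) / |N\<^sub>G D| \<in> \<int>\<^sub>(\<^sub>p\<^sub>)\<close> (\<open>integral_ghost\<close>, \<open>burnside_of_ghost\<close>). The marks \<open>\<Phi>\<^sub>Q\<close>
  are the upper sums of the ghost. The stabilizer of a point \<open>[y, x]\<close> of \<open>Y \<times>\<^sub>H X\<close> is the
  relational composite of the stabilizers of \<open>y\<close> and \<open>x\<close>, and the stabilizer of an orbit \<open>x S\<close> is
  the domain of the stabilizer of \<open>x\<close>, so both composition and collapse are explicit on ghosts
  (\<open>burnside_comp\<close>, \<open>collapse\<close>).

  Identify a morphism of \<open>\<F>\<close> with its graph \<open>\<Delta>(P, \<phi>)\<close>. The graphs are closed under subgroups,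
  relational composition and converse. An element \<open>X\<close> of \<open>A(S, S)\<^sub>(\<^sub>p\<^sub>)\<close> is \<open>\<F>\<close>-generated if and
  only if its ghost is supported on graphs (\<open>generated_iff\<close>). Such an \<open>X\<close> is \<open>\<F>\<close>-stable if and
  only if its mark at each graph equals its mark at the identity graph of the domain and at that
  of the range (\<open>char_iff\<close>). Hence for characteristic \<open>X\<close>, generated \<open>Y\<close> and \<open>Q \<le> S\<close>, with \<open>\<mu>\<close> the
  mark of \<open>X\<close> at the identity of \<open>Q\<close>,

  \<open>\<Phi>\<^sub>Q(q(X \<circ> Y)) = \<mu> / |S| \<cdot> \<Sum>\<^sub>R \<Phi>\<^bsub>range R\<^esub>(q(Y))\<close>,

  where \<open>R\<close> runs through the graphs with domain \<open>Q\<close> (\<open>cmark_char\<close>). The same computation without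
  \<open>Y\<close> gives \<open>\<Phi>\<^sub>Q(q(X)) = \<mu> / |S| \<cdot> #R\<close>. So \<open>q(X)\<close> determines \<open>X\<close>; it is \<open>\<F>\<close>-stable; if \<open>q(Y)\<close> is
  \<open>\<F>\<close>-stable, then \<open>q(X \<circ> Y) = q(X) q(Y)\<close>; and if \<open>q(X) = 1\<close>, then \<open>q(X \<circ> Y)\<close> is the average of
  \<open>q(Y)\<close> over \<open>\<F>\<close>-conjugates. The ring axioms and the multiplicativity of \<open>q\<close> are therefore
  statements about values in \<open>\<rat>\<close>. An idempotent \<open>\<omega>\<close> with \<open>q(\<omega>) = 1\<close> is the characteristic
  idempotent, and \<open>q(\<omega> \<circ> [P, id] \<circ> \<omega>)\<close> is the average of \<open>q([P, id]) = [S/P]\<close>, which is \<open>\<beta>\<^sub>P\<close>.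
  Averaging fixes the elements of \<open>A(\<F>)\<^sub>(\<^sub>p\<^sub>)\<close>, so an element \<open>\<Sum> c\<^sub>P [S/P]\<close> of it is also
  \<open>\<Sum> c\<^sub>P \<beta>\<^sub>P\<close>, and \<open>q\<close> is surjective.

  It remains to produce a characteristic element with collapse \<open>1\<close>, and this is what saturation
  provides. A characteristic element is built from the largest graphs downwards by prescribing
  marks. The obstruction at a graph \<open>D\<close> is a congruence modulo \<open>|N D : D|\<close> between the marks at
  \<open>D\<close> and at the identity of a fully normalized conjugate \<open>P\<^sub>0\<close> of its range. It holds because
  Sylow's theorem in \<open>Aut\<^sub>\<F>(P\<^sub>0)\<close> and the extension axiom extend an \<open>\<F> \<times> \<F>\<close>-isomorphism from \<open>D\<close>
  to that identity to the normalizer of \<open>D\<close> (\<open>normalizer_extension\<close>), so that the two marks belong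
  to two restrictions to one group, which agree above \<open>D\<close> (\<open>stable_above_congruence\<close>). The
  collapse of the resulting element has the value \<open>|Out\<^sub>\<F>(S)|\<close> at \<open>S\<close>, which is prime to \<open>p\<close>; the
  usual congruence for \<open>p\<close>-groups makes all its values units (\<open>marks_p_congruence\<close>), and a
  polynomial in it without constant term has all values \<open>1\<close> (\<open>char_unit_exists\<close>).\<close>

section \<open>Actions, orbits and stabilizers\<close>

locale finite_group = group +
  assumes finite_carrier: "finite (carrier G)"
begin

lemma card_carrier_pos: "card (carrier G) > 0"
  using finite_carrier one_closed card_gt_0_iff by blast

lemma finite_subgroups: "finite {H. subgroup H G}"
  by (rule finite_subset[of _ "Pow (carrier G)"]) (auto simp: finite_carrier dest: subgroup.subset)

lemma finite_subgroup: "subgroup H G \<Longrightarrow> finite H"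
  using finite_carrier finite_subset subgroup.subset by blast

lemma card_subgroup_pos: "subgroup H G \<Longrightarrow> card H > 0"
  using finite_subgroup subgroup.one_closed card_gt_0_iff by blast

end

text \<open>The group laws of an action without the extensionality that is built into group actions
  into \<open>Bij E\<close>: translation maps such as \<open>g <# C\<close> satisfy them as they stand.\<close>

definition acts :: "('g, 'm) monoid_scheme \<Rightarrow> 'x set \<Rightarrow> ('g \<Rightarrow> 'x \<Rightarrow> 'x) \<Rightarrow> bool" where
  "acts G E f \<longleftrightarrow> (\<forall>g\<in>carrier G. \<forall>x\<in>E. f g x \<in> E) \<and> (\<forall>x\<in>E. f \<one>\<^bsub>G\<^esub> x = x) \<and>
     (\<forall>g\<in>carrier G. \<forall>h\<in>carrier G. \<forall>x\<in>E. f (g \<otimes>\<^bsub>G\<^esub> h) x = f g (f h x))"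

lemma actsD:
  assumes "acts G E f"
  shows "\<And>g x. g \<in> carrier G \<Longrightarrow> x \<in> E \<Longrightarrow> f g x \<in> E" "\<And>x. x \<in> E \<Longrightarrow> f \<one>\<^bsub>G\<^esub> x = x"
    "\<And>g h x. g \<in> carrier G \<Longrightarrow> h \<in> carrier G \<Longrightarrow> x \<in> E \<Longrightarrow> f (g \<otimes>\<^bsub>G\<^esub> h) x = f g (f h x)"
  using assms unfolding acts_def by auto

context group
begin

lemma acts_inv:
  assumes "acts G E f" "g \<in> carrier G" "x \<in> E"
  shows "f (inv g) (f g x) = x" "f g (f (inv g) x) = x"
  using actsD[OF assms(1)] assms(2,3) by (metis inv_closed l_inv, metis inv_closed r_inv)

lemma acts_eq_iff:
  assumes "acts G E f" "g \<in> carrier G" "h \<in> carrier G" "x \<in> E" "y \<in> E"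
  shows "f g x = f h y \<longleftrightarrow> f (inv h \<otimes> g) x = y"
  using actsD[OF assms(1)] acts_inv[OF assms(1)] assms(2-5) by (metis inv_closed)

lemma finite_gset_iff:
  "finite_gset G X \<longleftrightarrow> finite (fst X) \<and> acts G (fst X) (snd X) \<and>
     (\<forall>g\<in>carrier G. snd X g \<in> extensional (fst X))"
proof
  assume "finite_gset G X"
  then have fin: "finite (fst X)" and "group_action G (fst X) (snd X)"
    unfolding finite_gset_def by auto
  then interpret group_action G "fst X" "snd X" by simp
  have "snd X g \<in> extensional (fst X)" if "g \<in> carrier G" for g
    using bij_prop0[OF that] by (simp add: Bij_def)
  moreover have "acts G (fst X) (snd X)"
    unfolding acts_def
  proof (intro conjI ballI)
    show "snd X \<one> x = x" if "x \<in> fst X" for x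
      using id_eq_one that by (metis restrict_apply')
    show "snd X g x \<in> fst X" if "g \<in> carrier G" "x \<in> fst X" for g x
      using element_image[OF that refl] .
    show "snd X (g \<otimes> h) x = snd X g (snd X h x)"
      if "g \<in> carrier G" "h \<in> carrier G" "x \<in> fst X" for g h x
      using composition_rule[OF that(3,1,2)] .
  qed
  ultimately show "finite (fst X) \<and> acts G (fst X) (snd X) \<and>
     (\<forall>g\<in>carrier G. snd X g \<in> extensional (fst X))" using fin by auto
next
  assume *: "finite (fst X) \<and> acts G (fst X) (snd X) \<and>
     (\<forall>g\<in>carrier G. snd X g \<in> extensional (fst X))"
  then have a: "acts G (fst X) (snd X)" by auto
  have bij: "snd X g \<in> Bij (fst X)" if g: "g \<in> carrier G" for g
  proof -
    have "bij_betw (snd X g) (fst X) (fst X)"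
      by (rule bij_betw_byWitness[where f' = "snd X (inv g)"])
         (use actsD[OF a] acts_inv[OF a] g in auto)
    then show ?thesis using * g by (auto simp: Bij_def)
  qed
  have "snd X \<in> hom G (BijGroup (fst X))"
  proof (rule homI)
    fix g h assume gh: "g \<in> carrier G" "h \<in> carrier G"
    have "snd X (g \<otimes> h) = compose (fst X) (snd X g) (snd X h)"
    proof
      fix x show "snd X (g \<otimes> h) x = compose (fst X) (snd X g) (snd X h) x"
        using * gh actsD(3)[OF a gh] by (cases "x \<in> fst X") (auto simp: compose_def extensional_def)
    qed
    then show "snd X (g \<otimes> h) = snd X g \<otimes>\<^bsub>BijGroup (fst X)\<^esub> snd X h"
      using bij gh by (simp add: BijGroup_def)
  qed (use bij in \<open>auto simp: BijGroup_def\<close>)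
  then show "finite_gset G X"
    using * unfolding finite_gset_def group_action_def
    by (auto intro!: group_hom.intro group_hom_axioms.intro group_BijGroup is_group)
qed

lemma finite_gsetD:
  assumes "finite_gset G X"
  shows "finite (fst X)" "acts G (fst X) (snd X)"
    "\<And>g. g \<in> carrier G \<Longrightarrow> snd X g \<in> extensional (fst X)"
  using assms unfolding finite_gset_iff by auto

lemma finite_gset_restrictI:
  assumes "finite E" "acts G E f" "\<And>g. g \<in> carrier G \<Longrightarrow> k g = restrict (f g) E"
  shows "finite_gset G (E, k)"
  unfolding finite_gset_iff using assms by (auto simp: acts_def)

lemma acts_orbit:
  assumes a: "acts G E f" and x: "x \<in> E"
  shows "x \<in> orbit G f x" "orbit G f x \<subseteq> E"
    "\<And>y. y \<in> orbit G f x \<Longrightarrow> orbit G f y = orbit G f x"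
proof -
  show "x \<in> orbit G f x" unfolding orbit_def using actsD(2)[OF a x] by force
  show "orbit G f x \<subseteq> E" unfolding orbit_def using actsD(1)[OF a] x by auto
  fix y assume "y \<in> orbit G f x"
  then obtain g where g: "g \<in> carrier G" "y = f g x" unfolding orbit_def by auto
  have e: "f h y = f (h \<otimes> g) x" "f h x = f (h \<otimes> inv g) y" if "h \<in> carrier G" for h
    using g that actsD[OF a] x acts_inv[OF a] by auto
  show "orbit G f y = orbit G f x" unfolding orbit_def
    using e g(1) by (blast intro: m_closed inv_closed)
qed

lemma acts_subgroup_stabilizer:
  assumes a: "acts G E f" and x: "x \<in> E"
  shows "subgroup (stabilizer G f x) G"
proof (rule subgroupI)
  show "stabilizer G f x \<noteq> {}" using actsD(2)[OF a x] by (auto simp: stabilizer_def)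
  fix g assume "g \<in> stabilizer G f x"
  then show "inv g \<in> stabilizer G f x"
    using acts_inv(1)[OF a _ x] by (auto simp: stabilizer_def) (metis)
qed (use actsD[OF a] x in \<open>auto simp: stabilizer_def\<close>)

lemma stabilizer_translate:
  assumes a: "acts G E f" and x: "x \<in> E" and g: "g \<in> carrier G"
  shows "stabilizer G f (f g x) = (\<lambda>k. g \<otimes> k \<otimes> inv g) ` stabilizer G f x"
proof
  show "(\<lambda>k. g \<otimes> k \<otimes> inv g) ` stabilizer G f x \<subseteq> stabilizer G f (f g x)"
    using actsD[OF a] acts_inv[OF a g x] x g by (auto simp: stabilizer_def m_assoc)
  show "stabilizer G f (f g x) \<subseteq> (\<lambda>k. g \<otimes> k \<otimes> inv g) ` stabilizer G f x"
  proof
    fix h assume "h \<in> stabilizer G f (f g x)"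
    then have h: "h \<in> carrier G" "f h (f g x) = f g x" by (auto simp: stabilizer_def)
    have "inv g \<otimes> h \<otimes> g \<in> stabilizer G f x"
      using h g actsD[OF a] x acts_inv[OF a g x] by (auto simp: stabilizer_def m_assoc)
    moreover have "h = g \<otimes> (inv g \<otimes> h \<otimes> g) \<otimes> inv g"
      using h g by (metis inv_closed m_assoc m_closed r_inv r_one inv_inv inv_solve_left)
    ultimately show "h \<in> (\<lambda>k. g \<otimes> k \<otimes> inv g) ` stabilizer G f x" by blast
  qed
qed

end

context finite_group
begin

lemma card_transporter:
  assumes a: "acts G E f" and x: "x \<in> E" and y: "y \<in> orbit G f x"
  shows "card {g \<in> carrier G. f g x = y} = card (stabilizer G f x)"
proof -
  obtain g where g: "g \<in> carrier G" "y = f g x" using y unfolding orbit_def by auto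
  have "bij_betw (\<lambda>h. g \<otimes> h) (stabilizer G f x) {h \<in> carrier G. f h x = y}"
  proof (rule bij_betw_byWitness[where f' = "\<lambda>h. inv g \<otimes> h"])
    show "\<forall>h\<in>stabilizer G f x. inv g \<otimes> (g \<otimes> h) = h"
      "\<forall>h\<in>{h \<in> carrier G. f h x = y}. g \<otimes> (inv g \<otimes> h) = h"
      using g(1) by (auto simp: stabilizer_def m_assoc[symmetric])
    show "(\<lambda>h. g \<otimes> h) ` stabilizer G f x \<subseteq> {h \<in> carrier G. f h x = y}"
      using g x by (auto simp: stabilizer_def actsD(3)[OF a])
    show "(\<lambda>h. inv g \<otimes> h) ` {h \<in> carrier G. f h x = y} \<subseteq> stabilizer G f x"
    proof
      fix k assume "k \<in> (\<lambda>h. inv g \<otimes> h) ` {h \<in> carrier G. f h x = y}"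
      then obtain h where h: "h \<in> carrier G" "f h x = f g x" "k = inv g \<otimes> h" using g by auto
      have "f k x = f (inv g) (f h x)" using actsD(3)[OF a, of "inv g" h x] h(1,3) g(1) x by simp
      also have "\<dots> = x" unfolding h(2) by (rule acts_inv(1)[OF a g(1) x])
      finally have "f k x = x" .
      moreover have "k \<in> carrier G" unfolding h(3) using h(1) g(1) by blast
      ultimately show "k \<in> stabilizer G f x" unfolding stabilizer_def by blast
    qed
  qed
  then show ?thesis by (rule bij_betw_same_card[symmetric])
qed

lemma sum_over_orbit:
  fixes w :: "'x \<Rightarrow> rat"
  assumes a: "acts G E f" and x: "x \<in> E"
  shows "(\<Sum>g\<in>carrier G. w (f g x)) = of_nat (card (stabilizer G f x)) * (\<Sum>y\<in>orbit G f x. w y)"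
proof -
  have fin: "finite (orbit G f x)" unfolding orbit_def using finite_carrier by auto
  have "(\<Sum>g\<in>carrier G. w (f g x))
      = (\<Sum>y\<in>orbit G f x. \<Sum>g\<in>{g \<in> carrier G. f g x = y}. w (f g x))"
    by (rule sum.group[OF finite_carrier fin, symmetric]) (auto simp: orbit_def)
  also have "\<dots> = (\<Sum>y\<in>orbit G f x. of_nat (card (stabilizer G f x)) * w y)"
    by (rule sum.cong[OF refl]) (simp add: card_transporter[OF a x, symmetric])
  finally show ?thesis by (simp add: sum_distrib_left)
qed

lemma card_orbit_stabilizer:
  assumes a: "acts G E f" and x: "x \<in> E"
  shows "card (orbit G f x) * card (stabilizer G f x) = card (carrier G)"
proof -
  have "of_nat (card (carrier G)) = (of_nat (card (orbit G f x) * card (stabilizer G f x)) :: rat)"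
    using sum_over_orbit[OF a x, of "\<lambda>_. 1"] by simp
  then show ?thesis by (metis of_nat_eq_iff)
qed

text \<open>A sum over orbits becomes a sum over points if every point \<open>x\<close> is given the weight
  \<open>1 / |orbit of x| = |stabilizer of x| / |G|\<close>. This is how quotients of \<open>G\<close>-sets are counted
  below.\<close>

lemma sum_over_orbits:
  fixes w :: "'x set \<Rightarrow> rat"
  assumes a: "acts G E f" and E: "finite E"
  shows "(\<Sum>c\<in>orbits G E f. w c)
    = (\<Sum>x\<in>E. w (orbit G f x) * of_nat (card (stabilizer G f x)) / of_nat (card (carrier G)))"
proof -
  have fin: "finite (orbits G E f)" "orbit G f ` E \<subseteq> orbits G E f"
    unfolding orbits_def using E by auto
  have pt: "w (orbit G f x) * of_nat (card (stabilizer G f x)) / of_nat (card (carrier G))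
      = w (orbit G f x) / of_nat (card (orbit G f x))" if x: "x \<in> E" for x
  proof -
    have "card (orbit G f x) > 0" "card (stabilizer G f x) > 0"
      using card_orbit_stabilizer[OF a x] card_carrier_pos
      by (metis mult_0 neq0_conv, metis mult_0_right neq0_conv)
    then show ?thesis
      unfolding card_orbit_stabilizer[OF a x, symmetric] by (simp add: field_simps)
  qed
  have "(\<Sum>x\<in>E. w (orbit G f x) * of_nat (card (stabilizer G f x)) / of_nat (card (carrier G)))
      = (\<Sum>x\<in>E. w (orbit G f x) / of_nat (card (orbit G f x)))" using pt by simp
  also have "\<dots> = (\<Sum>c\<in>orbits G E f. \<Sum>x\<in>{x\<in>E. orbit G f x = c}. w (orbit G f x) / of_nat (card (orbit G f x)))"
    by (rule sum.group[OF E fin, symmetric])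
  also have "\<dots> = (\<Sum>c\<in>orbits G E f. w c)"
  proof (rule sum.cong[OF refl])
    fix c assume "c \<in> orbits G E f"
    then obtain x where x: "x \<in> E" "c = orbit G f x" unfolding orbits_def by auto
    have c: "{y\<in>E. orbit G f y = c} = c"
    proof
      show "{y\<in>E. orbit G f y = c} \<subseteq> c" using acts_orbit(1)[OF a] by blast
      show "c \<subseteq> {y\<in>E. orbit G f y = c}" using acts_orbit(2,3)[OF a x(1)] unfolding x(2) by blast
    qed
    have "(\<Sum>y\<in>{y\<in>E. orbit G f y = c}. w (orbit G f y) / of_nat (card (orbit G f y)))
      = (\<Sum>y\<in>c. w c / of_nat (card c))"
      by (rule sum.cong) (use c in auto)
    also have "\<dots> = w c"
    proof -
      have "finite c" "c \<noteq> {}"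
        using acts_orbit(1,2)[OF a x(1)] finite_subset[OF _ E] unfolding x(2) by blast+
      then show ?thesis by (simp add: card_gt_0_iff)
    qed
    finally show "(\<Sum>y\<in>{y\<in>E. orbit G f y = c}. w (orbit G f y) / of_nat (card (orbit G f y))) = w c" .
  qed
  finally show ?thesis by simp
qed

end


section \<open>Isomorphism classes and stabilizer counts\<close>

abbreviation stab :: "('g, 'm) monoid_scheme \<Rightarrow> ('g, 'x) gset \<Rightarrow> 'x \<Rightarrow> 'g set" where
  "stab G X x \<equiv> stabilizer G (snd X) x"

definition stab_count :: "('g, 'm) monoid_scheme \<Rightarrow> ('g, 'x) gset \<Rightarrow> 'g set \<Rightarrow> nat" where
  "stab_count G X D = card {x \<in> fst X. stab G X x = D}"

lemma gset_iso_refl: "gset_iso G X X"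
  unfolding gset_iso_def by (rule exI[of _ id]) auto

lemma gset_iso_trans: "gset_iso G X Y \<Longrightarrow> gset_iso G Y Z \<Longrightarrow> gset_iso G X Z"
  unfolding gset_iso_def
proof (elim exE conjE)
  fix f h assume "bij_betw f (fst X) (fst Y)" "bij_betw h (fst Y) (fst Z)"
    "\<forall>g\<in>carrier G. \<forall>x\<in>fst X. f (snd X g x) = snd Y g (f x)"
    "\<forall>g\<in>carrier G. \<forall>x\<in>fst Y. h (snd Y g x) = snd Z g (h x)"
  then show "\<exists>f. bij_betw f (fst X) (fst Z) \<and> (\<forall>g\<in>carrier G. \<forall>x\<in>fst X. f (snd X g x) = snd Z g (f x))"
    by (intro exI[of _ "h \<circ> f"]) (auto intro: bij_betw_trans dest: bij_betwE)
qed

context group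
begin

lemma gset_iso_sym:
  assumes X: "finite_gset G X" and "gset_iso G X Y"
  shows "gset_iso G Y X"
proof -
  obtain f where f: "bij_betw f (fst X) (fst Y)"
    and e: "\<And>g x. g \<in> carrier G \<Longrightarrow> x \<in> fst X \<Longrightarrow> f (snd X g x) = snd Y g (f x)"
    using assms unfolding gset_iso_def by auto
  have cl: "inv_into (fst X) f y \<in> fst X" "f (inv_into (fst X) f y) = y" if "y \<in> fst Y" for y
    using f that by (auto simp: bij_betw_def inv_into_into f_inv_into_f)
  have "inv_into (fst X) f (snd Y g y) = snd X g (inv_into (fst X) f y)"
    if g: "g \<in> carrier G" and y: "y \<in> fst Y" for g y
    by (rule inv_into_f_eq[OF bij_betw_imp_inj_on[OF f] actsD(1)[OF finite_gsetD(2)[OF X] g cl(1)[OF y]]])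
       (use e[OF g cl(1)[OF y]] cl(2)[OF y] in simp)
  then show ?thesis unfolding gset_iso_def using f bij_betw_inv_into by blast
qed

lemma subgroup_stab: "finite_gset G X \<Longrightarrow> x \<in> fst X \<Longrightarrow> subgroup (stab G X x) G"
  by (rule acts_subgroup_stabilizer[OF finite_gsetD(2)])

lemma stab_gset_iso:
  assumes X: "finite_gset G X" and f: "bij_betw f (fst X) (fst Y)"
    and e: "\<And>g x. g \<in> carrier G \<Longrightarrow> x \<in> fst X \<Longrightarrow> f (snd X g x) = snd Y g (f x)"
    and x: "x \<in> fst X"
  shows "stab G Y (f x) = stab G X x"
  unfolding stabilizer_def
proof (rule Collect_cong, rule conj_cong[OF refl])
  fix g assume g: "g \<in> carrier G"
  have "f (snd X g x) = f x \<longleftrightarrow> snd X g x = x"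
    by (rule inj_on_eq_iff[OF bij_betw_imp_inj_on[OF f] actsD(1)[OF finite_gsetD(2)[OF X] g x] x])
  then show "(snd Y g (f x) = f x) = (snd X g x = x)" using e[OF g x] by simp
qed

lemma stab_count_gset_iso:
  assumes X: "finite_gset G X" and "gset_iso G X Y"
  shows "stab_count G X D = stab_count G Y D"
proof -
  obtain f where f: "bij_betw f (fst X) (fst Y)"
    and e: "\<And>g x. g \<in> carrier G \<Longrightarrow> x \<in> fst X \<Longrightarrow> f (snd X g x) = snd Y g (f x)"
    using assms unfolding gset_iso_def by auto
  have st: "stab G Y (f x) = stab G X x" if x: "x \<in> fst X" for x
    using stab_gset_iso[OF X f e x] by blast
  have "bij_betw f {x \<in> fst X. stab G X x = D} {y \<in> fst Y. stab G Y y = D}"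
  proof (rule bij_betw_subset[OF f])
    show "f ` {x \<in> fst X. stab G X x = D} = {y \<in> fst Y. stab G Y y = D}"
      unfolding bij_betw_imp_surj_on[OF f, symmetric] using st by auto
  qed auto
  then show ?thesis unfolding stab_count_def by (rule bij_betw_same_card)
qed

lemma finite_gset_transport:
  assumes X: "finite_gset G X" and f: "bij_betw f (fst X) E"
  shows "finite_gset G (E, \<lambda>g. \<lambda>y\<in>E. f (snd X g (inv_into (fst X) f y)))" (is "finite_gset G ?Y")
    and "gset_iso G X (E, \<lambda>g. \<lambda>y\<in>E. f (snd X g (inv_into (fst X) f y)))"
proof -
  note a = actsD[OF finite_gsetD(2)[OF X]]
  have cl: "inv_into (fst X) f y \<in> fst X" "f (inv_into (fst X) f y) = y" if "y \<in> E" for y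
    using f that by (auto simp: bij_betw_def inv_into_into f_inv_into_f)
  have fE: "f x \<in> E" "inv_into (fst X) f (f x) = x" if "x \<in> fst X" for x
    using f that by (auto simp: bij_betw_def)
  show "finite_gset G ?Y"
    by (rule finite_gset_restrictI[OF _ _ refl])
       (use f finite_gsetD(1)[OF X] bij_betw_finite cl fE a in \<open>auto simp: acts_def\<close>)
  show "gset_iso G X ?Y"
    unfolding gset_iso_def using f fE by (intro exI[of _ f]) auto
qed

lemma ex_nat_copy:
  assumes X: "finite_gset G X"
  shows "\<exists>Y :: ('a, nat) gset. finite_gset G Y \<and> gset_iso G X Y"
proof -
  obtain f where "bij_betw f (fst X) {..<card (fst X)}"
    using ex_bij_betw_finite_nat[OF finite_gsetD(1)[OF X]] by (auto simp: atLeast0LessThan)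
  then show ?thesis using finite_gset_transport[OF X] by blast
qed

lemma iso_class_eqI:
  assumes "finite_gset G X" "gset_iso G X Y"
  shows "iso_class G X = iso_class G Y"
  unfolding iso_class_def
  using gset_iso_trans[OF gset_iso_sym[OF assms]] gset_iso_trans[OF assms(2)] by blast

lemma iso_class_in: "finite_gset G X \<Longrightarrow> iso_class G X \<in> iso_classes G"
  using ex_nat_copy iso_class_eqI unfolding iso_classes_def by blast

lemma representative:
  assumes "C \<in> iso_classes G"
  shows "finite_gset G (representative C)" "iso_class G (representative C) = C"
proof -
  obtain X :: "('a, nat) gset" where X: "finite_gset G X" "C = iso_class G X"
    using assms unfolding iso_classes_def by auto
  then have "X \<in> C" using gset_iso_refl[of G X] by (simp add: iso_class_def)
  then have "representative C \<in> C" unfolding representative_def by (rule someI)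
  then have *: "finite_gset G (representative C)" "gset_iso G X (representative C)"
    using X by (auto simp: iso_class_def)
  then show "finite_gset G (representative C)" by simp
  show "iso_class G (representative C) = C" using iso_class_eqI[OF X(1) *(2)] X(2) by simp
qed

lemma representative_iso:
  assumes X: "finite_gset G X"
  shows "finite_gset G (representative (iso_class G X))"
    "gset_iso G X (representative (iso_class G X))"
proof -
  obtain Y :: "('a, nat) gset" where Y: "finite_gset G Y" "gset_iso G X Y"
    using ex_nat_copy[OF X] by auto
  then have "Y \<in> iso_class G X" by (auto simp: iso_class_def)
  then have "representative (iso_class G X) \<in> iso_class G X"
    unfolding representative_def by (rule someI)
  then show "finite_gset G (representative (iso_class G X))"
    "gset_iso G X (representative (iso_class G X))" by (auto simp: iso_class_def)
qed

lemma stab_count_representative: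
  "finite_gset G X \<Longrightarrow> stab_count G (representative (iso_class G X)) = stab_count G X"
  using stab_count_gset_iso[OF _ representative_iso(2), of X] by (intro ext) simp

end

context finite_group
begin

text \<open>Every count of points of a \<open>G\<close>-set used below depends on the points through their
  stabilizers only, hence on the \<open>G\<close>-set through its stabilizer counts only.\<close>

lemma sum_over_points:
  fixes w :: "'a set \<Rightarrow> rat"
  assumes X: "finite_gset G X"
  shows "(\<Sum>x\<in>fst X. w (stab G X x)) = (\<Sum>D | subgroup D G. of_nat (stab_count G X D) * w D)"
proof -
  have "(\<Sum>x\<in>fst X. w (stab G X x))
      = (\<Sum>D\<in>{D. subgroup D G}. \<Sum>x\<in>{x\<in>fst X. stab G X x = D}. w (stab G X x))"
    by (rule sum.group[OF finite_gsetD(1)[OF X] finite_subgroups, symmetric])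
       (use subgroup_stab[OF X] in auto)
  also have "\<dots> = (\<Sum>D\<in>{D. subgroup D G}. of_nat (stab_count G X D) * w D)"
    by (rule sum.cong[OF refl]) (simp add: stab_count_def)
  finally show ?thesis .
qed

lemma stab_count_not_subgroup:
  "finite_gset G X \<Longrightarrow> \<not> subgroup D G \<Longrightarrow> stab_count G X D = 0"
  unfolding stab_count_def card_eq_0_iff using subgroup_stab[of X] by blast

end


section \<open>Transitive sets and the decomposition into orbits\<close>

definition conj_set :: "('g, 'm) monoid_scheme \<Rightarrow> 'g \<Rightarrow> 'g set \<Rightarrow> 'g set" where
  "conj_set G g K = (\<lambda>k. g \<otimes>\<^bsub>G\<^esub> k \<otimes>\<^bsub>G\<^esub> inv\<^bsub>G\<^esub> g) ` K"

text \<open>This is the normalizer of \<open>D\<close> (see \<open>normalizer_eq\<close>), written with the action by conjugation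
  on subsets.\<close>

definition conj_stable :: "('g, 'm) monoid_scheme \<Rightarrow> 'g set \<Rightarrow> 'g set" where
  "conj_stable G D = {g \<in> carrier G. conj_set G g D = D}"

definition conjugate :: "('g, 'm) monoid_scheme \<Rightarrow> 'g set \<Rightarrow> 'g set \<Rightarrow> bool" where
  "conjugate G K D \<longleftrightarrow> (\<exists>g\<in>carrier G. D = conj_set G g K)"

context group
begin

lemma conj_set_mult:
  assumes "g \<in> carrier G" "h \<in> carrier G" "K \<subseteq> carrier G"
  shows "conj_set G (g \<otimes> h) K = conj_set G g (conj_set G h K)"
  unfolding conj_set_def image_image
  by (rule image_cong) (use assms in \<open>auto simp: subset_iff m_assoc inv_mult_group\<close>)

lemma conj_set_one: "K \<subseteq> carrier G \<Longrightarrow> conj_set G \<one> K = K"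
  unfolding conj_set_def by (auto simp: subset_iff image_iff)

lemma conj_set_closed: "g \<in> carrier G \<Longrightarrow> K \<subseteq> carrier G \<Longrightarrow> conj_set G g K \<subseteq> carrier G"
  unfolding conj_set_def by auto

lemma conj_set_inv:
  assumes "g \<in> carrier G" "K \<subseteq> carrier G"
  shows "conj_set G (inv g) (conj_set G g K) = K" "conj_set G g (conj_set G (inv g) K) = K"
  using assms conj_set_mult[of "inv g" g K] conj_set_mult[of g "inv g" K] conj_set_one by auto

lemma card_conj_set:
  assumes "g \<in> carrier G" "K \<subseteq> carrier G"
  shows "card (conj_set G g K) = card K"
  unfolding conj_set_def
  by (rule card_image) (use assms in \<open>auto simp: inj_on_def subset_iff\<close>)

lemma subgroup_conj_set:
  assumes g: "g \<in> carrier G" and K: "subgroup K G"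
  shows "subgroup (conj_set G g K) G"
proof (rule subgroupI)
  note sub = subgroup.mem_carrier[OF K]
  show "conj_set G g K \<subseteq> carrier G" using conj_set_closed g subgroup.subset[OF K] by auto
  show "conj_set G g K \<noteq> {}" using subgroup.one_closed[OF K] by (auto simp: conj_set_def)
  fix a assume "a \<in> conj_set G g K"
  then obtain k where k: "k \<in> K" "a = g \<otimes> k \<otimes> inv g" by (auto simp: conj_set_def)
  then have "inv a = g \<otimes> inv k \<otimes> inv g" using g sub by (simp add: inv_mult_group m_assoc)
  then show "inv a \<in> conj_set G g K" using k subgroup.m_inv_closed[OF K] by (auto simp: conj_set_def)
  fix b assume "b \<in> conj_set G g K"
  then obtain l where l: "l \<in> K" "b = g \<otimes> l \<otimes> inv g" by (auto simp: conj_set_def)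
  have "inv g \<otimes> (g \<otimes> (l \<otimes> inv g)) = l \<otimes> inv g"
    using l g sub by (simp add: m_assoc[symmetric])
  then have "a \<otimes> b = g \<otimes> (k \<otimes> l) \<otimes> inv g" using k l g sub by (simp add: m_assoc)
  then show "a \<otimes> b \<in> conj_set G g K"
    using k l subgroup.m_closed[OF K] by (auto simp: conj_set_def)
qed

lemma conjugate_refl: "subgroup K G \<Longrightarrow> conjugate G K K"
  unfolding conjugate_def using conj_set_one[OF subgroup.subset] by force

lemma conjugate_sym: "subgroup K G \<Longrightarrow> conjugate G K D \<Longrightarrow> conjugate G D K"
  unfolding conjugate_def using conj_set_inv(1)[OF _ subgroup.subset] by (metis inv_closed)

lemma conjugate_trans:
  "subgroup K G \<Longrightarrow> conjugate G K D \<Longrightarrow> conjugate G D E \<Longrightarrow> conjugate G K E"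
  unfolding conjugate_def using conj_set_mult[OF _ _ subgroup.subset] by (metis m_closed)

lemma acts_cosets:
  assumes "subgroup K G"
  shows "acts G (lcosets K) (\<lambda>g C. g <# C)"
proof -
  interpret subgroup K G by fact
  have *: "\<exists>a\<in>carrier G. C = a <# K" "C \<subseteq> carrier G" if "C \<in> lcosets K" for C
    using that l_coset_subset_G[OF subset] unfolding LCOSETS_def by auto
  show ?thesis unfolding acts_def
  proof (intro conjI ballI)
    fix g C assume g: "g \<in> carrier G" and C: "C \<in> lcosets K"
    then obtain a where "a \<in> carrier G" "C = a <# K" using * by auto
    then show "g <# C \<in> lcosets K"
      using g lcos_m_assoc[OF subset g] unfolding LCOSETS_def by auto
  qed (use * lcos_m_assoc lcos_mult_one in auto)
qed

lemma snd_coset_gset: "C \<in> lcosets K \<Longrightarrow> snd (coset_gset G K) g C = g <# C"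
  unfolding coset_gset_def by simp

lemma acts_coset_gset: "subgroup K G \<Longrightarrow> acts G (lcosets K) (snd (coset_gset G K))"
  using acts_cosets unfolding acts_def by (simp add: snd_coset_gset)

lemma self_in_lcosets: "subgroup K G \<Longrightarrow> K \<in> lcosets K"
  unfolding LCOSETS_def using lcos_mult_one[OF subgroup.subset] by force

lemma stab_coset_self:
  assumes "subgroup K G"
  shows "stab G (coset_gset G K) K = K"
proof -
  interpret subgroup K G by fact
  have "g <# K = K \<longleftrightarrow> g \<in> K" if "g \<in> carrier G" for g
    using that lcos_self[OF that assms] coset_join3 assms by metis
  then show ?thesis
    unfolding stabilizer_def snd_coset_gset[OF self_in_lcosets[OF assms]] using subset by blast
qed

lemma orbit_coset_self:
  assumes "subgroup K G"
  shows "orbit G (snd (coset_gset G K)) K = lcosets K"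
  unfolding orbit_def snd_coset_gset[OF self_in_lcosets[OF assms]] LCOSETS_def by auto

end

context finite_group
begin

lemma finite_gset_coset:
  assumes K: "subgroup K G"
  shows "finite_gset G (coset_gset G K)"
  unfolding coset_gset_def
  by (rule finite_gset_restrictI[OF _ acts_cosets[OF K]])
     (auto simp: LCOSETS_def finite_carrier)

lemma sum_over_cosets:
  fixes w :: "'a set \<Rightarrow> rat"
  assumes K: "subgroup K G"
  shows "(\<Sum>C\<in>lcosets K. w (stab G (coset_gset G K) C))
    = (\<Sum>g\<in>carrier G. w (conj_set G g K)) / of_nat (card K)"
proof -
  note a = acts_coset_gset[OF K] and KK = self_in_lcosets[OF K]
  have "(\<Sum>g\<in>carrier G. w (stab G (coset_gset G K) (snd (coset_gset G K) g K)))
     = of_nat (card K) * (\<Sum>C\<in>lcosets K. w (stab G (coset_gset G K) C))"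
    using sum_over_orbit[OF a KK, of "\<lambda>C. w (stab G (coset_gset G K) C)"]
    by (simp add: stab_coset_self[OF K] orbit_coset_self[OF K])
  moreover have "stab G (coset_gset G K) (snd (coset_gset G K) g K) = conj_set G g K"
    if "g \<in> carrier G" for g
    using stabilizer_translate[OF a KK that] by (simp add: stab_coset_self[OF K] conj_set_def)
  ultimately show ?thesis using card_subgroup_pos[OF K] by simp
qed

text \<open>Running through \<open>G\<close> instead of \<open>G/K\<close> meets every coset \<open>|K|\<close> times, and the stabilizer of
  \<open>g K\<close> is the conjugate of \<open>K\<close> by \<open>g\<close>.\<close>

lemma sum_stab_count_coset:
  fixes w :: "'a set \<Rightarrow> rat"
  assumes K: "subgroup K G"
  shows "(\<Sum>D | subgroup D G. of_nat (stab_count G (coset_gset G K) D) * w D)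
    = (\<Sum>g\<in>carrier G. w (conj_set G g K)) / of_nat (card K)"
  using sum_over_points[OF finite_gset_coset[OF K]] sum_over_cosets[OF K]
  by (simp add: coset_gset_def)

lemma sum_stab_count_coset_const:
  fixes w :: "'a set \<Rightarrow> rat"
  assumes K: "subgroup K G" and c: "\<And>g. g \<in> carrier G \<Longrightarrow> w (conj_set G g K) = c"
  shows "(\<Sum>D | subgroup D G. of_nat (stab_count G (coset_gset G K) D) * w D)
    = of_nat (card (carrier G)) / of_nat (card K) * c"
  unfolding sum_stab_count_coset[OF K] using c by simp

text \<open>The elements that conjugate \<open>K\<close> to \<open>D\<close> form a coset of the normalizer of \<open>D\<close>.\<close>

lemma stab_count_coset:
  assumes K: "subgroup K G"
  shows "(of_nat (stab_count G (coset_gset G K) D) :: rat)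
    = (if conjugate G K D then of_nat (card (conj_stable G D)) / of_nat (card D) else 0)"
proof (cases "subgroup D G")
  case True
  have "(of_nat (stab_count G (coset_gset G K) D) :: rat)
     = (\<Sum>E | subgroup E G. of_nat (stab_count G (coset_gset G K) E) * of_bool (E = D))"
    using True finite_subgroups by (subst sum.mono_neutral_right[of _ "{D}"]) auto
  also have "\<dots> = of_nat (card {g \<in> carrier G. conj_set G g K = D}) / of_nat (card K)"
    unfolding sum_stab_count_coset[OF K] using finite_carrier
    by (simp add: sum.If_cases of_bool_def Int_def)
  finally have 1: "(of_nat (stab_count G (coset_gset G K) D) :: rat)
     = of_nat (card {g \<in> carrier G. conj_set G g K = D}) / of_nat (card K)" .
  show ?thesis
  proof (cases "conjugate G K D")
    case True
    then obtain h where h: "h \<in> carrier G" "D = conj_set G h K" by (auto simp: conjugate_def)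
    note Ks = subgroup.subset[OF K]
    have "bij_betw (\<lambda>g. g \<otimes> h) (conj_stable G D) {g \<in> carrier G. conj_set G g K = D}"
      by (rule bij_betw_byWitness[where f' = "\<lambda>g. g \<otimes> inv h"])
         (use h conj_set_mult[OF _ h(1) Ks] conj_set_mult[OF _ _ conj_set_closed[OF h(1) Ks]]
            conj_set_inv[OF h(1) Ks] in \<open>auto simp: conj_stable_def m_assoc\<close>)
    then show ?thesis using 1 True h card_conj_set[OF h(1) Ks]
      by (simp add: bij_betw_same_card)
  next
    case False
    then have "{g \<in> carrier G. conj_set G g K = D} = {}" by (auto simp: conjugate_def)
    then have "card {g \<in> carrier G. conj_set G g K = D} = 0" by (simp only: card.empty)
    then show ?thesis using 1 False by simp
  qed
next
  case False
  then show ?thesis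
    using stab_count_not_subgroup[OF finite_gset_coset[OF K]] subgroup_conj_set[OF _ K]
    by (auto simp: conjugate_def)
qed

end

definition gset_part :: "('g, 'x) gset \<Rightarrow> 'x set \<Rightarrow> ('g, 'x) gset" where
  "gset_part X A = (A, \<lambda>g. restrict (snd X g) A)"

context group
begin

lemma finite_gset_part:
  assumes X: "finite_gset G X" and "A \<subseteq> fst X" "\<And>g x. g \<in> carrier G \<Longrightarrow> x \<in> A \<Longrightarrow> snd X g x \<in> A"
  shows "finite_gset G (gset_part X A)"
  unfolding gset_part_def
proof (rule finite_gset_restrictI[OF _ _ refl])
  show "finite A" using assms(2) finite_gsetD(1)[OF X] finite_subset by blast
  show "acts G A (snd X)"
    using finite_gsetD(2)[OF X] assms(2,3) unfolding acts_def by blast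
qed

lemma finite_gset_sum:
  assumes "finite_gset G X" "finite_gset G Y"
  shows "finite_gset G (gset_sum X Y)"
  unfolding gset_sum_def
  by (rule finite_gset_restrictI[OF _ _ refl])
     (use finite_gsetD(1,2)[OF assms(1)] finite_gsetD(1,2)[OF assms(2)] in \<open>auto simp: acts_def\<close>)

lemma stab_count_gset_sum:
  assumes "finite_gset G X" "finite_gset G Y"
  shows "stab_count G (gset_sum X Y) D = stab_count G X D + stab_count G Y D"
proof -
  have st: "stab G (gset_sum X Y) (Inl x) = stab G X x" if "x \<in> fst X" for x
    using that by (auto simp: stabilizer_def gset_sum_def)
  have st': "stab G (gset_sum X Y) (Inr y) = stab G Y y" if "y \<in> fst Y" for y
    using that by (auto simp: stabilizer_def gset_sum_def)
  have "{z \<in> fst (gset_sum X Y). stab G (gset_sum X Y) z = D}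
     = {x \<in> fst X. stab G X x = D} <+> {y \<in> fst Y. stab G Y y = D}"
  proof -
    have "fst (gset_sum X Y) = fst X <+> fst Y" by (simp add: gset_sum_def)
    then show ?thesis by (auto simp: st st')
  qed
  then show ?thesis unfolding stab_count_def
    using finite_gsetD(1)[OF assms(1)] finite_gsetD(1)[OF assms(2)] by (simp add: card_Plus)
qed

lemma gset_iso_parts:
  assumes "A \<union> B = fst X" "A \<inter> B = {}"
    "\<And>g x. g \<in> carrier G \<Longrightarrow> x \<in> A \<Longrightarrow> snd X g x \<in> A"
    "\<And>g x. g \<in> carrier G \<Longrightarrow> x \<in> B \<Longrightarrow> snd X g x \<in> B"
  shows "gset_iso G X (gset_sum (gset_part X A) (gset_part X B))"
  unfolding gset_iso_def
proof (intro exI[of _ "\<lambda>x. if x \<in> A then Inl x else Inr x"] conjI ballI)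
  show "bij_betw (\<lambda>x. if x \<in> A then Inl x else Inr x) (fst X)
      (fst (gset_sum (gset_part X A) (gset_part X B)))"
    using assms(1,2) unfolding bij_betw_def inj_on_def gset_sum_def gset_part_def by auto
  fix g x assume g: "g \<in> carrier G" and x: "x \<in> fst X"
  show "(if snd X g x \<in> A then Inl (snd X g x) else Inr (snd X g x)) =
      snd (gset_sum (gset_part X A) (gset_part X B)) g (if x \<in> A then Inl x else Inr x)"
    using assms(3)[OF g, of x] assms(4)[OF g, of x] x assms(1,2)
    by (auto simp: gset_sum_def gset_part_def)
qed

text \<open>The isomorphism \<open>G/G\<^sub>x \<cong> G x\<close>, read backwards: a point \<open>y\<close> of the orbit corresponds to the
  coset of all group elements that carry \<open>x\<close> to \<open>y\<close>.\<close>

lemma orbit_iso_coset: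
  assumes X: "finite_gset G X" and x: "x \<in> fst X"
  shows "gset_iso G (gset_part X (orbit G (snd X) x)) (coset_gset G (stab G X x))"
proof -
  let ?K = "stab G X x" and ?O = "orbit G (snd X) x"
  let ?f = "\<lambda>y. {g \<in> carrier G. snd X g x = y}"
  note a = finite_gsetD(2)[OF X]
  have co: "?f (snd X h x) = h <# ?K" if h: "h \<in> carrier G" for h
  proof
    show "h <# ?K \<subseteq> ?f (snd X h x)"
      using h actsD(3)[OF a] x by (auto simp: l_coset_def stabilizer_def)
    show "?f (snd X h x) \<subseteq> h <# ?K"
    proof
      fix g assume "g \<in> ?f (snd X h x)"
      then have g: "g \<in> carrier G" "snd X g x = snd X h x" by auto
      have "snd X (inv h \<otimes> g) x = x"
        using actsD(3)[OF a, of "inv h" g x] acts_inv(1)[OF a h x] g h x by simp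
      then have "inv h \<otimes> g \<in> ?K" using g h by (simp add: stabilizer_def)
      moreover have "g = h \<otimes> (inv h \<otimes> g)" using g h by (simp add: m_assoc[symmetric])
      ultimately show "g \<in> h <# ?K" unfolding l_coset_def by blast
    qed
  qed
  have "bij_betw ?f ?O (lcosets ?K)"
    unfolding bij_betw_def
  proof
    show "inj_on ?f ?O" unfolding inj_on_def orbit_def by auto
    show "?f ` ?O = lcosets ?K" using co unfolding orbit_def LCOSETS_def by auto
  qed
  moreover have "?f (snd X g y) = snd (coset_gset G ?K) g (?f y)"
    if g: "g \<in> carrier G" and y: "y \<in> ?O" for g y
  proof -
    obtain h where h: "h \<in> carrier G" "y = snd X h x" using y unfolding orbit_def by auto
    have "?f (snd X g y) = (g \<otimes> h) <# ?K"
      unfolding h(2) actsD(3)[OF a g h(1) x, symmetric] by (rule co) (use g h in simp)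
    also have "\<dots> = g <# (h <# ?K)"
      using lcos_m_assoc[OF _ g h(1)] subgroup.subset[OF subgroup_stab[OF X x]] by simp
    also have "\<dots> = snd (coset_gset G ?K) g (h <# ?K)"
      by (rule snd_coset_gset[symmetric]) (use h in \<open>auto simp: LCOSETS_def\<close>)
    finally show ?thesis unfolding h(2) co[OF h(1)] .
  qed
  ultimately show ?thesis
    unfolding gset_iso_def by (intro exI[of _ ?f]) (auto simp: gset_part_def coset_gset_def)
qed

text \<open>Splitting off one orbit at a time. All sets stay in the universe of natural numbers, where
  isomorphism classes are formed, so the splitting is stated up to isomorphism.\<close>

lemma finite_gset_induct [consumes 1, case_names empty orbit]:
  fixes X :: "('a, nat) gset"
  assumes X: "finite_gset G X"
    and empty: "\<And>X. finite_gset G X \<Longrightarrow> fst X = {} \<Longrightarrow> P X"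
    and orbit: "\<And>(X :: ('a, nat) gset) (Y :: ('a, nat) gset) Z K. \<lbrakk>finite_gset G X; finite_gset G Y; finite_gset G Z; subgroup K G;
        gset_iso G X (gset_sum Y Z); gset_iso G Y (coset_gset G K); P Z\<rbrakk> \<Longrightarrow> P X"
  shows "P X"
  using X
proof (induction "card (fst X)" arbitrary: X rule: less_induct)
  case less
  note X = less.prems
  note a = finite_gsetD(2)[OF X]
  show ?case
  proof (cases "fst X = {}")
    case False
    then obtain x where x: "x \<in> fst X" by auto
    let ?A = "orbit G (snd X) x"
    let ?B = "fst X - ?A"
    note o = acts_orbit[OF a x]
    have A: "snd X g y \<in> ?A" if "g \<in> carrier G" "y \<in> ?A" for g y
    proof -
      have "snd X g y \<in> orbit G (snd X) y" unfolding orbit_def using that by auto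
      then show ?thesis using o(3)[OF that(2)] by simp
    qed
    have B: "snd X g y \<in> ?B" if "g \<in> carrier G" "y \<in> ?B" for g y
    proof -
      have y: "y \<in> fst X" and yA: "y \<notin> ?A" using that by auto
      have "snd X g y \<in> ?A \<Longrightarrow> snd X (inv g) (snd X g y) \<in> ?A" using A that(1) by blast
      then show ?thesis using acts_inv(1)[OF a that(1) y] actsD(1)[OF a that(1) y] yA by auto
    qed
    have "card ?B < card (fst X)"
      using o(1,2) x finite_gsetD(1)[OF X] by (intro psubset_card_mono) auto
    moreover have fB: "finite_gset G (gset_part X ?B)"
      by (rule finite_gset_part[OF X _ B]) auto
    ultimately have "P (gset_part X ?B)" using less.hyps by (simp add: gset_part_def)
    moreover have "gset_iso G X (gset_sum (gset_part X ?A) (gset_part X ?B))"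
      by (rule gset_iso_parts) (use o(2) A B in auto)
    moreover have "finite_gset G (gset_part X ?A)"
      by (rule finite_gset_part[OF X o(2)]) (use A in auto)
    ultimately show ?thesis
      using orbit_iso_coset[OF X x] by (intro orbit[OF X _ fB subgroup_stab[OF X x]])
  qed (use empty X in auto)
qed

end


section \<open>The ghost of an element of the Burnside module\<close>

lemma localized_int_of_int:
  assumes "prime p"
  shows "of_int a \<in> localized_int p"
proof -
  have "\<not> int p dvd 1" using assms not_prime_unit[of "int p"] by auto
  moreover have "of_int a = (of_int a / of_int 1 :: rat)" by simp
  ultimately show ?thesis unfolding localized_int_def by blast
qed

lemma localized_int_0: "prime p \<Longrightarrow> 0 \<in> localized_int p"
  and localized_int_1: "prime p \<Longrightarrow> 1 \<in> localized_int p"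
  using localized_int_of_int[of p 0] localized_int_of_int[of p 1] by simp_all

lemma localized_int_of_nat: "prime p \<Longrightarrow> of_nat a \<in> localized_int p"
  using localized_int_of_int[of p "int a"] by simp

lemma localized_int_uminus: "x \<in> localized_int p \<Longrightarrow> - x \<in> localized_int p"
  unfolding localized_int_def by clarify (metis minus_divide_left of_int_minus)

lemma localized_int_add:
  assumes p: "prime p" and "x \<in> localized_int p" "y \<in> localized_int p"
  shows "x + y \<in> localized_int p"
proof -
  obtain a b c d where x: "x = of_int a / of_int b" "\<not> int p dvd b"
    and y: "y = of_int c / of_int d" "\<not> int p dvd d"
    using assms unfolding localized_int_def by blast
  have "b \<noteq> 0" "d \<noteq> 0" using x y by auto
  then have "x + y = of_int (a * d + c * b) / of_int (b * d)"
    using x y by (simp add: add_frac_eq)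
  moreover have "\<not> int p dvd b * d" using p x y by (simp add: prime_dvd_mult_iff)
  ultimately show ?thesis unfolding localized_int_def by blast
qed

lemma localized_int_mult:
  assumes p: "prime p" and "x \<in> localized_int p" "y \<in> localized_int p"
  shows "x * y \<in> localized_int p"
proof -
  obtain a b c d where x: "x = of_int a / of_int b" "\<not> int p dvd b"
    and y: "y = of_int c / of_int d" "\<not> int p dvd d"
    using assms unfolding localized_int_def by blast
  have "x * y = of_int (a * c) / of_int (b * d)" using x y by simp
  moreover have "\<not> int p dvd b * d" using p x y by (simp add: prime_dvd_mult_iff)
  ultimately show ?thesis unfolding localized_int_def by blast
qed

lemma localized_int_sum:
  assumes "prime p" "\<And>i. i \<in> A \<Longrightarrow> f i \<in> localized_int p"
  shows "(\<Sum>i\<in>A. f i) \<in> localized_int p"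
  using assms(2) by (induction A rule: infinite_finite_induct)
    (auto intro: localized_int_0 localized_int_add assms(1))

definition lin :: "('c \<Rightarrow> rat) \<Rightarrow> ('c \<Rightarrow>\<^sub>0 rat) \<Rightarrow> rat" where
  "lin f x = (\<Sum>C\<in>Poly_Mapping.keys x. Poly_Mapping.lookup x C * f C)"

lemma lin_superset:
  assumes "finite A" "Poly_Mapping.keys x \<subseteq> A"
  shows "lin f x = (\<Sum>C\<in>A. Poly_Mapping.lookup x C * f C)"
  unfolding lin_def using assms by (intro sum.mono_neutral_left) (auto simp: in_keys_iff)

lemma lin_add: "lin f (x + y) = lin f x + lin f y"
proof -
  let ?A = "Poly_Mapping.keys x \<union> Poly_Mapping.keys y"
  have "Poly_Mapping.keys (x + y) \<subseteq> ?A" by (rule Poly_Mapping.keys_add)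
  then show ?thesis
    by (simp add: lin_superset[of ?A] lookup_add distrib_right sum.distrib)
qed

lemma lin_0: "lin f 0 = 0"
  by (simp add: lin_def)

lemma lin_diff: "lin f (x - y) = lin f x - lin f y"
  using lin_add[of f "x - y" y] by simp

lemma lin_single: "lin f (Poly_Mapping.single C c) = c * f C"
  by (simp add: lin_def)

lemma lin_sum: "lin f (\<Sum>i\<in>A. x i) = (\<Sum>i\<in>A. lin f (x i))"
  by (induction A rule: infinite_finite_induct) (auto simp: lin_add lin_0)

lemma lin_linear_ext: "lin f (linear_ext h x) = lin (\<lambda>C. f (h C)) x"
  unfolding linear_ext_def lin_sum lin_single by (simp add: lin_def)

lemma lin_bilinear_ext:
  "lin f (bilinear_ext h x y) = lin (\<lambda>C. lin (\<lambda>D. f (h C D)) y) x"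
  unfolding bilinear_ext_def lin_sum lin_single
  by (simp add: lin_def sum_distrib_left mult.assoc)

lemma poly_mapping_as_sum:
  "x = (\<Sum>C\<in>Poly_Mapping.keys x. Poly_Mapping.single C (Poly_Mapping.lookup x C :: rat))"
proof (rule poly_mapping_eqI)
  fix D
  show "Poly_Mapping.lookup x D = Poly_Mapping.lookup
      (\<Sum>C\<in>Poly_Mapping.keys x. Poly_Mapping.single C (Poly_Mapping.lookup x C)) D"
    by (simp add: lookup_sum lookup_single when_def in_keys_iff)
qed

context
  fixes p :: nat
  assumes p: "prime p"
begin

lemma formal_sums_0: "0 \<in> formal_sums p G"
  unfolding formal_sums_def using localized_int_0[OF p] by simp

lemma formal_sums_single:
  "C \<in> iso_classes G \<Longrightarrow> c \<in> localized_int p \<Longrightarrow> Poly_Mapping.single C c \<in> formal_sums p G"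
  unfolding formal_sums_def using localized_int_0[OF p] by (auto simp: lookup_single when_def)

lemma formal_sums_add:
  assumes "x \<in> formal_sums p G" "y \<in> formal_sums p G"
  shows "x + y \<in> formal_sums p G"
  using assms localized_int_add[OF p] Poly_Mapping.keys_add[of x y]
  unfolding formal_sums_def by (auto simp: lookup_add)

lemma formal_sums_sum:
  "(\<And>i. i \<in> A \<Longrightarrow> x i \<in> formal_sums p G) \<Longrightarrow> (\<Sum>i\<in>A. x i) \<in> formal_sums p G"
  by (induction A rule: infinite_finite_induct) (auto intro: formal_sums_0 formal_sums_add)

lemma formal_sums_linear_ext:
  assumes "x \<in> formal_sums p G" "\<And>C. C \<in> iso_classes G \<Longrightarrow> f C \<in> iso_classes H"
  shows "linear_ext f x \<in> formal_sums p H"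
  unfolding linear_ext_def
  by (intro formal_sums_sum formal_sums_single) (use assms in \<open>auto simp: formal_sums_def\<close>)

lemma formal_sums_bilinear_ext:
  assumes "x \<in> formal_sums p G" "y \<in> formal_sums p H"
    "\<And>C D. C \<in> iso_classes G \<Longrightarrow> D \<in> iso_classes H \<Longrightarrow> f C D \<in> iso_classes K"
  shows "bilinear_ext f x y \<in> formal_sums p K"
  unfolding bilinear_ext_def
  by (intro formal_sums_sum formal_sums_single localized_int_mult[OF p] assms(3))
     (use assms(1,2) in \<open>auto simp: formal_sums_def\<close>)

lemma burnside_rels_add:
  assumes "r \<in> burnside_rels p G" "s \<in> burnside_rels p G"
  shows "r + s \<in> burnside_rels p G"
  using assms(2)
proof (induction s rule: burnside_rels.induct)
  case (step s c X Y)
  then show ?case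
    using burnside_rels.step[of "r + s" p G c X Y] by (simp add: algebra_simps)
qed (use assms(1) in simp)

lemma burnside_rels_single:
  fixes X Y :: "('g, nat) gset"
  assumes "c \<in> localized_int p" "finite_gset G X" "finite_gset G Y"
  shows "Poly_Mapping.single (iso_class G (gset_sum X Y)) c - Poly_Mapping.single (iso_class G X) c
     - Poly_Mapping.single (iso_class G Y) c \<in> burnside_rels p G"
  using burnside_rels.step[OF burnside_rels.zero assms] by simp

lemma burnside_rels_uminus: "r \<in> burnside_rels p G \<Longrightarrow> - r \<in> burnside_rels p G"
proof (induction r rule: burnside_rels.induct)
  case (step r c X Y)
  then show ?case
    using burnside_rels.step[OF step.IH localized_int_uminus[OF step.hyps(2)] step.hyps(3,4)]
    by (simp add: algebra_simps single_uminus)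
qed (simp add: burnside_rels.zero)

lemma burnside_rels_sum:
  "(\<And>i. i \<in> A \<Longrightarrow> x i \<in> burnside_rels p G) \<Longrightarrow> (\<Sum>i\<in>A. x i) \<in> burnside_rels p G"
  by (induction A rule: infinite_finite_induct) (auto intro: burnside_rels.zero burnside_rels_add)

end

definition ghost_sum :: "('g, 'm) monoid_scheme \<Rightarrow> ('g iso_type \<Rightarrow>\<^sub>0 rat) \<Rightarrow> 'g set \<Rightarrow> rat" where
  "ghost_sum G x D = lin (\<lambda>C. of_nat (stab_count G (representative C) D)) x"

text \<open>The ghost of an element of \<open>A(G)\<^sub>(\<^sub>p\<^sub>)\<close> counts the points by their exact stabilizers.
  Compared with the marks, which count the points whose stabilizer contains a given subgroup, its
  advantage is that the ghosts of the transitive sets have disjoint supports: \<open>G/K\<close> is seen on the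
  conjugates of \<open>K\<close> only, with the value \<open>|N\<^sub>G K : K|\<close>.\<close>

definition ghost :: "('g, 'm) monoid_scheme \<Rightarrow> 'g burnside \<Rightarrow> 'g set \<Rightarrow> rat" where
  "ghost G a = ghost_sum G (SOME x. x \<in> a)"

text \<open>The image of the ghost map: the third condition says that the coordinate of \<open>\<tau>\<close> at the
  transitive set \<open>G/D\<close> lies in \<open>\<int>\<^sub>(\<^sub>p\<^sub>)\<close>, because \<open>|N\<^sub>G D : D|\<close> points of \<open>G/D\<close> have stabilizer
  \<open>D\<close>.\<close>

definition integral :: "nat \<Rightarrow> ('g, 'm) monoid_scheme \<Rightarrow> ('g set \<Rightarrow> rat) \<Rightarrow> bool" where
  "integral p G \<tau> \<longleftrightarrow> (\<forall>D. \<not> subgroup D G \<longrightarrow> \<tau> D = 0) \<and>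
     (\<forall>g\<in>carrier G. \<forall>D. subgroup D G \<longrightarrow> \<tau> (conj_set G g D) = \<tau> D) \<and>
     (\<forall>D. subgroup D G \<longrightarrow>
        of_nat (card D) * \<tau> D / of_nat (card (conj_stable G D)) \<in> localized_int p)"

text \<open>The same subgroup is chosen for all members of a conjugacy class, see \<open>conj_rep_cong\<close>.\<close>

definition conj_rep :: "('g, 'm) monoid_scheme \<Rightarrow> 'g set \<Rightarrow> 'g set" where
  "conj_rep G D = (SOME K. subgroup K G \<and> conjugate G K D)"

text \<open>The coordinates of \<open>\<tau>\<close> with respect to the transitive sets, one for each conjugacy class of
  subgroups.\<close>

definition coord :: "('g, 'm) monoid_scheme \<Rightarrow> ('g set \<Rightarrow> rat) \<Rightarrow> 'g set \<Rightarrow> rat" where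
  "coord G \<tau> K = (if conj_rep G K = K
     then of_nat (card K) * \<tau> K / of_nat (card (conj_stable G K)) else 0)"

definition orbit_sum :: "('g, 'm) monoid_scheme \<Rightarrow> ('g set \<Rightarrow> rat) \<Rightarrow> 'g iso_type \<Rightarrow>\<^sub>0 rat" where
  "orbit_sum G \<tau> = (\<Sum>K | subgroup K G.
     Poly_Mapping.single (iso_class G (coset_gset G K)) (coord G \<tau> K))"

context group
begin

lemma ghost_sum_add: "ghost_sum G (x + y) D = ghost_sum G x D + ghost_sum G y D"
  by (simp add: ghost_sum_def lin_add)

lemma ghost_sum_diff: "ghost_sum G (x - y) D = ghost_sum G x D - ghost_sum G y D"
  by (simp add: ghost_sum_def lin_diff)

lemma ghost_sum_single:
  "finite_gset G X \<Longrightarrow>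
     ghost_sum G (Poly_Mapping.single (iso_class G X) c) D = c * of_nat (stab_count G X D)"
  by (simp add: ghost_sum_def lin_single stab_count_representative)

text \<open>Counts of points are additive on disjoint unions.\<close>

lemma ghost_sum_rels: "r \<in> burnside_rels p G \<Longrightarrow> ghost_sum G r D = 0"
proof (induction r rule: burnside_rels.induct)
  case (step r c X Y)
  then show ?case
    by (simp add: ghost_sum_add ghost_sum_diff ghost_sum_single stab_count_gset_sum
        finite_gset_sum distrib_left)
qed (simp add: ghost_sum_def lin_0)

lemma conj_rep:
  assumes "subgroup D G"
  shows "subgroup (conj_rep G D) G" "conjugate G (conj_rep G D) D"
  using someI[of "\<lambda>K. subgroup K G \<and> conjugate G K D" D] assms conjugate_refl
  unfolding conj_rep_def by auto

lemma conj_rep_cong: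
  assumes "subgroup D G" "conjugate G D E"
  shows "conj_rep G D = conj_rep G E"
proof -
  have "conjugate G K D \<longleftrightarrow> conjugate G K E" if K: "subgroup K G" for K
  proof -
    have E: "subgroup E G" using assms subgroup_conj_set unfolding conjugate_def by auto
    show ?thesis
      using conjugate_trans[OF K _ assms(2)] conjugate_trans[OF K _ conjugate_sym[OF assms]] by blast
  qed
  then show ?thesis unfolding conj_rep_def by (metis (no_types, lifting))
qed

lemma conj_rep_idem: "subgroup D G \<Longrightarrow> conj_rep G (conj_rep G D) = conj_rep G D"
  by (rule conj_rep_cong[OF conj_rep])

lemma conj_rep_eq_iff:
  assumes "subgroup K G" "subgroup D G"
  shows "conj_rep G K = K \<and> conjugate G K D \<longleftrightarrow> K = conj_rep G D"
  using conj_rep_cong[OF assms(1)] conj_rep[OF assms(2)] conj_rep_idem[OF assms(2)] by auto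

lemma coord_add: "coord G (\<lambda>D. \<sigma> D + \<tau> D) K = coord G \<sigma> K + coord G \<tau> K"
  by (simp add: coord_def distrib_left add_divide_distrib)

lemma orbit_sum_add: "orbit_sum G (\<lambda>D. \<sigma> D + \<tau> D) = orbit_sum G \<sigma> + orbit_sum G \<tau>"
  by (simp add: orbit_sum_def coord_add single_add sum.distrib)

lemma orbit_sum_0: "orbit_sum G (\<lambda>D. 0) = 0"
proof -
  have "coord G (\<lambda>D. 0) K = 0" for K by (simp add: coord_def)
  then show ?thesis by (simp add: orbit_sum_def)
qed

lemma orbit_sum_sum: "orbit_sum G (\<lambda>D. \<Sum>i\<in>A. \<tau> i D) = (\<Sum>i\<in>A. orbit_sum G (\<tau> i))"
  by (induction A rule: infinite_finite_induct) (auto simp: orbit_sum_add orbit_sum_0)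

end

context finite_group
begin

lemma card_conj_stable_pos:
  assumes "subgroup D G"
  shows "card (conj_stable G D) > 0"
proof -
  have "\<one> \<in> conj_stable G D"
    using conj_set_one[OF subgroup.subset[OF assms]] by (simp add: conj_stable_def)
  moreover have "finite (conj_stable G D)" using finite_carrier by (simp add: conj_stable_def)
  ultimately show ?thesis using card_gt_0_iff by blast
qed

lemma conj_stable_conj:
  assumes D: "subgroup D G" and g: "g \<in> carrier G"
  shows "card (conj_stable G (conj_set G g D)) = card (conj_stable G D)"
proof -
  note Ds = subgroup.subset[OF D]
  have *: "conj_set G (g \<otimes> h \<otimes> inv g) (conj_set G g D) = conj_set G g (conj_set G h D)"
    if "h \<in> carrier G" for h
  proof -
    have "g \<otimes> h \<otimes> inv g \<otimes> g = g \<otimes> h" using that g by (simp add: m_assoc)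
    then show ?thesis
      using conj_set_mult[of "g \<otimes> h \<otimes> inv g" g D] conj_set_mult[of g h D] that g Ds by simp
  qed
  have "bij_betw (\<lambda>h. g \<otimes> h \<otimes> inv g) (conj_stable G D) (conj_stable G (conj_set G g D))"
  proof (rule bij_betw_byWitness[where f' = "\<lambda>h. inv g \<otimes> h \<otimes> g"])
    show "\<forall>h\<in>conj_stable G D. inv g \<otimes> (g \<otimes> h \<otimes> inv g) \<otimes> g = h"
      using g by (auto simp: conj_stable_def m_assoc) (simp add: m_assoc[symmetric])
    show *: "\<forall>h\<in>conj_stable G (conj_set G g D). g \<otimes> (inv g \<otimes> h \<otimes> g) \<otimes> inv g = h"
      using g by (auto simp: conj_stable_def m_assoc) (simp add: m_assoc[symmetric])
    show "(\<lambda>h. g \<otimes> h \<otimes> inv g) ` conj_stable G D \<subseteq> conj_stable G (conj_set G g D)"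
      using \<open>\<And>h. h \<in> carrier G \<Longrightarrow> _\<close> g by (auto simp: conj_stable_def)
    show "(\<lambda>h. inv g \<otimes> h \<otimes> g) ` conj_stable G (conj_set G g D) \<subseteq> conj_stable G D"
    proof
      fix k assume "k \<in> (\<lambda>h. inv g \<otimes> h \<otimes> g) ` conj_stable G (conj_set G g D)"
      then obtain h where h: "h \<in> conj_stable G (conj_set G g D)" "k = inv g \<otimes> h \<otimes> g" by auto
      then have hc: "h \<in> carrier G" and k: "k \<in> carrier G" using g by (auto simp: conj_stable_def)
      have "conj_set G k D = conj_set G (inv g) (conj_set G h (conj_set G g D))"
        unfolding h(2) using hc g Ds by (simp add: conj_set_mult conj_set_closed)
      also have "\<dots> = D" using h(1) conj_set_inv(1)[OF g Ds] by (simp add: conj_stable_def)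
      finally show "k \<in> conj_stable G D" using k by (simp add: conj_stable_def)
    qed
  qed
  then show ?thesis by (rule bij_betw_same_card[symmetric])
qed

lemma coord_coset:
  assumes K: "subgroup K G" and L: "subgroup L G"
  shows "coord G (\<lambda>D. c * of_nat (stab_count G (coset_gset G K) D)) L
    = (if L = conj_rep G K then c else 0)"
proof -
  have "conj_rep G L = L \<and> conjugate G K L \<longleftrightarrow> L = conj_rep G K"
    using conj_rep_eq_iff[OF L K] conjugate_sym[OF K] conjugate_sym[OF L] by blast
  then show ?thesis
    using card_subgroup_pos[OF L] card_conj_stable_pos[OF L]
    by (auto simp: coord_def stab_count_coset[OF K])
qed

lemma iso_class_conjugate:
  assumes K: "subgroup K G" and "conjugate G K D"
  shows "iso_class G (coset_gset G D) = iso_class G (coset_gset G K)"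
proof -
  obtain g where g: "g \<in> carrier G" "D = conj_set G g K" using assms by (auto simp: conjugate_def)
  note a = acts_coset_gset[OF K] and KK = self_in_lcosets[OF K]
  let ?X = "coset_gset G K" let ?x = "snd (coset_gset G K) g K"
  have x: "?x \<in> fst ?X" "?x \<in> lcosets K" using actsD(1)[OF a g(1) KK] by (auto simp: coset_gset_def)
  have "stab G ?X ?x = D"
    using stabilizer_translate[OF a KK g(1)] g(2) by (simp add: stab_coset_self[OF K] conj_set_def)
  moreover have "orbit G (snd ?X) ?x = fst ?X"
  proof -
    have "?x \<in> orbit G (snd ?X) K" using g(1) unfolding orbit_def by auto
    from acts_orbit(3)[OF a KK this] show ?thesis
      by (simp add: orbit_coset_self[OF K]) (simp add: coset_gset_def)
  qed
  moreover have "gset_part ?X (fst ?X) = ?X" by (simp add: gset_part_def coset_gset_def)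
  ultimately have "gset_iso G ?X (coset_gset G D)"
    using orbit_iso_coset[OF finite_gset_coset[OF K] x(1)] by simp
  then show ?thesis by (rule iso_class_eqI[OF finite_gset_coset[OF K], symmetric])
qed

lemma orbit_sum_coset:
  assumes K: "subgroup K G"
  shows "orbit_sum G (\<lambda>D. c * of_nat (stab_count G (coset_gset G K) D))
    = Poly_Mapping.single (iso_class G (coset_gset G K)) c"
proof -
  have "orbit_sum G (\<lambda>D. c * of_nat (stab_count G (coset_gset G K) D))
    = (\<Sum>L | subgroup L G. if L = conj_rep G K then Poly_Mapping.single (iso_class G (coset_gset G L)) c else 0)"
    unfolding orbit_sum_def by (rule sum.cong[OF refl]) (simp add: coord_coset[OF K])
  also have "\<dots> = Poly_Mapping.single (iso_class G (coset_gset G (conj_rep G K))) c"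
    using finite_subgroups conj_rep(1)[OF K] by (simp add: sum.delta')
  also have "\<dots> = Poly_Mapping.single (iso_class G (coset_gset G K)) c"
    using iso_class_conjugate[OF conj_rep[OF K]] by simp
  finally show ?thesis .
qed

text \<open>Modulo the defining relations, a \<open>G\<close>-set is the sum of its orbits, and the orbits can be
  read off from the stabilizer counts.\<close>

lemma single_eq_orbit_sum:
  fixes X :: "('a, nat) gset"
  assumes p: "prime p" and X: "finite_gset G X" and c: "c \<in> localized_int p"
  shows "Poly_Mapping.single (iso_class G X) c - orbit_sum G (\<lambda>D. c * of_nat (stab_count G X D))
    \<in> burnside_rels p G"
  using X
proof (induction rule: finite_gset_induct)
  case (empty X)
  \<comment> \<open>The relation \<open>[X \<squnion> X] = 2 [X]\<close> kills the empty set.\<close>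
  have "gset_iso G (gset_sum X X) X"
    unfolding gset_iso_def using empty(2) by (auto simp: gset_sum_def bij_betw_def Plus_def)
  then have "iso_class G (gset_sum X X) = iso_class G X"
    by (rule iso_class_eqI[OF finite_gset_sum[OF empty(1) empty(1)]])
  then have "Poly_Mapping.single (iso_class G X) c \<in> burnside_rels p G"
    using burnside_rels_single[OF p localized_int_uminus[OF c] empty(1) empty(1)]
    by (simp add: single_uminus)
  moreover have "stab_count G X D = 0" for D using empty(2) by (simp add: stab_count_def)
  ultimately show ?case by (simp add: orbit_sum_0)
next
  case (orbit X Y Z K)
  have iX: "iso_class G X = iso_class G (gset_sum Y Z)"
    by (rule iso_class_eqI[OF orbit(1,5)])
  have iY: "iso_class G Y = iso_class G (coset_gset G K)"
    by (rule iso_class_eqI[OF orbit(2,6)])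
  have "stab_count G X D = stab_count G (coset_gset G K) D + stab_count G Z D" for D
    using stab_count_gset_iso[OF orbit(1,5)] stab_count_gset_iso[OF orbit(2,6)]
    by (simp add: stab_count_gset_sum orbit)
  then have o: "orbit_sum G (\<lambda>D. c * of_nat (stab_count G X D))
     = Poly_Mapping.single (iso_class G Y) c + orbit_sum G (\<lambda>D. c * of_nat (stab_count G Z D))"
    by (simp add: distrib_left orbit_sum_add orbit_sum_coset[OF orbit(4)] iY)
  show ?case
    using burnside_rels_add[OF p burnside_rels_single[OF p c orbit(2,3)] orbit(7)] p
    unfolding o iX by (simp add: algebra_simps)
qed

lemma formal_sum_eq_orbit_sum:
  assumes p: "prime p" and x: "x \<in> formal_sums p G"
  shows "x - orbit_sum G (ghost_sum G x) \<in> burnside_rels p G"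
proof -
  let ?s = "\<lambda>C. Poly_Mapping.single C (Poly_Mapping.lookup x C)"
  let ?t = "\<lambda>C D. Poly_Mapping.lookup x C * of_nat (stab_count G (representative C) D)"
  have "ghost_sum G x = (\<lambda>D. \<Sum>C\<in>Poly_Mapping.keys x. ?t C D)"
    by (intro ext) (simp add: ghost_sum_def lin_def)
  then have "x - orbit_sum G (ghost_sum G x)
     = (\<Sum>C\<in>Poly_Mapping.keys x. ?s C - orbit_sum G (?t C))"
    by (simp add: orbit_sum_sum sum_subtractf poly_mapping_as_sum[of x, symmetric])
  also have "\<dots> \<in> burnside_rels p G"
  proof (rule burnside_rels_sum[OF p])
    fix C assume "C \<in> Poly_Mapping.keys x"
    then have "C \<in> iso_classes G" "Poly_Mapping.lookup x C \<in> localized_int p"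
      using x by (auto simp: formal_sums_def)
    then show "?s C - orbit_sum G (?t C) \<in> burnside_rels p G"
      using single_eq_orbit_sum[OF p representative(1)] representative(2) by metis
  qed
  finally show ?thesis .
qed

text \<open>Each formal sum is congruent to the sum of orbits that its ghost describes, so equal ghosts
  give congruent formal sums.\<close>

theorem rels_iff_ghost_sum:
  assumes p: "prime p" and x: "x \<in> formal_sums p G" and y: "y \<in> formal_sums p G"
  shows "y - x \<in> burnside_rels p G \<longleftrightarrow> ghost_sum G x = ghost_sum G y"
proof
  assume "y - x \<in> burnside_rels p G"
  from ghost_sum_rels[OF this] show "ghost_sum G x = ghost_sum G y"
    by (auto simp: ghost_sum_diff)
next
  assume e: "ghost_sum G x = ghost_sum G y"
  have "y - x = (y - orbit_sum G (ghost_sum G y)) + - (x - orbit_sum G (ghost_sum G x))"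
    by (simp add: e)
  then show "y - x \<in> burnside_rels p G"
    using burnside_rels_add[OF p formal_sum_eq_orbit_sum[OF p y]
        burnside_rels_uminus[OF p formal_sum_eq_orbit_sum[OF p x]]] by simp
qed

lemma burnside_eq_image:
  assumes p: "prime p" and x: "x \<in> formal_sums p G"
  shows "burnside_eq p G `` {x} = {y \<in> formal_sums p G. ghost_sum G y = ghost_sum G x}"
  unfolding burnside_eq_def using rels_iff_ghost_sum[OF p x] x by auto

lemma burnside_iff:
  assumes p: "prime p"
  shows "a \<in> burnside p G \<longleftrightarrow> (\<exists>x\<in>formal_sums p G. a = burnside_eq p G `` {x})"
  unfolding burnside_def quotient_def by auto

lemma ghost_burnside_eq:
  assumes p: "prime p" and x: "x \<in> formal_sums p G"
  shows "ghost G (burnside_eq p G `` {x}) = ghost_sum G x"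
proof -
  have "x \<in> burnside_eq p G `` {x}" using x by (simp add: burnside_eq_image[OF p])
  then have "(SOME y. y \<in> burnside_eq p G `` {x}) \<in> burnside_eq p G `` {x}" by (rule someI)
  then show ?thesis unfolding ghost_def by (simp add: burnside_eq_image[OF p x])
qed

lemma burnside_elem:
  assumes p: "prime p" and a: "a \<in> burnside p G"
  shows "a = {y \<in> formal_sums p G. ghost_sum G y = ghost G a}" "\<exists>x. x \<in> a"
proof -
  obtain x where x: "x \<in> formal_sums p G" "a = burnside_eq p G `` {x}"
    using a burnside_iff[OF p] by auto
  then show e: "a = {y \<in> formal_sums p G. ghost_sum G y = ghost G a}"
    using ghost_burnside_eq[OF p x(1)] by (simp add: burnside_eq_image[OF p x(1)])
  show "\<exists>x. x \<in> a" using x by (auto simp: burnside_eq_image[OF p x(1)])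
qed

theorem ghost_inject:
  assumes p: "prime p" and "a \<in> burnside p G" "b \<in> burnside p G" "ghost G a = ghost G b"
  shows "a = b"
  using burnside_elem(1)[OF p assms(2)] burnside_elem(1)[OF p assms(3)] assms(4) by simp

lemma burnside_zero: "prime p \<Longrightarrow> burnside_zero p G \<in> burnside p G"
    "prime p \<Longrightarrow> ghost G (burnside_zero p G) = (\<lambda>_. 0)"
  unfolding burnside_zero_def
  using burnside_iff[of p "burnside_eq p G `` {0}"] formal_sums_0[of p G]
    ghost_burnside_eq[of p 0] by (auto simp: ghost_sum_def lin_0)

lemma burnside_class:
  assumes p: "prime p" and X: "finite_gset G X"
  shows "burnside_class p G X \<in> burnside p G"
    "ghost G (burnside_class p G X) D = of_nat (stab_count G X D)"
proof -
  have *: "Poly_Mapping.single (iso_class G X) 1 \<in> formal_sums p G"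
    by (rule formal_sums_single[OF p iso_class_in[OF X] localized_int_1[OF p]])
  then show "burnside_class p G X \<in> burnside p G"
    unfolding burnside_class_def using burnside_iff[OF p] by auto
  show "ghost G (burnside_class p G X) D = of_nat (stab_count G X D)"
    unfolding burnside_class_def ghost_burnside_eq[OF p *] by (simp add: ghost_sum_single[OF X])
qed

lemma integral_add:
  assumes "prime p" "integral p G \<sigma>" "integral p G \<tau>"
  shows "integral p G (\<lambda>D. \<sigma> D + \<tau> D)"
  using assms localized_int_add[OF assms(1)] unfolding integral_def
  by (auto simp: distrib_left add_divide_distrib)

lemma integral_scale:
  assumes "prime p" "integral p G \<tau>" "c \<in> localized_int p"
  shows "integral p G (\<lambda>D. c * \<tau> D)"
  unfolding integral_def
proof (intro conjI allI impI ballI)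
  fix D assume "subgroup D G"
  then have "of_nat (card D) * \<tau> D / of_nat (card (conj_stable G D)) \<in> localized_int p"
    using assms(2) by (auto simp: integral_def)
  from localized_int_mult[OF assms(1) assms(3) this]
  show "of_nat (card D) * (c * \<tau> D) / of_nat (card (conj_stable G D)) \<in> localized_int p"
    by (simp add: mult.left_commute)
qed (use assms(2) in \<open>auto simp: integral_def\<close>)

lemma integral_0: "prime p \<Longrightarrow> integral p G (\<lambda>D. 0)"
  by (simp add: integral_def localized_int_0)

lemma integral_sum:
  assumes "prime p" "\<And>i. i \<in> A \<Longrightarrow> integral p G (\<tau> i)"
  shows "integral p G (\<lambda>D. \<Sum>i\<in>A. \<tau> i D)"
  using assms(2)
  by (induction A rule: infinite_finite_induct) (auto intro: integral_0 integral_add assms(1))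

lemma integral_coset:
  assumes p: "prime p" and K: "subgroup K G"
  shows "integral p G (\<lambda>D. of_nat (stab_count G (coset_gset G K) D))"
  unfolding integral_def
proof (intro conjI allI impI ballI)
  fix D assume "\<not> subgroup D G"
  then show "of_nat (stab_count G (coset_gset G K) D) = (0 :: rat)"
    using stab_count_not_subgroup[OF finite_gset_coset[OF K]] by simp
next
  fix g D assume g: "g \<in> carrier G" and D: "subgroup D G"
  have DD: "conjugate G D (conj_set G g D)" using g by (auto simp: conjugate_def)
  have "conjugate G K (conj_set G g D) \<longleftrightarrow> conjugate G K D"
    using conjugate_trans[OF K _ DD] conjugate_trans[OF K _ conjugate_sym[OF D DD]] by blast
  then show "of_nat (stab_count G (coset_gset G K) (conj_set G g D))
      = (of_nat (stab_count G (coset_gset G K) D) :: rat)"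
    by (simp add: stab_count_coset[OF K] conj_stable_conj[OF D g]
        card_conj_set[OF g subgroup.subset[OF D]])
next
  fix D assume D: "subgroup D G"
  show "of_nat (card D) * of_nat (stab_count G (coset_gset G K) D) / of_nat (card (conj_stable G D))
      \<in> localized_int p"
    using card_subgroup_pos[OF D] card_conj_stable_pos[OF D]
    by (simp add: stab_count_coset[OF K] localized_int_0 localized_int_1 p)
qed

text \<open>By decomposition into orbits this reduces to transitive sets.\<close>

lemma integral_stab_count:
  assumes p: "prime p" and X: "finite_gset G X"
  shows "integral p G (\<lambda>D. of_nat (stab_count G X D))"
proof -
  have *: "integral p G (\<lambda>D. of_nat (stab_count G Y D))" if "finite_gset G Y" for Y :: "('a, nat) gset"
    using that
  proof (induction rule: finite_gset_induct)
    case (empty X)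
    then have "stab_count G X D = 0" for D by (simp add: stab_count_def)
    then show ?case by (simp add: integral_0[OF p])
  next
    case (orbit X Y Z K)
    have "stab_count G X D = stab_count G (coset_gset G K) D + stab_count G Z D" for D
      using stab_count_gset_iso[OF orbit(1,5)] stab_count_gset_iso[OF orbit(2,6)]
      by (simp add: stab_count_gset_sum orbit)
    then show ?case using integral_add[OF p integral_coset[OF p orbit(4)] orbit(7)] by simp
  qed
  obtain Y :: "('a, nat) gset" where Y: "finite_gset G Y" "gset_iso G X Y"
    using ex_nat_copy[OF X] by auto
  then show ?thesis using *[OF Y(1)] stab_count_gset_iso[OF X Y(2)] by simp
qed

lemma integral_ghost_sum:
  assumes p: "prime p" and x: "x \<in> formal_sums p G"
  shows "integral p G (ghost_sum G x)"
proof -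
  have "ghost_sum G x = (\<lambda>D. \<Sum>C\<in>Poly_Mapping.keys x.
      Poly_Mapping.lookup x C * of_nat (stab_count G (representative C) D))"
    by (intro ext) (simp add: ghost_sum_def lin_def)
  moreover have "integral p G \<dots>"
    by (intro integral_sum integral_scale integral_stab_count p representative)
       (use x in \<open>auto simp: formal_sums_def\<close>)
  ultimately show ?thesis by simp
qed

lemma integral_ghost:
  assumes p: "prime p" and a: "a \<in> burnside p G"
  shows "integral p G (ghost G a)"
  using a burnside_iff[OF p] ghost_burnside_eq[OF p] integral_ghost_sum[OF p] by auto

lemma coord_in_localized_int:
  "prime p \<Longrightarrow> integral p G \<tau> \<Longrightarrow> subgroup K G \<Longrightarrow> coord G \<tau> K \<in> localized_int p"
  unfolding coord_def integral_def using localized_int_0 by auto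

lemma orbit_sum_in_formal_sums:
  "prime p \<Longrightarrow> integral p G \<tau> \<Longrightarrow> orbit_sum G \<tau> \<in> formal_sums p G"
  unfolding orbit_sum_def
  by (intro formal_sums_sum formal_sums_single iso_class_in)
     (auto intro: finite_gset_coset coord_in_localized_int)

text \<open>Among the transitive sets chosen as representatives only the one of the class of \<open>D\<close> has
  points with stabilizer \<open>D\<close>.\<close>

lemma coord_expansion:
  assumes \<tau>: "integral p G \<tau>"
  shows "\<tau> D = (\<Sum>K | subgroup K G. coord G \<tau> K * of_nat (stab_count G (coset_gset G K) D))"
proof (cases "subgroup D G")
  case D: True
  let ?R = "conj_rep G D"
  note R = conj_rep[OF D]
  have "(\<Sum>K | subgroup K G. coord G \<tau> K * of_nat (stab_count G (coset_gset G K) D))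
     = (\<Sum>K | subgroup K G. if K = ?R then \<tau> D else 0)"
  proof (rule sum.cong[OF refl])
    fix K assume "K \<in> {K. subgroup K G}"
    then have K: "subgroup K G" by simp
    show "coord G \<tau> K * of_nat (stab_count G (coset_gset G K) D) = (if K = ?R then \<tau> D else 0)"
    proof (cases "K = ?R")
      case True
      obtain g where g: "g \<in> carrier G" "D = conj_set G g K"
        using R(2) True by (auto simp: conjugate_def)
      have "\<tau> K = \<tau> D" "card (conj_stable G K) = card (conj_stable G D)" "card K = card D"
        using \<tau> K g conj_stable_conj[OF K g(1)] card_conj_set[OF g(1) subgroup.subset[OF K]]
        by (auto simp: integral_def)
      then show ?thesis
        using True R conj_rep_idem[OF D] card_subgroup_pos[OF D] card_conj_stable_pos[OF D]
          stab_count_coset[OF R(1), of D] by (simp add: coord_def)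
    next
      case False
      then show ?thesis
        using conj_rep_eq_iff[OF K D] by (auto simp: coord_def stab_count_coset[OF K])
    qed
  qed
  also have "\<dots> = \<tau> D" using finite_subgroups R(1) by (simp add: sum.delta')
  finally show ?thesis by simp
next
  case False
  then show ?thesis
    using \<tau> stab_count_not_subgroup[OF finite_gset_coset] by (simp add: integral_def)
qed

lemma ghost_orbit_sum:
  assumes "integral p G \<tau>"
  shows "ghost_sum G (orbit_sum G \<tau>) = \<tau>"
proof
  fix D
  have "ghost_sum G (orbit_sum G \<tau>) D
     = (\<Sum>K | subgroup K G. coord G \<tau> K * of_nat (stab_count G (coset_gset G K) D))"
    unfolding ghost_sum_def orbit_sum_def lin_sum lin_single
    by (rule sum.cong[OF refl]) (simp add: stab_count_representative finite_gset_coset)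
  then show "ghost_sum G (orbit_sum G \<tau>) D = \<tau> D" using coord_expansion[OF assms] by simp
qed

text \<open>This is the way in which elements of \<open>A(G)\<^sub>(\<^sub>p\<^sub>)\<close> are constructed below: it is enough to
  write down a function and to check the divisibilities in \<open>integral\<close>.\<close>

theorem burnside_of_ghost:
  assumes p: "prime p" and \<tau>: "integral p G \<tau>"
  shows "burnside_eq p G `` {orbit_sum G \<tau>} \<in> burnside p G"
    "ghost G (burnside_eq p G `` {orbit_sum G \<tau>}) = \<tau>"
  using burnside_iff[OF p] orbit_sum_in_formal_sums[OF p \<tau>] ghost_burnside_eq[OF p]
    ghost_orbit_sum[OF \<tau>] by auto

end


section \<open>Marks\<close>

text \<open>The mark at \<open>Q\<close> counts the points fixed by \<open>Q\<close>, that is, those with stabilizer above \<open>Q\<close>; it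
  is defined for all functions on subgroups, so that it can be applied to ghosts under
  construction.\<close>

definition marks :: "('g, 'm) monoid_scheme \<Rightarrow> ('g set \<Rightarrow> rat) \<Rightarrow> 'g set \<Rightarrow> rat" where
  "marks G \<tau> Q = (\<Sum>D | subgroup D G \<and> Q \<subseteq> D. \<tau> D)"

context finite_group
begin

lemma marks_alt: "marks G \<tau> Q = (\<Sum>D | subgroup D G. \<tau> D * of_bool (Q \<subseteq> D))"
proof -
  have "{D. subgroup D G \<and> Q \<subseteq> D} = {D. subgroup D G} \<inter> {D. Q \<subseteq> D}" by auto
  then show ?thesis
    unfolding marks_def using finite_subgroups by (simp add: of_bool_def sum.inter_restrict if_distrib cong: if_cong)
qed

lemma marks_add: "marks G (\<lambda>D. \<sigma> D + \<tau> D) Q = marks G \<sigma> Q + marks G \<tau> Q"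
  and marks_diff: "marks G (\<lambda>D. \<sigma> D - \<tau> D) Q = marks G \<sigma> Q - marks G \<tau> Q"
  and marks_scale: "marks G (\<lambda>D. c * \<tau> D) Q = c * marks G \<tau> Q"
  and marks_sum: "marks G (\<lambda>D. \<Sum>i\<in>A. f i D) Q = (\<Sum>i\<in>A. marks G (f i) Q)"
  by (auto simp: marks_def sum.distrib sum_subtractf sum_distrib_left intro: sum.swap)

lemma marks_eq_0: "(\<And>D. subgroup D G \<Longrightarrow> Q \<subseteq> D \<Longrightarrow> \<tau> D = 0) \<Longrightarrow> marks G \<tau> Q = 0"
  unfolding marks_def by (rule sum.neutral) auto

lemma marks_split:
  assumes "subgroup D G"
  shows "marks G \<tau> D = \<tau> D + (\<Sum>E | subgroup E G \<and> D \<subset> E. \<tau> E)"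
proof -
  have "{E. subgroup E G \<and> D \<subseteq> E} = insert D {E. subgroup E G \<and> D \<subset> E}" using assms by auto
  moreover have "finite {E. subgroup E G \<and> D \<subset> E}"
    by (rule finite_subset[OF _ finite_subgroups]) auto
  ultimately show ?thesis unfolding marks_def by simp
qed

text \<open>The triangular shape of the passage from ghosts to marks: the values of a ghost above a
  subgroup are recovered from the marks above it, from the largest subgroups downwards.\<close>

lemma ghost_eq_0_of_marks:
  assumes up: "\<And>D E. U D \<Longrightarrow> D \<subseteq> E \<Longrightarrow> U E"
    and mk0: "\<And>D. subgroup D G \<Longrightarrow> U D \<Longrightarrow> marks G \<tau> D = 0"
    and D: "subgroup D G" "U D"
  shows "\<tau> D = 0"
  using D
proof (induction "card (carrier G) - card D" arbitrary: D rule: less_induct)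
  case less
  have "\<tau> E = 0" if E: "subgroup E G" "D \<subset> E" for E
  proof (rule less.hyps)
    have "card D < card E" "card E \<le> card (carrier G)"
      using E finite_subgroup[OF E(1)] finite_carrier subgroup.subset[OF E(1)]
      by (auto intro: psubset_card_mono card_mono)
    then show "card (carrier G) - card E < card (carrier G) - card D" by linarith
  qed (use E up[OF less.prems(2)] in auto)
  then have "(\<Sum>E | subgroup E G \<and> D \<subset> E. \<tau> E) = 0" by (intro sum.neutral) auto
  then show ?case using marks_split[OF less.prems(1)] mk0[OF less.prems] by simp
qed

lemma ghost_eq_of_marks:
  assumes "\<And>D. \<not> subgroup D G \<Longrightarrow> \<sigma> D = \<tau> D" "\<And>D. subgroup D G \<Longrightarrow> marks G \<sigma> D = marks G \<tau> D"
  shows "\<sigma> = \<tau>"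
proof
  fix D show "\<sigma> D = \<tau> D"
    using assms ghost_eq_0_of_marks[of "\<lambda>_. True" "\<lambda>D. \<sigma> D - \<tau> D" D]
    by (cases "subgroup D G") (auto simp: marks_diff)
qed

lemma marks_conj:
  assumes \<tau>: "integral p G \<tau>" and g: "g \<in> carrier G" and Q: "Q \<subseteq> carrier G"
  shows "marks G \<tau> (conj_set G g Q) = marks G \<tau> Q"
  unfolding marks_def
proof (rule sum.reindex_bij_witness[where i = "conj_set G g" and j = "conj_set G (inv g)"])
  have mono: "A \<subseteq> B \<Longrightarrow> conj_set G h A \<subseteq> conj_set G h B" for h A B
    unfolding conj_set_def by (rule image_mono)
  note i = conj_set_inv[OF g subgroup.subset]
  show "conj_set G g (conj_set G (inv g) D) = D"
    "conj_set G (inv g) D \<in> {D. subgroup D G \<and> Q \<subseteq> D}"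
    "\<tau> (conj_set G (inv g) D) = \<tau> D"
    if D: "D \<in> {D. subgroup D G \<and> conj_set G g Q \<subseteq> D}" for D
    using i(2) D mono[of "conj_set G g Q" D "inv g"] conj_set_inv(1)[OF g Q]
      subgroup_conj_set[of "inv g" D] g \<tau> by (simp_all add: integral_def)
  show "conj_set G (inv g) (conj_set G g D) = D"
    "conj_set G g D \<in> {D. subgroup D G \<and> conj_set G g Q \<subseteq> D}"
    if D: "D \<in> {D. subgroup D G \<and> Q \<subseteq> D}" for D
    using i(1) D mono[of Q D g] subgroup_conj_set[OF g, of D] by simp_all
qed

text \<open>An invariant that is linear in the stabilizer counts extends linearly from \<open>G\<close>-sets to
  ghosts. This computes every operation that is defined by linear extension.\<close>

lemma lin_stab_count:
  assumes x: "x \<in> formal_sums p G"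
    and f: "\<And>C. C \<in> iso_classes G \<Longrightarrow>
      f C = (\<Sum>D | subgroup D G. of_nat (stab_count G (representative C) D) * w D)"
  shows "lin f x = (\<Sum>D | subgroup D G. ghost_sum G x D * w D)"
proof -
  have "lin f x = (\<Sum>C\<in>Poly_Mapping.keys x. \<Sum>D | subgroup D G.
      Poly_Mapping.lookup x C * of_nat (stab_count G (representative C) D) * w D)"
    unfolding lin_def
    by (rule sum.cong[OF refl])
       (use x in \<open>auto simp: formal_sums_def f sum_distrib_left mult.assoc subset_iff\<close>)
  also have "\<dots> = (\<Sum>D | subgroup D G. ghost_sum G x D * w D)"
    by (subst sum.swap) (simp add: ghost_sum_def lin_def sum_distrib_right)
  finally show ?thesis .
qed

lemma rat_ext_eq:
  assumes p: "prime p" and a: "a \<in> burnside p G"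
    and f: "\<And>X. finite_gset G X \<Longrightarrow> f X = (\<Sum>D | subgroup D G. of_nat (stab_count G X D) * w D)"
  shows "rat_ext f a = (\<Sum>D | subgroup D G. ghost G a D * w D)"
proof -
  have "(\<Sum>C\<in>Poly_Mapping.keys x. Poly_Mapping.lookup x C * f (representative C))
     = (\<Sum>D | subgroup D G. ghost G a D * w D)" if "x \<in> a" for x
  proof -
    have x: "x \<in> formal_sums p G" "ghost_sum G x = ghost G a"
      using that burnside_elem(1)[OF p a] by auto
    show ?thesis
      using lin_stab_count[OF x(1), of "\<lambda>C. f (representative C)" w] f representative(1) x(2)
      by (simp add: lin_def)
  qed
  moreover obtain x where "x \<in> a" using burnside_elem(2)[OF p a] by auto
  ultimately have "(\<lambda>x. \<Sum>C\<in>Poly_Mapping.keys x. Poly_Mapping.lookup x C * f (representative C)) ` a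
     = {r. r = (\<Sum>D | subgroup D G. ghost G a D * w D)}" by (auto simp: image_iff)
  then show ?thesis unfolding rat_ext_def by simp
qed

lemma mark_eq_marks:
  assumes p: "prime p" and a: "a \<in> burnside p G" and Q: "Q \<subseteq> carrier G"
  shows "mark Q a = marks G (ghost G a) Q"
  unfolding mark_def marks_alt
proof (rule rat_ext_eq[OF p a])
  fix X :: "('a, nat) gset" assume X: "finite_gset G X"
  have "fixed_points Q X = {x \<in> fst X. Q \<subseteq> stab G X x}"
    using Q by (auto simp: fixed_points_def stabilizer_def)
  then have "of_nat (card (fixed_points Q X)) = (\<Sum>x\<in>fst X. of_bool (Q \<subseteq> stab G X x) :: rat)"
    using finite_gsetD(1)[OF X] by (simp add: of_bool_def sum.If_cases Int_def)
  also have "\<dots> = (\<Sum>D | subgroup D G. of_nat (stab_count G X D) * of_bool (Q \<subseteq> D))"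
    by (rule sum_over_points[OF X])
  finally show "of_nat (card (fixed_points Q X))
    = (\<Sum>D | subgroup D G. of_nat (stab_count G X D) * (of_bool (Q \<subseteq> D) :: rat))" .
qed

lemma stab_count_as_sum:
  "finite_gset G X \<Longrightarrow> of_nat (stab_count G X D) = (\<Sum>x\<in>fst X. of_bool (D = stab G X x) :: rat)"
  using finite_gsetD(1)[of X] by (simp add: stab_count_def of_bool_def sum.If_cases Int_def eq_commute)

end


section \<open>Operations on Burnside modules in terms of ghosts\<close>

text \<open>An operation on \<open>G\<close>-sets whose stabilizer counts are linear in those of its argument induces
  a well-defined linear map of Burnside modules, because these counts decide equality there.\<close>

lemma burnside_unary:
  fixes \<Phi> :: "('g, nat) gset \<Rightarrow> ('h, 'y) gset"
  assumes G: "finite_group G" and H: "finite_group H" and p: "prime p" and a: "a \<in> burnside p G"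
    and fin: "\<And>X. finite_gset G X \<Longrightarrow> finite_gset H (\<Phi> X)"
    and cnt: "\<And>X D. finite_gset G X \<Longrightarrow>
       of_nat (stab_count H (\<Phi> X) D) = (\<Sum>E | subgroup E G. of_nat (stab_count G X E) * w D E)"
  shows "(\<Union>x\<in>a. burnside_eq p H `` {linear_ext (\<lambda>C. iso_class H (\<Phi> (representative C))) x})
      \<in> burnside p H" (is "?b \<in> _")
    and "ghost H (\<Union>x\<in>a. burnside_eq p H `` {linear_ext (\<lambda>C. iso_class H (\<Phi> (representative C))) x})
      = (\<lambda>D. \<Sum>E | subgroup E G. ghost G a E * w D E)"
proof -
  interpret G: finite_group G by fact
  interpret H: finite_group H by fact
  let ?f = "\<lambda>C. iso_class H (\<Phi> (representative C))"
  have fs: "linear_ext ?f x \<in> formal_sums p H"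
    and gh: "ghost_sum H (linear_ext ?f x) = (\<lambda>D. \<Sum>E | subgroup E G. ghost G a E * w D E)"
    if "x \<in> a" for x
  proof -
    have x: "x \<in> formal_sums p G" "ghost_sum G x = ghost G a"
      using that G.burnside_elem(1)[OF p a] by auto
    show "linear_ext ?f x \<in> formal_sums p H"
      by (rule formal_sums_linear_ext[OF p x(1)]) (intro H.iso_class_in fin G.representative)
    have "ghost_sum H (linear_ext ?f x) D = (\<Sum>E | subgroup E G. ghost_sum G x E * w D E)" for D
      unfolding ghost_sum_def lin_linear_ext
      by (rule G.lin_stab_count[OF x(1), unfolded ghost_sum_def])
         (simp add: H.stab_count_representative fin G.representative cnt)
    then show "ghost_sum H (linear_ext ?f x) = (\<lambda>D. \<Sum>E | subgroup E G. ghost G a E * w D E)"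
      using x(2) by auto
  qed
  obtain x0 where x0: "x0 \<in> a" using G.burnside_elem(2)[OF p a] by auto
  have b: "?b = burnside_eq p H `` {linear_ext ?f x0}"
    by (rule UN_constant_eq[OF x0]) (simp add: H.burnside_eq_image[OF p] fs gh x0)
  show "?b \<in> burnside p H" unfolding b using H.burnside_iff[OF p] fs[OF x0] by auto
  show "ghost H ?b = (\<lambda>D. \<Sum>E | subgroup E G. ghost G a E * w D E)"
    unfolding b H.ghost_burnside_eq[OF p fs[OF x0]] by (rule gh[OF x0])
qed

lemma burnside_binary:
  fixes \<Phi> :: "('g, nat) gset \<Rightarrow> ('h, nat) gset \<Rightarrow> ('k, 'y) gset"
  assumes G: "finite_group G" and H: "finite_group H" and K: "finite_group K" and p: "prime p"
    and a: "a \<in> burnside p G" and b: "b \<in> burnside p H"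
    and fin: "\<And>X Y. finite_gset G X \<Longrightarrow> finite_gset H Y \<Longrightarrow> finite_gset K (\<Phi> X Y)"
    and cnt: "\<And>X Y D. finite_gset G X \<Longrightarrow> finite_gset H Y \<Longrightarrow>
       of_nat (stab_count K (\<Phi> X Y) D) = (\<Sum>A | subgroup A G. \<Sum>B | subgroup B H.
         of_nat (stab_count G X A) * of_nat (stab_count H Y B) * w D A B)"
  defines "c \<equiv> (\<Union>x\<in>a. \<Union>y\<in>b. burnside_eq p K ``
      {bilinear_ext (\<lambda>C D. iso_class K (\<Phi> (representative C) (representative D))) x y})"
  shows "c \<in> burnside p K"
    and "ghost K c = (\<lambda>D. \<Sum>A | subgroup A G. \<Sum>B | subgroup B H. ghost G a A * ghost H b B * w D A B)"
proof -
  interpret G: finite_group G by fact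
  interpret H: finite_group H by fact
  interpret K: finite_group K by fact
  let ?f = "\<lambda>C D. iso_class K (\<Phi> (representative C) (representative D))"
  let ?g = "\<lambda>D. \<Sum>A | subgroup A G. \<Sum>B | subgroup B H. ghost G a A * ghost H b B * w D A B"
  have fs: "bilinear_ext ?f x y \<in> formal_sums p K"
    and gh: "ghost_sum K (bilinear_ext ?f x y) = ?g"
    if "x \<in> a" "y \<in> b" for x y
  proof -
    have x: "x \<in> formal_sums p G" "ghost_sum G x = ghost G a"
      using that(1) G.burnside_elem(1)[OF p a] by auto
    have y: "y \<in> formal_sums p H" "ghost_sum H y = ghost H b"
      using that(2) H.burnside_elem(1)[OF p b] by auto
    show "bilinear_ext ?f x y \<in> formal_sums p K"
      by (rule formal_sums_bilinear_ext[OF p x(1) y(1)])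
         (intro K.iso_class_in fin G.representative H.representative)
    have "ghost_sum K (bilinear_ext ?f x y) D
      = (\<Sum>A | subgroup A G. \<Sum>B | subgroup B H. ghost_sum G x A * ghost_sum H y B * w D A B)" for D
    proof -
      have inner: "lin (\<lambda>C'. of_nat (stab_count K (representative (?f C C')) D)) y
        = (\<Sum>A | subgroup A G. of_nat (stab_count G (representative C) A)
            * (\<Sum>B | subgroup B H. ghost_sum H y B * w D A B))" if C: "C \<in> iso_classes G" for C
      proof -
        have "lin (\<lambda>C'. of_nat (stab_count K (representative (?f C C')) D)) y
          = (\<Sum>B | subgroup B H. ghost_sum H y B
              * (\<Sum>A | subgroup A G. of_nat (stab_count G (representative C) A) * w D A B))"
        proof (rule H.lin_stab_count[OF y(1)])
          fix C' assume "C' \<in> iso_classes H"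
          then show "of_nat (stab_count K (representative (?f C C')) D)
            = (\<Sum>B | subgroup B H. of_nat (stab_count H (representative C') B)
                * (\<Sum>A | subgroup A G. of_nat (stab_count G (representative C) A) * w D A B))"
            by (simp add: K.stab_count_representative fin cnt C G.representative H.representative
                sum_distrib_left mult_ac sum.swap[of _ "{A. subgroup A G}"])
        qed
        also have "\<dots> = (\<Sum>A | subgroup A G. of_nat (stab_count G (representative C) A)
            * (\<Sum>B | subgroup B H. ghost_sum H y B * w D A B))"
          by (simp add: sum_distrib_left mult_ac sum.swap[of _ "{A. subgroup A G}"])
        finally show ?thesis .
      qed
      have "ghost_sum K (bilinear_ext ?f x y) D
        = (\<Sum>A | subgroup A G. ghost_sum G x A * (\<Sum>B | subgroup B H. ghost_sum H y B * w D A B))"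
        unfolding ghost_sum_def[of K] lin_bilinear_ext by (rule G.lin_stab_count[OF x(1) inner])
      then show ?thesis by (simp add: sum_distrib_left mult.assoc)
    qed
    then show "ghost_sum K (bilinear_ext ?f x y) = ?g" using x(2) y(2) by auto
  qed
  obtain x0 where x0: "x0 \<in> a" using G.burnside_elem(2)[OF p a] by auto
  obtain y0 where y0: "y0 \<in> b" using H.burnside_elem(2)[OF p b] by auto
  have c: "c = burnside_eq p K `` {bilinear_ext ?f x0 y0}"
  proof -
    have "(\<Union>y\<in>b. burnside_eq p K `` {bilinear_ext ?f x y}) = burnside_eq p K `` {bilinear_ext ?f x0 y0}"
      if "x \<in> a" for x
      by (rule UN_constant_eq[OF y0]) (simp add: K.burnside_eq_image[OF p] fs gh x0 y0 that)
    then have "c = (\<Union>x\<in>a. burnside_eq p K `` {bilinear_ext ?f x0 y0})"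
      unfolding c_def by (intro SUP_cong refl) auto
    then show ?thesis using x0 by auto
  qed
  show "c \<in> burnside p K" unfolding c using K.burnside_iff[OF p] fs[OF x0 y0] by auto
  show "ghost K c = ?g"
    unfolding c K.ghost_burnside_eq[OF p fs[OF x0 y0]] by (rule gh[OF x0 y0])
qed

context finite_group
begin

lemma burnside_add:
  assumes p: "prime p" and a: "a \<in> burnside p G" and b: "b \<in> burnside p G"
  shows "burnside_add p G a b \<in> burnside p G"
    "ghost G (burnside_add p G a b) = (\<lambda>D. ghost G a D + ghost G b D)"
proof -
  note e = burnside_elem(1)[OF p a] burnside_elem(1)[OF p b]
  obtain x0 y0 where 0: "x0 \<in> a" "y0 \<in> b"
    using burnside_elem(2)[OF p a] burnside_elem(2)[OF p b] by auto
  have fs: "x + y \<in> formal_sums p G" "ghost_sum G (x + y) = (\<lambda>D. ghost G a D + ghost G b D)"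
    if "x \<in> a" "y \<in> b" for x y
  proof -
    have "x \<in> formal_sums p G" "y \<in> formal_sums p G" "ghost_sum G x = ghost G a" "ghost_sum G y = ghost G b"
      using that e by auto
    then show "x + y \<in> formal_sums p G" "ghost_sum G (x + y) = (\<lambda>D. ghost G a D + ghost G b D)"
      using formal_sums_add[OF p] by (auto simp: ghost_sum_add)
  qed
  have c: "burnside_add p G a b = burnside_eq p G `` {x0 + y0}"
  proof -
    have "(\<Union>y\<in>b. burnside_eq p G `` {x + y}) = burnside_eq p G `` {x0 + y0}" if "x \<in> a" for x
      by (rule UN_constant_eq[OF 0(2)]) (simp add: burnside_eq_image[OF p] fs 0 that)
    then have "burnside_add p G a b = (\<Union>x\<in>a. burnside_eq p G `` {x0 + y0})"
      unfolding burnside_add_def by (intro SUP_cong refl) auto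
    then show ?thesis using 0(1) by auto
  qed
  show "burnside_add p G a b \<in> burnside p G" unfolding c using burnside_iff[OF p] fs[OF 0] by auto
  show "ghost G (burnside_add p G a b) = (\<lambda>D. ghost G a D + ghost G b D)"
    unfolding c ghost_burnside_eq[OF p fs(1)[OF 0]] by (rule fs(2)[OF 0])
qed

lemma finite_gset_prod:
  assumes "finite_gset G X" "finite_gset G Y"
  shows "finite_gset G (gset_prod X Y)"
  unfolding gset_prod_def
  by (rule finite_gset_restrictI[OF _ _ refl])
     (use finite_gsetD(1,2)[OF assms(1)] finite_gsetD(1,2)[OF assms(2)] in \<open>auto simp: acts_def\<close>)

text \<open>The stabilizer of a pair is the intersection of the stabilizers, and \<open>Q\<close> lies in it if and
  only if it lies in both.\<close>

lemma burnside_mult: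
  assumes p: "prime p" and a: "a \<in> burnside p G" and b: "b \<in> burnside p G"
  shows "burnside_mult p G a b \<in> burnside p G"
    "Q \<subseteq> carrier G \<Longrightarrow> marks G (ghost G (burnside_mult p G a b)) Q = marks G (ghost G a) Q * marks G (ghost G b) Q"
proof -
  have cnt: "of_nat (stab_count G (gset_prod X Y) D) = (\<Sum>A | subgroup A G. \<Sum>B | subgroup B G.
      of_nat (stab_count G X A) * of_nat (stab_count G Y B) * (of_bool (D = A \<inter> B) :: rat))"
    if X: "finite_gset G X" and Y: "finite_gset G Y" for X Y :: "('a, nat) gset" and D
  proof -
    have st: "stab G (gset_prod X Y) z = stab G X (fst z) \<inter> stab G Y (snd z)"
      if "z \<in> fst X \<times> fst Y" for z
      using that by (auto simp: stabilizer_def gset_prod_def)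
    have "of_nat (stab_count G (gset_prod X Y) D)
      = (\<Sum>z\<in>fst X \<times> fst Y. of_bool (D = stab G X (fst z) \<inter> stab G Y (snd z)) :: rat)"
      unfolding stab_count_as_sum[OF finite_gset_prod[OF X Y]]
      by (rule sum.cong) (use st in \<open>auto simp: gset_prod_def\<close>)
    also have "\<dots> = (\<Sum>x\<in>fst X. \<Sum>y\<in>fst Y. of_bool (D = stab G X x \<inter> stab G Y y))"
      by (simp add: sum.cartesian_product case_prod_unfold)
    also have "\<dots> = (\<Sum>x\<in>fst X. \<Sum>B | subgroup B G. of_nat (stab_count G Y B) * of_bool (D = stab G X x \<inter> B))"
      by (rule sum.cong[OF refl]) (rule sum_over_points[OF Y])
    also have "\<dots> = (\<Sum>A | subgroup A G. of_nat (stab_count G X A)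
       * (\<Sum>B | subgroup B G. of_nat (stab_count G Y B) * of_bool (D = A \<inter> B)))"
      by (rule sum_over_points[OF X])
    finally show ?thesis by (simp add: sum_distrib_left mult.assoc)
  qed
  note m = burnside_binary[OF finite_group_axioms finite_group_axioms finite_group_axioms p a b
      finite_gset_prod cnt]
  show "burnside_mult p G a b \<in> burnside p G" unfolding burnside_mult_def by (rule m)
  assume Q: "Q \<subseteq> carrier G"
  have "marks G (ghost G (burnside_mult p G a b)) Q
    = (\<Sum>A | subgroup A G. \<Sum>B | subgroup B G. ghost G a A * ghost G b B * marks G (\<lambda>D. of_bool (D = A \<inter> B)) Q)"
    unfolding burnside_mult_def by (subst m(2)) (simp_all only: marks_sum marks_scale)
  also have "\<dots> = (\<Sum>A | subgroup A G. \<Sum>B | subgroup B G.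
      (ghost G a A * of_bool (Q \<subseteq> A)) * (ghost G b B * of_bool (Q \<subseteq> B)))"
  proof (intro sum.cong[OF refl])
    fix A B assume "A \<in> {A. subgroup A G}" "B \<in> {B. subgroup B G}"
    then have AB: "subgroup (A \<inter> B) G" by (simp add: subgroups_Inter_pair)
    have "marks G (\<lambda>D. of_bool (D = A \<inter> B)) Q = of_bool (Q \<subseteq> A \<inter> B)"
      unfolding marks_alt using AB finite_subgroups
      by (subst sum.mono_neutral_right[of _ "{A \<inter> B}"]) auto
    then show "ghost G a A * ghost G b B * marks G (\<lambda>D. of_bool (D = A \<inter> B)) Q
      = (ghost G a A * of_bool (Q \<subseteq> A)) * (ghost G b B * of_bool (Q \<subseteq> B))" by auto
  qed
  also have "\<dots> = marks G (ghost G a) Q * marks G (ghost G b) Q"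
    unfolding marks_alt by (simp add: sum_product)
  finally show "marks G (ghost G (burnside_mult p G a b)) Q = marks G (ghost G a) Q * marks G (ghost G b) Q" .
qed

end

text \<open>The stabilizer of a point for the restricted action is the preimage of its stabilizer, and
  \<open>Q\<close> lies in the preimage if and only if the image of \<open>Q\<close> lies in the stabilizer.\<close>

lemma burnside_restrict:
  fixes G :: "('g, 'm) monoid_scheme" and H :: "('h, 'n) monoid_scheme"
  assumes G: "finite_group G" and H: "finite_group H" and p: "prime p" and a: "a \<in> burnside p G"
    and \<phi>: "\<phi> \<in> hom H G"
  shows "burnside_restrict p H \<phi> a \<in> burnside p H"
    "Q \<subseteq> carrier H \<Longrightarrow> marks H (ghost H (burnside_restrict p H \<phi> a)) Q = marks G (ghost G a) (\<phi> ` Q)"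
proof -
  interpret G: finite_group G by fact
  interpret H: finite_group H by fact
  interpret \<phi>: group_hom H G \<phi>
    using \<phi> by (simp add: group_hom_def group_hom_axioms_def G.is_group H.is_group)
  let ?pre = "\<lambda>E. {h \<in> carrier H. \<phi> h \<in> E}"
  have fin: "finite_gset H (gset_restrict \<phi> X)" if X: "finite_gset G X" for X :: "('g, nat) gset"
    unfolding H.finite_gset_iff gset_restrict_def
    using G.finite_gsetD[OF X] by (auto simp: acts_def)
  have cnt: "of_nat (stab_count H (gset_restrict \<phi> X) D)
      = (\<Sum>E | subgroup E G. of_nat (stab_count G X E) * (of_bool (D = ?pre E) :: rat))"
    if X: "finite_gset G X" for X :: "('g, nat) gset" and D
  proof -
    have "of_nat (stab_count H (gset_restrict \<phi> X) D) = (\<Sum>x\<in>fst X. of_bool (D = ?pre (stab G X x)) :: rat)"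
      unfolding H.stab_count_as_sum[OF fin[OF X]]
      by (rule sum.cong) (auto simp: gset_restrict_def stabilizer_def)
    then show ?thesis using G.sum_over_points[OF X] by simp
  qed
  note r = burnside_unary[OF G H p a fin cnt]
  show "burnside_restrict p H \<phi> a \<in> burnside p H" unfolding burnside_restrict_def by (rule r)
  assume Q: "Q \<subseteq> carrier H"
  have "marks H (ghost H (burnside_restrict p H \<phi> a)) Q
    = (\<Sum>E | subgroup E G. ghost G a E * marks H (\<lambda>D. of_bool (D = ?pre E)) Q)"
    unfolding burnside_restrict_def by (subst r(2)) (simp_all only: H.marks_sum H.marks_scale)
  also have "\<dots> = (\<Sum>E | subgroup E G. ghost G a E * of_bool (\<phi> ` Q \<subseteq> E))"
  proof (intro sum.cong[OF refl])
    fix E assume "E \<in> {E. subgroup E G}"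
    then have E: "subgroup E G" by simp
    have "subgroup (?pre E) H"
      by (rule H.subgroupI)
         (use subgroup.one_closed[OF E] subgroup.m_closed[OF E] subgroup.m_inv_closed[OF E] in auto)
    then have "marks H (\<lambda>D. of_bool (D = ?pre E)) Q = of_bool (Q \<subseteq> ?pre E)"
      unfolding H.marks_alt using H.finite_subgroups
      by (subst sum.mono_neutral_right[of _ "{?pre E}"]) auto
    also have "Q \<subseteq> ?pre E \<longleftrightarrow> \<phi> ` Q \<subseteq> E" using Q by auto
    finally show "ghost G a E * marks H (\<lambda>D. of_bool (D = ?pre E)) Q = ghost G a E * of_bool (\<phi> ` Q \<subseteq> E)"
      by simp
  qed
  also have "\<dots> = marks G (ghost G a) (\<phi> ` Q)" unfolding G.marks_alt by simp
  finally show "marks H (ghost H (burnside_restrict p H \<phi> a)) Q = marks G (ghost G a) (\<phi> ` Q)" .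
qed

text \<open>The orbits of one of two commuting actions are permuted by the other.\<close>

lemma commuting_action_on_orbits:
  assumes H: "group H" and fH: "acts H E f" and kL: "acts L E k"
    and comm: "\<And>h l e. h \<in> carrier H \<Longrightarrow> l \<in> carrier L \<Longrightarrow> e \<in> E \<Longrightarrow> k l (f h e) = f h (k l e)"
  shows "acts L (orbits H E f) (\<lambda>l c. k l ` c)"
    and "e \<in> E \<Longrightarrow> stabilizer L (\<lambda>l. \<lambda>c\<in>orbits H E f. k l ` c) (orbit H f e)
           = {l \<in> carrier L. \<exists>h\<in>carrier H. k l e = f h e}"
proof -
  interpret H: group H by fact
  have im: "k l ` orbit H f e = orbit H f (k l e)" if "l \<in> carrier L" "e \<in> E" for l e
    using comm[OF _ that] unfolding orbit_def by (auto simp: image_iff) metis+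
  show "acts L (orbits H E f) (\<lambda>l c. k l ` c)"
    unfolding acts_def
  proof (intro conjI ballI)
    fix l c assume "l \<in> carrier L" "c \<in> orbits H E f"
    then show "k l ` c \<in> orbits H E f"
      using im actsD(1)[OF kL] unfolding orbits_def by clarsimp blast
  next
    fix c assume "c \<in> orbits H E f"
    then have "c \<subseteq> E" using H.acts_orbit(2)[OF fH] unfolding orbits_def by auto
    then show "k \<one>\<^bsub>L\<^esub> ` c = c" using actsD(2)[OF kL] by (auto simp: image_iff subset_iff)
    fix g l assume "g \<in> carrier L" "l \<in> carrier L"
    then show "k (g \<otimes>\<^bsub>L\<^esub> l) ` c = k g ` (k l ` c)"
      unfolding image_image using \<open>c \<subseteq> E\<close> actsD(3)[OF kL] by (intro image_cong) auto
  qed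
  assume e: "e \<in> E"
  have eo: "orbit H f e \<in> orbits H E f" using e by (auto simp: orbits_def)
  have "k l ` orbit H f e = orbit H f e \<longleftrightarrow> (\<exists>h\<in>carrier H. k l e = f h e)" if l: "l \<in> carrier L" for l
  proof -
    have "k l e \<in> E" using actsD(1)[OF kL l e] .
    then have "orbit H f (k l e) = orbit H f e \<longleftrightarrow> k l e \<in> orbit H f e"
      using H.acts_orbit(1)[OF fH] H.acts_orbit(3)[OF fH e] by blast
    then show ?thesis unfolding im[OF l e] by (auto simp: orbit_def)
  qed
  then show "stabilizer L (\<lambda>l. \<lambda>c\<in>orbits H E f. k l ` c) (orbit H f e)
           = {l \<in> carrier L. \<exists>h\<in>carrier H. k l e = f h e}"
    unfolding stabilizer_def using eo by auto
qed

text \<open>The common core of composition and collapse: both consist of the orbits of one of two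
  commuting actions, and an orbit has the weight of its points in \<open>sum_over_orbits\<close>.\<close>

lemma commuting_action_quotient:
  assumes H: "finite_group H" and L: "finite_group L" and E: "finite E"
    and fH: "acts H E f" and kL: "acts L E k"
    and comm: "\<And>h l e. h \<in> carrier H \<Longrightarrow> l \<in> carrier L \<Longrightarrow> e \<in> E \<Longrightarrow> k l (f h e) = f h (k l e)"
  defines "Q \<equiv> (orbits H E f, \<lambda>l. \<lambda>c\<in>orbits H E f. k l ` c)"
  shows "finite_gset L Q"
    and "of_nat (stab_count L Q D) = (\<Sum>e\<in>E. of_bool (D = {l \<in> carrier L. \<exists>h\<in>carrier H. k l e = f h e})
      * of_nat (card (stabilizer H f e)) / of_nat (card (carrier H)) :: rat)"
proof -
  interpret H: finite_group H by fact
  interpret L: finite_group L by fact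
  have q1: "acts L (orbits H E f) (\<lambda>l c. k l ` c)"
    by (rule commuting_action_on_orbits(1)[OF H.is_group fH kL]) (rule comm)
  show fin: "finite_gset L Q"
    unfolding Q_def
    by (rule L.finite_gset_restrictI[OF _ q1 refl])
       (unfold orbits_def Setcompr_eq_image, rule finite_imageI[OF E])
  have st: "stab L Q (orbit H f e) = {l \<in> carrier L. \<exists>h\<in>carrier H. k l e = f h e}" if "e \<in> E" for e
    unfolding Q_def snd_conv
    by (rule commuting_action_on_orbits(2)[OF H.is_group fH kL _ that]) (rule comm)
  have "of_nat (stab_count L Q D) = (\<Sum>c\<in>orbits H E f. of_bool (D = stab L Q c) :: rat)"
    unfolding L.stab_count_as_sum[OF fin] by (simp add: Q_def)
  also have "\<dots> = (\<Sum>e\<in>E. of_bool (D = stab L Q (orbit H f e))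
      * of_nat (card (stabilizer H f e)) / of_nat (card (carrier H)))"
    by (rule H.sum_over_orbits[OF fH E])
  also have "\<dots> = (\<Sum>e\<in>E. of_bool (D = {l \<in> carrier L. \<exists>h\<in>carrier H. k l e = f h e})
      * of_nat (card (stabilizer H f e)) / of_nat (card (carrier H)))"
    by (rule sum.cong[OF refl]) (simp add: st)
  finally show "of_nat (stab_count L Q D) = (\<Sum>e\<in>E. of_bool (D = {l \<in> carrier L. \<exists>h\<in>carrier H. k l e = f h e})
      * of_nat (card (stabilizer H f e)) / of_nat (card (carrier H)) :: rat)" .
qed

lemma finite_group_DirProd:
  "finite_group H \<Longrightarrow> finite_group G \<Longrightarrow> finite_group (H \<times>\<times> G)"
  unfolding finite_group_def finite_group_axioms_def using DirProd_group by (auto simp: DirProd_def)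

text \<open>If \<open>A\<close> and \<open>B\<close> are the stabilizers of \<open>y\<close> and \<open>x\<close>, this is the order of the stabilizer of
  \<open>(y, x)\<close> in \<open>H\<close>, which enters as the weight of the point in a sum over \<open>H\<close>-orbits. It is \<open>1\<close> if
  \<open>A\<close> or \<open>B\<close> is the graph of an injective homomorphism.\<close>

definition overlap :: "('g, 'm) monoid_scheme \<Rightarrow> ('h, 'n) monoid_scheme \<Rightarrow> ('k, 'o) monoid_scheme \<Rightarrow>
    ('k \<times> 'h) set \<Rightarrow> ('h \<times> 'g) set \<Rightarrow> nat" where
  "overlap G H K A B = card {h \<in> carrier H. (\<one>\<^bsub>K\<^esub>, h) \<in> A \<and> (h, \<one>\<^bsub>G\<^esub>) \<in> B}"

text \<open>An element \<open>(k, g)\<close> fixes \<open>[y, x] \<in> Y \<times>\<^sub>H X\<close> if and only if it moves \<open>(y, x)\<close> in the same way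
  as some \<open>h\<close> does, that is, if \<open>(k, h)\<close> fixes \<open>y\<close> and \<open>(h, g)\<close> fixes \<open>x\<close> for some \<open>h\<close>. So the
  stabilizer is the composite of the stabilizers as relations.\<close>

lemma burnside_comp:
  fixes G :: "('g, 'm) monoid_scheme" and H :: "('h, 'n) monoid_scheme" and K :: "('k, 'o) monoid_scheme"
  assumes G: "finite_group G" and H: "finite_group H" and K: "finite_group K" and p: "prime p"
    and b: "b \<in> bisets p H K" and a: "a \<in> bisets p G H"
  shows "burnside_comp p G H K b a \<in> bisets p G K"
    "ghost (K \<times>\<times> G) (burnside_comp p G H K b a) = (\<lambda>D.
       \<Sum>A | subgroup A (K \<times>\<times> H). \<Sum>B | subgroup B (H \<times>\<times> G).
       ghost (K \<times>\<times> H) b A * ghost (H \<times>\<times> G) a B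
         * (of_bool (D = A O B) * of_nat (overlap G H K A B) / of_nat (card (carrier H))))"
proof -
  interpret G: finite_group G by fact
  interpret H: finite_group H by fact
  interpret K: finite_group K by fact
  interpret KH: finite_group "K \<times>\<times> H" by (rule finite_group_DirProd[OF K H])
  interpret HG: finite_group "H \<times>\<times> G" by (rule finite_group_DirProd[OF H G])
  interpret KG: finite_group "K \<times>\<times> G" by (rule finite_group_DirProd[OF K G])
  have *: "finite_gset (K \<times>\<times> G) (biset_comp G H K Y X)"
    "of_nat (stab_count (K \<times>\<times> G) (biset_comp G H K Y X) D)
      = (\<Sum>A | subgroup A (K \<times>\<times> H). \<Sum>B | subgroup B (H \<times>\<times> G).
         of_nat (stab_count (K \<times>\<times> H) Y A) * of_nat (stab_count (H \<times>\<times> G) X B)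
          * (of_bool (D = A O B) * of_nat (overlap G H K A B) / of_nat (card (carrier H)) :: rat))"
    if Y: "finite_gset (K \<times>\<times> H) Y" and X: "finite_gset (H \<times>\<times> G) X"
    for Y :: "('k \<times> 'h, nat) gset" and X :: "('h \<times> 'g, nat) gset" and D
  proof -
    note aY = KH.finite_gsetD(2)[OF Y] and aX = HG.finite_gsetD(2)[OF X]
    let ?E = "fst Y \<times> fst X"
    let ?f = "\<lambda>h. map_prod (snd Y (\<one>\<^bsub>K\<^esub>, h)) (snd X (h, \<one>\<^bsub>G\<^esub>))"
    let ?k = "\<lambda>z. map_prod (snd Y (fst z, \<one>\<^bsub>H\<^esub>)) (snd X (\<one>\<^bsub>H\<^esub>, snd z))"
    have Y1: "snd Y (\<one>\<^bsub>K\<^esub>, \<one>\<^bsub>H\<^esub>) y = y" if "y \<in> fst Y" for y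
      using actsD(2)[OF aY that] by (simp add: DirProd_def)
    have X1: "snd X (\<one>\<^bsub>H\<^esub>, \<one>\<^bsub>G\<^esub>) x = x" if "x \<in> fst X" for x
      using actsD(2)[OF aX that] by (simp add: DirProd_def)
    have Yc: "snd Y (k, h) y \<in> fst Y"
      "k' \<in> carrier K \<Longrightarrow> h' \<in> carrier H \<Longrightarrow>
        snd Y (k, h) (snd Y (k', h') y) = snd Y (k \<otimes>\<^bsub>K\<^esub> k', h \<otimes>\<^bsub>H\<^esub> h') y"
      if "k \<in> carrier K" "h \<in> carrier H" "y \<in> fst Y" for k k' h h' y
      using actsD(1)[OF aY, of "(k,h)" y] actsD(3)[OF aY, of "(k,h)" "(k',h')" y] that
      by (auto simp: DirProd_def)
    have Xc: "snd X (h, g) x \<in> fst X"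
      "h' \<in> carrier H \<Longrightarrow> g' \<in> carrier G \<Longrightarrow>
        snd X (h, g) (snd X (h', g') x) = snd X (h \<otimes>\<^bsub>H\<^esub> h', g \<otimes>\<^bsub>G\<^esub> g') x"
      if "h \<in> carrier H" "g \<in> carrier G" "x \<in> fst X" for h h' g g' x
      using actsD(1)[OF aX, of "(h,g)" x] actsD(3)[OF aX, of "(h,g)" "(h',g')" x] that
      by (auto simp: DirProd_def)
    have fa: "acts H ?E ?f" unfolding acts_def by (auto simp: Yc Xc Y1 X1)
    have ka: "acts (K \<times>\<times> G) ?E ?k" unfolding acts_def by (auto simp: Yc Xc Y1 X1 DirProd_def)
    have comm: "?k l (?f h e) = ?f h (?k l e)"
      if "h \<in> carrier H" "l \<in> carrier (K \<times>\<times> G)" "e \<in> ?E" for h l e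
      using that by (auto simp: Yc Xc DirProd_def)
    have fE: "finite ?E" using KH.finite_gsetD(1)[OF Y] HG.finite_gsetD(1)[OF X] by simp
    have bc: "biset_comp G H K Y X = (orbits H ?E ?f, \<lambda>z. \<lambda>c\<in>orbits H ?E ?f. ?k z ` c)"
      unfolding biset_comp_def Let_def by (simp add: case_prod_unfold)
    note q = commuting_action_quotient[OF H KG.finite_group_axioms fE fa ka, folded bc]
    show "finite_gset (K \<times>\<times> G) (biset_comp G H K Y X)" by (rule q(1)) (rule comm)
    have st: "{l \<in> carrier (K \<times>\<times> G). \<exists>h\<in>carrier H. ?k l (y, x) = ?f h (y, x)}
        = stab (K \<times>\<times> H) Y y O stab (H \<times>\<times> G) X x" if y: "y \<in> fst Y" and x: "x \<in> fst X" for y x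
    proof -
      have yi: "snd Y (k, \<one>\<^bsub>H\<^esub>) y = snd Y (\<one>\<^bsub>K\<^esub>, h) y \<longleftrightarrow> (k, inv\<^bsub>H\<^esub> h) \<in> stab (K \<times>\<times> H) Y y"
        if "k \<in> carrier K" "h \<in> carrier H" for k h
        using KH.acts_eq_iff[OF aY, of "(k, \<one>\<^bsub>H\<^esub>)" "(\<one>\<^bsub>K\<^esub>, h)" y y] that y
        by (simp add: stabilizer_def inv_DirProd G.is_group H.is_group K.is_group)
      have xi: "snd X (\<one>\<^bsub>H\<^esub>, g) x = snd X (h, \<one>\<^bsub>G\<^esub>) x \<longleftrightarrow> (inv\<^bsub>H\<^esub> h, g) \<in> stab (H \<times>\<times> G) X x"
        if "h \<in> carrier H" "g \<in> carrier G" for h g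
        using HG.acts_eq_iff[OF aX, of "(\<one>\<^bsub>H\<^esub>, g)" "(h, \<one>\<^bsub>G\<^esub>)" x x] that x
        by (simp add: stabilizer_def inv_DirProd G.is_group H.is_group K.is_group)
      show ?thesis
      proof (intro Set.set_eqI iffI)
        fix l assume "l \<in> {l \<in> carrier (K \<times>\<times> G). \<exists>h\<in>carrier H. ?k l (y, x) = ?f h (y, x)}"
        then show "l \<in> stab (K \<times>\<times> H) Y y O stab (H \<times>\<times> G) X x"
          using yi xi by (cases l) (auto simp: DirProd_def)
      next
        fix l assume "l \<in> stab (K \<times>\<times> H) Y y O stab (H \<times>\<times> G) X x"
        then obtain k h g where l: "l = (k, g)" "(k, h) \<in> stab (K \<times>\<times> H) Y y" "(h, g) \<in> stab (H \<times>\<times> G) X x"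
          by auto
        then have c: "k \<in> carrier K" "h \<in> carrier H" "g \<in> carrier G"
          by (auto simp: stabilizer_def DirProd_def)
        have "?k l (y, x) = ?f (inv\<^bsub>H\<^esub> h) (y, x)"
          using yi[of k "inv\<^bsub>H\<^esub> h"] xi[of "inv\<^bsub>H\<^esub> h" g] c l by simp
        then show "l \<in> {l \<in> carrier (K \<times>\<times> G). \<exists>h\<in>carrier H. ?k l (y, x) = ?f h (y, x)}"
          using c l(1) H.inv_closed[of h] by (auto simp: DirProd_def)
      qed
    qed
    have sth: "card (stabilizer H ?f (y, x)) = overlap G H K (stab (K \<times>\<times> H) Y y) (stab (H \<times>\<times> G) X x)"
      for y x unfolding overlap_def by (rule arg_cong[where f = card]) (auto simp: stabilizer_def DirProd_def)
    let ?w = "\<lambda>A B. of_bool (D = A O B) * of_nat (overlap G H K A B) / of_nat (card (carrier H)) :: rat"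
    have "of_nat (stab_count (K \<times>\<times> G) (biset_comp G H K Y X) D)
      = (\<Sum>e\<in>?E. of_bool (D = {l \<in> carrier (K \<times>\<times> G). \<exists>h\<in>carrier H. ?k l e = ?f h e})
        * of_nat (card (stabilizer H ?f e)) / of_nat (card (carrier H)) :: rat)"
      by (rule q(2)) (rule comm)
    also have "\<dots> = (\<Sum>y\<in>fst Y. \<Sum>x\<in>fst X. ?w (stab (K \<times>\<times> H) Y y) (stab (H \<times>\<times> G) X x))"
      unfolding sum.cartesian_product by (rule sum.cong[OF refl]) (clarify, simp only: st sth prod.case)
    also have "\<dots> = (\<Sum>y\<in>fst Y. \<Sum>B | subgroup B (H \<times>\<times> G). of_nat (stab_count (H \<times>\<times> G) X B) * ?w (stab (K \<times>\<times> H) Y y) B)"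
      by (rule sum.cong[OF refl]) (rule HG.sum_over_points[OF X])
    also have "\<dots> = (\<Sum>A | subgroup A (K \<times>\<times> H). of_nat (stab_count (K \<times>\<times> H) Y A)
       * (\<Sum>B | subgroup B (H \<times>\<times> G). of_nat (stab_count (H \<times>\<times> G) X B) * ?w A B))"
      by (rule KH.sum_over_points[OF Y])
    finally show "of_nat (stab_count (K \<times>\<times> G) (biset_comp G H K Y X) D)
      = (\<Sum>A | subgroup A (K \<times>\<times> H). \<Sum>B | subgroup B (H \<times>\<times> G).
         of_nat (stab_count (K \<times>\<times> H) Y A) * of_nat (stab_count (H \<times>\<times> G) X B) * ?w A B)"
      by (simp add: sum_distrib_left mult.assoc)
  qed
  note r = burnside_binary[OF KH.finite_group_axioms HG.finite_group_axioms KG.finite_group_axioms p b a *]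
  show "burnside_comp p G H K b a \<in> bisets p G K"
    unfolding burnside_comp_def by (rule r)
  show "ghost (K \<times>\<times> G) (burnside_comp p G H K b a) = (\<lambda>D.
       \<Sum>A | subgroup A (K \<times>\<times> H). \<Sum>B | subgroup B (H \<times>\<times> G).
       ghost (K \<times>\<times> H) b A * ghost (H \<times>\<times> G) a B
         * (of_bool (D = A O B) * of_nat (overlap G H K A B) / of_nat (card (carrier H))))"
    unfolding burnside_comp_def by (rule r)
qed

text \<open>An element \<open>h\<close> fixes the orbit of \<open>x\<close> under the right action if and only if \<open>(h, g)\<close> fixes
  \<open>x\<close> for some \<open>g\<close>.\<close>

lemma collapse:
  fixes S :: "('g, 'm) monoid_scheme"
  assumes S: "finite_group S" and p: "prime p" and a: "a \<in> bisets p S S"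
  shows "collapse p S a \<in> burnside p S"
    "ghost S (collapse p S a) = (\<lambda>D. \<Sum>A | subgroup A (S \<times>\<times> S). ghost (S \<times>\<times> S) a A
       * (of_bool (D = Domain A) * of_nat (card {g \<in> carrier S. (\<one>\<^bsub>S\<^esub>, g) \<in> A}) / of_nat (card (carrier S))))"
proof -
  interpret S: finite_group S by fact
  interpret SS: finite_group "S \<times>\<times> S" by (rule finite_group_DirProd[OF S S])
  have *: "finite_gset S (biset_collapse S S X)"
    "of_nat (stab_count S (biset_collapse S S X) D)
      = (\<Sum>A | subgroup A (S \<times>\<times> S). of_nat (stab_count (S \<times>\<times> S) X A)
          * (of_bool (D = Domain A) * of_nat (card {g \<in> carrier S. (\<one>\<^bsub>S\<^esub>, g) \<in> A}) / of_nat (card (carrier S)) :: rat))"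
    if X: "finite_gset (S \<times>\<times> S) X" for X :: "('g \<times> 'g, nat) gset" and D
  proof -
    note aX = SS.finite_gsetD(2)[OF X]
    let ?f = "\<lambda>g. snd X (\<one>\<^bsub>S\<^esub>, g)" and ?k = "\<lambda>h. snd X (h, \<one>\<^bsub>S\<^esub>)"
    have X1: "snd X (\<one>\<^bsub>S\<^esub>, \<one>\<^bsub>S\<^esub>) x = x" if "x \<in> fst X" for x
      using actsD(2)[OF aX that] by (simp add: DirProd_def)
    have Xc: "snd X (h, g) x \<in> fst X"
      "h' \<in> carrier S \<Longrightarrow> g' \<in> carrier S \<Longrightarrow>
        snd X (h, g) (snd X (h', g') x) = snd X (h \<otimes>\<^bsub>S\<^esub> h', g \<otimes>\<^bsub>S\<^esub> g') x"
      if "h \<in> carrier S" "g \<in> carrier S" "x \<in> fst X" for h h' g g' x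
      using actsD(1)[OF aX, of "(h,g)" x] actsD(3)[OF aX, of "(h,g)" "(h',g')" x] that
      by (auto simp: DirProd_def)
    have fa: "acts S (fst X) ?f" and ka: "acts S (fst X) ?k" unfolding acts_def by (auto simp: Xc X1)
    have comm: "?k l (?f h e) = ?f h (?k l e)"
      if "h \<in> carrier S" "l \<in> carrier S" "e \<in> fst X" for h l e
      using that by (auto simp: Xc)
    note fE = SS.finite_gsetD(1)[OF X]
    have bc: "biset_collapse S S X = (orbits S (fst X) ?f, \<lambda>h. \<lambda>c\<in>orbits S (fst X) ?f. ?k h ` c)"
      unfolding biset_collapse_def Let_def by simp
    note q = commuting_action_quotient[OF S S fE fa ka, folded bc]
    show "finite_gset S (biset_collapse S S X)" by (rule q(1)) (rule comm)
    have st: "{l \<in> carrier S. \<exists>h\<in>carrier S. ?k l x = ?f h x} = Domain (stab (S \<times>\<times> S) X x)"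
      if x: "x \<in> fst X" for x
    proof -
      have xi: "snd X (h, \<one>\<^bsub>S\<^esub>) x = snd X (\<one>\<^bsub>S\<^esub>, g) x \<longleftrightarrow> (h, inv\<^bsub>S\<^esub> g) \<in> stab (S \<times>\<times> S) X x"
        if "h \<in> carrier S" "g \<in> carrier S" for h g
        using SS.acts_eq_iff[OF aX, of "(h, \<one>\<^bsub>S\<^esub>)" "(\<one>\<^bsub>S\<^esub>, g)" x x] that x
        by (simp add: stabilizer_def inv_DirProd S.is_group)
      show ?thesis
      proof (intro Set.set_eqI iffI)
        fix l assume "l \<in> {l \<in> carrier S. \<exists>h\<in>carrier S. ?k l x = ?f h x}"
        then show "l \<in> Domain (stab (S \<times>\<times> S) X x)" using xi by auto
      next
        fix l assume "l \<in> Domain (stab (S \<times>\<times> S) X x)"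
        then obtain g where l: "(l, g) \<in> stab (S \<times>\<times> S) X x" by auto
        then have c: "l \<in> carrier S" "g \<in> carrier S" by (auto simp: stabilizer_def DirProd_def)
        then have "?k l x = ?f (inv\<^bsub>S\<^esub> g) x" using xi[of l "inv\<^bsub>S\<^esub> g"] l by simp
        then show "l \<in> {l \<in> carrier S. \<exists>h\<in>carrier S. ?k l x = ?f h x}"
          using c S.inv_closed[of g] by auto
      qed
    qed
    have sth: "stabilizer S ?f x = {g \<in> carrier S. (\<one>\<^bsub>S\<^esub>, g) \<in> stab (S \<times>\<times> S) X x}" for x
      by (auto simp: stabilizer_def DirProd_def)
    have "of_nat (stab_count S (biset_collapse S S X) D)
      = (\<Sum>x\<in>fst X. of_bool (D = {l \<in> carrier S. \<exists>h\<in>carrier S. ?k l x = ?f h x})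
        * of_nat (card (stabilizer S ?f x)) / of_nat (card (carrier S)) :: rat)"
      by (rule q(2)) (rule comm)
    also have "\<dots> = (\<Sum>x\<in>fst X. of_bool (D = Domain (stab (S \<times>\<times> S) X x))
        * of_nat (card {g \<in> carrier S. (\<one>\<^bsub>S\<^esub>, g) \<in> stab (S \<times>\<times> S) X x}) / of_nat (card (carrier S)))"
      by (rule sum.cong[OF refl]) (simp only: st sth)
    also have "\<dots> = (\<Sum>A | subgroup A (S \<times>\<times> S). of_nat (stab_count (S \<times>\<times> S) X A)
          * (of_bool (D = Domain A) * of_nat (card {g \<in> carrier S. (\<one>\<^bsub>S\<^esub>, g) \<in> A}) / of_nat (card (carrier S))))"
      by (rule SS.sum_over_points[OF X])
    finally show "of_nat (stab_count S (biset_collapse S S X) D)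
      = (\<Sum>A | subgroup A (S \<times>\<times> S). of_nat (stab_count (S \<times>\<times> S) X A)
          * (of_bool (D = Domain A) * of_nat (card {g \<in> carrier S. (\<one>\<^bsub>S\<^esub>, g) \<in> A}) / of_nat (card (carrier S)) :: rat))" .
  qed
  note r = burnside_unary[OF SS.finite_group_axioms S p a *]
  show "collapse p S a \<in> burnside p S" unfolding collapse_def by (rule r)
  show "ghost S (collapse p S a) = (\<lambda>D. \<Sum>A | subgroup A (S \<times>\<times> S). ghost (S \<times>\<times> S) a A
       * (of_bool (D = Domain A) * of_nat (card {g \<in> carrier S. (\<one>\<^bsub>S\<^esub>, g) \<in> A}) / of_nat (card (carrier S))))"
    unfolding collapse_def by (rule r)
qed


section \<open>Subgroups of direct products as relations\<close>

lemma subgroup_DirProdI: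
  assumes "group H" "group G" "D \<subseteq> carrier H \<times> carrier G" "(\<one>\<^bsub>H\<^esub>, \<one>\<^bsub>G\<^esub>) \<in> D"
    "\<And>a b a' b'. (a, b) \<in> D \<Longrightarrow> (a', b') \<in> D \<Longrightarrow> (a \<otimes>\<^bsub>H\<^esub> a', b \<otimes>\<^bsub>G\<^esub> b') \<in> D"
    "\<And>a b. (a, b) \<in> D \<Longrightarrow> (inv\<^bsub>H\<^esub> a, inv\<^bsub>G\<^esub> b) \<in> D"
  shows "subgroup D (H \<times>\<times> G)"
proof -
  interpret group "H \<times>\<times> G" by (rule DirProd_group[OF assms(1,2)])
  show ?thesis
  proof (rule subgroupI)
    fix a b assume "a \<in> D" "b \<in> D"
    then show "inv\<^bsub>H \<times>\<times> G\<^esub> a \<in> D" "a \<otimes>\<^bsub>H \<times>\<times> G\<^esub> b \<in> D"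
      using assms by (cases a; cases b; auto)+
  qed (use assms in auto)
qed

lemma subgroup_DirProdD:
  assumes "group H" "group G" "subgroup D (H \<times>\<times> G)"
  shows "D \<subseteq> carrier H \<times> carrier G" "(\<one>\<^bsub>H\<^esub>, \<one>\<^bsub>G\<^esub>) \<in> D"
    "\<And>a b a' b'. (a, b) \<in> D \<Longrightarrow> (a', b') \<in> D \<Longrightarrow> (a \<otimes>\<^bsub>H\<^esub> a', b \<otimes>\<^bsub>G\<^esub> b') \<in> D"
    "\<And>a b. (a, b) \<in> D \<Longrightarrow> (inv\<^bsub>H\<^esub> a, inv\<^bsub>G\<^esub> b) \<in> D"
proof -
  show s: "D \<subseteq> carrier H \<times> carrier G" using subgroup.subset[OF assms(3)] by simp
  show "(\<one>\<^bsub>H\<^esub>, \<one>\<^bsub>G\<^esub>) \<in> D" using subgroup.one_closed[OF assms(3)] by simp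
  show "(a \<otimes>\<^bsub>H\<^esub> a', b \<otimes>\<^bsub>G\<^esub> b') \<in> D" if "(a, b) \<in> D" "(a', b') \<in> D" for a b a' b'
    using subgroup.m_closed[OF assms(3) that] by simp
  show "(inv\<^bsub>H\<^esub> a, inv\<^bsub>G\<^esub> b) \<in> D" if "(a, b) \<in> D" for a b
  proof -
    have "a \<in> carrier H" "b \<in> carrier G" using s that by auto
    then show ?thesis using subgroup.m_inv_closed[OF assms(3) that] assms(1,2) by simp
  qed
qed

lemma subgroup_relcomp:
  assumes "group K" "group H" "group G" "subgroup A (K \<times>\<times> H)" "subgroup B (H \<times>\<times> G)"
  shows "subgroup (A O B) (K \<times>\<times> G)"
proof (rule subgroup_DirProdI[OF assms(1,3)])
  note a = subgroup_DirProdD[OF assms(1,2,4)] and b = subgroup_DirProdD[OF assms(2,3,5)]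
  show "A O B \<subseteq> carrier K \<times> carrier G" using a(1) b(1) by auto
  show "(\<one>\<^bsub>K\<^esub>, \<one>\<^bsub>G\<^esub>) \<in> A O B" using a(2) b(2) by auto
  show "(x \<otimes>\<^bsub>K\<^esub> x', y \<otimes>\<^bsub>G\<^esub> y') \<in> A O B" if "(x, y) \<in> A O B" "(x', y') \<in> A O B" for x y x' y'
    using that a(3) b(3) by blast
  show "(inv\<^bsub>K\<^esub> x, inv\<^bsub>G\<^esub> y) \<in> A O B" if "(x, y) \<in> A O B" for x y
    using that a(4) b(4) by blast
qed

lemma subgroup_converse:
  assumes "group H" "group G" "subgroup B (H \<times>\<times> G)"
  shows "subgroup (B\<inverse>) (G \<times>\<times> H)"
  by (rule subgroup_DirProdI[OF assms(2,1)]) (use subgroup_DirProdD[OF assms] in auto)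

lemma subgroup_Domain_Range:
  assumes "group H" "group G" "subgroup B (H \<times>\<times> G)"
  shows "subgroup (Domain B) H" "subgroup (Range B) G"
proof -
  note b = subgroup_DirProdD[OF assms]
  show "subgroup (Domain B) H"
  proof (rule group.subgroupI[OF assms(1)])
    show "inv\<^bsub>H\<^esub> x \<in> Domain B" if "x \<in> Domain B" for x using that b(4) by blast
    show "x \<otimes>\<^bsub>H\<^esub> y \<in> Domain B" if "x \<in> Domain B" "y \<in> Domain B" for x y using that b(3) by blast
  qed (use b(1,2) in auto)
  show "subgroup (Range B) G"
  proof (rule group.subgroupI[OF assms(2)])
    show "inv\<^bsub>G\<^esub> x \<in> Range B" if "x \<in> Range B" for x using that b(4) by blast
    show "x \<otimes>\<^bsub>G\<^esub> y \<in> Range B" if "x \<in> Range B" "y \<in> Range B" for x y using that b(3) by blast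
  qed (use b(1,2) in auto)
qed

lemma subgroup_Id_on:
  assumes "group G" "subgroup P G"
  shows "subgroup (Id_on P) (G \<times>\<times> G)"
  by (rule subgroup_DirProdI[OF assms(1,1)])
     (use subgroup.subset[OF assms(2)] subgroup.one_closed[OF assms(2)] subgroup.m_closed[OF assms(2)]
        subgroup.m_inv_closed[OF assms(2)] in auto)

lemma subgroup_twisted_diagonal:
  assumes H: "group H" and G: "group G" and P: "subgroup P G" and \<phi>: "\<phi> \<in> hom (G\<lparr>carrier := P\<rparr>) H"
  shows "subgroup (twisted_diagonal P \<phi>) (H \<times>\<times> G)"
proof -
  interpret H: group H by fact
  interpret G: group G by fact
  interpret P: group "G\<lparr>carrier := P\<rparr>" using G.subgroup_imp_group[OF P] .
  interpret \<phi>: group_hom "G\<lparr>carrier := P\<rparr>" H \<phi>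
    using \<phi> by (simp add: group_hom_def group_hom_axioms_def H.is_group P.is_group)
  have m: "\<phi> (u \<otimes>\<^bsub>G\<^esub> v) = \<phi> u \<otimes>\<^bsub>H\<^esub> \<phi> v" "\<phi> (inv\<^bsub>G\<^esub> u) = inv\<^bsub>H\<^esub> \<phi> u" "\<phi> \<one>\<^bsub>G\<^esub> = \<one>\<^bsub>H\<^esub>" "\<phi> u \<in> carrier H"
    if "u \<in> P" "v \<in> P" for u v
    using that \<phi>.hom_mult[of u v] \<phi>.hom_inv[of u] \<phi>.hom_one \<phi>.hom_closed[of u] G.m_inv_consistent[OF P]
    by auto
  show ?thesis
    by (rule subgroup_DirProdI[OF H G])
       (use subgroup.subset[OF P] subgroup.one_closed[OF P] subgroup.m_closed[OF P] m
          subgroup.m_inv_closed[OF P] in \<open>auto simp: twisted_diagonal_def image_iff intro!: bexI\<close>)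
qed

lemma Domain_twisted_diagonal: "Domain (twisted_diagonal P \<phi>) = \<phi> ` P"
  and Range_twisted_diagonal: "Range (twisted_diagonal P \<phi>) = P"
  by (auto simp: twisted_diagonal_def)

lemma DirProd_restrict_carrier:
  "S \<times>\<times> (T\<lparr>carrier := P\<rparr>) = (S \<times>\<times> T)\<lparr>carrier := carrier S \<times> P\<rparr>"
  "(S\<lparr>carrier := P\<rparr>) \<times>\<times> T = (S \<times>\<times> T)\<lparr>carrier := P \<times> carrier T\<rparr>"
  by (simp_all add: DirProd_def)

lemma marks_comp:
  fixes G :: "('g, 'm) monoid_scheme" and H :: "('h, 'n) monoid_scheme" and K :: "('k, 'o) monoid_scheme"
  assumes G: "finite_group G" and H: "finite_group H" and K: "finite_group K" and p: "prime p"
    and b: "b \<in> bisets p H K" and a: "a \<in> bisets p G H"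
  shows "marks (K \<times>\<times> G) (ghost (K \<times>\<times> G) (burnside_comp p G H K b a)) D =
       (\<Sum>A | subgroup A (K \<times>\<times> H). \<Sum>B | subgroup B (H \<times>\<times> G).
       ghost (K \<times>\<times> H) b A * ghost (H \<times>\<times> G) a B
         * (of_bool (D \<subseteq> A O B) * of_nat (overlap G H K A B) / of_nat (card (carrier H))))"
proof -
  interpret KG: finite_group "K \<times>\<times> G" by (rule finite_group_DirProd[OF K G])
  have gr: "group K" "group H" "group G" using G H K by (auto simp: finite_group_def)
  have "marks (K \<times>\<times> G) (ghost (K \<times>\<times> G) (burnside_comp p G H K b a)) D
    = (\<Sum>A | subgroup A (K \<times>\<times> H). \<Sum>B | subgroup B (H \<times>\<times> G).
       ghost (K \<times>\<times> H) b A * ghost (H \<times>\<times> G) a B * of_nat (overlap G H K A B) / of_nat (card (carrier H))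
         * marks (K \<times>\<times> G) (\<lambda>E. of_bool (E = A O B)) D)"
  proof -
    have "ghost (K \<times>\<times> G) (burnside_comp p G H K b a)
      = (\<lambda>E. \<Sum>A | subgroup A (K \<times>\<times> H). \<Sum>B | subgroup B (H \<times>\<times> G).
       ghost (K \<times>\<times> H) b A * ghost (H \<times>\<times> G) a B * of_nat (overlap G H K A B) / of_nat (card (carrier H))
         * of_bool (E = A O B))"
      unfolding burnside_comp(2)[OF G H K p b a] by (intro ext sum.cong refl) simp
    then show ?thesis by (simp only: KG.marks_sum KG.marks_scale)
  qed
  also have "\<dots> = (\<Sum>A | subgroup A (K \<times>\<times> H). \<Sum>B | subgroup B (H \<times>\<times> G).
       ghost (K \<times>\<times> H) b A * ghost (H \<times>\<times> G) a B
         * (of_bool (D \<subseteq> A O B) * of_nat (overlap G H K A B) / of_nat (card (carrier H))))"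
  proof (intro sum.cong[OF refl])
    fix A B assume "A \<in> {A. subgroup A (K \<times>\<times> H)}" "B \<in> {B. subgroup B (H \<times>\<times> G)}"
    then have "subgroup (A O B) (K \<times>\<times> G)" using subgroup_relcomp[OF gr] by auto
    then have "marks (K \<times>\<times> G) (\<lambda>E. of_bool (E = A O B)) D = of_bool (D \<subseteq> A O B)"
      unfolding KG.marks_alt using KG.finite_subgroups
      by (subst sum.mono_neutral_right[of _ "{A O B}"]) auto
    then show "ghost (K \<times>\<times> H) b A * ghost (H \<times>\<times> G) a B * of_nat (overlap G H K A B) / of_nat (card (carrier H))
         * marks (K \<times>\<times> G) (\<lambda>E. of_bool (E = A O B)) D
       = ghost (K \<times>\<times> H) b A * ghost (H \<times>\<times> G) a B
         * (of_bool (D \<subseteq> A O B) * of_nat (overlap G H K A B) / of_nat (card (carrier H)))"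
      by simp
  qed
  finally show ?thesis .
qed


section \<open>Composition with a twisted diagonal\<close>

context finite_group
begin

lemma finite_group_subgroup: "subgroup P G \<Longrightarrow> finite_group (G\<lparr>carrier := P\<rparr>)"
  unfolding finite_group_def finite_group_axioms_def using subgroup_imp_group finite_subgroup by auto

text \<open>Up to reparametrization of the graph by \<open>v = t u t\<^sup>-\<^sup>1\<close>, conjugating by \<open>(s, t)\<close> changes \<open>\<psi>\<close>
  by a conjugation in the target only. So conjugate graphs are graphs over the same \<open>P\<close>.\<close>

lemma conj_twisted_diagonal:
  assumes P: "subgroup P G" and \<psi>: "\<psi> \<in> hom (G\<lparr>carrier := P\<rparr>) G"
    and s: "s \<in> carrier G" and t: "t \<in> P"
  shows "(\<lambda>u. (s \<otimes> \<psi> u \<otimes> inv s, t \<otimes> u \<otimes> inv t)) ` P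
    = (\<lambda>v. (s \<otimes> inv (\<psi> t) \<otimes> \<psi> v \<otimes> inv (s \<otimes> inv (\<psi> t)), v)) ` P"
proof -
  note Pm = subgroup.mem_carrier[OF P] subgroup.m_closed[OF P] subgroup.m_inv_closed[OF P]
  interpret P: group "G\<lparr>carrier := P\<rparr>" using subgroup_imp_group[OF P] .
  interpret \<psi>: group_hom "G\<lparr>carrier := P\<rparr>" G \<psi>
    using \<psi> by (simp add: group_hom_def group_hom_axioms_def is_group P.is_group)
  have m: "\<psi> (u \<otimes> v) = \<psi> u \<otimes> \<psi> v" "\<psi> (inv u) = inv (\<psi> u)" "\<psi> u \<in> carrier G"
    if "u \<in> P" "v \<in> P" for u v
    using that \<psi>.hom_mult[of u v] \<psi>.hom_inv[of u] \<psi>.hom_closed[of u] m_inv_consistent[OF P] by auto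
  have e: "s \<otimes> \<psi> u \<otimes> inv s = s \<otimes> inv (\<psi> t) \<otimes> \<psi> (t \<otimes> u \<otimes> inv t) \<otimes> inv (s \<otimes> inv (\<psi> t))"
    if u: "u \<in> P" for u
  proof -
    have c: "\<psi> u \<in> carrier G" "\<psi> t \<in> carrier G" using m u t by auto
    have "\<psi> (t \<otimes> u \<otimes> inv t) = \<psi> t \<otimes> \<psi> u \<otimes> inv (\<psi> t)" using m u t Pm by simp
    then have "s \<otimes> inv (\<psi> t) \<otimes> \<psi> (t \<otimes> u \<otimes> inv t) \<otimes> inv (s \<otimes> inv (\<psi> t))
      = s \<otimes> (inv (\<psi> t) \<otimes> (\<psi> t \<otimes> (\<psi> u \<otimes> (inv (\<psi> t) \<otimes> (\<psi> t \<otimes> inv s)))))"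
      using s c by (simp add: m_assoc inv_mult_group)
    moreover have "inv (\<psi> t) \<otimes> (\<psi> t \<otimes> x) = x" if "x \<in> carrier G" for x
      using c that by (simp add: m_assoc[symmetric])
    ultimately show ?thesis using s c by (simp add: m_assoc)
  qed
  have im: "(\<lambda>u. t \<otimes> u \<otimes> inv t) ` P = P"
  proof
    show "(\<lambda>u. t \<otimes> u \<otimes> inv t) ` P \<subseteq> P" using Pm t by auto
    show "P \<subseteq> (\<lambda>u. t \<otimes> u \<otimes> inv t) ` P"
    proof
      fix v assume v: "v \<in> P"
      have c: "v \<in> carrier G" "t \<in> carrier G" using Pm(1) v t by auto
      then have "t \<otimes> (inv t \<otimes> v \<otimes> t) \<otimes> inv t = (t \<otimes> inv t) \<otimes> v \<otimes> (t \<otimes> inv t)"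
        by (simp only: m_assoc m_closed inv_closed)
      then have "v = t \<otimes> (inv t \<otimes> v \<otimes> t) \<otimes> inv t" using c by simp
      moreover have "inv t \<otimes> v \<otimes> t \<in> P" using Pm(2)[OF Pm(2)[OF Pm(3)[OF t] v] t] .
      ultimately show "v \<in> (\<lambda>u. t \<otimes> u \<otimes> inv t) ` P" by (rule image_eqI)
    qed
  qed
  have "(\<lambda>u. (s \<otimes> \<psi> u \<otimes> inv s, t \<otimes> u \<otimes> inv t)) ` P
    = (\<lambda>v. (s \<otimes> inv (\<psi> t) \<otimes> \<psi> v \<otimes> inv (s \<otimes> inv (\<psi> t)), v)) ` ((\<lambda>u. t \<otimes> u \<otimes> inv t) ` P)"
    unfolding image_image by (rule image_cong) (use e in auto)
  then show ?thesis unfolding im .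
qed

end

text \<open>Composing with \<open>[P, \<psi>]\<close> restricts the right action along \<open>\<psi>\<close>, which on marks is the
  translation of \<open>D\<close> by the graph of \<open>\<psi>\<close>. The stabilizers of the points of \<open>[P, \<psi>]\<close> are conjugates
  of the graph. As the marks of \<open>X\<close> do not change under conjugation, they all contribute equally,
  and their number \<open>|S| |P| / |P|\<close> cancels the denominator \<open>|S|\<close>.\<close>

lemma marks_comp_twisted_right:
  fixes S :: "('a, 'm) monoid_scheme"
  assumes S: "finite_group S" and p: "prime p" and X: "X \<in> bisets p S S" and P: "subgroup P S"
    and \<psi>: "\<psi> \<in> hom (S\<lparr>carrier := P\<rparr>) S" and inj: "inj_on \<psi> P"
  defines "T \<equiv> S\<lparr>carrier := P\<rparr>"
  assumes D: "subgroup D (S \<times>\<times> T)"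
  shows "marks (S \<times>\<times> T) (ghost (S \<times>\<times> T) (burnside_comp p T S S X (basic_biset p T S P \<psi>))) D
    = marks (S \<times>\<times> S) (ghost (S \<times>\<times> S) X) (D O (twisted_diagonal P \<psi>)\<inverse>)"
proof -
  interpret S: finite_group S by fact
  have T: "finite_group T" unfolding T_def by (rule S.finite_group_subgroup[OF P])
  interpret T: finite_group T by fact
  interpret SS: finite_group "S \<times>\<times> S" by (rule finite_group_DirProd[OF S S])
  interpret ST: finite_group "S \<times>\<times> T" by (rule finite_group_DirProd[OF S T])
  let ?\<Delta> = "twisted_diagonal P \<psi>" let ?gX = "ghost (S \<times>\<times> S) X"
  have cT [simp]: "carrier T = P" "\<one>\<^bsub>T\<^esub> = \<one>\<^bsub>S\<^esub>" "mult T = mult S" by (simp_all add: T_def)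
  have iT: "inv\<^bsub>T\<^esub> t = inv\<^bsub>S\<^esub> t" if "t \<in> P" for t using S.m_inv_consistent[OF P that] by (simp add: T_def)
  have PT: "subgroup P T"
    by (rule T.subgroupI) (use subgroup.one_closed[OF P] T.m_closed T.inv_closed in auto)
  have TT: "T\<lparr>carrier := P\<rparr> = T" by (simp add: T_def)
  have \<Delta>: "subgroup ?\<Delta> (S \<times>\<times> T)"
    by (rule subgroup_twisted_diagonal[OF S.is_group T.is_group PT]) (use \<psi> in \<open>simp add: T_def\<close>)
  have \<Delta>S: "subgroup ?\<Delta> (S \<times>\<times> S)"
    by (rule subgroup_twisted_diagonal[OF S.is_group S.is_group P \<psi>])
  have DS: "D \<subseteq> carrier S \<times> P" using subgroup_DirProdD(1)[OF S.is_group T.is_group D] by simp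
  have card\<Delta>: "card ?\<Delta> = card P" unfolding twisted_diagonal_def by (rule card_image) (auto simp: inj_on_def)
  have fX: "finite_gset (S \<times>\<times> T) (coset_gset (S \<times>\<times> T) ?\<Delta>)" by (rule ST.finite_gset_coset[OF \<Delta>])
  have basic: "basic_biset p T S P \<psi> \<in> bisets p T S"
    "ghost (S \<times>\<times> T) (basic_biset p T S P \<psi>) B = of_nat (stab_count (S \<times>\<times> T) (coset_gset (S \<times>\<times> T) ?\<Delta>) B)" for B
    unfolding transitive_biset_def using ST.burnside_class[OF p fX] by auto
  interpret PP: group "S\<lparr>carrier := P\<rparr>" using S.subgroup_imp_group[OF P] .
  interpret \<psi>: group_hom "S\<lparr>carrier := P\<rparr>" S \<psi>
    using \<psi> by (simp add: group_hom_def group_hom_axioms_def S.is_group PP.is_group)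
  have \<psi>1: "\<psi> \<one>\<^bsub>S\<^esub> = \<one>\<^bsub>S\<^esub>" "\<And>u. u \<in> P \<Longrightarrow> \<psi> u \<in> carrier S" using \<psi>.hom_one \<psi>.hom_closed by auto
  have summand: "(\<Sum>A | subgroup A (S \<times>\<times> S). ?gX A * (of_bool (D \<subseteq> A O conj_set (S \<times>\<times> T) g ?\<Delta>)
      * of_nat (overlap T S S A (conj_set (S \<times>\<times> T) g ?\<Delta>)) / of_nat (card (carrier S))))
      = marks (S \<times>\<times> S) ?gX (D O ?\<Delta>\<inverse>) / of_nat (card (carrier S))"
    if g: "g \<in> carrier (S \<times>\<times> T)" for g
  proof -
    obtain s t where st: "g = (s, t)" "s \<in> carrier S" "t \<in> P" using g by (cases g) auto
    define w where "w = s \<otimes>\<^bsub>S\<^esub> inv\<^bsub>S\<^esub> (\<psi> t)"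
    have w: "w \<in> carrier S" unfolding w_def using st \<psi>1 by simp
    have B: "conj_set (S \<times>\<times> T) g ?\<Delta> = (\<lambda>v. (w \<otimes>\<^bsub>S\<^esub> \<psi> v \<otimes>\<^bsub>S\<^esub> inv\<^bsub>S\<^esub> w, v)) ` P"
      unfolding w_def S.conj_twisted_diagonal[OF P \<psi> st(2,3), symmetric]
      unfolding conj_set_def twisted_diagonal_def image_image st(1)
      by (rule image_cong) (use st in \<open>auto simp: S.is_group T.is_group iT\<close>)
    let ?B = "conj_set (S \<times>\<times> T) g ?\<Delta>"
    have ov: "overlap T S S A ?B = 1" if A: "subgroup A (S \<times>\<times> S)" for A
    proof -
      have "{h \<in> carrier S. (\<one>\<^bsub>S\<^esub>, h) \<in> A \<and> (h, \<one>\<^bsub>T\<^esub>) \<in> ?B} = {\<one>\<^bsub>S\<^esub>}"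
        using subgroup_DirProdD(2)[OF S.is_group S.is_group A] w \<psi>1 subgroup.one_closed[OF P]
        unfolding B by (auto simp: image_iff)
      then show ?thesis unfolding overlap_def by simp
    qed
    \<comment> \<open>\<open>?B\<close> is the graph of an injective map defined on all of \<open>P\<close>, so it can be moved to the other side.\<close>
    have sub: "D \<subseteq> A O ?B \<longleftrightarrow> D O ?B\<inverse> \<subseteq> A" for A
    proof
      show "D \<subseteq> A O ?B \<Longrightarrow> D O ?B\<inverse> \<subseteq> A" unfolding B by blast
      have "D \<subseteq> D O ?B\<inverse> O ?B"
      proof (rule subrelI)
        fix a v assume av: "(a, v) \<in> D"
        then have "v \<in> P" using DS by auto
        then have "(w \<otimes>\<^bsub>S\<^esub> \<psi> v \<otimes>\<^bsub>S\<^esub> inv\<^bsub>S\<^esub> w, v) \<in> ?B" unfolding B by (rule imageI)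
        then show "(a, v) \<in> D O ?B\<inverse> O ?B" using av by blast
      qed
      then show "D O ?B\<inverse> \<subseteq> A \<Longrightarrow> D \<subseteq> A O ?B" by blast
    qed
    have cj: "D O ?B\<inverse> = conj_set (S \<times>\<times> S) (\<one>\<^bsub>S\<^esub>, w) (D O ?\<Delta>\<inverse>)"
    proof -
      have "D O ?B\<inverse> = {(a, w \<otimes>\<^bsub>S\<^esub> \<psi> v \<otimes>\<^bsub>S\<^esub> inv\<^bsub>S\<^esub> w) | a v. (a, v) \<in> D}"
        unfolding B using DS by auto
      moreover have "D O ?\<Delta>\<inverse> = {(a, \<psi> v) | a v. (a, v) \<in> D}"
        unfolding twisted_diagonal_def using DS by auto
      ultimately show ?thesis unfolding conj_set_def using DS w
        by (auto simp: image_iff S.is_group) (force simp: subset_iff)+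
    qed
    have "(\<Sum>A | subgroup A (S \<times>\<times> S). ?gX A * (of_bool (D \<subseteq> A O ?B)
      * of_nat (overlap T S S A ?B) / of_nat (card (carrier S))))
      = (\<Sum>A | subgroup A (S \<times>\<times> S). ?gX A * of_bool (D O ?B\<inverse> \<subseteq> A) / of_nat (card (carrier S)))"
      by (rule sum.cong[OF refl]) (simp add: ov sub)
    also have "\<dots> = marks (S \<times>\<times> S) ?gX (D O ?B\<inverse>) / of_nat (card (carrier S))"
      unfolding SS.marks_alt by (simp add: sum_divide_distrib)
    also have "marks (S \<times>\<times> S) ?gX (D O ?B\<inverse>) = marks (S \<times>\<times> S) ?gX (D O ?\<Delta>\<inverse>)"
      unfolding cj
      by (rule SS.marks_conj[OF SS.integral_ghost[OF p X]]) (use w DS \<psi>1 in \<open>auto simp: twisted_diagonal_def\<close>)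
    finally show ?thesis .
  qed
  have "marks (S \<times>\<times> T) (ghost (S \<times>\<times> T) (burnside_comp p T S S X (basic_biset p T S P \<psi>))) D
    = (\<Sum>B | subgroup B (S \<times>\<times> T). of_nat (stab_count (S \<times>\<times> T) (coset_gset (S \<times>\<times> T) ?\<Delta>) B)
       * (\<Sum>A | subgroup A (S \<times>\<times> S). ?gX A
         * (of_bool (D \<subseteq> A O B) * of_nat (overlap T S S A B) / of_nat (card (carrier S)))))"
    unfolding marks_comp[OF T S S p X basic(1)] basic(2)
    by (subst sum.swap) (simp add: sum_distrib_left mult_ac)
  also have "\<dots> = of_nat (card (carrier (S \<times>\<times> T))) / of_nat (card ?\<Delta>)
      * (marks (S \<times>\<times> S) ?gX (D O ?\<Delta>\<inverse>) / of_nat (card (carrier S)))"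
    by (rule ST.sum_stab_count_coset_const[OF \<Delta>]) (rule summand)
  also have "\<dots> = marks (S \<times>\<times> S) ?gX (D O ?\<Delta>\<inverse>)"
    using S.card_carrier_pos S.card_subgroup_pos[OF P] by (simp add: card\<Delta> card_cartesian_product)
  finally show ?thesis .
qed

text \<open>The mirror image. The biset enters through its graph, which is the converse of that of \<open>\<psi>\<close>.
  So the lemma applies to \<open>[\<psi> P, \<psi>\<^sup>-\<^sup>1]\<close> and, for \<open>\<psi> = id\<close>, to \<open>[P, id]\<close>.\<close>

lemma marks_comp_twisted_left:
  fixes S :: "('a, 'm) monoid_scheme"
  assumes S: "finite_group S" and p: "prime p" and X: "X \<in> bisets p S S" and P: "subgroup P S"
    and \<psi>: "\<psi> \<in> hom (S\<lparr>carrier := P\<rparr>) S" and inj: "inj_on \<psi> P"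
    and \<chi>: "twisted_diagonal Q \<chi> = (twisted_diagonal P \<psi>)\<inverse>"
  defines "T \<equiv> S\<lparr>carrier := P\<rparr>"
  assumes D: "subgroup D (T \<times>\<times> S)"
  shows "marks (T \<times>\<times> S) (ghost (T \<times>\<times> S) (burnside_comp p S S T (basic_biset p S T Q \<chi>) X)) D
    = marks (S \<times>\<times> S) (ghost (S \<times>\<times> S) X) (twisted_diagonal P \<psi> O D)"
proof -
  interpret S: finite_group S by fact
  have T: "finite_group T" unfolding T_def by (rule S.finite_group_subgroup[OF P])
  interpret T: finite_group T by fact
  interpret SS: finite_group "S \<times>\<times> S" by (rule finite_group_DirProd[OF S S])
  interpret TS: finite_group "T \<times>\<times> S" by (rule finite_group_DirProd[OF T S])
  let ?\<Delta> = "twisted_diagonal P \<psi>" let ?gX = "ghost (S \<times>\<times> S) X"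
  have cT [simp]: "carrier T = P" "\<one>\<^bsub>T\<^esub> = \<one>\<^bsub>S\<^esub>" "mult T = mult S" by (simp_all add: T_def)
  have iT: "inv\<^bsub>T\<^esub> t = inv\<^bsub>S\<^esub> t" if "t \<in> P" for t using S.m_inv_consistent[OF P that] by (simp add: T_def)
  have PT: "subgroup P T"
    by (rule T.subgroupI) (use subgroup.one_closed[OF P] T.m_closed T.inv_closed in auto)
  have "subgroup ?\<Delta> (S \<times>\<times> T)"
    by (rule subgroup_twisted_diagonal[OF S.is_group T.is_group PT]) (use \<psi> in \<open>simp add: T_def\<close>)
  then have \<Delta>: "subgroup (?\<Delta>\<inverse>) (T \<times>\<times> S)" by (rule subgroup_converse[OF S.is_group T.is_group])
  have DS: "D \<subseteq> P \<times> carrier S" using subgroup_DirProdD(1)[OF T.is_group S.is_group D] by simp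
  have card\<Delta>: "card (?\<Delta>\<inverse>) = card P"
    unfolding card_inverse unfolding twisted_diagonal_def by (rule card_image) (auto simp: inj_on_def)
  have fX: "finite_gset (T \<times>\<times> S) (coset_gset (T \<times>\<times> S) (?\<Delta>\<inverse>))" by (rule TS.finite_gset_coset[OF \<Delta>])
  have basic: "basic_biset p S T Q \<chi> \<in> bisets p S T"
    "ghost (T \<times>\<times> S) (basic_biset p S T Q \<chi>) B = of_nat (stab_count (T \<times>\<times> S) (coset_gset (T \<times>\<times> S) (?\<Delta>\<inverse>)) B)" for B
    unfolding transitive_biset_def \<chi> using TS.burnside_class[OF p fX] by auto
  interpret PP: group "S\<lparr>carrier := P\<rparr>" using S.subgroup_imp_group[OF P] .
  interpret \<psi>: group_hom "S\<lparr>carrier := P\<rparr>" S \<psi>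
    using \<psi> by (simp add: group_hom_def group_hom_axioms_def S.is_group PP.is_group)
  have \<psi>1: "\<psi> \<one>\<^bsub>S\<^esub> = \<one>\<^bsub>S\<^esub>" "\<And>u. u \<in> P \<Longrightarrow> \<psi> u \<in> carrier S" using \<psi>.hom_one \<psi>.hom_closed by auto
  have summand: "(\<Sum>A | subgroup A (S \<times>\<times> S). ?gX A * (of_bool (D \<subseteq> conj_set (T \<times>\<times> S) g (?\<Delta>\<inverse>) O A)
      * of_nat (overlap S S T (conj_set (T \<times>\<times> S) g (?\<Delta>\<inverse>)) A) / of_nat (card (carrier S))))
      = marks (S \<times>\<times> S) ?gX (?\<Delta> O D) / of_nat (card (carrier S))"
    if g: "g \<in> carrier (T \<times>\<times> S)" for g
  proof -
    obtain s t where st: "g = (t, s)" "s \<in> carrier S" "t \<in> P" using g by (cases g) auto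
    define w where "w = s \<otimes>\<^bsub>S\<^esub> inv\<^bsub>S\<^esub> (\<psi> t)"
    have w: "w \<in> carrier S" unfolding w_def using st \<psi>1 by simp
    let ?B = "conj_set (T \<times>\<times> S) g (?\<Delta>\<inverse>)"
    have B: "?B = ((\<lambda>v. (w \<otimes>\<^bsub>S\<^esub> \<psi> v \<otimes>\<^bsub>S\<^esub> inv\<^bsub>S\<^esub> w, v)) ` P)\<inverse>"
    proof -
      have "?B = ((\<lambda>u. (s \<otimes>\<^bsub>S\<^esub> \<psi> u \<otimes>\<^bsub>S\<^esub> inv\<^bsub>S\<^esub> s, t \<otimes>\<^bsub>S\<^esub> u \<otimes>\<^bsub>S\<^esub> inv\<^bsub>S\<^esub> t)) ` P)\<inverse>"
      proof -
        have conv: "?\<Delta>\<inverse> = (\<lambda>u. (u, \<psi> u)) ` P" unfolding twisted_diagonal_def by auto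
        have "?B = (\<lambda>u. (t \<otimes>\<^bsub>S\<^esub> u \<otimes>\<^bsub>S\<^esub> inv\<^bsub>S\<^esub> t, s \<otimes>\<^bsub>S\<^esub> \<psi> u \<otimes>\<^bsub>S\<^esub> inv\<^bsub>S\<^esub> s)) ` P"
          unfolding conv conj_set_def image_image st(1)
          by (rule image_cong) (use st in \<open>auto simp: S.is_group T.is_group iT\<close>)
        then show ?thesis by auto
      qed
      then show ?thesis unfolding w_def S.conj_twisted_diagonal[OF P \<psi> st(2,3)] .
    qed
    have ov: "overlap S S T ?B A = 1" if A: "subgroup A (S \<times>\<times> S)" for A
    proof -
      have "{h \<in> carrier S. (\<one>\<^bsub>T\<^esub>, h) \<in> ?B \<and> (h, \<one>\<^bsub>S\<^esub>) \<in> A} = {\<one>\<^bsub>S\<^esub>}"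
        using subgroup_DirProdD(2)[OF S.is_group S.is_group A] w \<psi>1 subgroup.one_closed[OF P]
        unfolding B by (auto simp: image_iff)
      then show ?thesis unfolding overlap_def by simp
    qed
    have sub: "D \<subseteq> ?B O A \<longleftrightarrow> ?B\<inverse> O D \<subseteq> A" for A
    proof
      show "D \<subseteq> ?B O A \<Longrightarrow> ?B\<inverse> O D \<subseteq> A" unfolding B by blast
      have "D \<subseteq> ?B O ?B\<inverse> O D"
      proof (rule subrelI)
        fix v a assume av: "(v, a) \<in> D"
        then have "v \<in> P" using DS by auto
        then have "(v, w \<otimes>\<^bsub>S\<^esub> \<psi> v \<otimes>\<^bsub>S\<^esub> inv\<^bsub>S\<^esub> w) \<in> ?B" unfolding B by blast
        then show "(v, a) \<in> ?B O ?B\<inverse> O D" using av by blast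
      qed
      then show "?B\<inverse> O D \<subseteq> A \<Longrightarrow> D \<subseteq> ?B O A" by blast
    qed
    have cj: "?B\<inverse> O D = conj_set (S \<times>\<times> S) (w, \<one>\<^bsub>S\<^esub>) (?\<Delta> O D)"
    proof -
      have "?B\<inverse> O D = {(w \<otimes>\<^bsub>S\<^esub> \<psi> v \<otimes>\<^bsub>S\<^esub> inv\<^bsub>S\<^esub> w, a) | a v. (v, a) \<in> D}"
        unfolding B using DS by auto
      moreover have "?\<Delta> O D = {(\<psi> v, a) | a v. (v, a) \<in> D}"
        unfolding twisted_diagonal_def using DS by auto
      ultimately show ?thesis unfolding conj_set_def using DS w
        by (auto simp: image_iff S.is_group) (force simp: subset_iff)+
    qed
    have "(\<Sum>A | subgroup A (S \<times>\<times> S). ?gX A * (of_bool (D \<subseteq> ?B O A)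
      * of_nat (overlap S S T ?B A) / of_nat (card (carrier S))))
      = (\<Sum>A | subgroup A (S \<times>\<times> S). ?gX A * of_bool (?B\<inverse> O D \<subseteq> A) / of_nat (card (carrier S)))"
      by (rule sum.cong[OF refl]) (simp add: ov sub)
    also have "\<dots> = marks (S \<times>\<times> S) ?gX (?B\<inverse> O D) / of_nat (card (carrier S))"
      unfolding SS.marks_alt by (simp add: sum_divide_distrib)
    also have "marks (S \<times>\<times> S) ?gX (?B\<inverse> O D) = marks (S \<times>\<times> S) ?gX (?\<Delta> O D)"
      unfolding cj
      by (rule SS.marks_conj[OF SS.integral_ghost[OF p X]]) (use w DS \<psi>1 in \<open>auto simp: twisted_diagonal_def\<close>)
    finally show ?thesis .
  qed
  have "marks (T \<times>\<times> S) (ghost (T \<times>\<times> S) (burnside_comp p S S T (basic_biset p S T Q \<chi>) X)) D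
    = (\<Sum>B | subgroup B (T \<times>\<times> S). of_nat (stab_count (T \<times>\<times> S) (coset_gset (T \<times>\<times> S) (?\<Delta>\<inverse>)) B)
       * (\<Sum>A | subgroup A (S \<times>\<times> S). ?gX A
         * (of_bool (D \<subseteq> B O A) * of_nat (overlap S S T B A) / of_nat (card (carrier S)))))"
    unfolding marks_comp[OF S S T p basic(1) X] basic(2) by (simp add: sum_distrib_left mult.assoc)
  also have "\<dots> = of_nat (card (carrier (T \<times>\<times> S))) / of_nat (card (?\<Delta>\<inverse>))
      * (marks (S \<times>\<times> S) ?gX (?\<Delta> O D) / of_nat (card (carrier S)))"
    by (rule TS.sum_stab_count_coset_const[OF \<Delta>]) (rule summand)
  also have "\<dots> = marks (S \<times>\<times> S) ?gX (?\<Delta> O D)"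
    unfolding card\<Delta> using S.card_carrier_pos S.card_subgroup_pos[OF P] T.card_carrier_pos
    by (simp add: card_cartesian_product T_def)
  finally show ?thesis .
qed

lemma (in finite_group) burnside_eq_iff_marks:
  assumes p: "prime p" and a: "a \<in> burnside p G" and b: "b \<in> burnside p G"
  shows "a = b \<longleftrightarrow> (\<forall>D. subgroup D G \<longrightarrow> marks G (ghost G a) D = marks G (ghost G b) D)"
proof
  assume *: "\<forall>D. subgroup D G \<longrightarrow> marks G (ghost G a) D = marks G (ghost G b) D"
  have "ghost G a = ghost G b"
    by (rule ghost_eq_of_marks) (use * integral_ghost[OF p a] integral_ghost[OF p b] in \<open>auto simp: integral_def\<close>)
  then show "a = b" by (rule ghost_inject[OF p a b])
qed simp

section \<open>Twisted diagonals of a fusion system\<close>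

text \<open>A morphism of the fusion system is identified with its graph. Restriction, composition and
  inversion of morphisms are then subrelations, relational composition and converse, and domains
  and codomains no longer have to be tracked. With the convention \<open>\<Delta>(P, \<phi>) = {(\<phi> u, u)}\<close> the range
  of the graph as a relation is \<open>P\<close> and its domain is \<open>\<phi> P\<close>; as inverses of morphisms are
  morphisms, the distinction does not matter.\<close>

definition fdiag :: "('a, 'm) monoid_scheme \<Rightarrow> 'a hom_sets \<Rightarrow> ('a \<times> 'a) set set" where
  "fdiag S F = {twisted_diagonal P \<phi> | P \<phi>. subgroup P S \<and> \<phi> \<in> F P (carrier S)}"

sublocale fusion_system \<subseteq> finite_group S
  by unfold_locales (rule finite_S)

sublocale fusion_system \<subseteq> SS: finite_group "S \<times>\<times> S"
  by (rule finite_group_DirProd[OF finite_group_axioms finite_group_axioms])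

context fusion_system
begin

abbreviation S2 :: "('a \<times> 'a) monoid" where "S2 \<equiv> S \<times>\<times> S"

abbreviation nS :: rat where "nS \<equiv> of_nat (card (carrier S))"

abbreviation FD :: "('a \<times> 'a) set set" where "FD \<equiv> fdiag S F"

lemma subgroup_carrier: "subgroup (carrier S) S"
  by (rule subgroup_self)

lemma mor:
  assumes P: "subgroup P S" and Q: "subgroup Q S" and \<phi>: "\<phi> \<in> F P Q"
  shows "\<phi> \<in> hom (S\<lparr>carrier := P\<rparr>) S" "inj_on \<phi> P" "\<phi> ` P \<subseteq> Q" "\<phi> \<in> extensional P"
    "subgroup (\<phi> ` P) S"
proof -
  have m: "\<phi> \<in> mon (S\<lparr>carrier := P\<rparr>) (S\<lparr>carrier := Q\<rparr>) \<inter> extensional P" by (rule morphism[OF assms])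
  then show "inj_on \<phi> P" "\<phi> ` P \<subseteq> Q" "\<phi> \<in> extensional P" by (auto simp: mon_def hom_def)
  show h: "\<phi> \<in> hom (S\<lparr>carrier := P\<rparr>) S"
    using m subgroup.subset[OF Q] by (auto simp: mon_def hom_def)
  interpret PP: group "S\<lparr>carrier := P\<rparr>" using subgroup_imp_group[OF P] .
  interpret \<phi>: group_hom "S\<lparr>carrier := P\<rparr>" S \<phi>
    using h by (simp add: group_hom_def group_hom_axioms_def is_group PP.is_group)
  show "subgroup (\<phi> ` P) S" using \<phi>.img_is_subgroup by simp
qed

lemma mor_incl:
  assumes "subgroup P S" "subgroup Q S" "P \<subseteq> Q"
  shows "(\<lambda>u\<in>P. u) \<in> F P Q"
proof -
  have "conj_map S \<one> P = (\<lambda>u\<in>P. u)"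
    unfolding conj_map_def using subgroup.mem_carrier[OF assms(1)] by (auto simp: restrict_def)
  then show ?thesis using conj_closed[OF assms(1,2) one_closed] assms(3) by auto
qed

lemma mor_restrict:
  assumes P: "subgroup P S" "subgroup Q S" "\<phi> \<in> F P Q" and P': "subgroup P' S" "P' \<subseteq> P"
  shows "restrict \<phi> P' \<in> F P' Q"
proof -
  have "compose P' \<phi> (\<lambda>u\<in>P'. u) = restrict \<phi> P'" by (auto simp: compose_def restrict_def)
  then show ?thesis using compose_closed[OF P'(1) P(1,2) mor_incl[OF P'(1) P(1) P'(2)] P(3)] by simp
qed

lemma mor_codomain:
  assumes P: "subgroup P S" "subgroup Q S" "\<phi> \<in> F P Q" and Q': "subgroup Q' S" "\<phi> ` P \<subseteq> Q'"
  shows "\<phi> \<in> F P Q'"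
proof -
  note m = mor[OF P]
  have "compose P (\<lambda>u\<in>\<phi> ` P. u) \<phi> = \<phi>"
    using m(4) by (auto simp: compose_def restrict_def extensional_def)
  then show ?thesis
    using compose_closed[OF P(1) m(5) Q'(1) onto_image[OF P] mor_incl[OF m(5) Q']] by simp
qed

lemma fdI: "subgroup P S \<Longrightarrow> \<phi> \<in> F P (carrier S) \<Longrightarrow> twisted_diagonal P \<phi> \<in> FD"
  unfolding fdiag_def by auto

lemma fdI':
  assumes "subgroup P S" "subgroup Q S" "\<phi> \<in> F P Q"
  shows "twisted_diagonal P \<phi> \<in> FD"
  by (rule fdI[OF assms(1) mor_codomain[OF assms subgroup_carrier]])
     (use mor(3)[OF assms] subgroup.subset[OF assms(2)] in auto)

lemma fdE:
  assumes "D \<in> FD"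
  obtains P \<phi> where "subgroup P S" "\<phi> \<in> F P (carrier S)" "D = twisted_diagonal P \<phi>"
  using assms unfolding fdiag_def by auto

lemma fd_props:
  assumes "D \<in> FD"
  shows "subgroup D S2" "subgroup (Domain D) S" "subgroup (Range D) S"
    "\<And>a b b'. (a, b) \<in> D \<Longrightarrow> (a, b') \<in> D \<Longrightarrow> b = b'"
    "\<And>a a' b. (a, b) \<in> D \<Longrightarrow> (a', b) \<in> D \<Longrightarrow> a = a'"
    "card (Domain D) = card D" "card (Range D) = card D" "D \<subseteq> carrier S \<times> carrier S"
proof -
  obtain P \<phi> where P: "subgroup P S" and \<phi>: "\<phi> \<in> F P (carrier S)" and D: "D = twisted_diagonal P \<phi>"
    using fdE[OF assms] .
  note m = mor[OF P subgroup_carrier \<phi>]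
  show "subgroup D S2" unfolding D by (rule subgroup_twisted_diagonal[OF is_group is_group P m(1)])
  then show "D \<subseteq> carrier S \<times> carrier S" using SS.subgroupE(1) by auto
  show "subgroup (Domain D) S" "subgroup (Range D) S"
    unfolding D Domain_twisted_diagonal Range_twisted_diagonal by (rule m P)+
  show "b = b'" if "(a, b) \<in> D" "(a, b') \<in> D" for a b b'
    using that m(2) unfolding D twisted_diagonal_def by (auto dest: inj_onD)
  show "a = a'" if "(a, b) \<in> D" "(a', b) \<in> D" for a a' b
    using that unfolding D twisted_diagonal_def by auto
  have "card D = card P" unfolding D twisted_diagonal_def by (rule card_image) (auto simp: inj_on_def)
  then show "card (Domain D) = card D" "card (Range D) = card D"
    unfolding D Domain_twisted_diagonal Range_twisted_diagonal using m(2) by (simp_all add: card_image)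
qed

lemma fd_subset:
  assumes "D \<in> FD" "subgroup E S2" "E \<subseteq> D"
  shows "E \<in> FD"
proof -
  obtain P \<phi> where P: "subgroup P S" and \<phi>: "\<phi> \<in> F P (carrier S)" and D: "D = twisted_diagonal P \<phi>"
    using fdE[OF assms(1)] .
  have R: "subgroup (Range E) S" by (rule subgroup_Domain_Range(2)[OF is_group is_group assms(2)])
  have RP: "Range E \<subseteq> P" using assms(3) unfolding D twisted_diagonal_def by auto
  have "E = twisted_diagonal (Range E) (restrict \<phi> (Range E))"
    using assms(3) unfolding D twisted_diagonal_def by (auto simp: image_iff Range_iff)
  then show ?thesis
    using fdI[OF R mor_restrict[OF P subgroup_carrier \<phi> R RP]] by simp
qed

lemma fd_converse:
  assumes "D \<in> FD"
  shows "D\<inverse> \<in> FD"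
proof -
  obtain P \<phi> where P: "subgroup P S" and \<phi>: "\<phi> \<in> F P (carrier S)" and D: "D = twisted_diagonal P \<phi>"
    using fdE[OF assms(1)] .
  note m = mor[OF P subgroup_carrier \<phi>]
  have "D\<inverse> = twisted_diagonal (\<phi> ` P) (inverse_map P \<phi>)"
    unfolding D twisted_diagonal_def inverse_map_def using m(2) by (auto simp: image_iff)
  then show ?thesis using fdI'[OF m(5) P inverse_closed[OF P subgroup_carrier \<phi>]] by simp
qed

lemma fd_relcomp:
  assumes "D \<in> FD" "E \<in> FD"
  shows "D O E \<in> FD"
proof -
  obtain P \<phi> where P: "subgroup P S" and \<phi>: "\<phi> \<in> F P (carrier S)" and D: "D = twisted_diagonal P \<phi>"
    using fdE[OF assms(1)] .
  obtain Q \<psi> where Q: "subgroup Q S" and \<psi>: "\<psi> \<in> F Q (carrier S)" and E: "E = twisted_diagonal Q \<psi>"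
    using fdE[OF assms(2)] .
  have R: "subgroup (Range (D O E)) S"
    by (rule subgroup_Domain_Range(2)[OF is_group is_group
        subgroup_relcomp[OF is_group is_group is_group fd_props(1)[OF assms(1)] fd_props(1)[OF assms(2)]]])
  have Re: "Range (D O E) = {u \<in> Q. \<psi> u \<in> P}" unfolding D E twisted_diagonal_def by auto
  let ?R = "Range (D O E)"
  have r1: "restrict \<psi> ?R \<in> F ?R (carrier S)"
    by (rule mor_restrict[OF Q subgroup_carrier \<psi> R]) (auto simp: Re)
  have r2: "restrict \<psi> ?R \<in> F ?R P"
    by (rule mor_codomain[OF R subgroup_carrier r1 P]) (auto simp: Re)
  have "D O E = twisted_diagonal ?R (compose ?R \<phi> (restrict \<psi> ?R))"
    unfolding Re unfolding D E twisted_diagonal_def compose_def by (auto simp: image_iff)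
  then show ?thesis using fdI[OF R compose_closed[OF R P subgroup_carrier r2 \<phi>]] by simp
qed

lemma fd_Id_on: "subgroup P S \<Longrightarrow> Id_on P \<in> FD"
proof -
  assume P: "subgroup P S"
  have "Id_on P = twisted_diagonal P (\<lambda>u\<in>P. u)" by (auto simp: twisted_diagonal_def)
  then show ?thesis using fdI[OF P mor_incl[OF P subgroup_carrier subgroup.subset[OF P]]] by simp
qed

lemma fd_conj_graph:
  assumes P: "subgroup P S" and x: "x \<in> carrier S"
  shows "(\<lambda>u. (x \<otimes> u \<otimes> inv x, u)) ` P \<in> FD"
proof -
  have "conj_map S x P \<in> F P (carrier S)"
    by (rule conj_closed[OF P subgroup_carrier x])
       (use x subgroup.mem_carrier[OF P] in \<open>auto simp: conj_map_def\<close>)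
  from fdI[OF P this] show ?thesis
    by (simp add: twisted_diagonal_def conj_map_def cong: image_cong_simp)
qed

lemma fd_conj_set:
  assumes D: "D \<in> FD" and g: "g \<in> carrier S2"
  shows "conj_set S2 g D \<in> FD"
proof -
  obtain s t where st: "g = (s, t)" "s \<in> carrier S" "t \<in> carrier S" using g by (cases g) auto
  let ?C = "\<lambda>x. (\<lambda>u. (x \<otimes> u \<otimes> inv x, u)) ` carrier S"
  have "conj_set S2 g D = ?C s O D O (?C t)\<inverse>"
  proof -
    have "conj_set S2 g D = (\<lambda>(a, b). (s \<otimes> a \<otimes> inv s, t \<otimes> b \<otimes> inv t)) ` D"
      unfolding conj_set_def st(1)
      by (rule image_cong) (use st(2,3) fd_props(8)[OF D] in \<open>auto simp: is_group\<close>)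
    then show ?thesis using fd_props(8)[OF D] by (auto simp: image_iff) blast
  qed
  then show ?thesis
    using fd_relcomp fd_converse fd_conj_graph[OF subgroup_carrier] D st by simp
qed

lemma fd_conjugate_iff:
  assumes D: "subgroup D S2" and g: "g \<in> carrier S2"
  shows "conj_set S2 g D \<in> FD \<longleftrightarrow> D \<in> FD"
  using fd_conj_set[OF _ g] fd_conj_set[OF _ SS.inv_closed[OF g]]
    SS.conj_set_inv(1)[OF g SS.subgroupE(1)[OF D]] by metis

lemma fd_eq_of_Domain:
  assumes "D \<in> FD" "E \<in> FD" "E \<subseteq> D" "Domain D \<subseteq> Domain E"
  shows "E = D"
proof
  show "D \<subseteq> E"
  proof (rule subrelI)
    fix a b assume ab: "(a, b) \<in> D"
    then obtain b' where "(a, b') \<in> E" using assms(4) by blast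
    then show "(a, b) \<in> E" using fd_props(4)[OF assms(1) ab] assms(3) by blast
  qed
qed (rule assms(3))

lemma relcomp_converse_fd:
  assumes "E \<in> FD"
  shows "E O E\<inverse> = Id_on (Domain E)" "E\<inverse> O E = Id_on (Range E)"
  using fd_props(4,5)[OF assms] by (auto simp: Id_on_def)

lemma relcomp_Id_on_eq: "Range D \<subseteq> A \<Longrightarrow> D O Id_on A = D"
  and Id_on_relcomp_eq: "Domain D \<subseteq> A \<Longrightarrow> Id_on A O D = D"
  by (auto simp: Id_on_def relcomp_unfold)

lemma Domain_relcomp_sub: "Range D \<subseteq> Domain E \<Longrightarrow> Domain (D O E) = Domain D"
  and Range_relcomp_sub: "Domain E \<subseteq> Range D \<Longrightarrow> Range (D O E) = Range E"
  by blast+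

text \<open>Morphisms to \<open>S\<close> are enough to detect conjugacy, since a morphism is an isomorphism onto its
  image.\<close>

lemma fusion_conj_iff:
  assumes P: "subgroup P S" and Q: "subgroup Q S"
  shows "fusion_conj F P Q \<longleftrightarrow> (\<exists>R\<in>FD. Domain R = Q \<and> Range R = P)"
proof
  assume "fusion_conj F P Q"
  then obtain \<phi> \<psi> where \<phi>: "\<phi> \<in> F P Q" and \<psi>: "\<psi> \<in> F Q P"
    and c: "compose Q \<phi> \<psi> = (\<lambda>x\<in>Q. x)" unfolding fusion_conj_def by auto
  have "\<phi> ` P = Q"
  proof
    show "\<phi> ` P \<subseteq> Q" by (rule mor(3)[OF P Q \<phi>])
    show "Q \<subseteq> \<phi> ` P"
    proof
      fix x assume x: "x \<in> Q"
      have "x = \<phi> (\<psi> x)" using fun_cong[OF c, of x] x by (simp add: compose_def)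
      moreover have "\<psi> x \<in> P" using mor(3)[OF Q P \<psi>] x by auto
      ultimately show "x \<in> \<phi> ` P" by blast
    qed
  qed
  then show "\<exists>R\<in>FD. Domain R = Q \<and> Range R = P"
    using fdI'[OF P Q \<phi>] Domain_twisted_diagonal[of P \<phi>] Range_twisted_diagonal[of P \<phi>] by auto
next
  assume "\<exists>R\<in>FD. Domain R = Q \<and> Range R = P"
  then obtain R P' \<phi> where R: "Domain R = Q" "Range R = P"
    and \<phi>: "\<phi> \<in> F P' (carrier S)" "R = twisted_diagonal P' \<phi>"
    unfolding fdiag_def by auto
  then have e: "P' = P" "\<phi> ` P = Q" using Domain_twisted_diagonal Range_twisted_diagonal by metis+
  note m = mor[OF P subgroup_carrier \<phi>(1)[unfolded e(1)]]
  have "\<phi> \<in> F P Q" using onto_image[OF P subgroup_carrier] \<phi>(1) e by auto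
  moreover have "inverse_map P \<phi> \<in> F Q P"
    using inverse_closed[OF P subgroup_carrier] \<phi>(1) e by auto
  moreover have "compose P (inverse_map P \<phi>) \<phi> = (\<lambda>x\<in>P. x)"
    using m(2) by (auto simp: compose_def inverse_map_def restrict_def)
  moreover have "compose Q \<phi> (inverse_map P \<phi>) = (\<lambda>x\<in>Q. x)"
    using e(2) by (auto simp: compose_def inverse_map_def restrict_def f_inv_into_f)
  ultimately show "fusion_conj F P Q" unfolding fusion_conj_def by blast
qed

lemma fusion_class_eq:
  "subgroup P S \<Longrightarrow> fusion_class S F P = {Domain R | R. R \<in> FD \<and> Range R = P}"
  unfolding fusion_class_def using fusion_conj_iff[of P] fd_props(2) by auto

lemma fusion_class_cong:
  assumes "R \<in> FD"
  shows "fusion_class S F (Domain R) = fusion_class S F (Range R)"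
proof -
  have *: "fusion_class S F (Domain R) \<subseteq> fusion_class S F (Range R)" if R: "R \<in> FD" for R
  proof
    fix Q assume "Q \<in> fusion_class S F (Domain R)"
    then obtain E where E: "E \<in> FD" "Range E = Domain R" "Q = Domain E"
      using fusion_class_eq[OF fd_props(2)[OF R]] by auto
    then have "E O R \<in> FD" "Range (E O R) = Range R" "Q = Domain (E O R)"
      using fd_relcomp R Domain_relcomp_sub[of E R] Range_relcomp_sub[of R E] by auto
    then show "Q \<in> fusion_class S F (Range R)"
      using fusion_class_eq[OF fd_props(3)[OF R]] by auto
  qed
  show ?thesis using *[OF assms] *[OF fd_converse[OF assms]] by auto
qed


section \<open>Generated and stable elements\<close>

lemma fd_stab_count:
  assumes K: "K \<in> FD" and D: "D \<notin> FD"
  shows "stab_count S2 (coset_gset S2 K) D = 0"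
proof -
  have "\<not> conjugate S2 K D" using D fd_conj_set[OF K] by (auto simp: conjugate_def)
  then show ?thesis using SS.stab_count_coset[OF fd_props(1)[OF K], of D] by simp
qed

text \<open>The set of graphs is closed under conjugation in \<open>S \<times> S\<close>, so it contains the stabilizers of
  all points of \<open>[P, \<phi>]\<close>. Conversely, an element whose ghost is supported on graphs is the sum of
  the transitive sets over its coordinates, which are all of the form \<open>[P, \<phi>]\<close>.\<close>

lemma generated_iff:
  assumes X: "X \<in> bisets p S S"
  shows "biset_generated p S F X \<longleftrightarrow> (\<forall>D. D \<notin> FD \<longrightarrow> ghost S2 X D = 0)"
proof
  let ?I = "{(P, \<phi>). subgroup P S \<and> \<phi> \<in> F P (carrier S)}"
  let ?s = "\<lambda>K c. Poly_Mapping.single (iso_class S2 (coset_gset S2 K)) c"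
  {
    assume "biset_generated p S F X"
    then obtain c where c: "\<And>P \<phi>. c P \<phi> \<in> localized_int p"
      and Xc: "X = burnside_eq p S2 `` {\<Sum>(P, \<phi>)\<in>?I. ?s (twisted_diagonal P \<phi>) (c P \<phi>)}"
      unfolding biset_generated_def transitive_biset_def by auto
    have I: "twisted_diagonal P \<phi> \<in> FD" if "(P, \<phi>) \<in> ?I" for P \<phi> using fdI that by auto
    have fs: "(\<Sum>(P, \<phi>)\<in>?I. ?s (twisted_diagonal P \<phi>) (c P \<phi>)) \<in> formal_sums p S2"
    proof (rule formal_sums_sum[OF prime_p])
      fix i assume "i \<in> ?I"
      then obtain P \<phi> where i: "i = (P, \<phi>)" "(P, \<phi>) \<in> ?I" by (cases i) auto
      show "(case i of (P, \<phi>) \<Rightarrow> ?s (twisted_diagonal P \<phi>) (c P \<phi>)) \<in> formal_sums p S2"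
        unfolding i(1) prod.case
        by (rule formal_sums_single[OF prime_p SS.iso_class_in[OF SS.finite_gset_coset[OF fd_props(1)[OF I[OF i(2)]]]] c])
    qed
    show "\<forall>D. D \<notin> FD \<longrightarrow> ghost S2 X D = 0"
    proof (intro allI impI)
      fix D assume D: "D \<notin> FD"
      have "ghost S2 X D = (\<Sum>(P, \<phi>)\<in>?I. ghost_sum S2 (?s (twisted_diagonal P \<phi>) (c P \<phi>)) D)"
        unfolding Xc SS.ghost_burnside_eq[OF prime_p fs]
        by (simp add: ghost_sum_def lin_sum case_prod_unfold)
      also have "\<dots> = 0"
      proof (rule sum.neutral, rule ballI)
        fix i assume "i \<in> ?I"
        then obtain P \<phi> where i: "i = (P, \<phi>)" "(P, \<phi>) \<in> ?I" by (cases i) auto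
        show "(case i of (P, \<phi>) \<Rightarrow> ghost_sum S2 (?s (twisted_diagonal P \<phi>) (c P \<phi>)) D) = 0"
          unfolding i(1) prod.case
            SS.ghost_sum_single[OF SS.finite_gset_coset[OF fd_props(1)[OF I[OF i(2)]]]]
          by (simp add: fd_stab_count[OF I[OF i(2)] D])
      qed
      finally show "ghost S2 X D = 0" .
    qed
  }
  assume z: "\<forall>D. D \<notin> FD \<longrightarrow> ghost S2 X D = 0"
  let ?\<tau> = "ghost S2 X"
  note \<tau> = SS.integral_ghost[OF prime_p X]
  define c where "c P \<phi> = (if (P, \<phi>) \<in> ?I then coord S2 ?\<tau> (twisted_diagonal P \<phi>) else 0)" for P \<phi>
  have c: "c P \<phi> \<in> localized_int p" for P \<phi>
    unfolding c_def using SS.coord_in_localized_int[OF prime_p \<tau> fd_props(1)[OF fdI]] localized_int_0[OF prime_p]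
    by auto
  \<comment> \<open>As morphisms are extensional, each graph occurs once among the pairs \<open>(P, \<phi>)\<close>, so its
    coordinate can be used as the coefficient.\<close>
  have inj: "inj_on (\<lambda>(P, \<phi>). twisted_diagonal P \<phi>) ?I"
  proof (rule inj_onI, clarify)
    fix P \<phi> Q \<psi> assume P: "subgroup P S" "\<phi> \<in> F P (carrier S)" and Q: "subgroup Q S" "\<psi> \<in> F Q (carrier S)"
      and e: "twisted_diagonal P \<phi> = twisted_diagonal Q \<psi>"
    have PQ: "P = Q" using e Range_twisted_diagonal by metis
    have "\<phi> u = \<psi> u" for u
    proof (cases "u \<in> P")
      case True
      then have "(\<phi> u, u) \<in> twisted_diagonal Q \<psi>" unfolding e[symmetric] by (auto simp: twisted_diagonal_def)
      then show ?thesis by (auto simp: twisted_diagonal_def)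
    next
      case False
      then show ?thesis
        using mor(4)[OF P(1) subgroup_carrier P(2)] mor(4)[OF Q(1) subgroup_carrier Q(2)] PQ
        by (auto simp: extensional_def)
    qed
    then show "P = Q \<and> \<phi> = \<psi>" using PQ by auto
  qed
  have "(\<Sum>(P, \<phi>)\<in>?I. ?s (twisted_diagonal P \<phi>) (c P \<phi>))
     = (\<Sum>(P, \<phi>)\<in>?I. ?s (twisted_diagonal P \<phi>) (coord S2 ?\<tau> (twisted_diagonal P \<phi>)))"
    by (rule sum.cong[OF refl]) (auto simp: c_def)
  also have "\<dots> = (\<Sum>K\<in>(\<lambda>(P, \<phi>). twisted_diagonal P \<phi>) ` ?I. ?s K (coord S2 ?\<tau> K))"
    unfolding sum.reindex[OF inj] by (simp add: case_prod_unfold)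
  also have "(\<lambda>(P, \<phi>). twisted_diagonal P \<phi>) ` ?I = FD" unfolding fdiag_def by auto
  also have "(\<Sum>K\<in>FD. ?s K (coord S2 ?\<tau> K)) = orbit_sum S2 ?\<tau>"
    unfolding orbit_sum_def
    by (rule sum.mono_neutral_left[OF SS.finite_subgroups])
       (use fd_props(1) z in \<open>auto simp: coord_def\<close>)
  finally have e: "(\<Sum>(P, \<phi>)\<in>?I. ?s (twisted_diagonal P \<phi>) (c P \<phi>)) = orbit_sum S2 ?\<tau>" .
  have "X = burnside_eq p S2 `` {orbit_sum S2 ?\<tau>}"
    by (rule SS.ghost_inject[OF prime_p X]) (simp_all add: SS.burnside_of_ghost[OF prime_p \<tau>])
  then show "biset_generated p S F X"
    unfolding biset_generated_def transitive_biset_def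
    by (intro exI[of _ c] conjI allI c) (simp only: e)
qed

abbreviation bimark :: "('a \<times> 'a) burnside \<Rightarrow> ('a \<times> 'a) set \<Rightarrow> rat" where
  "bimark X \<equiv> marks S2 (ghost S2 X)"

lemma sub_right: "subgroup P S \<Longrightarrow> subgroup D (S \<times>\<times> S\<lparr>carrier := P\<rparr>) \<Longrightarrow> subgroup D S2"
  using SS.incl_subgroup[OF DirProd_subgroups[OF is_group subgroup_carrier is_group]]
  by (simp add: DirProd_restrict_carrier)

lemma sub_left: "subgroup P S \<Longrightarrow> subgroup D (S\<lparr>carrier := P\<rparr> \<times>\<times> S) \<Longrightarrow> subgroup D S2"
  using SS.incl_subgroup[OF DirProd_subgroups[OF is_group _ is_group subgroup_carrier]]
  by (simp add: DirProd_restrict_carrier)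

text \<open>Both conditions compare \<open>X\<close> with its restrictions along \<open>\<phi>\<close> and along the inclusion; they are
  read off marks, which decide equality.\<close>

lemma stable_iff:
  assumes X: "X \<in> bisets p S S"
  shows "biset_stable p S F X \<longleftrightarrow> (\<forall>P \<phi>. subgroup P S \<and> \<phi> \<in> F P (carrier S) \<longrightarrow>
     (\<forall>D. subgroup D (S \<times>\<times> S\<lparr>carrier := P\<rparr>) \<longrightarrow> bimark X (D O (twisted_diagonal P \<phi>)\<inverse>) = bimark X D) \<and>
     (\<forall>D. subgroup D (S\<lparr>carrier := P\<rparr> \<times>\<times> S) \<longrightarrow> bimark X (twisted_diagonal P \<phi> O D) = bimark X D))"
  unfolding biset_stable_def Let_def
proof (intro all_cong1 imp_cong[OF refl] conj_cong)
  fix P \<phi> assume "subgroup P S \<and> \<phi> \<in> F P (carrier S)"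
  then have P: "subgroup P S" and \<phi>: "\<phi> \<in> F P (carrier S)" by auto
  let ?T = "S\<lparr>carrier := P\<rparr>"
  have T: "finite_group ?T" by (rule finite_group_subgroup[OF P])
  interpret ST: finite_group "S \<times>\<times> ?T" by (rule finite_group_DirProd[OF finite_group_axioms T])
  interpret TS: finite_group "?T \<times>\<times> S" by (rule finite_group_DirProd[OF T finite_group_axioms])
  note m = mor[OF P subgroup_carrier \<phi>]
  have id: "id \<in> hom ?T S" "inj_on id P" using subgroup.mem_carrier[OF P] by (auto simp: hom_def)
  have Did: "twisted_diagonal P id = Id_on P" by (auto simp: twisted_diagonal_def)
  have PT: "subgroup P ?T"
    using subgroup.subgroup_is_group[OF P is_group] group.subgroup_self by fastforce
  have bas: "basic_biset p ?T S P \<psi> \<in> bisets p ?T S" if "\<psi> \<in> hom ?T S" for \<psi>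
    unfolding transitive_biset_def
    by (rule ST.burnside_class(1)[OF prime_p ST.finite_gset_coset[OF
          subgroup_twisted_diagonal[OF is_group finite_group.axioms(1)[OF T] PT]]]) (use that in simp)
  note F = finite_group_axioms
  have "burnside_comp p ?T S S X (basic_biset p ?T S P \<phi>) = burnside_comp p ?T S S X (basic_biset p ?T S P id)
     \<longleftrightarrow> (\<forall>D. subgroup D (S \<times>\<times> ?T) \<longrightarrow>
      marks (S \<times>\<times> ?T) (ghost (S \<times>\<times> ?T) (burnside_comp p ?T S S X (basic_biset p ?T S P \<phi>))) D
       = marks (S \<times>\<times> ?T) (ghost (S \<times>\<times> ?T) (burnside_comp p ?T S S X (basic_biset p ?T S P id))) D)"
    by (rule ST.burnside_eq_iff_marks[OF prime_p burnside_comp(1)[OF T F F prime_p X bas[OF m(1)]]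
       burnside_comp(1)[OF T F F prime_p X bas[OF id(1)]]])
  also have "\<dots> \<longleftrightarrow> (\<forall>D. subgroup D (S \<times>\<times> ?T) \<longrightarrow> bimark X (D O (twisted_diagonal P \<phi>)\<inverse>) = bimark X D)"
  proof (intro all_cong1 imp_cong[OF refl])
    fix D assume D: "subgroup D (S \<times>\<times> ?T)"
    have "D O (Id_on P)\<inverse> = D"
      using subgroup_DirProdD(1)[OF is_group finite_group.axioms(1)[OF T] D] by auto
    then show "(marks (S \<times>\<times> ?T) (ghost (S \<times>\<times> ?T) (burnside_comp p ?T S S X (basic_biset p ?T S P \<phi>))) D
       = marks (S \<times>\<times> ?T) (ghost (S \<times>\<times> ?T) (burnside_comp p ?T S S X (basic_biset p ?T S P id))) D)
       \<longleftrightarrow> bimark X (D O (twisted_diagonal P \<phi>)\<inverse>) = bimark X D"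
      using marks_comp_twisted_right[OF finite_group_axioms prime_p X P m(1,2) D]
        marks_comp_twisted_right[OF finite_group_axioms prime_p X P id D] by (simp add: Did)
  qed
  finally show "burnside_comp p ?T S S X (basic_biset p ?T S P \<phi>) = burnside_comp p ?T S S X (basic_biset p ?T S P id)
     \<longleftrightarrow> (\<forall>D. subgroup D (S \<times>\<times> ?T) \<longrightarrow> bimark X (D O (twisted_diagonal P \<phi>)\<inverse>) = bimark X D)" .
  have inv: "twisted_diagonal (\<phi> ` P) (inverse_map P \<phi>) = (twisted_diagonal P \<phi>)\<inverse>"
    unfolding twisted_diagonal_def inverse_map_def using m(2) by (auto simp: image_iff)
  have Did': "twisted_diagonal P id = (twisted_diagonal P id)\<inverse>" unfolding Did by simp
  have bas': "basic_biset p S ?T Q \<chi> \<in> bisets p S ?T"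
    if "twisted_diagonal Q \<chi> = (twisted_diagonal P \<psi>)\<inverse>" "\<psi> \<in> hom ?T S" for Q \<chi> \<psi>
    unfolding transitive_biset_def that(1)
    by (rule TS.burnside_class(1)[OF prime_p TS.finite_gset_coset[OF subgroup_converse[OF is_group finite_group.axioms(1)[OF T]
          subgroup_twisted_diagonal[OF is_group finite_group.axioms(1)[OF T] PT]]]]) (use that in simp)
  note b1 = bas'[OF inv m(1)] and b2 = bas'[OF Did' id(1)]
  have "burnside_comp p S S ?T (basic_biset p S ?T (\<phi> ` P) (inverse_map P \<phi>)) X = burnside_comp p S S ?T (basic_biset p S ?T P id) X
     \<longleftrightarrow> (\<forall>D. subgroup D (?T \<times>\<times> S) \<longrightarrow>
      marks (?T \<times>\<times> S) (ghost (?T \<times>\<times> S) (burnside_comp p S S ?T (basic_biset p S ?T (\<phi> ` P) (inverse_map P \<phi>)) X)) D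
       = marks (?T \<times>\<times> S) (ghost (?T \<times>\<times> S) (burnside_comp p S S ?T (basic_biset p S ?T P id) X)) D)"
    by (rule TS.burnside_eq_iff_marks[OF prime_p burnside_comp(1)[OF F F T prime_p b1 X]
       burnside_comp(1)[OF F F T prime_p b2 X]])
  also have "\<dots> \<longleftrightarrow> (\<forall>D. subgroup D (?T \<times>\<times> S) \<longrightarrow> bimark X (twisted_diagonal P \<phi> O D) = bimark X D)"
  proof (intro all_cong1 imp_cong[OF refl])
    fix D assume D: "subgroup D (?T \<times>\<times> S)"
    have "Id_on P O D = D"
      using subgroup_DirProdD(1)[OF finite_group.axioms(1)[OF T] is_group D] by auto
    then show "(marks (?T \<times>\<times> S) (ghost (?T \<times>\<times> S) (burnside_comp p S S ?T (basic_biset p S ?T (\<phi> ` P) (inverse_map P \<phi>)) X)) D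
       = marks (?T \<times>\<times> S) (ghost (?T \<times>\<times> S) (burnside_comp p S S ?T (basic_biset p S ?T P id) X)) D)
       \<longleftrightarrow> bimark X (twisted_diagonal P \<phi> O D) = bimark X D"
      using marks_comp_twisted_left[OF finite_group_axioms prime_p X P m(1,2) inv D]
        marks_comp_twisted_left[OF finite_group_axioms prime_p X P id Did' D] by (simp add: Did)
  qed
  finally show "burnside_comp p S S ?T (basic_biset p S ?T (\<phi> ` P) (inverse_map P \<phi>)) X = burnside_comp p S S ?T (basic_biset p S ?T P id) X
     \<longleftrightarrow> (\<forall>D. subgroup D (?T \<times>\<times> S) \<longrightarrow> bimark X (twisted_diagonal P \<phi> O D) = bimark X D)" .
qed

definition generated_ghost :: "(('a \<times> 'a) set \<Rightarrow> rat) \<Rightarrow> bool" where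
  "generated_ghost \<tau> \<longleftrightarrow> (\<forall>D. D \<notin> FD \<longrightarrow> \<tau> D = 0)"

text \<open>For a ghost supported on graphs, stability of the left (right) action only compares marks at
  graphs, and it amounts to forgetting everything about a graph but its range (domain): replacing
  the map to the left by the identity is composition with the converse graph on the left.\<close>

definition left_stable :: "(('a \<times> 'a) set \<Rightarrow> rat) \<Rightarrow> bool" where
  "left_stable \<tau> \<longleftrightarrow> (\<forall>D\<in>FD. marks S2 \<tau> D = marks S2 \<tau> (Id_on (Range D)))"

definition right_stable :: "(('a \<times> 'a) set \<Rightarrow> rat) \<Rightarrow> bool" where
  "right_stable \<tau> \<longleftrightarrow> (\<forall>D\<in>FD. marks S2 \<tau> D = marks S2 \<tau> (Id_on (Domain D)))"

text \<open>A subgroup above a non-graph is not a graph.\<close>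

lemma marks_not_fd:
  assumes "\<forall>D. D \<notin> FD \<longrightarrow> \<tau> D = 0" "subgroup D S2" "D \<notin> FD"
  shows "marks S2 \<tau> D = 0"
  by (rule SS.marks_eq_0) (use assms fd_subset in blast)

text \<open>If \<open>X\<close> is stable, composing a graph with its converse turns it into the identity of its range
  or domain. Conversely, translating \<open>D\<close> by a graph on one side changes neither its range or domain
  on the other side nor the property of being a graph, and off the graphs all marks vanish.\<close>

lemma char_iff:
  "X \<in> carrier (char_ring p S F) \<longleftrightarrow> X \<in> bisets p S S \<and> generated_ghost (ghost S2 X) \<and>
     left_stable (ghost S2 X) \<and> right_stable (ghost S2 X)"
proof (cases "X \<in> bisets p S S \<and> (\<forall>D. D \<notin> FD \<longrightarrow> ghost S2 X D = 0)")
  case False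
  then show ?thesis using generated_iff[of X] by (auto simp: char_ring_def generated_ghost_def)
next
  case True
  then have X: "X \<in> bisets p S S" and z: "\<forall>D. D \<notin> FD \<longrightarrow> ghost S2 X D = 0" by auto
  have "biset_stable p S F X \<longleftrightarrow> (\<forall>D\<in>FD. bimark X D = bimark X (Id_on (Domain D)) \<and> bimark X D = bimark X (Id_on (Range D)))"
  proof
    assume "biset_stable p S F X"
    then have r: "\<And>P \<phi> D. subgroup P S \<Longrightarrow> \<phi> \<in> F P (carrier S) \<Longrightarrow> subgroup D (S \<times>\<times> S\<lparr>carrier := P\<rparr>) \<Longrightarrow>
        bimark X (D O (twisted_diagonal P \<phi>)\<inverse>) = bimark X D"
      and l: "\<And>P \<phi> D. subgroup P S \<Longrightarrow> \<phi> \<in> F P (carrier S) \<Longrightarrow> subgroup D (S\<lparr>carrier := P\<rparr> \<times>\<times> S) \<Longrightarrow>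
        bimark X (twisted_diagonal P \<phi> O D) = bimark X D"
      using stable_iff[OF X] by blast+
    show "\<forall>D\<in>FD. bimark X D = bimark X (Id_on (Domain D)) \<and> bimark X D = bimark X (Id_on (Range D))"
    proof
      fix D assume D: "D \<in> FD"
      obtain P \<phi> where P: "subgroup P S" and \<phi>: "\<phi> \<in> F P (carrier S)" and D': "D = twisted_diagonal P \<phi>"
        using fdE[OF D] .
      have RD: "Range D = P" unfolding D' by (rule Range_twisted_diagonal)
      have sD: "subgroup D (S \<times>\<times> S\<lparr>carrier := P\<rparr>)"
        unfolding DirProd_restrict_carrier
        by (rule SS.subgroup_incl[OF fd_props(1)[OF D]])
           (use RD fd_props(8)[OF D] DirProd_subgroups[OF is_group subgroup_carrier is_group P] in auto)
      have sI: "subgroup (Id_on P) (S\<lparr>carrier := P\<rparr> \<times>\<times> S)"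
        unfolding DirProd_restrict_carrier
        by (rule SS.subgroup_incl[OF subgroup_Id_on[OF is_group P]])
           (use subgroup.subset[OF P] DirProd_subgroups[OF is_group P is_group subgroup_carrier] in auto)
      have "D O Id_on P = D" using RD by auto
      then show "bimark X D = bimark X (Id_on (Domain D)) \<and> bimark X D = bimark X (Id_on (Range D))"
        using r[OF P \<phi> sD] l[OF P \<phi> sI] relcomp_converse_fd(1)[OF D] RD by (simp add: D')
    qed
  next
    assume c: "\<forall>D\<in>FD. bimark X D = bimark X (Id_on (Domain D)) \<and> bimark X D = bimark X (Id_on (Range D))"
    show "biset_stable p S F X"
      unfolding stable_iff[OF X]
    proof (intro allI impI conjI; elim conjE)
      fix P \<phi> D assume P: "subgroup P S" and \<phi>: "\<phi> \<in> F P (carrier S)"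
      let ?E = "twisted_diagonal P \<phi>"
      have E: "?E \<in> FD" by (rule fdI[OF P \<phi>])
      have RE: "Range ?E = P" by (rule Range_twisted_diagonal)
      {
        assume D: "subgroup D (S \<times>\<times> S\<lparr>carrier := P\<rparr>)"
        have DS: "subgroup D S2" by (rule sub_right[OF P D])
        have RD: "Range D \<subseteq> Range ?E"
          using subgroup_DirProdD(1)[OF is_group subgroup_imp_group[OF P] D] RE by auto
        have sDE: "subgroup (D O ?E\<inverse>) S2"
          by (rule subgroup_relcomp[OF is_group is_group is_group DS subgroup_converse[OF is_group is_group fd_props(1)[OF E]]])
        have undo: "(D O ?E\<inverse>) O ?E = D"
          unfolding O_assoc relcomp_converse_fd(2)[OF E] by (rule relcomp_Id_on_eq[OF RD])
        show "bimark X (D O ?E\<inverse>) = bimark X D"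
        proof (cases "D \<in> FD")
          case True
          have "D O ?E\<inverse> \<in> FD" by (rule fd_relcomp[OF True fd_converse[OF E]])
          moreover have "Domain (D O ?E\<inverse>) = Domain D" by (rule Domain_relcomp_sub) (use RD in auto)
          ultimately show ?thesis using c True by metis
        next
          case False
          then have "D O ?E\<inverse> \<notin> FD" using fd_relcomp[OF _ E] undo by metis
          then show ?thesis using marks_not_fd[OF z sDE] marks_not_fd[OF z DS False] by simp
        qed
      }
      assume D: "subgroup D (S\<lparr>carrier := P\<rparr> \<times>\<times> S)"
      have DS: "subgroup D S2" by (rule sub_left[OF P D])
      have RD: "Domain D \<subseteq> Range ?E"
        using subgroup_DirProdD(1)[OF subgroup_imp_group[OF P] is_group D] RE by auto
      have sDE: "subgroup (?E O D) S2"
        by (rule subgroup_relcomp[OF is_group is_group is_group fd_props(1)[OF E] DS])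
      have undo: "?E\<inverse> O ?E O D = D"
        unfolding O_assoc[symmetric] relcomp_converse_fd(2)[OF E] by (rule Id_on_relcomp_eq[OF RD])
      show "bimark X (?E O D) = bimark X D"
      proof (cases "D \<in> FD")
        case True
        have "?E O D \<in> FD" by (rule fd_relcomp[OF E True])
        moreover have "Range (?E O D) = Range D" by (rule Range_relcomp_sub) (use RD in auto)
        ultimately show ?thesis using c True by metis
      next
        case False
        then have "?E O D \<notin> FD" using fd_relcomp[OF fd_converse[OF E]] undo by metis
        then show ?thesis using marks_not_fd[OF z sDE] marks_not_fd[OF z DS False] by simp
      qed
    qed
  qed
  then have "biset_stable p S F X \<longleftrightarrow> left_stable (ghost S2 X) \<and> right_stable (ghost S2 X)"
    unfolding left_stable_def right_stable_def by blast
  then show ?thesis using X z generated_iff[OF X] by (auto simp: char_ring_def generated_ghost_def)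
qed

end


section \<open>Collapse and composition of generated elements\<close>

context fusion_system
begin

abbreviation gh :: "('a \<times> 'a) burnside \<Rightarrow> ('a \<times> 'a) set \<Rightarrow> rat" where
  "gh X \<equiv> ghost S2 X"

abbreviation comp :: "('a \<times> 'a) burnside \<Rightarrow> ('a \<times> 'a) burnside \<Rightarrow> ('a \<times> 'a) burnside" where
  "comp X Y \<equiv> burnside_comp p S S S X Y"

text \<open>The values on which all identities between characteristic elements are checked.\<close>

abbreviation cmark :: "('a \<times> 'a) burnside \<Rightarrow> 'a set \<Rightarrow> rat" where
  "cmark X Q \<equiv> marks S (ghost S (collapse p S X)) Q"

lemma finite_FD: "finite FD"
  by (rule finite_subset[OF _ SS.finite_subgroups]) (use fd_props(1) in auto)

lemma FD_sub: "FD \<subseteq> {D. subgroup D S2}"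
  using fd_props(1) by auto

lemma sum_FD:
  assumes "\<And>D. D \<notin> FD \<Longrightarrow> f D = 0"
  shows "(\<Sum>D | subgroup D S2. f D) = (\<Sum>D\<in>FD. f D :: rat)"
  by (rule sum.mono_neutral_right[OF SS.finite_subgroups FD_sub]) (use assms in auto)

lemma marks_generated:
  assumes "generated_ghost \<tau>"
  shows "marks S2 \<tau> D = (\<Sum>A\<in>FD. \<tau> A * of_bool (D \<subseteq> A))"
  unfolding SS.marks_alt by (rule sum_FD) (use assms in \<open>simp add: generated_ghost_def\<close>)

lemma comp_in: "X \<in> bisets p S S \<Longrightarrow> Y \<in> bisets p S S \<Longrightarrow> comp X Y \<in> bisets p S S"
  by (rule burnside_comp(1)[OF finite_group_axioms finite_group_axioms finite_group_axioms prime_p])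

lemma one_fd: "D \<in> FD \<Longrightarrow> (\<one>, \<one>) \<in> D"
  by (rule subgroup_DirProdD(2)[OF is_group is_group fd_props(1)])

lemma overlap_fd:
  assumes "A \<in> FD" "B \<in> FD"
  shows "overlap S S S A B = 1"
proof -
  have "{h \<in> carrier S. (\<one>, h) \<in> A \<and> (h, \<one>) \<in> B} = {\<one>}"
    using one_fd[OF assms(1)] one_fd[OF assms(2)] fd_props(4)[OF assms(1)] by auto
  then show ?thesis by (simp add: overlap_def)
qed

text \<open>Generated elements are linear combinations of bifree bisets, so the middle group acts freely
  on the pairs that are identified.\<close>

lemma ghost_comp:
  assumes X: "X \<in> bisets p S S" and gX: "generated_ghost (gh X)"
    and Y: "Y \<in> bisets p S S" and gY: "generated_ghost (gh Y)"
  shows "gh (comp X Y) D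
    = (\<Sum>A\<in>FD. \<Sum>B\<in>FD. gh X A * gh Y B * of_bool (D = A O B)) / nS"
proof -
  have "gh (comp X Y) D = (\<Sum>A | subgroup A S2. \<Sum>B | subgroup B S2. gh X A * gh Y B
         * (of_bool (D = A O B) * of_nat (overlap S S S A B) / nS))"
    unfolding burnside_comp(2)[OF finite_group_axioms finite_group_axioms finite_group_axioms prime_p X Y] ..
  also have "\<dots> = (\<Sum>A\<in>FD. \<Sum>B | subgroup B S2. gh X A * gh Y B
         * (of_bool (D = A O B) * of_nat (overlap S S S A B) / nS))"
    by (rule sum_FD) (use gX in \<open>simp add: generated_ghost_def\<close>)
  also have "\<dots> = (\<Sum>A\<in>FD. \<Sum>B\<in>FD. gh X A * gh Y B
         * (of_bool (D = A O B) * of_nat (overlap S S S A B) / nS))"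
    by (intro sum.cong[OF refl] sum_FD) (use gY in \<open>simp add: generated_ghost_def\<close>)
  also have "\<dots> = (\<Sum>A\<in>FD. \<Sum>B\<in>FD. gh X A * gh Y B * of_bool (D = A O B) / nS)"
    by (intro sum.cong[OF refl]) (simp add: overlap_fd)
  finally show ?thesis by (simp add: sum_divide_distrib)
qed

lemma generated_comp:
  assumes "X \<in> bisets p S S" "generated_ghost (gh X)" "Y \<in> bisets p S S" "generated_ghost (gh Y)"
  shows "generated_ghost (gh (comp X Y))"
  unfolding generated_ghost_def
proof (intro allI impI)
  fix D assume D: "D \<notin> FD"
  have "(\<Sum>A\<in>FD. \<Sum>B\<in>FD. gh X A * gh Y B * of_bool (D = A O B)) = 0"
    by (intro sum.neutral ballI) (use D fd_relcomp in auto)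
  then show "gh (comp X Y) D = 0" unfolding ghost_comp[OF assms] by simp
qed

text \<open>Marks and collapses of composites are obtained by choosing the weight \<open>w\<close>.\<close>

lemma sum_ghost_comp:
  assumes "X \<in> bisets p S S" "generated_ghost (gh X)" "Y \<in> bisets p S S" "generated_ghost (gh Y)"
  shows "(\<Sum>D\<in>FD. gh (comp X Y) D * w D)
    = (\<Sum>A\<in>FD. \<Sum>B\<in>FD. gh X A * gh Y B * w (A O B)) / nS"
proof -
  have "(\<Sum>D\<in>FD. gh (comp X Y) D * w D)
    = (\<Sum>D\<in>FD. \<Sum>A\<in>FD. \<Sum>B\<in>FD. gh X A * gh Y B * of_bool (D = A O B) * w D) / nS"
    unfolding ghost_comp[OF assms] by (simp add: sum_divide_distrib sum_distrib_right)
  also have "(\<Sum>D\<in>FD. \<Sum>A\<in>FD. \<Sum>B\<in>FD. gh X A * gh Y B * of_bool (D = A O B) * w D)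
    = (\<Sum>A\<in>FD. \<Sum>D\<in>FD. \<Sum>B\<in>FD. gh X A * gh Y B * of_bool (D = A O B) * w D)"
    by (rule sum.swap)
  also have "\<dots> = (\<Sum>A\<in>FD. \<Sum>B\<in>FD. \<Sum>D\<in>FD. gh X A * gh Y B * of_bool (D = A O B) * w D)"
    by (intro sum.cong[OF refl] sum.swap)
  also have "\<dots> = (\<Sum>A\<in>FD. \<Sum>B\<in>FD. gh X A * gh Y B * w (A O B))"
  proof (intro sum.cong[OF refl])
    fix A B assume "A \<in> FD" "B \<in> FD"
    then have "A O B \<in> FD" by (rule fd_relcomp)
    then show "(\<Sum>D\<in>FD. gh X A * gh Y B * of_bool (D = A O B) * w D) = gh X A * gh Y B * w (A O B)"
      using finite_FD by (subst sum.mono_neutral_right[of _ "{A O B}"]) auto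
  qed
  finally show ?thesis .
qed

text \<open>For an injective \<open>A\<close> the inclusion \<open>D \<subseteq> A O B\<close> can be solved for \<open>B\<close>.\<close>

lemma bimark_comp_left:
  assumes X: "X \<in> bisets p S S" "generated_ghost (gh X)" and Y: "Y \<in> bisets p S S" "generated_ghost (gh Y)"
  shows "bimark (comp X Y) D
    = (\<Sum>A\<in>FD. gh X A * of_bool (Domain D \<subseteq> Domain A) * bimark Y (A\<inverse> O D)) / nS"
proof -
  have sub: "D \<subseteq> A O B \<longleftrightarrow> Domain D \<subseteq> Domain A \<and> A\<inverse> O D \<subseteq> B" if A: "A \<in> FD" for A B
  proof
    assume s: "D \<subseteq> A O B"
    have "A\<inverse> O D \<subseteq> B"
    proof (rule subrelI)
      fix x y assume "(x, y) \<in> A\<inverse> O D"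
      then obtain a where a: "(a, x) \<in> A" "(a, y) \<in> D" by auto
      then obtain x' where "(a, x') \<in> A" "(x', y) \<in> B" using s by auto
      then show "(x, y) \<in> B" using fd_props(4)[OF A a(1)] by auto
    qed
    then show "Domain D \<subseteq> Domain A \<and> A\<inverse> O D \<subseteq> B" using s by auto
  next
    assume s: "Domain D \<subseteq> Domain A \<and> A\<inverse> O D \<subseteq> B"
    show "D \<subseteq> A O B"
    proof (rule subrelI)
      fix a y assume ay: "(a, y) \<in> D"
      then obtain x where "(a, x) \<in> A" using s by blast
      then show "(a, y) \<in> A O B" using s ay by blast
    qed
  qed
  have "bimark (comp X Y) D = (\<Sum>A\<in>FD. \<Sum>B\<in>FD. gh X A * gh Y B * of_bool (D \<subseteq> A O B)) / nS"
    unfolding marks_generated[OF generated_comp[OF X Y]] by (rule sum_ghost_comp[OF X Y])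
  also have "(\<Sum>A\<in>FD. \<Sum>B\<in>FD. gh X A * gh Y B * of_bool (D \<subseteq> A O B))
     = (\<Sum>A\<in>FD. gh X A * of_bool (Domain D \<subseteq> Domain A) * bimark Y (A\<inverse> O D))"
    unfolding marks_generated[OF Y(2)] sum_distrib_left
    by (intro sum.cong[OF refl]) (auto simp: sub)
  finally show ?thesis .
qed

lemma bimark_comp_right:
  assumes X: "X \<in> bisets p S S" "generated_ghost (gh X)" and Y: "Y \<in> bisets p S S" "generated_ghost (gh Y)"
  shows "bimark (comp X Y) D
    = (\<Sum>B\<in>FD. gh Y B * of_bool (Range D \<subseteq> Range B) * bimark X (D O B\<inverse>)) / nS"
proof -
  have sub: "D \<subseteq> A O B \<longleftrightarrow> Range D \<subseteq> Range B \<and> D O B\<inverse> \<subseteq> A" if B: "B \<in> FD" for A B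
  proof
    assume s: "D \<subseteq> A O B"
    have "D O B\<inverse> \<subseteq> A"
    proof (rule subrelI)
      fix x y assume "(x, y) \<in> D O B\<inverse>"
      then obtain b where b: "(y, b) \<in> B" "(x, b) \<in> D" by auto
      then obtain y' where "(x, y') \<in> A" "(y', b) \<in> B" using s by auto
      then show "(x, y) \<in> A" using fd_props(5)[OF B b(1)] by auto
    qed
    then show "Range D \<subseteq> Range B \<and> D O B\<inverse> \<subseteq> A" using s by auto
  next
    assume s: "Range D \<subseteq> Range B \<and> D O B\<inverse> \<subseteq> A"
    show "D \<subseteq> A O B"
    proof (rule subrelI)
      fix x b assume xb: "(x, b) \<in> D"
      then obtain y where "(y, b) \<in> B" using s by blast
      then show "(x, b) \<in> A O B" using s xb by blast
    qed
  qed
  have "bimark (comp X Y) D = (\<Sum>A\<in>FD. \<Sum>B\<in>FD. gh X A * gh Y B * of_bool (D \<subseteq> A O B)) / nS"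
    unfolding marks_generated[OF generated_comp[OF X Y]] by (rule sum_ghost_comp[OF X Y])
  also have "(\<Sum>A\<in>FD. \<Sum>B\<in>FD. gh X A * gh Y B * of_bool (D \<subseteq> A O B))
     = (\<Sum>B\<in>FD. \<Sum>A\<in>FD. gh X A * gh Y B * of_bool (D \<subseteq> A O B))" by (rule sum.swap)
  also have "\<dots> = (\<Sum>B\<in>FD. gh Y B * of_bool (Range D \<subseteq> Range B) * bimark X (D O B\<inverse>))"
    unfolding marks_generated[OF X(2)] sum_distrib_left
    by (intro sum.cong[OF refl]) (auto simp: sub)
  finally show ?thesis .
qed

text \<open>Composition on the right translates \<open>D\<close> by \<open>B\<inverse>\<close> on the right, and the range of the translate
  depends on \<open>D\<close> through its range only.\<close>

lemma left_stable_comp: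
  assumes X: "X \<in> bisets p S S" "generated_ghost (gh X)" and Y: "Y \<in> bisets p S S" "generated_ghost (gh Y)"
    and st: "left_stable (gh X)"
  shows "left_stable (gh (comp X Y))"
  unfolding left_stable_def bimark_comp_right[OF X Y]
proof (intro ballI arg_cong[where f = "\<lambda>x. x / nS"] sum.cong[OF refl])
  fix D B assume D: "D \<in> FD" and B: "B \<in> FD"
  note st' = st[unfolded left_stable_def, rule_format]
  have I: "Id_on (Range D) \<in> FD" by (rule fd_Id_on[OF fd_props(3)[OF D]])
  have "Range (D O B\<inverse>) = Range (Id_on (Range D) O B\<inverse>)" by (auto simp: Id_on_def)
  then have "bimark X (D O B\<inverse>) = bimark X (Id_on (Range D) O B\<inverse>)"
    using st'[OF fd_relcomp[OF D fd_converse[OF B]]] st'[OF fd_relcomp[OF I fd_converse[OF B]]] by simp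
  then show "gh Y B * of_bool (Range D \<subseteq> Range B) * bimark X (D O B\<inverse>)
    = gh Y B * of_bool (Range (Id_on (Range D)) \<subseteq> Range B) * bimark X (Id_on (Range D) O B\<inverse>)"
    by simp
qed

lemma right_stable_comp:
  assumes X: "X \<in> bisets p S S" "generated_ghost (gh X)" and Y: "Y \<in> bisets p S S" "generated_ghost (gh Y)"
    and st: "right_stable (gh Y)"
  shows "right_stable (gh (comp X Y))"
  unfolding right_stable_def bimark_comp_left[OF X Y]
proof (intro ballI arg_cong[where f = "\<lambda>x. x / nS"] sum.cong[OF refl])
  fix D A assume D: "D \<in> FD" and A: "A \<in> FD"
  note st' = st[unfolded right_stable_def, rule_format]
  have I: "Id_on (Domain D) \<in> FD" by (rule fd_Id_on[OF fd_props(2)[OF D]])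
  have "Domain (A\<inverse> O D) = Domain (A\<inverse> O Id_on (Domain D))" by (auto simp: Id_on_def)
  then have "bimark Y (A\<inverse> O D) = bimark Y (A\<inverse> O Id_on (Domain D))"
    using st'[OF fd_relcomp[OF fd_converse[OF A] D]] st'[OF fd_relcomp[OF fd_converse[OF A] I]] by simp
  then show "gh X A * of_bool (Domain D \<subseteq> Domain A) * bimark Y (A\<inverse> O D)
    = gh X A * of_bool (Domain (Id_on (Domain D)) \<subseteq> Domain A) * bimark Y (A\<inverse> O Id_on (Domain D))"
    by simp
qed

lemma char_comp_closed:
  "X \<in> carrier (char_ring p S F) \<Longrightarrow> Y \<in> carrier (char_ring p S F) \<Longrightarrow> comp X Y \<in> carrier (char_ring p S F)"
  unfolding char_iff using comp_in generated_comp left_stable_comp right_stable_comp by blast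

lemma collapse_in: "X \<in> bisets p S S \<Longrightarrow> collapse p S X \<in> burnside p S"
  by (rule collapse(1)[OF finite_group_axioms prime_p])

text \<open>The right action on a generated element is free, so every orbit has \<open>|S|\<close> points.\<close>

lemma cmark_generated:
  assumes X: "X \<in> bisets p S S" "generated_ghost (gh X)"
  shows "cmark X Q = (\<Sum>A\<in>FD. gh X A * of_bool (Q \<subseteq> Domain A)) / nS"
proof -
  have n: "card {g \<in> carrier S. (\<one>, g) \<in> A} = 1" if "A \<in> FD" for A
  proof -
    have "{g \<in> carrier S. (\<one>, g) \<in> A} = {\<one>}"
      using one_fd[OF that] fd_props(4)[OF that] by auto
    then show ?thesis by simp
  qed
  have "ghost S (collapse p S X) D = (\<Sum>A\<in>FD. gh X A / nS * of_bool (D = Domain A))" for D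
  proof -
    have "ghost S (collapse p S X) D = (\<Sum>A | subgroup A S2. gh X A
       * (of_bool (D = Domain A) * of_nat (card {g \<in> carrier S. (\<one>, g) \<in> A}) / nS))"
      unfolding collapse(2)[OF finite_group_axioms prime_p X(1)] ..
    also have "\<dots> = (\<Sum>A\<in>FD. gh X A
       * (of_bool (D = Domain A) * of_nat (card {g \<in> carrier S. (\<one>, g) \<in> A}) / nS))"
      by (rule sum_FD) (use X(2) in \<open>simp add: generated_ghost_def\<close>)
    also have "\<dots> = (\<Sum>A\<in>FD. gh X A / nS * of_bool (D = Domain A))"
      by (rule sum.cong[OF refl]) (simp only: n of_nat_1, simp)
    finally show ?thesis .
  qed
  then have "ghost S (collapse p S X) = (\<lambda>D. \<Sum>A\<in>FD. gh X A / nS * of_bool (D = Domain A))"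
    by (rule ext)
  then have "cmark X Q = (\<Sum>A\<in>FD. gh X A / nS * marks S (\<lambda>D. of_bool (D = Domain A)) Q)"
    by (simp only: marks_sum marks_scale)
  also have "\<dots> = (\<Sum>A\<in>FD. gh X A / nS * of_bool (Q \<subseteq> Domain A))"
  proof (rule sum.cong[OF refl])
    fix A assume A: "A \<in> FD"
    have "marks S (\<lambda>D. of_bool (D = Domain A)) Q = of_bool (Q \<subseteq> Domain A)"
      unfolding marks_alt using fd_props(2)[OF A] finite_subgroups
      by (subst sum.mono_neutral_right[of _ "{Domain A}"]) auto
    then show "gh X A / nS * marks S (\<lambda>D. of_bool (D = Domain A)) Q
      = gh X A / nS * of_bool (Q \<subseteq> Domain A)" by simp
  qed
  finally show ?thesis by (simp add: sum_divide_distrib)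
qed

text \<open>\<open>Q\<close> lies in the domain of \<open>A O B\<close> if and only if \<open>A\<close> is defined on \<open>Q\<close> and \<open>B\<close> on its image.\<close>

lemma cmark_comp:
  assumes X: "X \<in> bisets p S S" "generated_ghost (gh X)" and Y: "Y \<in> bisets p S S" "generated_ghost (gh Y)"
  shows "cmark (comp X Y) Q
    = (\<Sum>A\<in>FD. gh X A * of_bool (Q \<subseteq> Domain A) * cmark Y (A `` Q)) / nS"
proof -
  have dom: "Q \<subseteq> Domain (A O B) \<longleftrightarrow> Q \<subseteq> Domain A \<and> A `` Q \<subseteq> Domain B" if A: "A \<in> FD" for A B
  proof
    assume s: "Q \<subseteq> Domain (A O B)"
    have "A `` Q \<subseteq> Domain B"
    proof
      fix x assume "x \<in> A `` Q"
      then obtain a where a: "a \<in> Q" "(a, x) \<in> A" by auto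
      then obtain x' y where "(a, x') \<in> A" "(x', y) \<in> B" using s by blast
      then show "x \<in> Domain B" using fd_props(4)[OF A a(2)] by auto
    qed
    then show "Q \<subseteq> Domain A \<and> A `` Q \<subseteq> Domain B" using s by auto
  next
    assume s: "Q \<subseteq> Domain A \<and> A `` Q \<subseteq> Domain B"
    show "Q \<subseteq> Domain (A O B)"
    proof
      fix a assume a: "a \<in> Q"
      then obtain x where x: "(a, x) \<in> A" using s by blast
      then have "x \<in> Domain B" using s a by blast
      then show "a \<in> Domain (A O B)" using x by blast
    qed
  qed
  let ?n = nS
  have "cmark (comp X Y) Q = (\<Sum>A\<in>FD. \<Sum>B\<in>FD. gh X A * gh Y B * of_bool (Q \<subseteq> Domain (A O B))) / ?n / ?n"
    unfolding cmark_generated[OF comp_in[OF X(1) Y(1)] generated_comp[OF X Y]] sum_ghost_comp[OF X Y] ..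
  also have "(\<Sum>A\<in>FD. \<Sum>B\<in>FD. gh X A * gh Y B * of_bool (Q \<subseteq> Domain (A O B))) / ?n
    = (\<Sum>A\<in>FD. gh X A * of_bool (Q \<subseteq> Domain A) * cmark Y (A `` Q))"
    unfolding cmark_generated[OF Y] sum_distrib_left sum_divide_distrib
    by (intro sum.cong[OF refl]) (auto simp: dom)
  finally show ?thesis .
qed

definition fusion_invariant :: "('a set \<Rightarrow> rat) \<Rightarrow> bool" where
  "fusion_invariant f \<longleftrightarrow> (\<forall>R\<in>FD. f (Domain R) = f (Range R))"

lemma fd_image:
  assumes A: "A \<in> FD" and Q: "subgroup Q S" "Q \<subseteq> Domain A"
  shows "Id_on Q O A \<in> FD" "Domain (Id_on Q O A) = Q" "Range (Id_on Q O A) = A `` Q"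
proof -
  show "Id_on Q O A \<in> FD" by (rule fd_relcomp[OF fd_Id_on[OF Q(1)] A])
  show "Domain (Id_on Q O A) = Q" using Q(2) by blast
  show "Range (Id_on Q O A) = A `` Q" by (auto simp: Id_on_def)
qed

text \<open>The summands of \<open>cmark_comp\<close> evaluate \<open>Y\<close> at \<open>\<F>\<close>-conjugates \<open>A Q\<close> of \<open>Q\<close>. If they all have
  the value at \<open>Q\<close>, this value factors out.\<close>

lemma cmark_comp_mult:
  assumes X: "X \<in> bisets p S S" "generated_ghost (gh X)" and Y: "Y \<in> bisets p S S" "generated_ghost (gh Y)"
    and inv: "fusion_invariant (cmark Y)" and Q: "subgroup Q S"
  shows "cmark (comp X Y) Q = cmark X Q * cmark Y Q"
proof -
  have "cmark (comp X Y) Q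
    = (\<Sum>A\<in>FD. gh X A * of_bool (Q \<subseteq> Domain A) * cmark Y Q) / nS"
    unfolding cmark_comp[OF X Y]
  proof (rule arg_cong[where f = "\<lambda>x. x / nS"], rule sum.cong[OF refl])
    fix A assume A: "A \<in> FD"
    show "gh X A * of_bool (Q \<subseteq> Domain A) * cmark Y (A `` Q) = gh X A * of_bool (Q \<subseteq> Domain A) * cmark Y Q"
    proof (cases "Q \<subseteq> Domain A")
      case True
      then show ?thesis using fd_image[OF A Q True] inv unfolding fusion_invariant_def by metis
    qed simp
  qed
  then show ?thesis unfolding cmark_generated[OF X] by (simp add: sum_distrib_right)
qed

abbreviation fd_from :: "'a set \<Rightarrow> ('a \<times> 'a) set set" where
  "fd_from Q \<equiv> {R \<in> FD. Domain R = Q}"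

text \<open>A graph \<open>A\<close> that is defined on \<open>Q\<close> contains exactly one graph \<open>R\<close> with domain \<open>Q\<close>, its
  restriction. Grouping the \<open>A\<close> by \<open>R\<close> makes the mark of \<open>\<tau>\<close> at \<open>R\<close> appear.\<close>

lemma sum_by_restriction:
  assumes \<tau>: "generated_ghost \<tau>" and Q: "subgroup Q S"
  shows "(\<Sum>A\<in>FD. \<tau> A * of_bool (Q \<subseteq> Domain A) * f (A `` Q)) = (\<Sum>R\<in>fd_from Q. marks S2 \<tau> R * f (Range R))"
proof -
  have fin: "finite (fd_from Q)" using finite_FD by simp
  have "(\<Sum>R\<in>fd_from Q. marks S2 \<tau> R * f (Range R))
    = (\<Sum>A\<in>FD. \<Sum>R\<in>fd_from Q. \<tau> A * of_bool (R \<subseteq> A) * f (Range R))"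
    unfolding marks_generated[OF \<tau>] sum_distrib_right by (rule sum.swap)
  also have "\<dots> = (\<Sum>A\<in>FD. \<tau> A * of_bool (Q \<subseteq> Domain A) * f (A `` Q))"
  proof (rule sum.cong[OF refl])
    fix A assume A: "A \<in> FD"
    show "(\<Sum>R\<in>fd_from Q. \<tau> A * of_bool (R \<subseteq> A) * f (Range R)) = \<tau> A * of_bool (Q \<subseteq> Domain A) * f (A `` Q)"
    proof (cases "Q \<subseteq> Domain A")
      case True
      note r = fd_image[OF A Q True]
      have "R = Id_on Q O A" if "R \<in> fd_from Q" "R \<subseteq> A" for R
      proof (rule fd_eq_of_Domain[OF r(1)])
        show "R \<subseteq> Id_on Q O A" using that by (auto simp: Id_on_def)
      qed (use that r in auto)
      then have "(\<Sum>R\<in>fd_from Q. \<tau> A * of_bool (R \<subseteq> A) * f (Range R))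
        = (\<Sum>R\<in>{Id_on Q O A}. \<tau> A * of_bool (R \<subseteq> A) * f (Range R))"
      proof (intro sum.mono_neutral_right[OF fin] ballI)
        fix R assume "R \<in> fd_from Q - {Id_on Q O A}"
        then have "\<not> R \<subseteq> A" using \<open>\<And>R. R \<in> fd_from Q \<Longrightarrow> R \<subseteq> A \<Longrightarrow> R = Id_on Q O A\<close> by blast
        then show "\<tau> A * of_bool (R \<subseteq> A) * f (Range R) = 0" by simp
      qed (use r in simp)
      also have "\<dots> = \<tau> A * f (A `` Q)" unfolding r(3)[symmetric] by (auto simp: Id_on_def)
      finally show ?thesis using True by simp
    next
      case False
      then have "\<not> R \<subseteq> A" if "R \<in> fd_from Q" for R using that Domain_mono[of R A] by blast
      then show ?thesis using False by simp
    qed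
  qed
  finally show ?thesis by simp
qed

lemma card_fd_from:
  assumes "R \<in> FD"
  shows "card (fd_from (Domain R)) = card (fd_from (Range R))"
proof -
  have "bij_betw (\<lambda>E. R\<inverse> O E) (fd_from (Domain R)) (fd_from (Range R))"
  proof (rule bij_betw_byWitness[where f' = "\<lambda>E. R O E"])
    show "\<forall>E\<in>fd_from (Domain R). R O R\<inverse> O E = E"
      by (simp add: O_assoc[symmetric] relcomp_converse_fd[OF assms] Id_on_relcomp_eq)
    show "\<forall>E\<in>fd_from (Range R). R\<inverse> O R O E = E"
      by (simp add: O_assoc[symmetric] relcomp_converse_fd[OF assms] Id_on_relcomp_eq)
    show "(\<lambda>E. R\<inverse> O E) ` fd_from (Domain R) \<subseteq> fd_from (Range R)"
      by (rule image_subsetI) (simp add: fd_relcomp fd_converse Domain_relcomp_sub assms)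
    show "(\<lambda>E. R O E) ` fd_from (Range R) \<subseteq> fd_from (Domain R)"
      by (rule image_subsetI) (simp add: fd_relcomp Domain_relcomp_sub assms)
  qed
  then show ?thesis by (rule bij_betw_same_card)
qed

lemma card_fd_from_pos: "subgroup Q S \<Longrightarrow> card (fd_from Q) > 0"
  using fd_Id_on[of Q] finite_FD by (auto simp: card_gt_0_iff intro!: exI[of _ "Id_on Q"])

text \<open>Each \<open>\<F>\<close>-conjugate of \<open>Q\<close> is the range of the same number \<open>|Aut\<^sub>\<F>(Q)|\<close> of graphs with domain
  \<open>Q\<close>.\<close>

lemma sum_fd_from_average:
  assumes Q: "subgroup Q S"
  shows "(\<Sum>R\<in>fd_from Q. f (Range R)) / of_nat (card (fd_from Q))
    = (\<Sum>Q'\<in>fusion_class S F Q. f Q') / (of_nat (card (fusion_class S F Q)) :: rat)"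
proof -
  let ?C = "fusion_class S F Q"
  have C: "?C = Range ` fd_from Q"
  proof (intro equalityI subsetI)
    fix Q' assume "Q' \<in> ?C"
    then obtain R where "R \<in> FD" "Range R = Q" "Domain R = Q'" unfolding fusion_class_eq[OF Q] by auto
    then have "R\<inverse> \<in> fd_from Q" "Q' = Range (R\<inverse>)" using fd_converse by simp_all
    then show "Q' \<in> Range ` fd_from Q" by blast
  next
    fix Q' assume "Q' \<in> Range ` fd_from Q"
    then obtain R where "R \<in> FD" "Domain R = Q" "Range R = Q'" by auto
    then have "R\<inverse> \<in> FD" "Range (R\<inverse>) = Q" "Q' = Domain (R\<inverse>)" using fd_converse by simp_all
    then show "Q' \<in> ?C" unfolding fusion_class_eq[OF Q] by blast
  qed
  have finC: "finite ?C" and fin: "finite (fd_from Q)" unfolding C using finite_FD by auto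
  have QC: "Q \<in> ?C" unfolding C using fd_Id_on[OF Q] by (force simp: image_iff)
  define m where "m = card {R \<in> fd_from Q. Range R = Q}"
  have m: "card {R \<in> fd_from Q. Range R = Q'} = m" if Q': "Q' \<in> ?C" for Q'
  proof -
    obtain E where E: "E \<in> FD" "Domain E = Q" "Range E = Q'" using Q' unfolding C by auto
    have "bij_betw (\<lambda>R. R O E) {R \<in> fd_from Q. Range R = Q} {R \<in> fd_from Q. Range R = Q'}"
    proof (rule bij_betw_byWitness[where f' = "\<lambda>R. R O E\<inverse>"])
      show "\<forall>R\<in>{R \<in> fd_from Q. Range R = Q}. (R O E) O E\<inverse> = R"
        "\<forall>R\<in>{R \<in> fd_from Q. Range R = Q'}. (R O E\<inverse>) O E = R"
        using E by (simp_all add: O_assoc relcomp_converse_fd[OF E(1)] relcomp_Id_on_eq)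
      show "(\<lambda>R. R O E) ` {R \<in> fd_from Q. Range R = Q} \<subseteq> {R \<in> fd_from Q. Range R = Q'}"
        by (rule image_subsetI) (simp add: fd_relcomp E Domain_relcomp_sub Range_relcomp_sub)
      show "(\<lambda>R. R O E\<inverse>) ` {R \<in> fd_from Q. Range R = Q'} \<subseteq> {R \<in> fd_from Q. Range R = Q}"
        by (rule image_subsetI) (simp add: fd_relcomp fd_converse E Domain_relcomp_sub Range_relcomp_sub)
    qed
    then show ?thesis unfolding m_def by (rule bij_betw_same_card[symmetric])
  qed
  have "(\<Sum>R\<in>fd_from Q. f (Range R)) = (\<Sum>Q'\<in>?C. \<Sum>R\<in>{R \<in> fd_from Q. Range R = Q'}. f (Range R))"
    by (rule sum.group[OF fin finC, symmetric]) (use C in auto)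
  also have "\<dots> = (\<Sum>Q'\<in>?C. of_nat m * f Q')" by (rule sum.cong[OF refl]) (use m in simp)
  finally have 1: "(\<Sum>R\<in>fd_from Q. f (Range R)) = of_nat m * (\<Sum>Q'\<in>?C. f Q')" by (simp add: sum_distrib_left)
  have "card (fd_from Q) = (\<Sum>R\<in>fd_from Q. 1)" by simp
  also have "\<dots> = (\<Sum>Q'\<in>?C. \<Sum>R\<in>{R \<in> fd_from Q. Range R = Q'}. 1)"
    by (rule sum.group[OF fin finC, symmetric]) (use C in auto)
  also have "\<dots> = (\<Sum>Q'\<in>?C. m)" by (rule sum.cong[OF refl]) (use m in simp)
  finally have 2: "card (fd_from Q) = card ?C * m" by simp
  then have "m > 0" using card_fd_from_pos[OF Q] by (cases m) auto
  then show ?thesis unfolding 1 2 by simp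
qed

text \<open>Right stability makes the marks at all restrictions \<open>R\<close> with domain \<open>Q\<close> equal. So the
  collapse of \<open>X\<close> knows all marks of \<open>X\<close>, and composition with \<open>X\<close> on the left averages over the
  \<open>\<F>\<close>-conjugates of \<open>Q\<close>, up to a factor.\<close>

lemma cmark_char:
  assumes X: "X \<in> carrier (char_ring p S F)" and Q: "subgroup Q S"
  shows "cmark X Q = of_nat (card (fd_from Q)) * bimark X (Id_on Q) / nS"
    and "Y \<in> bisets p S S \<Longrightarrow> generated_ghost (gh Y) \<Longrightarrow>
      cmark (comp X Y) Q = bimark X (Id_on Q) * (\<Sum>R\<in>fd_from Q. cmark Y (Range R)) / nS"
proof -
  have X': "X \<in> bisets p S S" "generated_ghost (gh X)" "right_stable (gh X)" using X char_iff by auto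
  have r: "bimark X R = bimark X (Id_on Q)" if "R \<in> fd_from Q" for R
    using X'(3) that unfolding right_stable_def by auto
  have "cmark X Q = (\<Sum>R\<in>fd_from Q. bimark X R * 1) / nS"
    unfolding cmark_generated[OF X'(1,2)] sum_by_restriction[OF X'(2) Q, of "\<lambda>_. 1", symmetric] by simp
  then show "cmark X Q = of_nat (card (fd_from Q)) * bimark X (Id_on Q) / nS"
    by (simp add: r)
  assume Y: "Y \<in> bisets p S S" "generated_ghost (gh Y)"
  have "cmark (comp X Y) Q = (\<Sum>R\<in>fd_from Q. bimark X R * cmark Y (Range R)) / nS"
    unfolding cmark_comp[OF X'(1,2) Y] sum_by_restriction[OF X'(2) Q, of "cmark Y", symmetric] ..
  then show "cmark (comp X Y) Q = bimark X (Id_on Q) * (\<Sum>R\<in>fd_from Q. cmark Y (Range R)) / nS"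
    by (simp add: r sum_distrib_left)
qed

lemma cmark_char_invariant:
  assumes X: "X \<in> carrier (char_ring p S F)"
  shows "fusion_invariant (cmark X)"
  unfolding fusion_invariant_def
proof
  fix R assume R: "R \<in> FD"
  have "bimark X (Id_on (Domain R)) = bimark X (Id_on (Range R))"
    using X R unfolding char_iff left_stable_def right_stable_def by auto
  then show "cmark X (Domain R) = cmark X (Range R)"
    using cmark_char(1)[OF X] fd_props(2,3)[OF R] card_fd_from[OF R] by simp
qed

text \<open>The collapse determines the marks at identity graphs, these determine the marks at all graphs
  by stability, and the marks off the graphs are zero.\<close>

lemma cmark_char_inject:
  assumes X: "X \<in> carrier (char_ring p S F)" and Y: "Y \<in> carrier (char_ring p S F)"
    and e: "\<And>Q. subgroup Q S \<Longrightarrow> cmark X Q = cmark Y Q"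
  shows "X = Y"
proof -
  have X': "X \<in> bisets p S S" "generated_ghost (gh X)" "right_stable (gh X)" using X char_iff by auto
  have Y': "Y \<in> bisets p S S" "generated_ghost (gh Y)" "right_stable (gh Y)" using Y char_iff by auto
  have "bimark X D = bimark Y D" if D: "subgroup D S2" for D
  proof (cases "D \<in> FD")
    case True
    note d = fd_props(2)[OF True]
    have "bimark X (Id_on (Domain D)) = bimark Y (Id_on (Domain D))"
      using e[OF d] card_fd_from_pos[OF d] card_carrier_pos
      unfolding cmark_char(1)[OF X d] cmark_char(1)[OF Y d] by simp
    then show ?thesis using X'(3) Y'(3) True unfolding right_stable_def by simp
  next
    case False
    then show ?thesis using marks_not_fd[OF _ D False] X'(2) Y'(2) unfolding generated_ghost_def by simp
  qed
  then show ?thesis using SS.burnside_eq_iff_marks[OF prime_p X'(1) Y'(1)] by blast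
qed

text \<open>Restrictions along \<open>\<phi>\<close> are compared by their marks at all \<open>D \<le> P\<close>, and the restriction of
  \<open>\<phi>\<close> to \<open>D\<close> is again a morphism.\<close>

lemma fusion_stable_iff:
  assumes a: "a \<in> burnside p S"
  shows "fusion_stable p S F a \<longleftrightarrow> fusion_invariant (marks S (ghost S a))"
proof
  note res = burnside_restrict[OF finite_group_axioms finite_group_subgroup prime_p a]
  {
    assume st: "fusion_stable p S F a"
    show "fusion_invariant (marks S (ghost S a))"
      unfolding fusion_invariant_def
    proof
      fix R assume "R \<in> FD"
      then obtain P \<phi> where P: "subgroup P S" and \<phi>: "\<phi> \<in> F P (carrier S)" and R: "R = twisted_diagonal P \<phi>"
        by (rule fdE)
      have id: "id \<in> hom (S\<lparr>carrier := P\<rparr>) S" using subgroup.mem_carrier[OF P] by (auto simp: hom_def)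
      have "burnside_restrict p (S\<lparr>carrier := P\<rparr>) \<phi> a = burnside_restrict p (S\<lparr>carrier := P\<rparr>) id a"
        using st P \<phi> unfolding fusion_stable_def by blast
      then show "marks S (ghost S a) (Domain R) = marks S (ghost S a) (Range R)"
        using res(2)[OF P mor(1)[OF P subgroup_carrier \<phi>], of P] res(2)[OF P id, of P]
        unfolding R Domain_twisted_diagonal Range_twisted_diagonal by simp
    qed
  }
  assume inv: "fusion_invariant (marks S (ghost S a))"
  show "fusion_stable p S F a"
    unfolding fusion_stable_def
  proof (intro allI impI, elim conjE)
    fix P \<phi> assume P: "subgroup P S" and \<phi>: "\<phi> \<in> F P (carrier S)"
    let ?T = "S\<lparr>carrier := P\<rparr>"
    interpret T: finite_group ?T by (rule finite_group_subgroup[OF P])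
    have id: "id \<in> hom ?T S" using subgroup.mem_carrier[OF P] by (auto simp: hom_def)
    note m = mor(1)[OF P subgroup_carrier \<phi>]
    show "burnside_restrict p ?T \<phi> a = burnside_restrict p ?T id a"
      unfolding T.burnside_eq_iff_marks[OF prime_p res(1)[OF P m] res(1)[OF P id]]
    proof (intro allI impI)
      fix D assume D: "subgroup D ?T"
      have DP: "D \<subseteq> P" using subgroup.subset[OF D] by simp
      have DS: "subgroup D S" by (rule incl_subgroup[OF P D])
      have "twisted_diagonal D (restrict \<phi> D) \<in> FD"
        by (rule fdI[OF DS mor_restrict[OF P subgroup_carrier \<phi> DS DP]])
      then have "marks S (ghost S a) (restrict \<phi> D ` D) = marks S (ghost S a) D"
        using inv unfolding fusion_invariant_def by (metis Domain_twisted_diagonal Range_twisted_diagonal)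
      moreover have "restrict \<phi> D ` D = \<phi> ` D" by auto
      ultimately show "marks ?T (ghost ?T (burnside_restrict p ?T \<phi> a)) D = marks ?T (ghost ?T (burnside_restrict p ?T id a)) D"
        using res(2)[OF P m, of D] res(2)[OF P id, of D] DP by simp
    qed
  qed
qed

end


section \<open>Congruences for marks\<close>

text \<open>Divisibility by \<open>p\<close> in \<open>\<int>\<^sub>(\<^sub>p\<^sub>)\<close>, the maximal ideal of the local ring;
  \<open>punit\<close> is its complement in \<open>\<int>\<^sub>(\<^sub>p\<^sub>)\<close>, the group of units.\<close>

definition pdiv :: "nat \<Rightarrow> rat \<Rightarrow> bool" where
  "pdiv p x \<longleftrightarrow> (\<exists>y\<in>localized_int p. x = of_nat p * y)"

definition punit :: "nat \<Rightarrow> rat \<Rightarrow> bool" where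
  "punit p x \<longleftrightarrow> x \<in> localized_int p \<and> \<not> pdiv p x"

lemma pdiv_0: "prime p \<Longrightarrow> pdiv p 0"
  unfolding pdiv_def using localized_int_0 by force

lemma pdiv_add: "prime p \<Longrightarrow> pdiv p x \<Longrightarrow> pdiv p y \<Longrightarrow> pdiv p (x + y)"
  unfolding pdiv_def by (metis distrib_left localized_int_add)

lemma pdiv_uminus: "pdiv p x \<Longrightarrow> pdiv p (- x)"
  unfolding pdiv_def by (metis localized_int_uminus mult_minus_right)

lemma pdiv_sum: "prime p \<Longrightarrow> (\<And>i. i \<in> A \<Longrightarrow> pdiv p (f i)) \<Longrightarrow> pdiv p (\<Sum>i\<in>A. f i)"
  by (induction A rule: infinite_finite_induct) (auto intro: pdiv_0 pdiv_add)

lemma pdiv_mult_left: "prime p \<Longrightarrow> x \<in> localized_int p \<Longrightarrow> pdiv p y \<Longrightarrow> pdiv p (x * y)"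
  unfolding pdiv_def by (metis localized_int_mult mult.left_commute)

lemma pdiv_of_nat_iff:
  assumes p: "prime p"
  shows "pdiv p (of_nat n) \<longleftrightarrow> p dvd n"
proof
  assume "pdiv p (of_nat n)"
  then obtain a b where ab: "(of_nat n :: rat) = of_nat p * (of_int a / of_int b)" "\<not> int p dvd b"
    unfolding pdiv_def localized_int_def by auto
  then have "b \<noteq> 0" by auto
  then have "of_int (int n * b) = (of_int (int p * a) :: rat)" using ab by (simp add: field_simps)
  then have "int n * b = int p * a" by (simp only: of_int_eq_iff)
  then have "int p dvd int n * b" by simp
  moreover have "prime (int p)" using p by simp
  ultimately have "int p dvd int n" using ab(2) prime_dvd_multD by blast
  then show "p dvd n" by simp
next
  assume "p dvd n"
  then obtain k where "n = p * k" by auto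
  then show "pdiv p (of_nat n)"
    unfolding pdiv_def using localized_int_of_nat[OF p, of k] by auto
qed

lemma punit_inverse:
  assumes p: "prime p" and x: "punit p x"
  shows "x \<noteq> 0" "1 / x \<in> localized_int p"
proof -
  show "x \<noteq> 0" using x pdiv_0[OF p] unfolding punit_def by auto
  obtain a b where ab: "x = of_int a / of_int b" "\<not> int p dvd b"
    using x unfolding punit_def localized_int_def by auto
  have "\<not> int p dvd a"
  proof
    assume "int p dvd a"
    then obtain c where "a = int p * c" by auto
    then have "x = of_nat p * (of_int c / of_int b)" using ab by simp
    moreover have "of_int c / of_int b \<in> localized_int p" using ab(2) unfolding localized_int_def by auto
    ultimately show False using x unfolding punit_def pdiv_def by blast
  qed
  then show "1 / x \<in> localized_int p" using ab unfolding localized_int_def by force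
qed

lemma punit_cong:
  assumes p: "prime p" and "punit p x" "y \<in> localized_int p" "pdiv p (x - y)"
  shows "punit p y"
  unfolding punit_def
proof
  show "\<not> pdiv p y" using pdiv_add[OF p assms(4), of y] assms(2) unfolding punit_def by auto
qed (rule assms(3))

context finite_group
begin

lemma integral_values:
  assumes "prime p" "integral p G \<tau>"
  shows "\<tau> D \<in> localized_int p"
  unfolding coord_expansion[OF assms(2), of D]
  by (intro localized_int_sum localized_int_mult localized_int_of_nat coord_in_localized_int assms) auto

lemma marks_in_localized_int: "prime p \<Longrightarrow> integral p G \<tau> \<Longrightarrow> marks G \<tau> Q \<in> localized_int p"
  unfolding marks_def by (intro localized_int_sum integral_values) auto

lemma conj_set_carrier: "g \<in> carrier G \<Longrightarrow> conj_set G g (carrier G) = carrier G"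
proof -
  assume g: "g \<in> carrier G"
  have "card (conj_set G g (carrier G)) = card (carrier G)" by (rule card_conj_set[OF g order.refl])
  then show ?thesis
    using conj_set_closed[OF g order.refl] card_subset_eq[OF finite_carrier] by blast
qed

text \<open>In a \<open>p\<close>-group every orbit outside the fixed points has length divisible by \<open>p\<close>. For a ghost
  the coordinates at proper subgroups play the part of the numbers of such orbits.\<close>

lemma p_group_total:
  assumes p: "prime p" and ord: "order G = p ^ n" and \<tau>: "integral p G \<tau>"
  shows "pdiv p ((\<Sum>D | subgroup D G. \<tau> D) - \<tau> (carrier G))"
proof -
  let ?U = "{K. subgroup K G}"
  have G: "carrier G \<in> ?U" using subgroup_self by simp
  have cG: "coord G \<tau> (carrier G) = \<tau> (carrier G)"
  proof -
    have "conj_rep G (carrier G) = carrier G"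
      using conj_rep[OF subgroup_self] subgroup.subset card_conj_set card_subset_eq[OF finite_carrier]
      unfolding conjugate_def by (metis (no_types, lifting))
    moreover have "conj_stable G (carrier G) = carrier G" using conj_set_carrier by (auto simp: conj_stable_def)
    ultimately show ?thesis using card_carrier_pos by (simp add: coord_def)
  qed
  have "(\<Sum>D\<in>?U. \<tau> D) = (\<Sum>D\<in>?U. \<Sum>K\<in>?U. coord G \<tau> K * of_nat (stab_count G (coset_gset G K) D))"
    using coord_expansion[OF \<tau>] by (intro sum.cong[OF refl]) blast
  also have "\<dots> = (\<Sum>K\<in>?U. coord G \<tau> K * (\<Sum>D\<in>?U. of_nat (stab_count G (coset_gset G K) D) * 1))"
    by (subst sum.swap) (simp add: sum_distrib_left)
  also have "\<dots> = (\<Sum>K\<in>?U. coord G \<tau> K * (of_nat (card (carrier G)) / of_nat (card K)))"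
  proof (rule sum.cong[OF refl])
    fix K assume "K \<in> ?U"
    then have K: "subgroup K G" by simp
    show "coord G \<tau> K * (\<Sum>D\<in>?U. of_nat (stab_count G (coset_gset G K) D) * 1)
        = coord G \<tau> K * (of_nat (card (carrier G)) / of_nat (card K))"
      using sum_stab_count_coset[OF K, of "\<lambda>_. 1"] by simp
  qed
  also have "\<dots> = \<tau> (carrier G) + (\<Sum>K\<in>?U - {carrier G}. coord G \<tau> K * (of_nat (card (carrier G)) / of_nat (card K)))"
    using card_carrier_pos by (subst sum.remove[OF finite_subgroups G]) (simp add: cG)
  finally have "(\<Sum>D\<in>?U. \<tau> D) - \<tau> (carrier G)
    = (\<Sum>K\<in>?U - {carrier G}. coord G \<tau> K * (of_nat (card (carrier G)) / of_nat (card K)))" by simp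
  moreover have "pdiv p \<dots>"
  proof (rule pdiv_sum[OF p], rule pdiv_mult_left[OF p])
    fix K assume K: "K \<in> ?U - {carrier G}"
    then have Ks: "subgroup K G" by simp
    show "coord G \<tau> K \<in> localized_int p" by (rule coord_in_localized_int[OF p \<tau> Ks])
    have lag: "card (rcosets K) * card K = p ^ n" using lagrange[OF Ks] ord by simp
    have "K \<subset> carrier G" using K subgroup.subset[OF Ks] by auto
    then have "card K < p ^ n" using psubset_card_mono[OF finite_carrier] ord by (simp add: order_def)
    then have "card (rcosets K) \<noteq> 1" using lag by auto
    moreover have "card (rcosets K) dvd p ^ n" using lag by (metis dvd_triv_left)
    ultimately have "p dvd card (rcosets K)"
      using divides_primepow_nat[OF p] by (metis dvd_power gr0I power_0)
    moreover have "of_nat (card (carrier G)) / of_nat (card K) = (of_nat (card (rcosets K)) :: rat)"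
      using lag ord card_subgroup_pos[OF Ks]
      by (metis (no_types, lifting) nonzero_mult_div_cancel_right of_nat_0_eq_iff of_nat_mult order_def neq0_conv)
    ultimately show "pdiv p (of_nat (card (carrier G)) / of_nat (card K))" using pdiv_of_nat_iff[OF p] by simp
  qed
  ultimately show ?thesis by simp
qed

lemma p_group_fixed_point:
  assumes p: "prime p" and ord: "order G = p ^ n" and X: "finite_gset G X" and np: "\<not> p dvd card (fst X)"
  shows "\<exists>x\<in>fst X. stab G X x = carrier G"
proof (rule ccontr)
  assume "\<not> (\<exists>x\<in>fst X. stab G X x = carrier G)"
  then have "{x \<in> fst X. stab G X x = carrier G} = {}" by blast
  then have "stab_count G X (carrier G) = 0" unfolding stab_count_def by (simp only: card.empty)
  moreover have "(\<Sum>D | subgroup D G. of_nat (stab_count G X D)) = (of_nat (card (fst X)) :: rat)"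
    using sum_over_points[OF X, of "\<lambda>_. 1"] by simp
  ultimately have "pdiv p (of_nat (card (fst X)))"
    using p_group_total[OF p ord integral_stab_count[OF p X]] by simp
  then show False using np pdiv_of_nat_iff[OF p] by simp
qed

lemma marks_carrier: "marks G \<tau> (carrier G) = \<tau> (carrier G)"
proof -
  have "{D. subgroup D G \<and> carrier G \<subseteq> D} = {carrier G}"
    using subgroup_self subgroup.subset by blast
  then show ?thesis by (simp add: marks_def)
qed

lemma marks_one: "marks G \<tau> {\<one>} = (\<Sum>D | subgroup D G. \<tau> D)"
  unfolding marks_def by (rule sum.cong) (auto dest: subgroup.one_closed)

text \<open>Restrict to \<open>Q\<close>, where the marks at \<open>1\<close> and \<open>Q\<close> count all points and the fixed points.\<close>

lemma marks_p_congruence: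
  assumes p: "prime p" and ord: "order G = p ^ n" and a: "a \<in> burnside p G" and Q: "subgroup Q G"
  shows "pdiv p (marks G (ghost G a) {\<one>} - marks G (ghost G a) Q)"
proof -
  let ?T = "G\<lparr>carrier := Q\<rparr>"
  interpret T: finite_group ?T by (rule finite_group_subgroup[OF Q])
  have id: "id \<in> hom ?T G" using subgroup.mem_carrier[OF Q] by (auto simp: hom_def)
  have "card (rcosets Q) * card Q = p ^ n" using lagrange[OF Q] ord by simp
  then have "card Q dvd p ^ n" by (metis dvd_triv_right)
  then obtain k where k: "order ?T = p ^ k" using divides_primepow_nat[OF p] by (auto simp: order_def)
  let ?b = "burnside_restrict p ?T id a"
  have b: "?b \<in> burnside p ?T" and m: "R \<subseteq> Q \<Longrightarrow> marks ?T (ghost ?T ?b) R = marks G (ghost G a) R" for R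
    using burnside_restrict[OF finite_group_axioms T.finite_group_axioms p a id] by auto
  have "pdiv p (marks ?T (ghost ?T ?b) {\<one>} - marks ?T (ghost ?T ?b) Q)"
    using T.p_group_total[OF p k T.integral_ghost[OF p b]] T.marks_one[of "ghost ?T ?b"] T.marks_carrier[of "ghost ?T ?b"]
    by simp
  then show ?thesis using m[of "{\<one>}"] m[of Q] subgroup.one_closed[OF Q] by simp
qed

lemma subgroup_conj_stable:
  assumes D: "D \<subseteq> carrier G"
  shows "subgroup (conj_stable G D) G"
proof (rule subgroupI)
  show "conj_stable G D \<noteq> {}" using conj_set_one[OF D] by (auto simp: conj_stable_def)
  fix g assume g: "g \<in> conj_stable G D"
  then show "inv g \<in> conj_stable G D"
    using conj_set_inv(1)[of g D] D by (auto simp: conj_stable_def)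
  fix h assume "h \<in> conj_stable G D"
  then show "g \<otimes> h \<in> conj_stable G D" using g conj_set_mult[of g h D] D by (auto simp: conj_stable_def)
qed (auto simp: conj_stable_def)

lemma subgroup_sub_conj_stable:
  assumes D: "subgroup D G"
  shows "D \<subseteq> conj_stable G D"
proof
  fix d assume d: "d \<in> D"
  have dc: "d \<in> carrier G" by (rule subgroup.mem_carrier[OF D d])
  have "conj_set G d D \<subseteq> D"
    using d subgroup.m_closed[OF D] subgroup.m_inv_closed[OF D] by (auto simp: conj_set_def)
  moreover have "card (conj_set G d D) = card D" by (rule card_conj_set[OF dc subgroup.subset[OF D]])
  ultimately have "conj_set G d D = D" using card_subset_eq[OF finite_subgroup[OF D]] by blast
  then show "d \<in> conj_stable G D" using dc by (simp add: conj_stable_def)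
qed

lemma normalizer_eq:
  assumes "P \<subseteq> carrier G"
  shows "normalizer G P = conj_stable G P"
proof -
  have "g <# P #> inv g = conj_set G g P" for g
    by (auto simp: l_coset_def r_coset_def conj_set_def)
  then show ?thesis using assms by (auto simp: normalizer_def stabilizer_def conj_stable_def)
qed

end

text \<open>If two homomorphisms \<open>N \<rightarrow> G\<close> give the same marks on all subgroups strictly above a normal
  subgroup \<open>D\<close> of \<open>N\<close>, then the difference of the two restrictions to \<open>N\<close> has only points with
  stabilizer exactly \<open>D\<close> to offer to the mark at \<open>D\<close>, and these come in multiples of \<open>|N : D|\<close>.\<close>

lemma marks_congruence:
  assumes G: "finite_group G" and N: "finite_group N" and p: "prime p"
    and f1: "f1 \<in> hom N G" and f2: "f2 \<in> hom N G" and \<tau>: "integral p G \<tau>"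
    and D: "subgroup D N" and norm: "conj_stable N D = carrier N"
    and eq: "\<And>E. subgroup E N \<Longrightarrow> D \<subset> E \<Longrightarrow> marks G \<tau> (f1 ` E) = marks G \<tau> (f2 ` E)"
  shows "of_nat (card D) * (marks G \<tau> (f1 ` D) - marks G \<tau> (f2 ` D)) / of_nat (card (carrier N)) \<in> localized_int p"
proof -
  interpret G: finite_group G by fact
  interpret N: finite_group N by fact
  obtain a where a: "a \<in> burnside p G" "ghost G a = \<tau>" using G.burnside_of_ghost[OF p \<tau>] by blast
  note r1 = burnside_restrict[OF G N p a(1) f1] and r2 = burnside_restrict[OF G N p a(1) f2]
  let ?\<sigma>1 = "ghost N (burnside_restrict p N f1 a)" and ?\<sigma>2 = "ghost N (burnside_restrict p N f2 a)"
  let ?\<delta> = "\<lambda>E. ?\<sigma>1 E - ?\<sigma>2 E"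
  have marks\<delta>: "marks N ?\<delta> E = marks G \<tau> (f1 ` E) - marks G \<tau> (f2 ` E)" if "subgroup E N" for E
    using r1(2)[of E] r2(2)[of E] subgroup.subset[OF that] a(2) by (simp add: N.marks_diff)
  have "?\<delta> E = 0" if "subgroup E N" "D \<subset> E" for E
    by (rule N.ghost_eq_0_of_marks[of "\<lambda>E. D \<subset> E"]) (use that marks\<delta> eq in auto)
  then have "(\<Sum>E | subgroup E N \<and> D \<subset> E. ?\<delta> E) = 0" by (intro sum.neutral) auto
  then have "?\<delta> D = marks G \<tau> (f1 ` D) - marks G \<tau> (f2 ` D)" using N.marks_split[OF D, of ?\<delta>] marks\<delta>[OF D] by simp
  moreover have "integral p N (\<lambda>E. ?\<sigma>1 E + (-1) * ?\<sigma>2 E)"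
    by (intro N.integral_add N.integral_scale N.integral_ghost p r1 r2 localized_int_uminus localized_int_1)
  then have "of_nat (card D) * ?\<delta> D / of_nat (card (conj_stable N D)) \<in> localized_int p"
    using D unfolding integral_def by simp
  ultimately show ?thesis unfolding norm by simp
qed


section \<open>Extending conjugations to normalizers\<close>

context fusion_system
begin

lemma finite_homs: "subgroup P S \<Longrightarrow> finite (F P P)"
proof -
  assume P: "subgroup P S"
  have "F P P \<subseteq> PiE P (\<lambda>_. P)" using mor(3,4)[OF P P] by (auto simp: PiE_def)
  then show ?thesis by (rule finite_subset) (intro finite_PiE finite_subgroup P)
qed

lemma aut_image: "subgroup P S \<Longrightarrow> \<gamma> \<in> F P P \<Longrightarrow> \<gamma> ` P = P"
  using mor(2,3)[of P P \<gamma>] endo_inj_surj[OF finite_subgroup] by blast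

lemma group_aut_fusion:
  assumes P: "subgroup P S"
  shows "finite_group (aut_fusion F P)"
proof -
  have "group (aut_fusion F P)"
  proof (rule groupI)
    fix \<phi> \<psi> \<chi> assume a: "\<phi> \<in> carrier (aut_fusion F P)" "\<psi> \<in> carrier (aut_fusion F P)" "\<chi> \<in> carrier (aut_fusion F P)"
    then have f: "\<phi> \<in> F P P" "\<psi> \<in> F P P" "\<chi> \<in> F P P" by (auto simp: aut_fusion_def)
    show "\<phi> \<otimes>\<^bsub>aut_fusion F P\<^esub> \<psi> \<in> carrier (aut_fusion F P)"
      using compose_closed[OF P P P f(2) f(1)] by (simp add: aut_fusion_def)
    show "\<phi> \<otimes>\<^bsub>aut_fusion F P\<^esub> \<psi> \<otimes>\<^bsub>aut_fusion F P\<^esub> \<chi> = \<phi> \<otimes>\<^bsub>aut_fusion F P\<^esub> (\<psi> \<otimes>\<^bsub>aut_fusion F P\<^esub> \<chi>)"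
    proof
      fix u show "(\<phi> \<otimes>\<^bsub>aut_fusion F P\<^esub> \<psi> \<otimes>\<^bsub>aut_fusion F P\<^esub> \<chi>) u
          = (\<phi> \<otimes>\<^bsub>aut_fusion F P\<^esub> (\<psi> \<otimes>\<^bsub>aut_fusion F P\<^esub> \<chi>)) u"
        using mor(3)[OF P P f(3)] by (cases "u \<in> P") (auto simp: aut_fusion_def compose_def)
    qed
    show "\<one>\<^bsub>aut_fusion F P\<^esub> \<otimes>\<^bsub>aut_fusion F P\<^esub> \<phi> = \<phi>"
    proof
      fix u show "(\<one>\<^bsub>aut_fusion F P\<^esub> \<otimes>\<^bsub>aut_fusion F P\<^esub> \<phi>) u = \<phi> u"
        using mor(3,4)[OF P P f(1)] by (cases "u \<in> P") (auto simp: aut_fusion_def compose_def extensional_def)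
    qed
    have "inverse_map P \<phi> \<in> F P P" using inverse_closed[OF P P f(1)] aut_image[OF P f(1)] by simp
    moreover have "compose P (inverse_map P \<phi>) \<phi> = (\<lambda>x\<in>P. x)"
      using mor(2)[OF P P f(1)] by (auto simp: compose_def inverse_map_def restrict_def)
    ultimately show "\<exists>\<psi>\<in>carrier (aut_fusion F P). \<psi> \<otimes>\<^bsub>aut_fusion F P\<^esub> \<phi> = \<one>\<^bsub>aut_fusion F P\<^esub>"
      by (auto simp: aut_fusion_def)
  qed (use mor_incl[OF P P] in \<open>auto simp: aut_fusion_def\<close>)
  then show ?thesis
    using finite_homs[OF P] by (simp add: finite_group_def finite_group_axioms_def aut_fusion_def)
qed

lemma subgroup_extension_domain:
  assumes P: "subgroup P S" and \<phi>: "\<phi> \<in> F P (carrier S)"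
  shows "subgroup (extension_domain S P \<phi>) S"
proof -
  have Ps: "P \<subseteq> carrier S" by (rule subgroup.subset[OF P])
  note e = extension_domain_def normalizer_eq[OF Ps]
  have \<phi>c: "\<phi> u \<in> carrier S" if "u \<in> P" for u using mor(3)[OF P subgroup_carrier \<phi>] that by auto
  have st: "x \<otimes> u \<otimes> inv x \<in> P" if "x \<in> conj_stable S P" "u \<in> P" for x u
    using that by (auto simp: conj_stable_def conj_set_def)
  have N: "subgroup (conj_stable S P) S" by (rule subgroup_conj_stable[OF Ps])
  show ?thesis
  proof (rule subgroupI)
    show "extension_domain S P \<phi> \<subseteq> carrier S" unfolding e by (auto simp: conj_stable_def)
    have "\<one> \<in> extension_domain S P \<phi>"
      unfolding e using subgroup.one_closed[OF N] Ps \<phi>c by (auto intro!: bexI[of _ \<one>] simp: subset_iff)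
    then show "extension_domain S P \<phi> \<noteq> {}" by auto
    fix x assume "x \<in> extension_domain S P \<phi>"
    then obtain y where x: "x \<in> conj_stable S P" and y: "y \<in> carrier S"
      and xy: "\<And>u. u \<in> P \<Longrightarrow> \<phi> (x \<otimes> u \<otimes> inv x) = y \<otimes> \<phi> u \<otimes> inv y" unfolding e by auto
    have xc: "x \<in> carrier S" using x by (simp add: conj_stable_def)
    have ix: "inv x \<in> conj_stable S P" by (rule subgroup.m_inv_closed[OF N x])
    have "\<phi> (inv x \<otimes> u \<otimes> inv (inv x)) = inv y \<otimes> \<phi> u \<otimes> inv (inv y)" if u: "u \<in> P" for u
    proof -
      let ?v = "inv x \<otimes> u \<otimes> inv (inv x)"
      have v: "?v \<in> P" by (rule st[OF ix u])
      have uc: "u \<in> carrier S" using u Ps by auto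
      have "x \<otimes> ?v \<otimes> inv x = (x \<otimes> inv x) \<otimes> u \<otimes> (x \<otimes> inv x)"
        using xc uc by (simp only: m_assoc m_closed inv_closed inv_inv)
      then have "x \<otimes> ?v \<otimes> inv x = u" using xc uc by simp
      then have "\<phi> u = y \<otimes> \<phi> ?v \<otimes> inv y" using xy[OF v] by simp
      moreover have "inv y \<otimes> (y \<otimes> \<phi> ?v \<otimes> inv y) \<otimes> inv (inv y) = (inv y \<otimes> y) \<otimes> \<phi> ?v \<otimes> (inv y \<otimes> y)"
        using y \<phi>c[OF v] by (simp only: m_assoc m_closed inv_closed inv_inv)
      ultimately show ?thesis using y \<phi>c[OF v] by simp
    qed
    then show "inv x \<in> extension_domain S P \<phi>"
      unfolding e using ix y by (auto intro!: bexI[of _ "inv y"])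
    fix x' assume "x' \<in> extension_domain S P \<phi>"
    then obtain y' where x': "x' \<in> conj_stable S P" and y': "y' \<in> carrier S"
      and xy': "\<And>u. u \<in> P \<Longrightarrow> \<phi> (x' \<otimes> u \<otimes> inv x') = y' \<otimes> \<phi> u \<otimes> inv y'" unfolding e by auto
    have x'c: "x' \<in> carrier S" using x' by (simp add: conj_stable_def)
    have "\<phi> (x \<otimes> x' \<otimes> u \<otimes> inv (x \<otimes> x')) = y \<otimes> y' \<otimes> \<phi> u \<otimes> inv (y \<otimes> y')" if u: "u \<in> P" for u
    proof -
      have uc: "u \<in> carrier S" using u Ps by auto
      have "x \<otimes> x' \<otimes> u \<otimes> inv (x \<otimes> x') = x \<otimes> (x' \<otimes> u \<otimes> inv x') \<otimes> inv x"
        using xc x'c uc by (simp add: inv_mult_group m_assoc)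
      then have "\<phi> (x \<otimes> x' \<otimes> u \<otimes> inv (x \<otimes> x')) = y \<otimes> (y' \<otimes> \<phi> u \<otimes> inv y') \<otimes> inv y"
        using xy[OF st[OF x' u]] xy'[OF u] by simp
      then show ?thesis using y y' \<phi>c[OF u] by (simp add: inv_mult_group m_assoc)
    qed
    then show "x \<otimes> x' \<in> extension_domain S P \<phi>"
      unfolding e using subgroup.m_closed[OF N x x'] y y' by (auto intro!: bexI[of _ "y \<otimes> y'"])
  qed
qed

text \<open>The normalizer of \<open>\<Delta>(P, \<phi>)\<close> consists of the pairs \<open>(y, x)\<close> in the normalizers of \<open>\<phi> P\<close> and
  \<open>P\<close> for which \<open>\<phi>\<close> carries conjugation by \<open>x\<close> to conjugation by \<open>y\<close>.\<close>

abbreviation norm_diag :: "('a \<times> 'a) set \<Rightarrow> ('a \<times> 'a) set" where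
  "norm_diag D \<equiv> conj_stable S2 D"

lemma norm_diagD:
  assumes P: "subgroup P S" and \<phi>: "\<phi> \<in> F P (carrier S)" and yx: "(y, x) \<in> norm_diag (twisted_diagonal P \<phi>)"
  shows "x \<in> carrier S" "y \<in> carrier S" "conj_set S x P = P" "conj_set S y (\<phi> ` P) = \<phi> ` P"
    "\<And>u. u \<in> P \<Longrightarrow> \<phi> (x \<otimes> u \<otimes> inv x) = y \<otimes> \<phi> u \<otimes> inv y"
proof -
  let ?D = "twisted_diagonal P \<phi>"
  note m = mor[OF P subgroup_carrier \<phi>]
  have Ps: "P \<subseteq> carrier S" by (rule subgroup.subset[OF P])
  show c: "x \<in> carrier S" "y \<in> carrier S" using yx by (auto simp: conj_stable_def)
  have "conj_set S2 (y, x) ?D = (\<lambda>u. (y \<otimes> \<phi> u \<otimes> inv y, x \<otimes> u \<otimes> inv x)) ` P"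
    unfolding conj_set_def twisted_diagonal_def image_image
    by (rule image_cong) (use c in \<open>auto simp: is_group\<close>)
  then have e: "(\<lambda>u. (y \<otimes> \<phi> u \<otimes> inv y, x \<otimes> u \<otimes> inv x)) ` P = ?D"
    using yx by (simp add: conj_stable_def)
  have "Range ((\<lambda>u. (y \<otimes> \<phi> u \<otimes> inv y, x \<otimes> u \<otimes> inv x)) ` P) = conj_set S x P"
    "Domain ((\<lambda>u. (y \<otimes> \<phi> u \<otimes> inv y, x \<otimes> u \<otimes> inv x)) ` P) = conj_set S y (\<phi> ` P)"
    by (auto simp: conj_set_def)
  then show "conj_set S x P = P" "conj_set S y (\<phi> ` P) = \<phi> ` P"
    unfolding e Domain_twisted_diagonal Range_twisted_diagonal by auto
  fix u assume "u \<in> P"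
  then have "(y \<otimes> \<phi> u \<otimes> inv y, x \<otimes> u \<otimes> inv x) \<in> ?D" unfolding e[symmetric] by auto
  then show "\<phi> (x \<otimes> u \<otimes> inv x) = y \<otimes> \<phi> u \<otimes> inv y" by (auto simp: twisted_diagonal_def)
qed

lemma order_norm_diag:
  assumes "D \<in> FD"
  shows "finite_group (S2\<lparr>carrier := norm_diag D\<rparr>)" "\<exists>k. order (S2\<lparr>carrier := norm_diag D\<rparr>) = p ^ k"
proof -
  have N: "subgroup (norm_diag D) S2" by (rule SS.subgroup_conj_stable) (use fd_props(8)[OF assms] in simp)
  then show "finite_group (S2\<lparr>carrier := norm_diag D\<rparr>)" by (rule SS.finite_group_subgroup)
  obtain n where n: "order S = p ^ n" using p_group by auto
  have "order S2 = p ^ (n + n)" using n by (simp add: order_def card_cartesian_product power_add)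
  moreover have "card (rcosets\<^bsub>S2\<^esub> norm_diag D) * card (norm_diag D) = order S2"
    by (rule SS.lagrange[OF N])
  ultimately have "card (norm_diag D) dvd p ^ (n + n)" by (metis dvd_triv_right)
  then show "\<exists>k. order (S2\<lparr>carrier := norm_diag D\<rparr>) = p ^ k"
    using divides_primepow_nat[OF prime_p] by (auto simp: order_def)
qed

end

context saturated_fusion_system
begin

text \<open>Sylow's theorem in \<open>Aut\<^sub>\<F>(P\<^sub>0)\<close> moves the automorphisms of \<open>P\<^sub>0\<close> that the normalizer of a
  twisted diagonal induces into \<open>Aut\<^sub>S(P\<^sub>0)\<close>. It is applied in the form that a \<open>p\<close>-group fixes a
  coset of a Sylow subgroup.\<close>

lemma sylow_adjustment:
  assumes P: "subgroup P S" and \<phi>: "\<phi> \<in> F P (carrier S)"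
    and P0: "subgroup P0 S" "fully_normalized S F P0"
    and \<alpha>0: "\<alpha>0 \<in> F P (carrier S)" "\<alpha>0 ` P = P0"
  obtains \<alpha> where "\<alpha> \<in> F P (carrier S)" "\<alpha> ` P = P0"
    "\<And>y x. (y, x) \<in> norm_diag (twisted_diagonal P \<phi>) \<Longrightarrow>
       \<exists>n\<in>carrier S. \<forall>u\<in>P. \<alpha> (x \<otimes> u \<otimes> inv x) = n \<otimes> \<alpha> u \<otimes> inv n"
proof -
  let ?D = "twisted_diagonal P \<phi>" let ?\<Gamma> = "aut_fusion F P0" let ?A = "aut_conj S P0"
  let ?N = "S2\<lparr>carrier := norm_diag ?D\<rparr>"
  have D: "?D \<in> FD" by (rule fdI[OF P \<phi>])
  interpret N: finite_group ?N by (rule order_norm_diag(1)[OF D])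
  interpret \<Gamma>: finite_group ?\<Gamma> by (rule group_aut_fusion[OF P0(1)])
  have A: "subgroup ?A ?\<Gamma>" "card ?A = p ^ multiplicity p (order ?\<Gamma>)"
    using sylow_axiom[OF P0] by (auto simp: sylow_subgroup_def)
  have Ps: "P \<subseteq> carrier S" and P0s: "P0 \<subseteq> carrier S" using subgroup.subset P P0 by auto
  note m0 = mor[OF P subgroup_carrier \<alpha>0(1)]
  have \<alpha>0': "\<alpha>0 \<in> F P P0" "inverse_map P \<alpha>0 \<in> F P0 P"
    using onto_image[OF P subgroup_carrier \<alpha>0(1)] inverse_closed[OF P subgroup_carrier \<alpha>0(1)] \<alpha>0(2) by auto
  define \<beta>0 where "\<beta>0 = inv_into P \<alpha>0"
  have \<beta>0: "\<beta>0 v \<in> P" "\<alpha>0 (\<beta>0 v) = v" if "v \<in> P0" for v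
    unfolding \<beta>0_def using that \<alpha>0(2) by (auto simp: inv_into_into f_inv_into_f)
  have \<beta>0': "\<beta>0 (\<alpha>0 u) = u" if "u \<in> P" for u unfolding \<beta>0_def using m0(2) that by simp
  have nP: "x \<otimes> u \<otimes> inv x \<in> P" if "(y, x) \<in> norm_diag ?D" "u \<in> P" for x y u
    using norm_diagD(3)[OF P \<phi> that(1)] that(2) by (auto simp: conj_set_def)
  \<comment> \<open>The action of the normalizer on \<open>P\<^sub>0\<close>: conjugation by \<open>x\<close> on \<open>P\<close>, transported by \<open>\<alpha>0\<close>.\<close>
  define \<kappa> where "\<kappa> z = (\<lambda>v\<in>P0. \<alpha>0 (snd z \<otimes> \<beta>0 v \<otimes> inv (snd z)))" for z :: "'a \<times> 'a"
  have \<kappa>F: "\<kappa> z \<in> F P0 P0" if z: "z \<in> norm_diag ?D" for z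
  proof -
    obtain y x where yx: "z = (y, x)" by (cases z)
    have c: "conj_map S x P \<in> F P P"
      by (rule conj_closed[OF P P]) (use norm_diagD(1)[OF P \<phi>] nP z yx in \<open>auto simp: conj_map_def\<close>)
    have "\<kappa> z = compose P0 (compose P \<alpha>0 (conj_map S x P)) (inverse_map P \<alpha>0)"
      unfolding \<kappa>_def yx snd_conv
      using \<beta>0(1) \<alpha>0(2) by (auto simp: compose_def conj_map_def inverse_map_def \<beta>0_def restrict_def)
    then show ?thesis
      using compose_closed[OF P0(1) P P0(1) \<alpha>0'(2) compose_closed[OF P P P0(1) c \<alpha>0'(1)]] by simp
  qed
  have \<kappa>hom: "\<kappa> \<in> hom ?N ?\<Gamma>"
  proof (rule homI)
    show "\<kappa> z \<in> carrier ?\<Gamma>" if "z \<in> carrier ?N" for z using \<kappa>F that by (simp add: aut_fusion_def)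
    fix z z' assume zz: "z \<in> carrier ?N" "z' \<in> carrier ?N"
    obtain y x y' x' where yx: "z = (y, x)" "z' = (y', x')" by (cases z; cases z')
    have n: "(y, x) \<in> norm_diag ?D" "(y', x') \<in> norm_diag ?D" using zz yx by auto
    note xc = norm_diagD(1)[OF P \<phi> n(1)] norm_diagD(1)[OF P \<phi> n(2)]
    show "\<kappa> (z \<otimes>\<^bsub>?N\<^esub> z') = \<kappa> z \<otimes>\<^bsub>?\<Gamma>\<^esub> \<kappa> z'"
    proof
      fix v show "\<kappa> (z \<otimes>\<^bsub>?N\<^esub> z') v = (\<kappa> z \<otimes>\<^bsub>?\<Gamma>\<^esub> \<kappa> z') v"
      proof (cases "v \<in> P0")
        case True
        let ?w = "x' \<otimes> \<beta>0 v \<otimes> inv x'"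
        have w: "?w \<in> P" by (rule nP[OF n(2) \<beta>0(1)[OF True]])
        have "\<beta>0 v \<in> carrier S" using \<beta>0(1)[OF True] Ps by auto
        then have "x \<otimes> x' \<otimes> \<beta>0 v \<otimes> inv (x \<otimes> x') = x \<otimes> ?w \<otimes> inv x"
          using xc by (simp add: inv_mult_group m_assoc)
        moreover have "\<alpha>0 ?w \<in> P0" using w \<alpha>0(2) by auto
        ultimately show ?thesis using True \<beta>0'[OF w] by (simp add: aut_fusion_def compose_def \<kappa>_def yx)
      qed (simp add: aut_fusion_def compose_def \<kappa>_def yx)
    qed
  qed
  let ?Y = "gset_restrict \<kappa> (coset_gset ?\<Gamma> ?A)"
  have fY: "finite_gset ?N ?Y"
  proof -
    interpret \<kappa>: group_hom ?N ?\<Gamma> \<kappa>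
      using \<kappa>hom by (simp add: group_hom_def group_hom_axioms_def N.is_group \<Gamma>.is_group)
    note f = \<Gamma>.finite_gset_coset[OF A(1)]
    have k1: "\<kappa> z \<in> carrier ?\<Gamma>" if "z \<in> carrier ?N" for z using \<kappa>.hom_closed[OF that] .
    have k2: "\<kappa> (z \<otimes>\<^bsub>?N\<^esub> z') = \<kappa> z \<otimes>\<^bsub>?\<Gamma>\<^esub> \<kappa> z'" if "z \<in> carrier ?N" "z' \<in> carrier ?N" for z z'
      using \<kappa>.hom_mult[OF that] .
    have k3: "\<kappa> \<one>\<^bsub>?N\<^esub> = \<one>\<^bsub>?\<Gamma>\<^esub>" by (rule \<kappa>.hom_one)
    have "acts ?N (fst ?Y) (snd ?Y)"
      unfolding acts_def gset_restrict_def fst_conv snd_conv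
    proof (intro conjI ballI)
      note a = actsD[OF \<Gamma>.finite_gsetD(2)[OF f]]
      fix x assume x: "x \<in> fst (coset_gset ?\<Gamma> ?A)"
      show "snd (coset_gset ?\<Gamma> ?A) (\<kappa> \<one>\<^bsub>?N\<^esub>) x = x" unfolding k3 by (rule a(2)[OF x])
      fix z assume z: "z \<in> carrier ?N"
      show "snd (coset_gset ?\<Gamma> ?A) (\<kappa> z) x \<in> fst (coset_gset ?\<Gamma> ?A)" by (rule a(1)[OF k1[OF z] x])
      fix z' assume z': "z' \<in> carrier ?N"
      show "snd (coset_gset ?\<Gamma> ?A) (\<kappa> (z \<otimes>\<^bsub>?N\<^esub> z')) x
        = snd (coset_gset ?\<Gamma> ?A) (\<kappa> z) (snd (coset_gset ?\<Gamma> ?A) (\<kappa> z') x)"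
        unfolding k2[OF z z'] by (rule a(3)[OF k1[OF z] k1[OF z'] x])
    qed
    then show ?thesis
      unfolding N.finite_gset_iff
      using \<Gamma>.finite_gsetD(1,3)[OF f] k1 by (auto simp: gset_restrict_def)
  qed
  have fY': "fst ?Y = lcosets\<^bsub>?\<Gamma>\<^esub> ?A" by (simp add: gset_restrict_def coset_gset_def)
  have "\<not> p dvd card (fst ?Y)"
  proof
    assume d: "p dvd card (fst ?Y)"
    have "card (lcosets\<^bsub>?\<Gamma>\<^esub> ?A) * card ?A = order ?\<Gamma>" by (rule \<Gamma>.l_lagrange[OF \<Gamma>.finite_carrier A(1)])
    then have "p * p ^ multiplicity p (order ?\<Gamma>) dvd order ?\<Gamma>"
      using mult_dvd_mono[OF d dvd_refl[of "card ?A"]] A(2) unfolding fY' by simp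
    moreover have "order ?\<Gamma> \<noteq> 0" using \<Gamma>.card_carrier_pos by (simp add: order_def)
    moreover have "\<not> is_unit p" using prime_p not_prime_unit by blast
    ultimately have "Suc (multiplicity p (order ?\<Gamma>)) \<le> multiplicity p (order ?\<Gamma>)"
      by (intro multiplicity_geI) auto
    then show False by simp
  qed
  \<comment> \<open>The number of cosets of a Sylow subgroup is prime to \<open>p\<close>, so the \<open>p\<close>-group \<open>?N\<close> fixes one of them.\<close>
  then obtain C where C: "C \<in> lcosets\<^bsub>?\<Gamma>\<^esub> ?A" "stab ?N ?Y C = carrier ?N"
    using order_norm_diag(2)[OF D] N.p_group_fixed_point[OF prime_p _ fY] fY' by blast
  obtain \<gamma> where \<gamma>: "\<gamma> \<in> carrier ?\<Gamma>" "C = \<gamma> <#\<^bsub>?\<Gamma>\<^esub> ?A" using C(1) by (auto simp: LCOSETS_def)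
  have \<gamma>F: "\<gamma> \<in> F P0 P0" using \<gamma>(1) by (simp add: aut_fusion_def)
  note \<gamma>im = aut_image[OF P0(1) \<gamma>F] and \<gamma>m = mor[OF P0(1) P0(1) \<gamma>F]
  have key: "\<exists>n\<in>carrier S. \<forall>v\<in>P0. n \<otimes> v \<otimes> inv n \<in> P0 \<and> \<kappa> z (\<gamma> v) = \<gamma> (n \<otimes> v \<otimes> inv n)"
    if z: "z \<in> norm_diag ?D" for z
  proof -
    have "snd ?Y z C = C" using C(2) z by (auto simp: stabilizer_def)
    then have "\<kappa> z <#\<^bsub>?\<Gamma>\<^esub> C = C" using C(1) by (simp add: gset_restrict_def coset_gset_def)
    moreover have "\<gamma> \<in> C" unfolding \<gamma>(2) by (rule \<Gamma>.lcos_self[OF \<gamma>(1) A(1)])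
    ultimately have "\<kappa> z \<otimes>\<^bsub>?\<Gamma>\<^esub> \<gamma> \<in> \<gamma> <#\<^bsub>?\<Gamma>\<^esub> ?A" unfolding \<gamma>(2)[symmetric] by (auto simp: l_coset_def)
    then obtain a where a: "a \<in> ?A" "\<kappa> z \<otimes>\<^bsub>?\<Gamma>\<^esub> \<gamma> = \<gamma> \<otimes>\<^bsub>?\<Gamma>\<^esub> a" by (auto simp: l_coset_def)
    then obtain n where n: "n \<in> normalizer S P0" "a = conj_map S n P0" by (auto simp: aut_conj_def)
    have nn: "n \<in> carrier S" "conj_set S n P0 = P0" using n(1) unfolding normalizer_eq[OF P0s] by (auto simp: conj_stable_def)
    have "n \<otimes> v \<otimes> inv n \<in> P0 \<and> \<kappa> z (\<gamma> v) = \<gamma> (n \<otimes> v \<otimes> inv n)" if v: "v \<in> P0" for v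
    proof
      show "n \<otimes> v \<otimes> inv n \<in> P0" using nn(2) v by (auto simp: conj_set_def)
      show "\<kappa> z (\<gamma> v) = \<gamma> (n \<otimes> v \<otimes> inv n)"
        using fun_cong[OF a(2), of v] v by (simp add: aut_fusion_def compose_def n(2) conj_map_def)
    qed
    then show ?thesis using nn(1) by blast
  qed
  \<comment> \<open>Since \<open>\<gamma>\<close> represents a fixed coset, \<open>\<gamma>\<^sup>-\<^sup>1\<close> conjugates the image of \<open>\<kappa>\<close> into \<open>Aut\<^sub>S(P\<^sub>0)\<close>.\<close>
  define \<alpha> where "\<alpha> = compose P (inverse_map P0 \<gamma>) \<alpha>0"
  have "inverse_map P0 \<gamma> \<in> F P0 P0" using inverse_closed[OF P0(1) P0(1) \<gamma>F] \<gamma>im by simp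
  then have \<alpha>F': "\<alpha> \<in> F P P0" unfolding \<alpha>_def by (rule compose_closed[OF P P0(1) P0(1) \<alpha>0'(1)])
  have \<alpha>F: "\<alpha> \<in> F P (carrier S)"
    by (rule mor_codomain[OF P P0(1) \<alpha>F' subgroup_carrier]) (use mor(3)[OF P P0(1) \<alpha>F'] P0s in auto)
  have \<alpha>v: "\<alpha> u \<in> P0" "\<gamma> (\<alpha> u) = \<alpha>0 u" if u: "u \<in> P" for u
  proof -
    have "\<alpha>0 u \<in> \<gamma> ` P0" using u \<alpha>0(2) \<gamma>im by auto
    then show "\<alpha> u \<in> P0" "\<gamma> (\<alpha> u) = \<alpha>0 u"
      using u by (simp_all add: \<alpha>_def compose_def inverse_map_def inv_into_into f_inv_into_f)
  qed
  have "card (\<alpha> ` P) = card (\<alpha>0 ` P)"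
    using mor(2)[OF P P0(1) \<alpha>F'] m0(2) by (simp add: card_image)
  then have im: "\<alpha> ` P = P0"
    using \<alpha>v(1) \<alpha>0(2) by (intro card_subset_eq[OF finite_subgroup[OF P0(1)]]) auto
  show ?thesis
  proof (rule that[OF \<alpha>F im])
    fix y x assume yx: "(y, x) \<in> norm_diag ?D"
    obtain n where n: "n \<in> carrier S"
      and k: "\<And>v. v \<in> P0 \<Longrightarrow> n \<otimes> v \<otimes> inv n \<in> P0" "\<And>v. v \<in> P0 \<Longrightarrow> \<kappa> (y, x) (\<gamma> v) = \<gamma> (n \<otimes> v \<otimes> inv n)"
      using key[OF yx] by blast
    have "\<alpha> (x \<otimes> u \<otimes> inv x) = n \<otimes> \<alpha> u \<otimes> inv n" if u: "u \<in> P" for u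
    proof -
      have x: "x \<otimes> u \<otimes> inv x \<in> P" by (rule nP[OF yx u])
      have "\<gamma> (\<alpha> (x \<otimes> u \<otimes> inv x)) = \<alpha>0 (x \<otimes> u \<otimes> inv x)" by (rule \<alpha>v(2)[OF x])
      also have "\<dots> = \<kappa> (y, x) (\<gamma> (\<alpha> u))"
        using \<alpha>v(2)[OF u] \<beta>0'[OF u] u \<alpha>0(2) by (auto simp: \<kappa>_def)
      also have "\<dots> = \<gamma> (n \<otimes> \<alpha> u \<otimes> inv n)" by (rule k(2)[OF \<alpha>v(1)[OF u]])
      finally show ?thesis using inj_onD[OF \<gamma>m(2)] \<alpha>v(1)[OF x] k(1)[OF \<alpha>v(1)[OF u]] by blast
    qed
    then show "\<exists>n\<in>carrier S. \<forall>u\<in>P. \<alpha> (x \<otimes> u \<otimes> inv x) = n \<otimes> \<alpha> u \<otimes> inv n" using n by blast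
  qed
qed

text \<open>With \<open>D = \<Delta>(P, \<phi>)\<close>, choose \<open>\<alpha> : P \<rightarrow> P\<^sub>0\<close> by \<open>sylow_adjustment\<close> and put \<open>\<beta> = \<alpha> \<phi>\<^sup>-\<^sup>1\<close>. Then
  \<open>(\<beta>, \<alpha>)\<close> carries \<open>D\<close> to the identity of \<open>P\<^sub>0\<close>. For \<open>(y, x)\<close> in the normalizer of \<open>D\<close> one element
  of \<open>S\<close> serves as the witness both for \<open>x \<in> N\<^sub>\<alpha>\<close> and for \<open>y \<in> N\<^sub>\<beta>\<close>. So the extensions of \<open>\<alpha>\<close> and
  \<open>\<beta>\<close>, with graphs \<open>Ra\<close> and \<open>Rb\<close>, are defined on the two projections of the normalizer.\<close>

lemma normalizer_extension:
  assumes D: "D \<in> FD" and P0: "P0 \<in> fusion_class S F (Range D)" "fully_normalized S F P0"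
  obtains Ra Rb where "Ra \<in> FD" "Rb \<in> FD" "norm_diag D \<subseteq> Range Rb \<times> Range Ra" "Rb O D O Ra\<inverse> = Id_on P0"
proof -
  obtain P \<phi> where P: "subgroup P S" and \<phi>: "\<phi> \<in> F P (carrier S)" and D': "D = twisted_diagonal P \<phi>"
    using fdE[OF D] .
  have RD: "Range D = P" unfolding D' by (rule Range_twisted_diagonal)
  obtain R0 where R0: "R0 \<in> FD" "Range R0 = P" "P0 = Domain R0"
    using P0(1) unfolding RD fusion_class_eq[OF P] by auto
  have P0s: "subgroup P0 S" unfolding R0(3) by (rule fd_props(2)[OF R0(1)])
  obtain P' \<alpha>0 where \<alpha>0': "subgroup P' S" "\<alpha>0 \<in> F P' (carrier S)" "R0 = twisted_diagonal P' \<alpha>0"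
    using fdE[OF R0(1)] .
  then have "P' = P" "\<alpha>0 ` P' = P0" using R0 Range_twisted_diagonal Domain_twisted_diagonal by metis+
  then have \<alpha>0: "\<alpha>0 \<in> F P (carrier S)" "\<alpha>0 ` P = P0" using \<alpha>0' by auto
  obtain \<alpha> where \<alpha>: "\<alpha> \<in> F P (carrier S)" "\<alpha> ` P = P0"
    and key: "\<And>y x. (y, x) \<in> norm_diag D \<Longrightarrow> \<exists>n\<in>carrier S. \<forall>u\<in>P. \<alpha> (x \<otimes> u \<otimes> inv x) = n \<otimes> \<alpha> u \<otimes> inv n"
    unfolding D' by (rule sylow_adjustment[OF P \<phi> P0s P0(2) \<alpha>0]) blast
  note m\<phi> = mor[OF P subgroup_carrier \<phi>]
  let ?Q = "\<phi> ` P"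
  define \<beta> where "\<beta> = compose ?Q \<alpha> (inverse_map P \<phi>)"
  have \<beta>F: "\<beta> \<in> F ?Q (carrier S)"
    unfolding \<beta>_def
    by (rule compose_closed[OF m\<phi>(5) P subgroup_carrier inverse_closed[OF P subgroup_carrier \<phi>] \<alpha>(1)])
  have \<beta>: "\<beta> (\<phi> u) = \<alpha> u" if "u \<in> P" for u
    using that m\<phi>(2) by (simp add: \<beta>_def compose_def inverse_map_def)
  have \<beta>im: "\<beta> ` ?Q = P0" using \<beta> \<alpha>(2) by (auto simp: image_image)
  have fc: "fully_centralized S F P0" using sylow_axiom[OF P0s P0(2)] by simp
  obtain \<psi>a where \<psi>a: "\<psi>a \<in> F (extension_domain S P \<alpha>) (carrier S)" "restrict \<psi>a P = \<alpha>"
    using extension_axiom[OF P \<alpha>(1)] fc \<alpha>(2) by auto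
  obtain \<psi>b where \<psi>b: "\<psi>b \<in> F (extension_domain S ?Q \<beta>) (carrier S)" "restrict \<psi>b ?Q = \<beta>"
    using extension_axiom[OF m\<phi>(5) \<beta>F] fc \<beta>im by auto
  let ?Na = "extension_domain S P \<alpha>" let ?Nb = "extension_domain S ?Q \<beta>"
  let ?Ra = "twisted_diagonal ?Na \<psi>a" let ?Rb = "twisted_diagonal ?Nb \<psi>b"
  have Ps: "P \<subseteq> carrier S" and Qs: "?Q \<subseteq> carrier S" using subgroup.subset P m\<phi>(5) by auto
  have sub: "norm_diag D \<subseteq> ?Nb \<times> ?Na"
  proof (rule subrelI)
    fix y x assume yx: "(y, x) \<in> norm_diag D"
    note n = norm_diagD[OF P \<phi> yx[unfolded D']]
    obtain z where z: "z \<in> carrier S" "\<And>u. u \<in> P \<Longrightarrow> \<alpha> (x \<otimes> u \<otimes> inv x) = z \<otimes> \<alpha> u \<otimes> inv z"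
      using key[OF yx] by blast
    have "x \<in> ?Na" unfolding extension_domain_def normalizer_eq[OF Ps] using n z by (auto simp: conj_stable_def)
    moreover have "\<beta> (y \<otimes> v \<otimes> inv y) = z \<otimes> \<beta> v \<otimes> inv z" if "v \<in> ?Q" for v
    proof -
      from \<open>v \<in> ?Q\<close> obtain u where u: "u \<in> P" "v = \<phi> u" by (elim imageE)
      have "x \<otimes> u \<otimes> inv x \<in> P" using n(3) u(1) by (auto simp: conj_set_def)
      then have "\<beta> (\<phi> (x \<otimes> u \<otimes> inv x)) = z \<otimes> \<alpha> u \<otimes> inv z" using \<beta> z(2)[OF u(1)] by simp
      then show ?thesis using n(5)[OF u(1)] \<beta>[OF u(1)] u(2) by simp
    qed
    then have "y \<in> ?Nb" unfolding extension_domain_def normalizer_eq[OF Qs] using n z(1) by (auto simp: conj_stable_def)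
    ultimately show "(y, x) \<in> ?Nb \<times> ?Na" by simp
  qed
  have Ds: "D \<subseteq> norm_diag D" by (rule SS.subgroup_sub_conj_stable[OF fd_props(1)[OF D]])
  then have PN: "P \<subseteq> ?Na" "?Q \<subseteq> ?Nb" using sub unfolding D' twisted_diagonal_def by blast+
  have va: "\<psi>a u = \<alpha> u" if "u \<in> P" for u using fun_cong[OF \<psi>a(2), of u] that by simp
  have vb: "\<psi>b v = \<beta> v" if "v \<in> ?Q" for v using fun_cong[OF \<psi>b(2), of v] that by simp
  show ?thesis
  proof (rule that[of ?Ra ?Rb])
    show "?Ra \<in> FD" by (rule fdI[OF subgroup_extension_domain[OF P \<alpha>(1)] \<psi>a(1)])
    show "?Rb \<in> FD" by (rule fdI[OF subgroup_extension_domain[OF m\<phi>(5) \<beta>F] \<psi>b(1)])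
    show "norm_diag D \<subseteq> Range ?Rb \<times> Range ?Ra" using sub by (simp add: Range_twisted_diagonal)
    have "?Rb O D O ?Ra\<inverse> = (\<lambda>u. (\<psi>b (\<phi> u), \<psi>a u)) ` P"
      unfolding D' twisted_diagonal_def using PN by (auto simp: image_iff) blast
    also have "\<dots> = (\<lambda>u. (\<alpha> u, \<alpha> u)) ` P" by (rule image_cong) (auto simp: va vb \<beta>)
    also have "\<dots> = Id_on P0" unfolding \<alpha>(2)[symmetric] by (auto simp: Id_on_def)
    finally show "?Rb O D O ?Ra\<inverse> = Id_on P0" .
  qed
qed

end


section \<open>Existence of a characteristic element\<close>

context saturated_fusion_system
begin

text \<open>One fully normalized subgroup for each \<open>\<F>\<close>-conjugacy class. The marks of the characteristic
  element under construction are prescribed by their values at the identities of these subgroups.\<close>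

definition fully_normalized_rep :: "'a set \<Rightarrow> 'a set" where
  "fully_normalized_rep P = (SOME P0. P0 \<in> fusion_class S F P \<and> fully_normalized S F P0)"

lemma fusion_class_member:
  assumes "subgroup P S" "P0 \<in> fusion_class S F P"
  shows "fusion_class S F P0 = fusion_class S F P" "subgroup P0 S"
proof -
  obtain R where R: "R \<in> FD" "Range R = P" "P0 = Domain R"
    using assms(2) unfolding fusion_class_eq[OF assms(1)] by auto
  then show "fusion_class S F P0 = fusion_class S F P" "subgroup P0 S"
    using fusion_class_cong[OF R(1)] fd_props(2)[OF R(1)] by simp_all
qed

lemma self_in_fusion_class: "subgroup P S \<Longrightarrow> P \<in> fusion_class S F P"
  unfolding fusion_class_eq using fd_Id_on[of P] by force

lemma fully_normalized_rep:
  assumes P: "subgroup P S"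
  shows "fully_normalized_rep P \<in> fusion_class S F P" "fully_normalized S F (fully_normalized_rep P)"
proof -
  let ?C = "fusion_class S F P" let ?f = "\<lambda>Q. card (normalizer S Q)"
  have fin: "finite ?C" by (rule finite_subset[OF _ finite_subgroups]) (auto simp: fusion_class_def)
  have ne: "?C \<noteq> {}" using self_in_fusion_class[OF P] by auto
  then have "Max (?f ` ?C) \<in> ?f ` ?C" using fin by (intro Max_in) auto
  then obtain P0 where P0: "P0 \<in> ?C" "?f P0 = Max (?f ` ?C)" by auto
  then have "fully_normalized S F P0"
    unfolding fully_normalized_def fusion_class_member(1)[OF P P0(1)] using fin by auto
  then have "\<exists>P0. P0 \<in> ?C \<and> fully_normalized S F P0" using P0(1) by blast
  from someI_ex[OF this] show "fully_normalized_rep P \<in> ?C" "fully_normalized S F (fully_normalized_rep P)"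
    unfolding fully_normalized_rep_def by auto
qed

lemma fully_normalized_rep_cong: "R \<in> FD \<Longrightarrow> fully_normalized_rep (Domain R) = fully_normalized_rep (Range R)"
  unfolding fully_normalized_rep_def by (simp add: fusion_class_cong)

text \<open>The partial characteristic elements: stability is required at the graphs of order at least
  \<open>n\<close>, and no smaller graph is used as a stabilizer yet. The last clause fixes the normalization:
  a multiple \<open>|Z(S)|\<close> at the automorphisms of \<open>S\<close> means that every \<open>[S, \<phi>]\<close> up to conjugation,
  that is, every element of \<open>Out\<^sub>\<F>(S)\<close>, occurs once.\<close>

definition stable_above :: "nat \<Rightarrow> (('a \<times> 'a) set \<Rightarrow> rat) \<Rightarrow> bool" where
  "stable_above n \<tau> \<longleftrightarrow> integral p S2 \<tau> \<and> (\<forall>D. D \<notin> FD \<longrightarrow> \<tau> D = 0) \<and> (\<forall>D. card D < n \<longrightarrow> \<tau> D = 0) \<and>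
     (\<forall>D\<in>FD. n \<le> card D \<longrightarrow> marks S2 \<tau> D = marks S2 \<tau> (Id_on (Domain D)) \<and>
        marks S2 \<tau> D = marks S2 \<tau> (Id_on (Range D))) \<and>
     (\<forall>D\<in>FD. card D = card (carrier S) \<longrightarrow> \<tau> D = of_nat (card (centralizer S (carrier S))))"

lemma card_Id_on: "card (Id_on P) = card P"
proof -
  have "Id_on P = (\<lambda>u. (u, u)) ` P" by (auto simp: Id_on_def)
  then show ?thesis by (simp add: card_image inj_on_def)
qed

text \<open>For an automorphism \<open>\<phi>\<close> of \<open>S\<close> the pair \<open>(y, x)\<close> normalizes the graph if and only if \<open>y\<close> and
  \<open>\<phi> x\<close> induce the same conjugation, so \<open>y\<close> is determined by \<open>x\<close> up to the center.\<close>

lemma card_norm_diag_full: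
  assumes D: "D \<in> FD" and full: "card D = card (carrier S)"
  shows "card (norm_diag D) = card (carrier S) * card (centralizer S (carrier S))"
proof -
  obtain P \<phi> where P: "subgroup P S" and \<phi>: "\<phi> \<in> F P (carrier S)" and D': "D = twisted_diagonal P \<phi>"
    using fdE[OF D] .
  have "card P = card (carrier S)" using fd_props(7)[OF D] full unfolding D' Range_twisted_diagonal by simp
  then have PS: "P = carrier S" using card_subset_eq[OF finite_carrier subgroup.subset[OF P]] by simp
  note m = mor[OF P subgroup_carrier \<phi>]
  have im: "\<phi> ` carrier S = carrier S" using aut_image[OF subgroup_carrier] \<phi> PS by simp
  have \<phi>c: "\<phi> u \<in> carrier S" if "u \<in> carrier S" for u using im that by auto
  have \<phi>h: "\<phi> (u \<otimes> v) = \<phi> u \<otimes> \<phi> v" if "u \<in> carrier S" "v \<in> carrier S" for u v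
    using m(1) that PS by (simp add: hom_def)
  interpret PP: group "S\<lparr>carrier := P\<rparr>" using subgroup_imp_group[OF P] .
  interpret \<phi>: group_hom "S\<lparr>carrier := P\<rparr>" S \<phi>
    using m(1) by (simp add: group_hom_def group_hom_axioms_def is_group PP.is_group)
  have \<phi>i: "\<phi> (inv u) = inv (\<phi> u)" if "u \<in> carrier S" for u
    using \<phi>.hom_inv[of u] that PS m_inv_consistent[OF P] by simp
  let ?Z = "centralizer S (carrier S)"
  have "bij_betw (\<lambda>(x, z). (\<phi> x \<otimes> z, x)) (carrier S \<times> ?Z) (norm_diag D)"
  proof (rule bij_betw_byWitness[where f' = "\<lambda>(y, x). (x, inv (\<phi> x) \<otimes> y)"])
    show "\<forall>a\<in>carrier S \<times> ?Z. (case (case a of (x, z) \<Rightarrow> (\<phi> x \<otimes> z, x)) of (y, x) \<Rightarrow> (x, inv (\<phi> x) \<otimes> y)) = a"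
      using \<phi>c by (auto simp: centralizer_def m_assoc[symmetric])
    show "\<forall>a\<in>norm_diag D. (case (case a of (y, x) \<Rightarrow> (x, inv (\<phi> x) \<otimes> y)) of (x, z) \<Rightarrow> (\<phi> x \<otimes> z, x)) = a"
      using \<phi>c by (auto simp: conj_stable_def m_assoc[symmetric])
    show "(\<lambda>(x, z). (\<phi> x \<otimes> z, x)) ` (carrier S \<times> ?Z) \<subseteq> norm_diag D"
    proof (clarify)
      fix x z assume x: "x \<in> carrier S" and z: "z \<in> ?Z"
      have zc: "z \<in> carrier S" using z by (simp add: centralizer_def)
      have zu: "z \<otimes> u \<otimes> inv z = u" if u: "u \<in> carrier S" for u
      proof -
        have "z \<otimes> u = u \<otimes> z" using z u by (simp add: centralizer_def)
        then show ?thesis using zc u by (simp add: m_assoc)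
      qed
      have e: "\<phi> x \<otimes> z \<otimes> \<phi> u \<otimes> inv (\<phi> x \<otimes> z) = \<phi> (x \<otimes> u \<otimes> inv x)" if u: "u \<in> carrier S" for u
      proof -
        have "\<phi> x \<otimes> z \<otimes> \<phi> u \<otimes> inv (\<phi> x \<otimes> z) = \<phi> x \<otimes> (z \<otimes> \<phi> u \<otimes> inv z) \<otimes> inv (\<phi> x)"
          using zc \<phi>c x u by (simp add: m_assoc inv_mult_group)
        then show ?thesis using zu[OF \<phi>c[OF u]] x u by (simp add: \<phi>h \<phi>i)
      qed
      have "conj_set S2 (\<phi> x \<otimes> z, x) D = (\<lambda>u. (\<phi> (x \<otimes> u \<otimes> inv x), x \<otimes> u \<otimes> inv x)) ` carrier S"
        unfolding conj_set_def D' twisted_diagonal_def image_image PS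
        by (rule image_cong) (use zc \<phi>c x e in \<open>auto simp: is_group\<close>)
      also have "\<dots> = (\<lambda>u. (\<phi> u, u)) ` conj_set S x (carrier S)" unfolding conj_set_def image_image ..
      also have "\<dots> = D" unfolding conj_set_carrier[OF x] D' twisted_diagonal_def PS ..
      finally show "(\<phi> x \<otimes> z, x) \<in> norm_diag D" using zc \<phi>c x by (simp add: conj_stable_def)
    qed
    show "(\<lambda>(y, x). (x, inv (\<phi> x) \<otimes> y)) ` norm_diag D \<subseteq> carrier S \<times> ?Z"
    proof (clarify)
      fix y x assume yx: "(y, x) \<in> norm_diag D"
      note n = norm_diagD[OF P \<phi> yx[unfolded D']]
      have "inv (\<phi> x) \<otimes> y \<otimes> v = v \<otimes> (inv (\<phi> x) \<otimes> y)" if v: "v \<in> carrier S" for v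
      proof -
        obtain u where u: "u \<in> carrier S" "v = \<phi> u" using v im by auto
        have "\<phi> x \<otimes> v \<otimes> inv (\<phi> x) = y \<otimes> v \<otimes> inv y"
          using n(5)[of u] u n(1) PS by (simp add: \<phi>h \<phi>i)
        then have "inv (\<phi> x) \<otimes> (\<phi> x \<otimes> v \<otimes> inv (\<phi> x)) \<otimes> y = inv (\<phi> x) \<otimes> (y \<otimes> v \<otimes> inv y) \<otimes> y" by simp
        moreover have "inv (\<phi> x) \<otimes> (\<phi> x \<otimes> v \<otimes> inv (\<phi> x)) \<otimes> y = (inv (\<phi> x) \<otimes> \<phi> x) \<otimes> v \<otimes> inv (\<phi> x) \<otimes> y"
          using \<phi>c[OF n(1)] v n(2) by (simp only: m_assoc m_closed inv_closed)
        moreover have "inv (\<phi> x) \<otimes> (y \<otimes> v \<otimes> inv y) \<otimes> y = inv (\<phi> x) \<otimes> y \<otimes> v \<otimes> (inv y \<otimes> y)"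
          using \<phi>c[OF n(1)] v n(2) by (simp only: m_assoc m_closed inv_closed)
        ultimately show ?thesis using \<phi>c[OF n(1)] v n(2) by (simp add: m_assoc)
      qed
      then have "inv (\<phi> x) \<otimes> y \<in> ?Z" using n(1,2) \<phi>c by (simp add: centralizer_def)
      then show "x \<in> carrier S \<and> inv (\<phi> x) \<otimes> y \<in> ?Z" using n(1) by simp
    qed
  qed
  then have "card (carrier S \<times> ?Z) = card (norm_diag D)" by (rule bij_betw_same_card)
  then show ?thesis by (simp add: card_cartesian_product)
qed

lemma card_FD_le: "D \<in> FD \<Longrightarrow> card D \<le> card (carrier S)"
  using fd_props(3,7)[of D] card_mono[OF finite_carrier] subgroup.subset by metis

lemma card_subset_FD: "D \<in> FD \<Longrightarrow> E \<in> FD \<Longrightarrow> D \<subset> E \<Longrightarrow> card D < card E"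
  using SS.finite_subgroup[OF fd_props(1)] by (intro psubset_card_mono) auto

text \<open>There are no stabilizers strictly above \<open>D\<close>.\<close>

lemma marks_generated_top:
  assumes \<tau>: "generated_ghost \<tau>" and D: "D \<in> FD"
    and z: "\<And>E. E \<in> FD \<Longrightarrow> card D < card E \<Longrightarrow> \<tau> E = 0"
  shows "marks S2 \<tau> D = \<tau> D"
proof -
  have "(\<Sum>E | subgroup E S2 \<and> D \<subset> E. \<tau> E) = 0"
    by (rule sum.neutral) (use z \<tau> card_subset_FD[OF D] in \<open>unfold generated_ghost_def; blast\<close>)
  then show ?thesis using SS.marks_split[OF fd_props(1)[OF D], of \<tau>] by simp
qed

lemma conj_set_fd_range:
  assumes D: "D \<in> FD" and g: "g \<in> carrier S2"
  shows "fully_normalized_rep (Range (conj_set S2 g D)) = fully_normalized_rep (Range D)"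
proof -
  obtain s t where st: "g = (s, t)" "s \<in> carrier S" "t \<in> carrier S" using g by (cases g) auto
  let ?C = "(\<lambda>u. (t \<otimes> u \<otimes> inv t, u)) ` Range D"
  have C: "?C \<in> FD" by (rule fd_conj_graph[OF fd_props(3)[OF D] st(3)])
  have "conj_set S2 g D = (\<lambda>(a, b). (s \<otimes> a \<otimes> inv s, t \<otimes> b \<otimes> inv t)) ` D"
    unfolding conj_set_def st(1)
    by (rule image_cong) (use st(2,3) fd_props(8)[OF D] in \<open>auto simp: is_group\<close>)
  then have "Range (conj_set S2 g D) = Domain ?C" by (auto simp: image_iff)
  moreover have "Range ?C = Range D" by (auto simp: image_iff)
  ultimately show ?thesis using fully_normalized_rep_cong[OF C] by simp
qed

lemma stable_above_full: "\<exists>\<tau>. stable_above (card (carrier S)) \<tau>"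
proof -
  let ?n = "card (carrier S)" let ?z = "of_nat (card (centralizer S (carrier S))) :: rat"
  define \<tau> where "\<tau> D = (if D \<in> FD \<and> card D = ?n then ?z else 0)" for D
  have gen: "generated_ghost \<tau>" by (simp add: generated_ghost_def \<tau>_def)
  have mkD: "marks S2 \<tau> D = ?z" if "D \<in> FD" "?n \<le> card D" for D
  proof -
    have "card D = ?n" using card_FD_le[OF that(1)] that(2) by simp
    then show ?thesis using marks_generated_top[OF gen that(1)] that(1) by (simp add: \<tau>_def)
  qed
  have "integral p S2 \<tau>"
    unfolding integral_def
  proof (intro conjI allI impI ballI)
    fix D assume "\<not> subgroup D S2"
    then show "\<tau> D = 0" using fd_props(1) by (auto simp: \<tau>_def)
  next
    fix g D assume "g \<in> carrier S2" "subgroup D S2"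
    then show "\<tau> (conj_set S2 g D) = \<tau> D"
      using fd_conjugate_iff SS.card_conj_set[OF _ SS.subgroupE(1)] by (simp add: \<tau>_def)
  next
    fix D assume D: "subgroup D S2"
    show "of_nat (card D) * \<tau> D / of_nat (card (norm_diag D)) \<in> localized_int p"
    proof (cases "D \<in> FD \<and> card D = ?n")
      case True
      have "of_nat (card D) * \<tau> D = of_nat (card (norm_diag D))"
        using True card_norm_diag_full[of D] by (simp add: \<tau>_def)
      then have "of_nat (card D) * \<tau> D / of_nat (card (norm_diag D)) = (1 :: rat)"
        using SS.card_conj_stable_pos[OF D] by (simp del: of_nat_mult)
      then show ?thesis using localized_int_1[OF prime_p] by (simp only:)
    next
      case False
      then have "\<tau> D = 0" by (auto simp: \<tau>_def)
      then show ?thesis using localized_int_0[OF prime_p] by simp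
    qed
  qed
  moreover have "marks S2 \<tau> D = marks S2 \<tau> (Id_on (Domain D)) \<and>
        marks S2 \<tau> D = marks S2 \<tau> (Id_on (Range D))" if D: "D \<in> FD" "?n \<le> card D" for D
    using mkD[OF D] mkD[OF fd_Id_on[OF fd_props(2)[OF D(1)]]] mkD[OF fd_Id_on[OF fd_props(3)[OF D(1)]]]
      fd_props(6,7)[OF D(1)] D(2) by (simp add: card_Id_on)
  moreover have "\<tau> D = 0" if "D \<notin> FD \<or> card D < ?n" for D using that by (auto simp: \<tau>_def)
  moreover have "\<tau> D = ?z" if "D \<in> FD" "card D = ?n" for D using that by (simp add: \<tau>_def)
  ultimately show ?thesis
    unfolding stable_above_def by (intro exI[of _ \<tau>] conjI allI impI ballI) blast+
qed

text \<open>The pair of extensions in \<open>normalizer_extension\<close> is a homomorphism from the normalizer \<open>N\<close>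
  of \<open>D\<close> to \<open>S \<times> S\<close> that takes \<open>D\<close> to the identity of the fully normalized \<open>P\<^sub>0\<close>. Compare it with
  the inclusion of \<open>N\<close>: at a subgroup \<open>E\<close> strictly above \<open>D\<close> the two images of \<open>E\<close> are both
  graphs, with conjugate domains, or both no graphs. So the marks of \<open>\<tau>\<close> agree there by the
  stability already reached, and \<open>marks_congruence\<close> applies at \<open>D\<close>.\<close>

lemma stable_above_congruence:
  assumes \<tau>: "stable_above (Suc m) \<tau>" and D: "D \<in> FD" "card D = m"
  shows "of_nat (card D) * (marks S2 \<tau> (Id_on (fully_normalized_rep (Range D))) - marks S2 \<tau> D)
    / of_nat (card (norm_diag D)) \<in> localized_int p"
proof -
  let ?P0 = "fully_normalized_rep (Range D)"
  obtain Ra Rb where R: "Ra \<in> FD" "Rb \<in> FD" "norm_diag D \<subseteq> Range Rb \<times> Range Ra" "Rb O D O Ra\<inverse> = Id_on ?P0"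
    using normalizer_extension[OF D(1) fully_normalized_rep[OF fd_props(3)[OF D(1)]]] by blast
  let ?N = "S2\<lparr>carrier := norm_diag D\<rparr>"
  have N: "finite_group ?N" by (rule order_norm_diag(1)[OF D(1)])
  have sN: "subgroup (norm_diag D) S2"
    by (rule SS.subgroup_conj_stable) (use fd_props(8)[OF D(1)] in simp)
  have gen: "generated_ghost \<tau>" using \<tau> by (simp add: stable_above_def generated_ghost_def)
  have int: "integral p S2 \<tau>" using \<tau> by (simp add: stable_above_def)
  have st: "marks S2 \<tau> E = marks S2 \<tau> (Id_on (Domain E))"
    "marks S2 \<tau> E = marks S2 \<tau> (Id_on (Range E))" if "E \<in> FD" "m < card E" for E
    using \<tau> that by (auto simp: stable_above_def Suc_le_eq)
  define a where "a x = (THE a. (a, x) \<in> Ra)" for x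
  define b where "b y = (THE b. (b, y) \<in> Rb)" for y
  have aI: "(a x, x) \<in> Ra" if "x \<in> Range Ra" for x
  proof -
    have "\<exists>!a. (a, x) \<in> Ra" using that fd_props(5)[OF R(1)] by blast
    then show ?thesis unfolding a_def by (rule theI')
  qed
  have bI: "(b y, y) \<in> Rb" if "y \<in> Range Rb" for y
  proof -
    have "\<exists>!b. (b, y) \<in> Rb" using that fd_props(5)[OF R(2)] by blast
    then show ?thesis unfolding b_def by (rule theI')
  qed
  let ?f = "\<lambda>z. (b (fst z), a (snd z))"
  \<comment> \<open>Applying the pair of extensions to a subgroup is translation by their graphs.\<close>
  have im: "?f ` E = Rb O E O Ra\<inverse>" if "E \<subseteq> norm_diag D" for E
  proof
    show "?f ` E \<subseteq> Rb O E O Ra\<inverse>"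
    proof
      fix w assume "w \<in> ?f ` E"
      then obtain y x where yx: "(y, x) \<in> E" "w = (b y, a x)" by auto
      then have "(b y, y) \<in> Rb" "(a x, x) \<in> Ra" using that R(3) aI bI by blast+
      then show "w \<in> Rb O E O Ra\<inverse>" using yx by blast
    qed
    show "Rb O E O Ra\<inverse> \<subseteq> ?f ` E"
    proof (rule subrelI)
      fix v w assume "(v, w) \<in> Rb O E O Ra\<inverse>"
      then obtain y x where yx: "(v, y) \<in> Rb" "(y, x) \<in> E" "(w, x) \<in> Ra" by blast
      then have "(b y, y) \<in> Rb" "(a x, x) \<in> Ra" using aI bI by blast+
      then have "v = b y" "w = a x" using yx fd_props(5)[OF R(1)] fd_props(5)[OF R(2)] by blast+
      then show "(v, w) \<in> ?f ` E" using yx(2) by force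
    qed
  qed
  have f1: "?f \<in> hom ?N S2"
  proof (rule homI)
    fix z assume "z \<in> carrier ?N"
    then have "?f z \<in> Rb O norm_diag D O Ra\<inverse>" using im[OF order.refl] by auto
    then show "?f z \<in> carrier S2" using fd_props(8)[OF R(1)] fd_props(8)[OF R(2)] by auto
  next
    fix z z' assume z: "z \<in> carrier ?N" "z' \<in> carrier ?N"
    obtain y x y' x' where yx: "z = (y, x)" "z' = (y', x')" by (cases z; cases z')
    have r: "y \<in> Range Rb" "x \<in> Range Ra" "y' \<in> Range Rb" "x' \<in> Range Ra" using z yx R(3) by auto
    have "(b y \<otimes> b y', y \<otimes> y') \<in> Rb"
      by (rule subgroup_DirProdD(3)[OF is_group is_group fd_props(1)[OF R(2)] bI[OF r(1)] bI[OF r(3)]])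
    moreover have "(a x \<otimes> a x', x \<otimes> x') \<in> Ra"
      by (rule subgroup_DirProdD(3)[OF is_group is_group fd_props(1)[OF R(1)] aI[OF r(2)] aI[OF r(4)]])
    ultimately have "b (y \<otimes> y') = b y \<otimes> b y'" "a (x \<otimes> x') = a x \<otimes> a x'"
      using aI bI fd_props(5)[OF R(1)] fd_props(5)[OF R(2)] by blast+
    then show "?f (z \<otimes>\<^bsub>?N\<^esub> z') = ?f z \<otimes>\<^bsub>S2\<^esub> ?f z'" by (simp add: yx)
  qed
  have f2: "id \<in> hom ?N S2" using SS.subgroupE(1)[OF sN] by (auto simp: hom_def)
  have DN: "subgroup D ?N" by (rule SS.subgroup_incl[OF fd_props(1)[OF D(1)] sN SS.subgroup_sub_conj_stable[OF fd_props(1)[OF D(1)]]])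
  have norm: "conj_stable ?N D = carrier ?N"
  proof -
    have "conj_set ?N g D = conj_set S2 g D" if "g \<in> norm_diag D" for g
      unfolding conj_set_def using SS.m_inv_consistent[OF sN that] by simp
    then show ?thesis by (auto simp: conj_stable_def)
  qed
  have "of_nat (card D) * (marks S2 \<tau> (?f ` D) - marks S2 \<tau> (id ` D)) / of_nat (card (carrier ?N)) \<in> localized_int p"
  proof (rule marks_congruence[OF SS.finite_group_axioms N prime_p f1 f2 int DN norm])
    fix E assume E: "subgroup E ?N" "D \<subset> E"
    have EN: "E \<subseteq> norm_diag D" using subgroup.subset[OF E(1)] by simp
    have ES: "subgroup E S2" by (rule SS.incl_subgroup[OF sN E(1)])
    let ?E = "Rb O E O Ra\<inverse>"
    have E'S: "subgroup ?E S2"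
      by (intro subgroup_relcomp[OF is_group is_group is_group] fd_props(1) R ES subgroup_converse[OF is_group is_group])
    have dr: "Domain E \<subseteq> Range Rb" "Range E \<subseteq> Range Ra" using EN R(3) by auto
    have "marks S2 \<tau> ?E = marks S2 \<tau> E"
    proof (cases "E \<in> FD")
      case True
      have cE: "m < card E" using card_subset_FD[OF D(1) True E(2)] D(2) by simp
      let ?R = "Ra O Id_on (Range E)"
      have R': "?R \<in> FD" by (rule fd_relcomp[OF R(1) fd_Id_on[OF fd_props(3)[OF True]]])
      have RR: "Range ?R = Range E" by (simp add: Range_relcomp_sub dr(2))
      have E': "?E \<in> FD" by (intro fd_relcomp fd_converse R True)
      have RE: "Range ?E = Domain ?R" using dr(1) by (auto simp: Id_on_def) blast+
      have cR: "m < card ?R" using cE fd_props(7)[OF R'] fd_props(7)[OF True] RR by simp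
      then have cE': "m < card ?E" using fd_props(6)[OF R'] fd_props(7)[OF E'] RE by simp
      show ?thesis using st(2)[OF E' cE'] st[OF R' cR] st(2)[OF True cE] RE RR by simp
    next
      case False
      have "E = Rb\<inverse> O ?E O Ra"
      proof -
        have "Rb\<inverse> O ?E O Ra = (Rb\<inverse> O Rb) O E O (Ra\<inverse> O Ra)" by (simp add: O_assoc)
        also have "\<dots> = E" unfolding relcomp_converse_fd(2)[OF R(1)] relcomp_converse_fd(2)[OF R(2)]
          using dr by (simp add: relcomp_Id_on_eq Id_on_relcomp_eq)
        finally show ?thesis by simp
      qed
      then have "?E \<notin> FD" using False fd_relcomp[OF fd_converse[OF R(2)] fd_relcomp[OF _ R(1)]] by metis
      then show ?thesis
        using marks_not_fd[OF gen[unfolded generated_ghost_def] E'S] marks_not_fd[OF gen[unfolded generated_ghost_def] ES False]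
        by simp
    qed
    then show "marks S2 \<tau> (?f ` E) = marks S2 \<tau> (id ` E)" using im[OF EN] by simp
  qed
  moreover have "?f ` D = Id_on ?P0"
    using im[of D] R(4) SS.subgroup_sub_conj_stable[OF fd_props(1)[OF D(1)]] by simp
  ultimately show ?thesis by simp
qed

text \<open>At each graph \<open>D\<close> of order \<open>m\<close> the mark is corrected to the mark at the identity of the
  chosen subgroup. This changes no mark at larger graphs, and the congruence says that the
  correction is a sum of transitive sets with coefficients in \<open>\<int>\<^sub>(\<^sub>p\<^sub>)\<close>.\<close>

lemma stable_above_step:
  assumes \<tau>: "stable_above (Suc m) \<tau>" and m: "m < card (carrier S)"
  shows "\<exists>\<tau>'. stable_above m \<tau>'"
proof -
  have int: "integral p S2 \<tau>" and gen: "generated_ghost \<tau>"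
    using \<tau> by (auto simp: stable_above_def generated_ghost_def)
  define c where "c P = marks S2 \<tau> (Id_on (fully_normalized_rep P))" for P
  define \<delta> where "\<delta> D = (if D \<in> FD \<and> card D = m then c (Range D) - marks S2 \<tau> D else 0)" for D
  let ?\<tau> = "\<lambda>D. \<tau> D + \<delta> D"
  have "integral p S2 \<delta>"
    unfolding integral_def
  proof (intro conjI allI impI ballI)
    fix D assume "\<not> subgroup D S2"
    then show "\<delta> D = 0" using fd_props(1) by (auto simp: \<delta>_def)
  next
    fix g D assume g: "g \<in> carrier S2" and D: "subgroup D S2"
    note Ds = SS.subgroupE(1)[OF D]
    show "\<delta> (conj_set S2 g D) = \<delta> D"
      using fd_conjugate_iff[OF D g] SS.card_conj_set[OF g Ds] SS.marks_conj[OF int g Ds] conj_set_fd_range[OF _ g]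
      by (simp add: \<delta>_def c_def)
  next
    fix D assume D: "subgroup D S2"
    show "of_nat (card D) * \<delta> D / of_nat (card (norm_diag D)) \<in> localized_int p"
      using stable_above_congruence[OF \<tau>, of D] localized_int_0[OF prime_p] by (auto simp: \<delta>_def c_def)
  qed
  then have int': "integral p S2 ?\<tau>" by (rule SS.integral_add[OF prime_p int])
  have gen\<delta>: "generated_ghost \<delta>" by (simp add: generated_ghost_def \<delta>_def)
  have mk1: "marks S2 ?\<tau> D = marks S2 \<tau> D" if "D \<in> FD" "m < card D" for D
  proof -
    have "marks S2 \<delta> D = \<delta> D"
      by (rule marks_generated_top[OF gen\<delta> that(1)]) (use that(2) in \<open>simp add: \<delta>_def\<close>)
    moreover have "\<delta> D = 0" using that(2) by (simp add: \<delta>_def)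
    ultimately show ?thesis by (simp add: SS.marks_add)
  qed
  have mk2: "marks S2 ?\<tau> D = c (Range D)" if "D \<in> FD" "card D = m" for D
  proof -
    have "marks S2 \<delta> D = \<delta> D"
      by (rule marks_generated_top[OF gen\<delta> that(1)]) (use that(2) in \<open>simp add: \<delta>_def\<close>)
    moreover have "\<delta> D = c (Range D) - marks S2 \<tau> D" using that by (simp add: \<delta>_def)
    ultimately show ?thesis by (simp add: SS.marks_add)
  qed
  have "marks S2 ?\<tau> D = marks S2 ?\<tau> (Id_on (Domain D)) \<and>
        marks S2 ?\<tau> D = marks S2 ?\<tau> (Id_on (Range D))" if D: "D \<in> FD" "m \<le> card D" for D
  proof -
    note I = fd_Id_on[OF fd_props(2)[OF D(1)]] fd_Id_on[OF fd_props(3)[OF D(1)]]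
    have cI: "card (Id_on (Domain D)) = card D" "card (Id_on (Range D)) = card D"
      using fd_props(6,7)[OF D(1)] by (simp_all add: card_Id_on)
    show ?thesis
    proof (cases "card D = m")
      case True
      then show ?thesis
        using mk2[OF D(1)] mk2[OF I(1)] mk2[OF I(2)] cI fully_normalized_rep_cong[OF D(1)] by (simp add: c_def)
    next
      case False
      then have mD: "m < card D" using D(2) by simp
      have st: "marks S2 \<tau> D = marks S2 \<tau> (Id_on (Domain D)) \<and>
          marks S2 \<tau> D = marks S2 \<tau> (Id_on (Range D))"
        using D(1) mD \<tau> unfolding stable_above_def Suc_le_eq by blast
      have mI: "m < card (Id_on (Domain D))" "m < card (Id_on (Range D))" using cI mD by simp_all
      show ?thesis unfolding mk1[OF D(1) mD] mk1[OF I(1) mI(1)] mk1[OF I(2) mI(2)] by (rule st)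
    qed
  qed
  moreover have "?\<tau> D = 0" if "D \<notin> FD \<or> card D < m" for D
    using that \<tau> by (auto simp: stable_above_def \<delta>_def)
  moreover have "?\<tau> D = of_nat (card (centralizer S (carrier S)))" if "D \<in> FD" "card D = card (carrier S)" for D
    using that \<tau> m by (simp add: stable_above_def \<delta>_def)
  ultimately show ?thesis
    unfolding stable_above_def by (intro exI[of _ ?\<tau>] conjI allI impI ballI int') blast+
qed

lemma ex_stable_ghost: "\<exists>\<tau>. stable_above 0 \<tau>"
proof -
  have "\<exists>\<tau>. stable_above (card (carrier S) - k) \<tau>" for k
  proof (induction k)
    case 0
    then show ?case using stable_above_full by simp
  next
    case (Suc k)
    then show ?case
    proof (cases "k < card (carrier S)")
      case True
      then have "card (carrier S) - k = Suc (card (carrier S) - Suc k)" "card (carrier S) - Suc k < card (carrier S)"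
        by auto
      then show ?thesis using Suc stable_above_step by metis
    qed simp
  qed
  from this[of "card (carrier S)"] show ?thesis by simp
qed

text \<open>The group of inner automorphisms is \<open>S / Z(S)\<close>, obtained here as the orbit of the identity
  map under conjugation.\<close>

lemma card_aut_conj_carrier:
  "card (aut_conj S (carrier S)) * card (centralizer S (carrier S)) = card (carrier S)"
proof -
  let ?E = "PiE (carrier S) (\<lambda>_. carrier S)"
  let ?f = "\<lambda>x h. \<lambda>u\<in>carrier S. x \<otimes> h u \<otimes> inv x"
  let ?i = "\<lambda>u\<in>carrier S. u"
  have a: "acts S ?E ?f"
    unfolding acts_def
  proof (intro conjI ballI)
    fix g h k assume gh: "g \<in> carrier S" "h \<in> carrier S" and k: "k \<in> ?E"
    show "?f (g \<otimes> h) k = ?f g (?f h k)"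
    proof
      fix u show "?f (g \<otimes> h) k u = ?f g (?f h k) u"
        using gh k by (cases "u \<in> carrier S") (auto simp: inv_mult_group m_assoc PiE_iff)
    qed
  next
    fix k assume k: "k \<in> ?E"
    show "?f \<one> k = k"
      using k by (intro ext) (auto simp: PiE_iff extensional_def restrict_def)
  qed (auto simp: PiE_iff)
  have i: "?i \<in> ?E" by auto
  have "orbit S ?f ?i = aut_conj S (carrier S)"
  proof -
    have "normalizer S (carrier S) = carrier S"
      unfolding normalizer_eq[OF order.refl] conj_stable_def using conj_set_carrier by auto
    moreover have "?f x ?i = conj_map S x (carrier S)" for x by (auto simp: conj_map_def restrict_def)
    ultimately show ?thesis unfolding orbit_def aut_conj_def by auto
  qed
  moreover have "stabilizer S ?f ?i = centralizer S (carrier S)"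
  proof -
    have "?f x ?i = ?i \<longleftrightarrow> (\<forall>u\<in>carrier S. x \<otimes> u = u \<otimes> x)" if x: "x \<in> carrier S" for x
    proof -
      have "?f x ?i = ?i \<longleftrightarrow> (\<forall>u\<in>carrier S. x \<otimes> u \<otimes> inv x = u)"
        by (auto simp: restrict_def fun_eq_iff)
      also have "\<dots> \<longleftrightarrow> (\<forall>u\<in>carrier S. x \<otimes> u = u \<otimes> x)"
        using x by (intro ball_cong refl) (metis inv_solve_right m_closed)
      finally show ?thesis .
    qed
    then show ?thesis unfolding stabilizer_def centralizer_def by auto
  qed
  ultimately show ?thesis using card_orbit_stabilizer[OF a i] by simp
qed

lemma fully_normalized_carrier: "fully_normalized S F (carrier S)"
  unfolding fully_normalized_def
proof
  fix Q assume "Q \<in> fusion_class S F (carrier S)"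
  have "normalizer S Q \<subseteq> carrier S" by (auto simp: normalizer_def stabilizer_def)
  moreover have "normalizer S (carrier S) = carrier S"
    unfolding normalizer_eq[OF order.refl] conj_stable_def using conj_set_carrier by auto
  ultimately show "card (normalizer S Q) \<le> card (normalizer S (carrier S))"
    using card_mono[OF finite_carrier] by simp
qed

text \<open>At \<open>S\<close> the collapse counts the automorphisms of \<open>S\<close> in \<open>\<F>\<close>, each with the weight \<open>|Z(S)| /
  |S|\<close>, so its value is \<open>|Aut\<^sub>\<F>(S) : Inn(S)|\<close>. As \<open>S\<close> is fully normalized, the Sylow axiom makes
  this index prime to \<open>p\<close>.\<close>

lemma char_element_exists:
  "\<exists>X\<in>carrier (char_ring p S F). punit p (cmark X (carrier S))"
proof -
  obtain \<tau> where \<tau>: "stable_above 0 \<tau>" using ex_stable_ghost by auto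
  obtain X where X: "X \<in> bisets p S S" "gh X = \<tau>"
    using SS.burnside_of_ghost[OF prime_p] \<tau> unfolding stable_above_def by blast
  have Xc: "X \<in> carrier (char_ring p S F)"
    using X \<tau> unfolding char_iff stable_above_def generated_ghost_def left_stable_def right_stable_def by auto
  let ?z = "card (centralizer S (carrier S))" let ?\<Gamma> = "aut_fusion F (carrier S)"
  let ?Full = "{A \<in> FD. card A = card (carrier S)}"
  have dom: "carrier S \<subseteq> Domain A \<longleftrightarrow> card A = card (carrier S)" if "A \<in> FD" for A
  proof -
    note s = subgroup.subset[OF fd_props(2)[OF that]]
    show ?thesis
      using fd_props(6)[OF that] s card_subset_eq[OF finite_carrier s] by (metis order.refl subset_antisym)
  qed
  have "cmark X (carrier S) = (\<Sum>A\<in>FD. gh X A * of_bool (carrier S \<subseteq> Domain A)) / nS"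
    by (rule cmark_generated[OF X(1)]) (use Xc char_iff in auto)
  also have "(\<Sum>A\<in>FD. gh X A * of_bool (carrier S \<subseteq> Domain A)) = (\<Sum>A\<in>?Full. of_nat ?z)"
    using \<tau> finite_FD unfolding X(2) stable_above_def
    by (intro sum.mono_neutral_cong_right) (auto simp: dom)
  also have "\<dots> = of_nat (card ?Full * ?z)" by simp
  also have "card ?Full = order ?\<Gamma>"
  proof -
    have "bij_betw (twisted_diagonal (carrier S)) (F (carrier S) (carrier S)) ?Full"
      unfolding bij_betw_def
    proof
      show "inj_on (twisted_diagonal (carrier S)) (F (carrier S) (carrier S))"
      proof (rule inj_onI)
        fix \<phi> \<psi> assume f: "\<phi> \<in> F (carrier S) (carrier S)" "\<psi> \<in> F (carrier S) (carrier S)"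
          and e: "twisted_diagonal (carrier S) \<phi> = twisted_diagonal (carrier S) \<psi>"
        show "\<phi> = \<psi>"
        proof (rule extensionalityI)
          fix u assume "u \<in> carrier S"
          then have "(\<phi> u, u) \<in> twisted_diagonal (carrier S) \<psi>" unfolding e[symmetric] by (auto simp: twisted_diagonal_def)
          then show "\<phi> u = \<psi> u" by (auto simp: twisted_diagonal_def)
        qed (use mor(4)[OF subgroup_carrier subgroup_carrier] f in auto)
      qed
      show "twisted_diagonal (carrier S) ` F (carrier S) (carrier S) = ?Full"
      proof (intro equalityI subsetI)
        fix A assume "A \<in> twisted_diagonal (carrier S) ` F (carrier S) (carrier S)"
        then obtain \<phi> where \<phi>: "\<phi> \<in> F (carrier S) (carrier S)" "A = twisted_diagonal (carrier S) \<phi>" by auto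
        have A: "A \<in> FD" unfolding \<phi>(2) by (rule fdI[OF subgroup_carrier \<phi>(1)])
        then show "A \<in> ?Full" using fd_props(7)[OF A] Range_twisted_diagonal[of "carrier S" \<phi>] \<phi>(2) by simp
      next
        fix A assume A: "A \<in> ?Full"
        obtain P \<phi> where P: "subgroup P S" and \<phi>: "\<phi> \<in> F P (carrier S)" and A': "A = twisted_diagonal P \<phi>"
          using A fdE by blast
        have "card P = card (carrier S)" using fd_props(7)[of A] A Range_twisted_diagonal[of P \<phi>] A' by simp
        then have "P = carrier S" using card_subset_eq[OF finite_carrier subgroup.subset[OF P]] by simp
        then show "A \<in> twisted_diagonal (carrier S) ` F (carrier S) (carrier S)" using \<phi> A' by auto
      qed
    qed
    then show ?thesis using bij_betw_same_card by (fastforce simp: order_def aut_fusion_def)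
  qed
  finally have cm: "cmark X (carrier S) = of_nat (order ?\<Gamma> * ?z) / nS" .
  interpret \<Gamma>: finite_group ?\<Gamma> by (rule group_aut_fusion[OF subgroup_carrier])
  have sy: "card (aut_conj S (carrier S)) = p ^ multiplicity p (order ?\<Gamma>)"
    using sylow_axiom[OF subgroup_carrier fully_normalized_carrier] by (simp add: sylow_subgroup_def)
  have "order ?\<Gamma> \<noteq> 0" using \<Gamma>.card_carrier_pos by (simp add: order_def)
  moreover have "\<not> is_unit p" using prime_p not_prime_unit by blast
  ultimately obtain k where k: "order ?\<Gamma> = p ^ multiplicity p (order ?\<Gamma>) * k" "\<not> p dvd k"
    by (rule multiplicity_decompose')
  have "order ?\<Gamma> * ?z = k * card (carrier S)"
    using k(1) sy card_aut_conj_carrier by (metis mult.assoc mult.commute)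
  then have "cmark X (carrier S) = of_nat k" unfolding cm using card_carrier_pos by simp
  then have "punit p (cmark X (carrier S))"
    unfolding punit_def using k(2) pdiv_of_nat_iff[OF prime_p] localized_int_of_nat[OF prime_p] by simp
  then show ?thesis using Xc by blast
qed

end


section \<open>The characteristic idempotent and the isomorphism\<close>

text \<open>A set of elements that is determined by values in \<open>\<rat>\<close> on which the operations act pointwise
  is a ring as soon as it is closed under them. Both rings of the theorem are treated in this way,
  with the marks of the collapse and the marks themselves as values.\<close>

lemma ring_of_functions:
  fixes R :: "'r ring" and f :: "'r \<Rightarrow> 'i \<Rightarrow> rat"
  assumes inj: "\<And>x y. x \<in> carrier R \<Longrightarrow> y \<in> carrier R \<Longrightarrow> (\<And>i. i \<in> I \<Longrightarrow> f x i = f y i) \<Longrightarrow> x = y"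
    and add: "\<And>x y. x \<in> carrier R \<Longrightarrow> y \<in> carrier R \<Longrightarrow> x \<oplus>\<^bsub>R\<^esub> y \<in> carrier R"
      "\<And>x y i. x \<in> carrier R \<Longrightarrow> y \<in> carrier R \<Longrightarrow> i \<in> I \<Longrightarrow> f (x \<oplus>\<^bsub>R\<^esub> y) i = f x i + f y i"
    and mult: "\<And>x y. x \<in> carrier R \<Longrightarrow> y \<in> carrier R \<Longrightarrow> x \<otimes>\<^bsub>R\<^esub> y \<in> carrier R"
      "\<And>x y i. x \<in> carrier R \<Longrightarrow> y \<in> carrier R \<Longrightarrow> i \<in> I \<Longrightarrow> f (x \<otimes>\<^bsub>R\<^esub> y) i = f x i * f y i"
    and zero: "\<zero>\<^bsub>R\<^esub> \<in> carrier R" "\<And>i. i \<in> I \<Longrightarrow> f \<zero>\<^bsub>R\<^esub> i = 0"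
    and one: "\<one>\<^bsub>R\<^esub> \<in> carrier R" "\<And>i. i \<in> I \<Longrightarrow> f \<one>\<^bsub>R\<^esub> i = 1"
    and neg: "\<And>x. x \<in> carrier R \<Longrightarrow> \<exists>y\<in>carrier R. \<forall>i\<in>I. f y i = - f x i"
  shows "ring R"
proof (rule ringI)
  show "abelian_group R"
  proof (rule abelian_groupI)
    fix x assume x: "x \<in> carrier R"
    obtain y where y: "y \<in> carrier R" "\<And>i. i \<in> I \<Longrightarrow> f y i = - f x i" using neg[OF x] by blast
    have "y \<oplus>\<^bsub>R\<^esub> x = \<zero>\<^bsub>R\<^esub>" by (rule inj) (use x y add zero in simp_all)
    then show "\<exists>y\<in>carrier R. y \<oplus>\<^bsub>R\<^esub> x = \<zero>\<^bsub>R\<^esub>" using y(1) by blast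
    show "\<zero>\<^bsub>R\<^esub> \<oplus>\<^bsub>R\<^esub> x = x" by (rule inj) (use x add zero in simp_all)
  next
    fix x y z assume "x \<in> carrier R" "y \<in> carrier R" "z \<in> carrier R"
    then show "x \<oplus>\<^bsub>R\<^esub> y \<oplus>\<^bsub>R\<^esub> z = x \<oplus>\<^bsub>R\<^esub> (y \<oplus>\<^bsub>R\<^esub> z)" by (intro inj) (simp_all add: add)
  next
    fix x y assume "x \<in> carrier R" "y \<in> carrier R"
    then show "x \<oplus>\<^bsub>R\<^esub> y = y \<oplus>\<^bsub>R\<^esub> x" by (intro inj) (simp_all add: add)
  qed (use add zero in simp_all)
  show "monoid R"
  proof (rule monoidI)
    fix x y z assume "x \<in> carrier R" "y \<in> carrier R" "z \<in> carrier R"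
    then show "x \<otimes>\<^bsub>R\<^esub> y \<otimes>\<^bsub>R\<^esub> z = x \<otimes>\<^bsub>R\<^esub> (y \<otimes>\<^bsub>R\<^esub> z)" by (intro inj) (simp_all add: mult)
  next
    fix x assume "x \<in> carrier R"
    then show "\<one>\<^bsub>R\<^esub> \<otimes>\<^bsub>R\<^esub> x = x" "x \<otimes>\<^bsub>R\<^esub> \<one>\<^bsub>R\<^esub> = x" by (intro inj; simp add: mult one)+
  qed (use mult one in simp_all)
  fix x y z assume "x \<in> carrier R" "y \<in> carrier R" "z \<in> carrier R"
  then show "(x \<oplus>\<^bsub>R\<^esub> y) \<otimes>\<^bsub>R\<^esub> z = x \<otimes>\<^bsub>R\<^esub> z \<oplus>\<^bsub>R\<^esub> y \<otimes>\<^bsub>R\<^esub> z"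
    "z \<otimes>\<^bsub>R\<^esub> (x \<oplus>\<^bsub>R\<^esub> y) = z \<otimes>\<^bsub>R\<^esub> x \<oplus>\<^bsub>R\<^esub> z \<otimes>\<^bsub>R\<^esub> y"
    by (intro inj; simp add: add mult algebra_simps)+
qed

context saturated_fusion_system
begin

abbreviation CR :: "('a \<times> 'a) burnside ring" where "CR \<equiv> char_ring p S F"
abbreviation FR :: "'a burnside ring" where "FR \<equiv> fusion_burnside_ring p S F"
abbreviation smark :: "'a burnside \<Rightarrow> 'a set \<Rightarrow> rat" where "smark a \<equiv> marks S (ghost S a)"

lemma subgroup_one: "subgroup {\<one>} S"
  by (rule triv_subgroup)

lemma char_bisets: "X \<in> carrier CR \<Longrightarrow> X \<in> bisets p S S" "X \<in> carrier CR \<Longrightarrow> generated_ghost (gh X)"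
  using char_iff by auto

lemma char_of_ghost:
  assumes "integral p S2 \<tau>" "generated_ghost \<tau>" "left_stable \<tau>" "right_stable \<tau>"
  shows "\<exists>X\<in>carrier CR. gh X = \<tau>"
  using SS.burnside_of_ghost[OF prime_p assms(1)] assms(2-4) char_iff by metis

lemma char_sum:
  assumes "\<And>i. i \<in> A \<Longrightarrow> c i \<in> localized_int p" "\<And>i. i \<in> A \<Longrightarrow> X i \<in> carrier CR"
  shows "\<exists>Z\<in>carrier CR. gh Z = (\<lambda>D. \<Sum>i\<in>A. c i * gh (X i) D)"
proof (rule char_of_ghost)
  have X: "X i \<in> bisets p S S" "generated_ghost (gh (X i))" "left_stable (gh (X i))" "right_stable (gh (X i))"
    if "i \<in> A" for i using assms(2)[OF that] char_iff by auto
  show "integral p S2 (\<lambda>D. \<Sum>i\<in>A. c i * gh (X i) D)"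
    by (intro SS.integral_sum SS.integral_scale SS.integral_ghost prime_p X assms(1))
  show "generated_ghost (\<lambda>D. \<Sum>i\<in>A. c i * gh (X i) D)"
    using X(2) by (simp add: generated_ghost_def)
  show "left_stable (\<lambda>D. \<Sum>i\<in>A. c i * gh (X i) D)"
    using X(3) by (simp add: left_stable_def SS.marks_sum SS.marks_scale)
  show "right_stable (\<lambda>D. \<Sum>i\<in>A. c i * gh (X i) D)"
    using X(4) by (simp add: right_stable_def SS.marks_sum SS.marks_scale)
qed

lemma cmark_sum:
  assumes "\<And>i. i \<in> A \<Longrightarrow> X i \<in> carrier CR" "Z \<in> carrier CR" "gh Z = (\<lambda>D. \<Sum>i\<in>A. c i * gh (X i) D)"
  shows "cmark Z Q = (\<Sum>i\<in>A. c i * cmark (X i) Q)"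
proof -
  have "cmark Z Q = (\<Sum>D\<in>FD. \<Sum>i\<in>A. c i * gh (X i) D * of_bool (Q \<subseteq> Domain D)) / nS"
    unfolding cmark_generated[OF char_bisets[OF assms(2)]] assms(3) by (simp add: sum_distrib_right)
  also have "\<dots> = (\<Sum>i\<in>A. \<Sum>D\<in>FD. c i * gh (X i) D * of_bool (Q \<subseteq> Domain D)) / nS"
    by (subst sum.swap) simp
  also have "\<dots> = (\<Sum>i\<in>A. c i * cmark (X i) Q)"
    unfolding sum_divide_distrib
    by (rule sum.cong[OF refl])
       (simp add: cmark_generated[OF char_bisets[OF assms(1)]] sum_distrib_left mult.assoc sum_divide_distrib)
  finally show ?thesis .
qed

lemma cmark_mult:
  "X \<in> carrier CR \<Longrightarrow> Y \<in> carrier CR \<Longrightarrow> subgroup Q S \<Longrightarrow> cmark (comp X Y) Q = cmark X Q * cmark Y Q"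
  by (rule cmark_comp_mult[OF char_bisets char_bisets cmark_char_invariant])

lemma cmark_congruence:
  assumes X: "X \<in> carrier CR" and Q: "subgroup Q S"
  shows "pdiv p (cmark X {\<one>} - cmark X Q)"
  using p_group marks_p_congruence[OF prime_p _ collapse_in[OF char_bisets(1)[OF X]] Q] by blast

lemma cmark_localized: "X \<in> carrier CR \<Longrightarrow> cmark X Q \<in> localized_int p"
  by (intro marks_in_localized_int integral_ghost prime_p collapse_in char_bisets)

text \<open>If all values of \<open>u\<close> are units, then \<open>1 - (1 - u) (1 - u / u\<^sub>1) \<cdots> (1 - u / u\<^sub>k)\<close> is
  identically \<open>1\<close> when \<open>u\<^sub>1, \<dots>, u\<^sub>k\<close> are these values, and it is a polynomial in \<open>u\<close> without
  constant term. So it makes sense in a ring that is not yet known to have a unit. The polynomial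
  is built up one factor at a time: passing from \<open>w\<close> to \<open>w + u\<^sub>i\<^sup>-\<^sup>1 u (1 - w)\<close> multiplies \<open>1 - w\<close>
  by \<open>1 - u / u\<^sub>i\<close>.\<close>

lemma char_unit_exists: "\<exists>w\<in>carrier CR. \<forall>Q. subgroup Q S \<longrightarrow> cmark w Q = 1"
proof -
  obtain u where u: "u \<in> carrier CR" "punit p (cmark u (carrier S))" using char_element_exists by blast
  have un: "punit p (cmark u Q)" if Q: "subgroup Q S" for Q
  proof (rule punit_cong[OF prime_p u(2) cmark_localized[OF u(1)]])
    have "pdiv p ((cmark u {\<one>} - cmark u Q) + - (cmark u {\<one>} - cmark u (carrier S)))"
      by (intro pdiv_add pdiv_uminus cmark_congruence prime_p u Q subgroup_carrier)
    then show "pdiv p (cmark u (carrier S) - cmark u Q)" by simp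
  qed
  have "finite T \<Longrightarrow> T \<subseteq> {Q. subgroup Q S} \<Longrightarrow> \<exists>w\<in>carrier CR. \<forall>Q\<in>T. cmark w Q = 1" for T
  proof (induction T rule: finite_induct)
    case empty
    then show ?case using u(1) by auto
  next
    case (insert Q0 T)
    then obtain w where w: "w \<in> carrier CR" "\<forall>Q\<in>T. cmark w Q = 1" by auto
    have Q0: "subgroup Q0 S" using insert by auto
    let ?v = "1 / cmark u Q0"
    note v = punit_inverse[OF prime_p un[OF Q0]]
    let ?X = "\<lambda>i::nat. if i = 0 then w else if i = 1 then u else comp u w"
    let ?c = "\<lambda>i::nat. if i = 0 then 1 else if i = 1 then ?v else - ?v"
    have X: "?X i \<in> carrier CR" for i using w(1) u(1) char_comp_closed by auto
    have "?c i \<in> localized_int p" for i using v(2) localized_int_1[OF prime_p] localized_int_uminus by auto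
    then obtain z where z: "z \<in> carrier CR" "gh z = (\<lambda>D. \<Sum>i\<in>{..<3}. ?c i * gh (?X i) D)"
      using char_sum[of "{..<3}" ?c ?X] X by blast
    have cz: "cmark z Q = cmark w Q + ?v * cmark u Q * (1 - cmark w Q)" if Q: "subgroup Q S" for Q
    proof -
      have "cmark z Q = (\<Sum>i<3. ?c i * cmark (?X i) Q)" by (rule cmark_sum[OF X z])
      also have "\<dots> = cmark w Q + ?v * cmark u Q - ?v * cmark (comp u w) Q" by (simp add: numeral_3_eq_3)
      also have "\<dots> = cmark w Q + ?v * cmark u Q * (1 - cmark w Q)"
      proof -
        have "a + v * b - v * (b * a) = a + v * b * (1 - a)" for a b v :: rat by (simp add: algebra_simps)
        then show ?thesis unfolding cmark_mult[OF u(1) w(1) Q] .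
      qed
      finally show ?thesis .
    qed
    have "cmark z Q0 = 1" using cz[OF Q0] v(1) by simp
    moreover have "cmark z Q = 1" if "Q \<in> T" for Q using cz[of Q] w(2) that insert(4) by auto
    ultimately show ?case using z(1) by auto
  qed
  from this[OF finite_subgroups order.refl] show ?thesis by auto
qed

lemma augmentation_eq:
  assumes "X \<in> carrier CR"
  shows "augmentation S X = cmark X {\<one>}"
proof -
  have "augmentation S X = (\<Sum>D | subgroup D S2. gh X D * (1 / of_nat (order S)))"
    unfolding augmentation_def
  proof (rule SS.rat_ext_eq[OF prime_p char_bisets(1)[OF assms]])
    fix Y :: "('a \<times> 'a, nat) gset" assume "finite_gset S2 Y"
    from SS.sum_over_points[OF this, of "\<lambda>_. 1 / of_nat (order S)"]
    show "of_nat (card (fst Y)) / of_nat (order S)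
      = (\<Sum>D | subgroup D S2. of_nat (stab_count S2 Y D) * (1 / of_nat (order S) :: rat))" by simp
  qed
  also have "\<dots> = (\<Sum>D\<in>FD. gh X D * (1 / of_nat (order S)))"
    by (rule sum_FD) (use char_bisets(2)[OF assms] in \<open>simp add: generated_ghost_def\<close>)
  also have "\<dots> = cmark X {\<one>}"
    unfolding cmark_generated[OF char_bisets[OF assms]] sum_divide_distrib
    by (rule sum.cong[OF refl]) (use subgroup.one_closed[OF fd_props(2)] in \<open>auto simp: order_def\<close>)
  finally show ?thesis .
qed

text \<open>The values of an idempotent are \<open>0\<close> or \<open>1\<close>. They are congruent modulo \<open>p\<close>, and the
  augmentation is the value at the trivial subgroup. So an idempotent with invertible augmentation
  has all values \<open>1\<close>, which leaves only one.\<close>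

lemma char_idempotent:
  "char_idempotent p S F \<in> carrier CR" "subgroup Q S \<Longrightarrow> cmark (char_idempotent p S F) Q = 1"
proof -
  obtain w where w: "w \<in> carrier CR" "\<And>Q. subgroup Q S \<Longrightarrow> cmark w Q = 1" using char_unit_exists by blast
  have "char_idempotent p S F = w"
    unfolding char_idempotent_def
  proof (rule the_equality)
    have "comp w w = w"
      by (rule cmark_char_inject[OF char_comp_closed[OF w(1) w(1)] w(1)]) (simp add: cmark_mult w)
    moreover have "augmentation S w = 1" using augmentation_eq[OF w(1)] w(2)[OF subgroup_one] by simp
    ultimately show "w \<in> bisets p S S \<and> comp w w = w \<and> biset_generated p S F w \<and> biset_stable p S F w \<and>
       (\<exists>u\<in>localized_int p. augmentation S w \<in> localized_int p \<and> augmentation S w * u = 1)"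
      using w(1) localized_int_1[OF prime_p] by (auto simp: char_ring_def)
  next
    fix x assume x: "x \<in> bisets p S S \<and> comp x x = x \<and> biset_generated p S F x \<and> biset_stable p S F x \<and>
       (\<exists>u\<in>localized_int p. augmentation S x \<in> localized_int p \<and> augmentation S x * u = 1)"
    then have xc: "x \<in> carrier CR" by (simp add: char_ring_def)
    have id: "cmark x Q = 0 \<or> cmark x Q = 1" if "subgroup Q S" for Q
      using cmark_mult[OF xc xc that] x by auto
    have "cmark x {\<one>} \<noteq> 0" using x augmentation_eq[OF xc] by auto
    then have 1: "cmark x {\<one>} = 1" using id[OF subgroup_one] by simp
    have "\<not> pdiv p 1" using pdiv_of_nat_iff[OF prime_p, of 1] prime_p not_prime_unit by auto
    then have "cmark x Q = 1" if Q: "subgroup Q S" for Q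
      using cmark_congruence[OF xc Q] id[OF Q] 1 by auto
    then show "x = w" using cmark_char_inject[OF xc w(1)] w(2) by simp
  qed
  then show "char_idempotent p S F \<in> carrier CR" "subgroup Q S \<Longrightarrow> cmark (char_idempotent p S F) Q = 1"
    using w by auto
qed

lemma char_add:
  assumes "X \<in> carrier CR" "Y \<in> carrier CR"
  shows "burnside_add p S2 X Y \<in> carrier CR"
    "cmark (burnside_add p S2 X Y) Q = cmark X Q + cmark Y Q"
proof -
  note X = char_bisets[OF assms(1)] and Y = char_bisets[OF assms(2)]
  note a = SS.burnside_add[OF prime_p X(1) Y(1)]
  show "burnside_add p S2 X Y \<in> carrier CR"
  proof -
    have l: "left_stable (gh X)" "left_stable (gh Y)" and r: "right_stable (gh X)" "right_stable (gh Y)"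
      using assms char_iff by auto
    have "left_stable (gh (burnside_add p S2 X Y))"
      using l unfolding left_stable_def a(2) SS.marks_add by simp
    moreover have "right_stable (gh (burnside_add p S2 X Y))"
      using r unfolding right_stable_def a(2) SS.marks_add by simp
    moreover have "generated_ghost (gh (burnside_add p S2 X Y))"
      using X(2) Y(2) unfolding generated_ghost_def a(2) by simp
    ultimately show ?thesis using a(1) char_iff by blast
  qed
  then have "burnside_add p S2 X Y \<in> bisets p S S" "generated_ghost (gh (burnside_add p S2 X Y))"
    by (rule char_bisets)+
  then show "cmark (burnside_add p S2 X Y) Q = cmark X Q + cmark Y Q"
    unfolding cmark_generated[OF X] cmark_generated[OF Y]
    by (simp add: cmark_generated a(2) distrib_right sum.distrib add_divide_distrib)
qed

lemma ring_char_ring: "ring CR"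
proof (rule ring_of_functions[where f = cmark and I = "{Q. subgroup Q S}"])
  fix X Y assume X: "X \<in> carrier CR" and Y: "Y \<in> carrier CR"
  show "X = Y" if "\<And>Q. Q \<in> {Q. subgroup Q S} \<Longrightarrow> cmark X Q = cmark Y Q"
    using cmark_char_inject[OF X Y] that by auto
  show "X \<oplus>\<^bsub>CR\<^esub> Y \<in> carrier CR" "\<And>Q. cmark (X \<oplus>\<^bsub>CR\<^esub> Y) Q = cmark X Q + cmark Y Q"
    using char_add[OF X Y] by (simp_all add: char_ring_def)
  show "X \<otimes>\<^bsub>CR\<^esub> Y \<in> carrier CR" using char_comp_closed[OF X Y] by (simp add: char_ring_def)
  show "cmark (X \<otimes>\<^bsub>CR\<^esub> Y) Q = cmark X Q * cmark Y Q" if "Q \<in> {Q. subgroup Q S}" for Q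
    using cmark_mult[OF X Y] that by (simp add: char_ring_def)
next
  have z: "burnside_zero p S2 \<in> bisets p S S" "gh (burnside_zero p S2) = (\<lambda>_. 0)"
    using SS.burnside_zero[OF prime_p] by auto
  have "generated_ghost (gh (burnside_zero p S2))" by (simp add: z generated_ghost_def)
  then show "cmark \<zero>\<^bsub>CR\<^esub> Q = 0" for Q
    by (simp add: char_ring_def cmark_generated[OF z(1)] z(2))
  have "burnside_zero p S2 \<in> carrier CR"
    unfolding char_iff generated_ghost_def left_stable_def right_stable_def z(2) by (simp add: z(1) SS.marks_eq_0)
  then show "\<zero>\<^bsub>CR\<^esub> \<in> carrier CR" by (simp add: char_ring_def)
next
  show "\<one>\<^bsub>CR\<^esub> \<in> carrier CR" using char_idempotent(1) by (simp add: char_ring_def)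
  show "cmark \<one>\<^bsub>CR\<^esub> Q = 1" if "Q \<in> {Q. subgroup Q S}" for Q
    using char_idempotent(2) that by (simp add: char_ring_def)
next
  fix X assume X: "X \<in> carrier CR"
  obtain Z where Z: "Z \<in> carrier CR" "gh Z = (\<lambda>D. \<Sum>i\<in>{()}. -1 * gh X D)"
    using char_sum[of "{()}" "\<lambda>_. -1" "\<lambda>_. X"] X localized_int_uminus[OF localized_int_1[OF prime_p]] by auto
  have "cmark Z Q = - cmark X Q" for Q using cmark_sum[OF X Z] by simp
  then show "\<exists>Y\<in>carrier CR. \<forall>Q\<in>{Q. subgroup Q S}. cmark Y Q = - cmark X Q" using Z(1) by auto
qed

lemma fusion_ring_iff: "a \<in> carrier FR \<longleftrightarrow> a \<in> burnside p S \<and> fusion_invariant (smark a)"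
  using fusion_stable_iff by (auto simp: fusion_burnside_ring_def)

lemma smark_coset:
  assumes P: "subgroup P S"
  shows "burnside_class p S (coset_gset S P) \<in> burnside p S"
    "smark (burnside_class p S (coset_gset S P)) Q = (\<Sum>g\<in>carrier S. of_bool (Q \<subseteq> conj_set S g P)) / of_nat (card P)"
proof -
  note b = burnside_class[OF prime_p finite_gset_coset[OF P]]
  show "burnside_class p S (coset_gset S P) \<in> burnside p S" by (rule b(1))
  have g: "ghost S (burnside_class p S (coset_gset S P)) = (\<lambda>D. of_nat (stab_count S (coset_gset S P) D))"
    using b(2) by blast
  show "smark (burnside_class p S (coset_gset S P)) Q = (\<Sum>g\<in>carrier S. of_bool (Q \<subseteq> conj_set S g P)) / of_nat (card P)"
    unfolding marks_alt g by (rule sum_stab_count_coset[OF P])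
qed

lemma smark_one: "subgroup Q S \<Longrightarrow> smark (burnside_class p S (coset_gset S (carrier S))) Q = 1"
  using card_carrier_pos subgroup.subset[of Q S]
  by (simp add: smark_coset(2)[OF subgroup_carrier] conj_set_carrier)

lemma ring_fusion_ring: "ring FR"
proof (rule ring_of_functions[where f = smark and I = "{Q. subgroup Q S}"])
  fix a b assume ab: "a \<in> carrier FR" "b \<in> carrier FR"
  then have a: "a \<in> burnside p S" "fusion_invariant (smark a)" and b: "b \<in> burnside p S" "fusion_invariant (smark b)"
    using fusion_ring_iff by auto
  show "a = b" if "\<And>Q. Q \<in> {Q. subgroup Q S} \<Longrightarrow> smark a Q = smark b Q"
    using burnside_eq_iff_marks[OF prime_p a(1) b(1)] that by auto
  note s = burnside_add[OF prime_p a(1) b(1)] and m = burnside_mult[OF prime_p a(1) b(1)]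
  show "smark (a \<oplus>\<^bsub>FR\<^esub> b) Q = smark a Q + smark b Q" for Q
    using s(2) by (simp add: fusion_burnside_ring_def marks_add)
  have "fusion_invariant (smark (burnside_add p S a b))"
    using a(2) b(2) by (simp add: fusion_invariant_def s(2) marks_add)
  then show "a \<oplus>\<^bsub>FR\<^esub> b \<in> carrier FR" using s(1) fusion_ring_iff by (simp add: fusion_burnside_ring_def)
  show "smark (a \<otimes>\<^bsub>FR\<^esub> b) Q = smark a Q * smark b Q" if "Q \<in> {Q. subgroup Q S}" for Q
    using m(2)[of Q] that subgroup.subset[of Q S] by (simp add: fusion_burnside_ring_def)
  have "fusion_invariant (smark (burnside_mult p S a b))"
    using a(2) b(2) m(2) subgroup.subset[OF fd_props(2)] subgroup.subset[OF fd_props(3)]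
    by (simp add: fusion_invariant_def)
  then show "a \<otimes>\<^bsub>FR\<^esub> b \<in> carrier FR" using m(1) fusion_ring_iff by (simp add: fusion_burnside_ring_def)
next
  note z = burnside_zero[OF prime_p]
  have m0: "smark (burnside_zero p S) Q = 0" for Q unfolding z(2) by (simp add: marks_eq_0)
  then show "smark \<zero>\<^bsub>FR\<^esub> Q = 0" for Q by (simp add: fusion_burnside_ring_def)
  have "burnside_zero p S \<in> carrier FR" using fusion_ring_iff z(1) m0 by (simp add: fusion_invariant_def)
  then show "\<zero>\<^bsub>FR\<^esub> \<in> carrier FR" by (simp add: fusion_burnside_ring_def)
next
  have "burnside_class p S (coset_gset S (carrier S)) \<in> carrier FR"
    using fusion_ring_iff smark_coset(1)[OF subgroup_carrier] smark_one fd_props(2,3) by (simp add: fusion_invariant_def)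
  then show "\<one>\<^bsub>FR\<^esub> \<in> carrier FR" by (simp add: fusion_burnside_ring_def)
  show "smark \<one>\<^bsub>FR\<^esub> Q = 1" if "Q \<in> {Q. subgroup Q S}" for Q
    using smark_one that by (simp add: fusion_burnside_ring_def)
next
  fix a assume "a \<in> carrier FR"
  then have a: "a \<in> burnside p S" "fusion_invariant (smark a)" using fusion_ring_iff by auto
  have "integral p S (\<lambda>D. -1 * ghost S a D)"
    by (intro integral_scale integral_ghost prime_p a localized_int_uminus localized_int_1)
  then obtain b where b: "b \<in> burnside p S" "ghost S b = (\<lambda>D. -1 * ghost S a D)"
    using burnside_of_ghost[OF prime_p] by blast
  have m: "smark b Q = - smark a Q" for Q unfolding b(2) marks_scale by simp
  have "b \<in> carrier FR" using fusion_ring_iff b(1) a(2) m by (simp add: fusion_invariant_def)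
  then show "\<exists>b\<in>carrier FR. \<forall>Q\<in>{Q. subgroup Q S}. smark b Q = - smark a Q" using m by auto
qed

text \<open>The points of \<open>[P, id]\<close> have the conjugates of the identity graph of \<open>P\<close> as stabilizers,
  whose domains are the conjugates of \<open>P\<close>; so the collapse has the marks of \<open>[S/P]\<close>.\<close>

lemma basic_biset_identity:
  assumes P: "subgroup P S"
  shows "basic_biset p S S P id \<in> bisets p S S" "generated_ghost (gh (basic_biset p S S P id))"
    "cmark (basic_biset p S S P id) Q = smark (burnside_class p S (coset_gset S P)) Q"
proof -
  let ?K = "Id_on P" let ?n = nS
  have K: "?K \<in> FD" by (rule fd_Id_on[OF P])
  have tb: "transitive_biset S S P id = coset_gset S2 ?K"
    unfolding transitive_biset_def by (rule arg_cong[where f = "coset_gset S2"]) (auto simp: twisted_diagonal_def)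
  have cancel: "?n * x / c / ?n = x / c" for x c using card_carrier_pos by simp
  note b = SS.burnside_class[OF prime_p SS.finite_gset_coset[OF fd_props(1)[OF K]]]
  show B: "basic_biset p S S P id \<in> bisets p S S" unfolding tb by (rule b(1))
  have g: "gh (basic_biset p S S P id) D = of_nat (stab_count S2 (coset_gset S2 ?K) D)" for D
    unfolding tb by (rule b(2))
  show G: "generated_ghost (gh (basic_biset p S S P id))"
    unfolding generated_ghost_def g using fd_stab_count[OF K] by simp
  have cd: "Domain (conj_set S2 z ?K) = conj_set S (fst z) P" if zc: "z \<in> carrier S2" for z
  proof -
    obtain s t where z: "z = (s, t)" "s \<in> carrier S" "t \<in> carrier S" using zc by (cases z) auto
    have "conj_set S2 z ?K = (\<lambda>u. (s \<otimes> u \<otimes> inv s, t \<otimes> u \<otimes> inv t)) ` P"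
    proof -
      have "?K = (\<lambda>u. (u, u)) ` P" by auto
      then show ?thesis unfolding conj_set_def z(1)
        by (simp only: image_image, intro image_cong) (use z in \<open>auto simp: is_group\<close>)
    qed
    then show ?thesis unfolding z(1) by (auto simp: conj_set_def)
  qed
  have "cmark (basic_biset p S S P id) Q
    = (\<Sum>A | subgroup A S2. of_nat (stab_count S2 (coset_gset S2 ?K) A) * of_bool (Q \<subseteq> Domain A)) / ?n"
    unfolding cmark_generated[OF B G] g
    by (subst sum_FD[symmetric]) (use fd_stab_count[OF K] in simp_all)
  also have "\<dots> = (\<Sum>z\<in>carrier S2. of_bool (Q \<subseteq> conj_set S (fst z) P)) / of_nat (card P) / ?n"
    unfolding SS.sum_stab_count_coset[OF fd_props(1)[OF K]] card_Id_on
    by (simp only: cd cong: sum.cong)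
  also have "(\<Sum>z\<in>carrier S2. of_bool (Q \<subseteq> conj_set S (fst z) P))
     = ?n * (\<Sum>s\<in>carrier S. of_bool (Q \<subseteq> conj_set S s P))"
  proof -
    have "(\<Sum>z\<in>carrier S2. of_bool (Q \<subseteq> conj_set S (fst z) P))
      = (\<Sum>s\<in>carrier S. \<Sum>t\<in>carrier S. of_bool (Q \<subseteq> conj_set S s P) :: rat)"
      by (simp only: sum.cartesian_product split_def carrier_DirProd)
    then show ?thesis by (simp add: sum_distrib_left)
  qed
  finally show "cmark (basic_biset p S S P id) Q = smark (burnside_class p S (coset_gset S P)) Q"
    unfolding smark_coset(2)[OF P] cancel .
qed

text \<open>By \<open>cmark_comp_mult\<close> the factor \<open>\<omega>\<close> on the right multiplies the collapse by \<open>1\<close>, and by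
  \<open>cmark_char\<close> the factor \<open>\<omega>\<close> on the left averages it over the \<open>\<F>\<close>-conjugates; the normalizing
  factor comes from the collapse of \<open>\<omega>\<close> being \<open>1\<close>.\<close>

lemma beta_diagonal:
  assumes P: "subgroup P S"
  shows "beta_diagonal p S F P \<in> carrier CR"
    "subgroup Q S \<Longrightarrow> cmark (beta_diagonal p S F P) Q
      = (\<Sum>Q'\<in>fusion_class S F Q. smark (burnside_class p S (coset_gset S P)) Q') / of_nat (card (fusion_class S F Q))"
proof -
  let ?w = "char_idempotent p S F" let ?X = "basic_biset p S S P id"
  note X = basic_biset_identity[OF P]
  note w = char_idempotent(1) and wb = char_bisets[OF char_idempotent(1)]
  have wX: "comp ?w ?X \<in> bisets p S S" "generated_ghost (gh (comp ?w ?X))" "left_stable (gh (comp ?w ?X))"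
    using comp_in[OF wb(1) X(1)] generated_comp[OF wb X(1,2)] left_stable_comp[OF wb X(1,2)] w char_iff by auto
  have "right_stable (gh (comp (comp ?w ?X) ?w))"
    using right_stable_comp[OF wX(1,2) wb] w char_iff by auto
  then show "beta_diagonal p S F P \<in> carrier CR"
    unfolding beta_diagonal_def char_iff
    using comp_in[OF wX(1) wb(1)] generated_comp[OF wX(1,2) wb] left_stable_comp[OF wX(1,2) wb wX(3)] by auto
  assume Q: "subgroup Q S"
  have "cmark (beta_diagonal p S F P) Q = cmark (comp ?w ?X) Q * cmark ?w Q"
    unfolding beta_diagonal_def by (rule cmark_comp_mult[OF wX(1,2) wb cmark_char_invariant[OF w] Q])
  also have "\<dots> = bimark ?w (Id_on Q) * (\<Sum>R\<in>fd_from Q. cmark ?X (Range R)) / nS"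
    using char_idempotent(2)[OF Q] cmark_char(2)[OF w Q X(1,2)] by simp
  also have "\<dots> = (\<Sum>R\<in>fd_from Q. cmark ?X (Range R)) / of_nat (card (fd_from Q))"
  proof -
    have "bimark ?w (Id_on Q) = nS / of_nat (card (fd_from Q))"
      using char_idempotent(2)[OF Q] card_fd_from_pos[OF Q] card_carrier_pos
      unfolding cmark_char(1)[OF w Q] by (simp add: field_simps)
    then show ?thesis using card_carrier_pos by simp
  qed
  also have "\<dots> = (\<Sum>Q'\<in>fusion_class S F Q. cmark ?X Q') / of_nat (card (fusion_class S F Q))"
    by (rule sum_fd_from_average[OF Q])
  finally show "cmark (beta_diagonal p S F P) Q
      = (\<Sum>Q'\<in>fusion_class S F Q. smark (burnside_class p S (coset_gset S P)) Q') / of_nat (card (fusion_class S F Q))"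
    by (simp only: X(3))
qed

lemma collapse_char:
  assumes "X \<in> carrier CR"
  shows "collapse p S X \<in> carrier FR"
  using fusion_ring_iff collapse_in[OF char_bisets(1)[OF assms]] cmark_char_invariant[OF assms] by simp

lemma collapse_eqI:
  assumes "X \<in> carrier CR" "a \<in> burnside p S" "\<And>Q. subgroup Q S \<Longrightarrow> cmark X Q = smark a Q"
  shows "collapse p S X = a"
  using burnside_eq_iff_marks[OF prime_p collapse_in[OF char_bisets(1)[OF assms(1)]] assms(2)] assms(3) by blast

lemma beta:
  assumes P: "subgroup P S"
  shows "beta p S F P \<in> carrier FR" "collapse p S (beta_diagonal p S F P) = beta p S F P"
proof -
  let ?b = "collapse p S (beta_diagonal p S F P)"
  note d = beta_diagonal[OF P]
  have mQ: "mark Q (burnside_class p S (coset_gset S P)) = smark (burnside_class p S (coset_gset S P)) Q"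
    if "subgroup Q S" for Q
    by (rule mark_eq_marks[OF prime_p smark_coset(1)[OF P] subgroup.subset[OF that]])
  have avg: "(\<Sum>Q'\<in>fusion_class S F Q. mark Q' (burnside_class p S (coset_gset S P))) / of_nat (card (fusion_class S F Q))
    = cmark (beta_diagonal p S F P) Q" if Q: "subgroup Q S" for Q
    unfolding d(2)[OF Q]
    by (rule arg_cong[where f = "\<lambda>x. x / of_nat (card (fusion_class S F Q))"], rule sum.cong[OF refl mQ])
       (simp add: fusion_class_def)
  have b: "?b \<in> carrier FR" by (rule collapse_char[OF d(1)])
  have "beta p S F P = ?b"
    unfolding beta_def
  proof (rule the_equality)
    show "?b \<in> carrier FR \<and> (\<forall>Q. subgroup Q S \<longrightarrow> mark Q ?b =
        (\<Sum>Q'\<in>fusion_class S F Q. mark Q' (burnside_class p S (coset_gset S P))) / of_nat (card (fusion_class S F Q)))"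
      using b avg mark_eq_marks[OF prime_p collapse_in[OF char_bisets(1)[OF d(1)]] subgroup.subset] by simp
  next
    fix a assume a: "a \<in> carrier FR \<and> (\<forall>Q. subgroup Q S \<longrightarrow> mark Q a =
        (\<Sum>Q'\<in>fusion_class S F Q. mark Q' (burnside_class p S (coset_gset S P))) / of_nat (card (fusion_class S F Q)))"
    then have ab: "a \<in> burnside p S" using fusion_ring_iff by simp
    have "cmark (beta_diagonal p S F P) Q = smark a Q" if Q: "subgroup Q S" for Q
      using a avg[OF Q] mark_eq_marks[OF prime_p ab subgroup.subset[OF Q]] Q by simp
    then show "a = ?b" using collapse_eqI[OF d(1) ab] by simp
  qed
  then show "beta p S F P \<in> carrier FR" "collapse p S (beta_diagonal p S F P) = beta p S F P" using b by auto
qed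

text \<open>Write \<open>a = \<Sum> c\<^sub>K [S/K]\<close>. As \<open>a\<close> is \<open>\<F>\<close>-stable, it is equal to its average over
  \<open>\<F>\<close>-conjugates, which is the collapse of \<open>\<Sum> c\<^sub>K \<beta>\<^bsub>\<Delta>(K, id)\<^esub>\<close>.\<close>

lemma collapse_surjective:
  assumes a: "a \<in> carrier FR"
  shows "\<exists>X\<in>carrier CR. collapse p S X = a"
proof -
  have ab: "a \<in> burnside p S" "fusion_invariant (smark a)" using a fusion_ring_iff by auto
  note int = integral_ghost[OF prime_p ab(1)]
  let ?U = "{K. subgroup K S}" let ?c = "coord S (ghost S a)" let ?B = "\<lambda>K. beta_diagonal p S F K"
  let ?m = "\<lambda>K. smark (burnside_class p S (coset_gset S K))"
  have B: "?B K \<in> carrier CR" if "K \<in> ?U" for K using beta_diagonal(1) that by simp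
  obtain Z where Z: "Z \<in> carrier CR" "gh Z = (\<lambda>D. \<Sum>K\<in>?U. ?c K * gh (?B K) D)"
    using char_sum[of ?U ?c ?B] B coord_in_localized_int[OF prime_p int] by blast
  have ex: "smark a Q = (\<Sum>K\<in>?U. ?c K * ?m K Q)" for Q
  proof -
    have "ghost S a = (\<lambda>D. \<Sum>K\<in>?U. ?c K * ghost S (burnside_class p S (coset_gset S K)) D)"
    proof
      fix D
      have "ghost S a D = (\<Sum>K\<in>?U. ?c K * of_nat (stab_count S (coset_gset S K) D))"
        by (rule coord_expansion[OF int])
      then show "ghost S a D = (\<Sum>K\<in>?U. ?c K * ghost S (burnside_class p S (coset_gset S K)) D)"
        by (simp add: burnside_class(2)[OF prime_p finite_gset_coset])
    qed
    then have "smark a Q = marks S (\<lambda>D. \<Sum>K\<in>?U. ?c K * ghost S (burnside_class p S (coset_gset S K)) D) Q" by simp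
    then show ?thesis by (simp only: marks_sum marks_scale)
  qed
  have "cmark Z Q = smark a Q" if Q: "subgroup Q S" for Q
  proof -
    let ?C = "fusion_class S F Q"
    have inv: "smark a Q' = smark a Q" if "Q' \<in> ?C" for Q'
      using that ab(2) unfolding fusion_class_eq[OF Q] fusion_invariant_def by auto
    have "finite ?C" by (rule finite_subset[OF _ finite_subgroups]) (auto simp: fusion_class_def)
    then have C: "card ?C \<noteq> 0" using self_in_fusion_class[OF Q] by auto
    have "cmark Z Q = (\<Sum>K\<in>?U. ?c K * cmark (?B K) Q)" by (rule cmark_sum[OF B Z])
    also have "\<dots> = (\<Sum>K\<in>?U. \<Sum>Q'\<in>?C. ?c K * ?m K Q') / of_nat (card ?C)"
      unfolding sum_divide_distrib[of _ ?U]
      by (rule sum.cong[OF refl]) (simp add: beta_diagonal(2)[OF _ Q] sum_distrib_left)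
    also have "\<dots> = (\<Sum>Q'\<in>?C. smark a Q') / of_nat (card ?C)" unfolding ex by (subst sum.swap) simp
    also have "\<dots> = smark a Q" using C inv by simp
    finally show ?thesis .
  qed
  then show ?thesis using collapse_eqI[OF Z(1) ab(1)] Z(1) by blast
qed

lemma collapse_ring_iso: "collapse p S \<in> ring_iso CR FR"
proof -
  have "collapse p S \<in> ring_hom CR FR"
  proof (rule ring_hom_memI)
    fix X assume X: "X \<in> carrier CR"
    then show "collapse p S X \<in> carrier FR" by (rule collapse_char)
    fix Y assume Y: "Y \<in> carrier CR"
    note cX = collapse_in[OF char_bisets(1)[OF X]] and cY = collapse_in[OF char_bisets(1)[OF Y]]
    show "collapse p S (X \<otimes>\<^bsub>CR\<^esub> Y) = collapse p S X \<otimes>\<^bsub>FR\<^esub> collapse p S Y"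
      using collapse_eqI[OF char_comp_closed[OF X Y] burnside_mult(1)[OF prime_p cX cY]]
        burnside_mult(2)[OF prime_p cX cY subgroup.subset] cmark_mult[OF X Y]
      by (simp add: char_ring_def fusion_burnside_ring_def)
    show "collapse p S (X \<oplus>\<^bsub>CR\<^esub> Y) = collapse p S X \<oplus>\<^bsub>FR\<^esub> collapse p S Y"
      using collapse_eqI[OF char_add(1)[OF X Y] burnside_add(1)[OF prime_p cX cY]]
        burnside_add(2)[OF prime_p cX cY] char_add(2)[OF X Y]
      by (simp add: char_ring_def fusion_burnside_ring_def marks_add)
  next
    show "collapse p S \<one>\<^bsub>CR\<^esub> = \<one>\<^bsub>FR\<^esub>"
      using collapse_eqI[OF char_idempotent(1) smark_coset(1)[OF subgroup_carrier]] char_idempotent(2) smark_one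
      by (simp add: char_ring_def fusion_burnside_ring_def)
  qed
  moreover have "bij_betw (collapse p S) (carrier CR) (carrier FR)"
    unfolding bij_betw_def
  proof
    show "inj_on (collapse p S) (carrier CR)"
      by (rule inj_onI) (use cmark_char_inject in simp)
    show "collapse p S ` carrier CR = carrier FR" using collapse_char collapse_surjective by blast
  qed
  ultimately show ?thesis by (simp add: ring_iso_def)
qed

end

theorem theorem4:
  fixes S :: "('a, 'm) monoid_scheme" and p :: nat and F :: "'a hom_sets"
  assumes "saturated_fusion_system S p F"
  shows "ring (char_ring p S F) \<and> ring (fusion_burnside_ring p S F) \<and>
    collapse p S \<in> ring_iso (char_ring p S F) (fusion_burnside_ring p S F) \<and>
    (\<forall>P. subgroup P S \<longrightarrow>
       beta_diagonal p S F P \<in> carrier (char_ring p S F) \<and>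
       beta p S F P \<in> carrier (fusion_burnside_ring p S F) \<and>
       collapse p S (beta_diagonal p S F P) = beta p S F P)"
proof -
  interpret saturated_fusion_system S p F by (rule assms)
  show ?thesis
    using ring_char_ring ring_fusion_ring collapse_ring_iso beta_diagonal(1) beta by blast
qed

end
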